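(* Let $N\ge1$, $l\ge0$, let $z=(z_1,\dots,z_l)\in\mathbb C^l$ with $z_i-z_j\notin\mathbb Z$ for all $i\ne j$, and let $k\in\mathbb C$ be Weil generic (outside a suitable countable subset of $\mathbb C$). Then the formal cyclotomic DAHA $\mathcal H_N^{l,\mathrm{formal}}(z,1,k)$ is the algebra of all elements of $\mathcal H_N^{\mathrm{formal}}(1,k)$ which preserve $(\prod_jX_j)^{z_i}\mathbf P_+$ for all $i=1,\dots,l$.
   Context: DAHA. For $q,\mathbf t$ invertible and $t=\mathbf t^2$, the DAHA $\mathcal H_N(q,t)$ is generated by invertible $X_i,Y_i$ ($1\le i\le N$) and $T_i$ ($1\le i\le N-1$) with relations: $(T_i-\mathbf t)(T_i+\mathbf t^{-1})=0$; $T_iT_{i+1}T_i=T_{i+1}T_iT_{i+1}$; $T_iT_j=T_jT_i$ for $|i-j|\ge2$; $T_iX_iT_i=X_{i+1}$; $T_iX_j=X_jT_i$ for $j\ne i,i+1$; $T_iY_iT_i=Y_{i+1}$; $T_iY_j=Y_jT_i$ for $j\neq i,i+1$; $X_1^{-1}Y_2^{-1}X_1Y_2=T_1^2$; $Y_i\tilde X=q\tilde XY_i$; $X_i\tilde Y=q^{-1}\tilde YX_i$; $[X_i,X_j]=0$; $[Y_i,Y_j]=0$, where $\tilde X=\prod_iX_i$, $\tilde Y=\prod_iY_i$. Formal DAHA. $\mathcal H_N^{\mathrm{formal}}(\hbar,k)$ is the $\varepsilon$-adically complete algebra over $\mathbb C[[\varepsilon]]$ generated by $s_i$ ($1\le i\le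 N-1$), $X_i^{\pm1}$, $y_i$ ($1\le i\le N$) such that, with $q=e^{\varepsilon\hbar}$, $t=e^{-\varepsilon k}$, $\mathbf t=e^{-\varepsilon k/2}$, $T_i=s_ie^{-\varepsilon ks_i/2}$, $Y_i=e^{\varepsilon y_i}$, the elements $T_i,X_i,Y_i$ satisfy the relations $(T_i-\mathbf t)(T_i+\mathbf t^{-1})=0$; $T_iT_{i+1}T_i=T_{i+1}T_iT_{i+1}$; $T_iT_j=T_jT_i$ for $|i-j|\ge2$; $T_iX_iT_i=X_{i+1}$; $T_iX_j=X_jT_i$ for $j\ne i,i+1$; $T_iY_iT_i=Y_{i+1}$; $T_iY_j=Y_jT_i$ for $j\neq i,i+1$; $X_1^{-1}Y_2^{-1}X_1Y_2=T_1^2$; $Y_i\tilde X=q\tilde XY_i$; $X_i\tilde Y=q^{-1}\tilde YX_i$; $[X_i,X_j]=0$; $[Y_i,Y_j]=0$, where $\tilde X=\prod_iX_i$, $\tilde Y=\prod_iY_i$ (relations divisible by a power of $\varepsilon$ are understood to be divided by it; the algebra is $\varepsilon$-torsion-free). Formal cyclotomic DAHA. With $\pi=X_1T_1\cdots T_{N-1}$, $\mathcal H_N^{l,\mathrm{formal}}(z,\hbar,k)$ is the ($\varepsilon$-adically closed) subalgebra of $\mathcal H_N^{\mathrm{formal}}(\hbar,k)$ generated by $T_i$ ($1\le i\le N-1$), $y_i$ ($1\le i\le N$), $\pi$, and $\pi^{-1}\prod_{i=1}^l\frac{e^{\varepsilon y_1}-e^{\varepsilon z_i}}{\varepsilon}$.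 Polynomial representation. $\mathcal H_N^{\mathrm{formal}}(\hbar,k)$ acts on $\mathbf P=\mathbb C[X_1^{\pm1},\dots,X_N^{\pm1}]$ (with scalars extended to $\mathbb C[[\varepsilon]]$ and completed) by $X_i\mapsto X_i$, $T_i\mapsto\mathbf ts_i+\frac{\mathbf t-\mathbf t^{-1}}{X_i/X_{i+1}-1}(s_i-1)$, $Y_i\mapsto\mathbf t^{N-1}T_i^{-1}\cdots T_{N-1}^{-1}\,\omega\,T_1\cdots T_{i-1}$, where $(\omega f)(X_1,\dots,X_N)=f(qX_N,X_1,\dots,X_{N-1})$. The same formulas define an action on $(\prod_jX_j)^u\mathbf P$ for $u\in\mathbb C$, where $(\prod_jX_j)^u$ is treated as $S_N$-invariant and $\omega$ multiplies it by $q^u=e^{\varepsilon\hbar u}$. $\mathbf P_+=\mathbb C[X_1,\dots,X_N]$ (again with scalars extended to $\mathbb C[[\varepsilon]]$ and completed); an element preserves $(\prod_jX_j)^u\mathbf P_+$ if it maps this subspace of $(\prod_jX_j)^u\mathbf P$ to itself. *)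

theory Defs
  imports
    Complex_Main
    "HOL-Library.FuncSet"
    "HOL-Library.Poly_Mapping"
    "HOL-Library.Countable_Set"
    "HOL-Computational_Algebra.Formal_Power_Series"
    "HOL-Combinatorics.Transposition"
    "HOL-Algebra.QuotRing"
    "HOL-Algebra.Subrings"
begin

text \<open>
  The formal variable \<open>\<epsilon>\<close> is the variable \<^const>\<open>fps_X\<close> of formal power series, so that
  the base ring of power series in \<open>\<epsilon>\<close> is the type \<^typ>\<open>complex fps\<close>.  For a monoid \<open>'m\<close>, written
  additively, the type \<open>'m \<Rightarrow>\<^sub>0 complex\<close> is its monoid algebra, and \<open>('m \<Rightarrow>\<^sub>0 complex) fps\<close> is the
  \<open>\<epsilon>\<close>-adic completion of the monoid algebra over \<^typ>\<open>complex fps\<close>.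
\<close>

definition scal :: "complex fps \<Rightarrow> ('m::zero \<Rightarrow>\<^sub>0 complex) fps" where
  "scal c = Abs_fps (\<lambda>n. Poly_Mapping.single 0 (fps_nth c n))"

text \<open>The parameter \<open>\<t> = e\<^bsup>-\<epsilon>k/2\<^esup>\<close>; here \<open>fps_exp c = e\<^bsup>c\<epsilon>\<^esup>\<close>.\<close>

definition tpar :: "complex \<Rightarrow> complex fps" where
  "tpar k = fps_exp (- k / 2)"

datatype 'a free_monoid = Word (letters: "'a list")

instantiation free_monoid :: (type) monoid_add
begin

definition zero_free_monoid :: "'a free_monoid" where
  "zero_free_monoid = Word []"

definition plus_free_monoid :: "'a free_monoid \<Rightarrow> 'a free_monoid \<Rightarrow> 'a free_monoid" where
  "plus_free_monoid v w = Word (letters v @ letters w)"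

instance
  by standard (simp_all add: zero_free_monoid_def plus_free_monoid_def)

end

datatype gen = GS nat | GX nat | GXinv nat | GY nat

definition gens :: "nat \<Rightarrow> gen set" where
  "gens N = GS ` {1..<N} \<union> GX ` {1..N} \<union> GXinv ` {1..N} \<union> GY ` {1..N}"

type_synonym free_elt = "(gen free_monoid \<Rightarrow>\<^sub>0 complex) fps"

definition free_alg :: "nat \<Rightarrow> free_elt ring" where
  "free_alg N =
     \<lparr>carrier = {f. \<forall>n. \<forall>w\<in>Poly_Mapping.keys (fps_nth f n). set (letters w) \<subseteq> gens N},
      mult = (*), one = 1, zero = 0, add = (+)\<rparr>"

text \<open>\<open>eexp c a = e\<^bsup>\<epsilon>ca\<^esup>\<close> for \<open>a\<close> in the (uncompleted) free algebra over the complex numbers.\<close>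

definition eexp :: "complex \<Rightarrow> (gen free_monoid \<Rightarrow>\<^sub>0 complex) \<Rightarrow> free_elt" where
  "eexp c a = Abs_fps (\<lambda>n. Poly_Mapping.single 0 (c ^ n / fact n) * a ^ n)"

definition letter :: "gen \<Rightarrow> gen free_monoid \<Rightarrow>\<^sub>0 complex" where
  "letter g = Poly_Mapping.single (Word [g]) 1"

definition fX :: "nat \<Rightarrow> free_elt" where
  "fX i = fps_const (letter (GX i))"

definition fXinv :: "nat \<Rightarrow> free_elt" where
  "fXinv i = fps_const (letter (GXinv i))"

definition fy :: "nat \<Rightarrow> free_elt" where
  "fy i = fps_const (letter (GY i))"

definition fY :: "nat \<Rightarrow> free_elt" where
  "fY i = eexp 1 (letter (GY i))"

definition fYinv :: "nat \<Rightarrow> free_elt" where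
  "fYinv i = eexp (- 1) (letter (GY i))"

definition fT :: "complex \<Rightarrow> nat \<Rightarrow> free_elt" where
  "fT k i = fps_const (letter (GS i)) * eexp (- k / 2) (letter (GS i))"

definition fXtilde :: "nat \<Rightarrow> free_elt" where
  "fXtilde N = prod_list (map fX [1..<Suc N])"

definition fYtilde :: "nat \<Rightarrow> free_elt" where
  "fYtilde N = prod_list (map fY [1..<Suc N])"

text \<open>A relation \<open>a = b\<close> is represented by the element \<open>a - b\<close>; \<open>h\<close> stands for \<open>\<hbar>\<close>.\<close>

inductive_set daha_rels :: "nat \<Rightarrow> complex \<Rightarrow> complex \<Rightarrow> free_elt set"
  for N :: nat and h k :: complex
where
  X_Xinv: "i \<in> {1..N} \<Longrightarrow> fX i * fXinv i - 1 \<in> daha_rels N h k"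
| Xinv_X: "i \<in> {1..N} \<Longrightarrow> fXinv i * fX i - 1 \<in> daha_rels N h k"
| T_quadratic: "i \<in> {1..<N} \<Longrightarrow>
    (fT k i - scal (tpar k)) * (fT k i + scal (inverse (tpar k))) \<in> daha_rels N h k"
| T_braid: "1 \<le> i \<Longrightarrow> i + 1 < N \<Longrightarrow>
    fT k i * fT k (i+1) * fT k i - fT k (i+1) * fT k i * fT k (i+1) \<in> daha_rels N h k"
| T_T: "i \<in> {1..<N} \<Longrightarrow> j \<in> {1..<N} \<Longrightarrow> i + 2 \<le> j \<or> j + 2 \<le> i \<Longrightarrow>
    fT k i * fT k j - fT k j * fT k i \<in> daha_rels N h k"
| T_X_T: "i \<in> {1..<N} \<Longrightarrow> fT k i * fX i * fT k i - fX (i+1) \<in> daha_rels N h k"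
| T_X: "i \<in> {1..<N} \<Longrightarrow> j \<in> {1..N} \<Longrightarrow> j \<noteq> i \<Longrightarrow> j \<noteq> i + 1 \<Longrightarrow>
    fT k i * fX j - fX j * fT k i \<in> daha_rels N h k"
| T_Y_T: "i \<in> {1..<N} \<Longrightarrow> fT k i * fY i * fT k i - fY (i+1) \<in> daha_rels N h k"
| T_Y: "i \<in> {1..<N} \<Longrightarrow> j \<in> {1..N} \<Longrightarrow> j \<noteq> i \<Longrightarrow> j \<noteq> i + 1 \<Longrightarrow>
    fT k i * fY j - fY j * fT k i \<in> daha_rels N h k"
| X_Y_T: "2 \<le> N \<Longrightarrow> fXinv 1 * fYinv 2 * fX 1 * fY 2 - fT k 1 * fT k 1 \<in> daha_rels N h k"
| Y_Xtilde: "i \<in> {1..N} \<Longrightarrow>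
    fY i * fXtilde N - scal (fps_exp h) * fXtilde N * fY i \<in> daha_rels N h k"
| X_Ytilde: "i \<in> {1..N} \<Longrightarrow>
    fX i * fYtilde N - scal (inverse (fps_exp h)) * fYtilde N * fX i \<in> daha_rels N h k"
| X_X: "i \<in> {1..N} \<Longrightarrow> j \<in> {1..N} \<Longrightarrow> fX i * fX j - fX j * fX i \<in> daha_rels N h k"
| Y_Y: "i \<in> {1..N} \<Longrightarrow> j \<in> {1..N} \<Longrightarrow> fY i * fY j - fY j * fY i \<in> daha_rels N h k"

text \<open>\<open>S\<close> is closed in the \<open>e\<close>-adic topology of \<open>R\<close>, for \<open>e\<close> central in \<open>R\<close>.\<close>

definition adic_closed :: "('a, 'b) ring_scheme \<Rightarrow> 'a \<Rightarrow> 'a set \<Rightarrow> bool" where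
  "adic_closed R e S \<longleftrightarrow>
     (\<forall>a\<in>carrier R. (\<forall>n::nat. \<exists>s\<in>S. \<exists>r\<in>carrier R. a = s \<oplus>\<^bsub>R\<^esub> (e [^]\<^bsub>R\<^esub> n) \<otimes>\<^bsub>R\<^esub> r) \<longrightarrow> a \<in> S)"

text \<open>
  The quotient of the completed free algebra by a two-sided ideal is again complete and separated iff
  the ideal is closed, and \<open>\<epsilon>\<close>-torsion-free iff the ideal is saturated with respect to \<open>\<epsilon>\<close>; saturation
  is what makes the relations hold after division by powers of \<open>\<epsilon>\<close>.
\<close>

definition daha_ideal :: "nat \<Rightarrow> complex \<Rightarrow> complex \<Rightarrow> free_elt set" where
  "daha_ideal N h k =
     \<Inter> {J. ideal J (free_alg N) \<and> adic_closed (free_alg N) fps_X J \<and>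
           (\<forall>a\<in>carrier (free_alg N). fps_X * a \<in> J \<longrightarrow> a \<in> J) \<and> daha_rels N h k \<subseteq> J}"

definition formal_daha :: "nat \<Rightarrow> complex \<Rightarrow> complex \<Rightarrow> free_elt set ring" where
  "formal_daha N h k = free_alg N Quot daha_ideal N h k"

definition cls :: "nat \<Rightarrow> complex \<Rightarrow> complex \<Rightarrow> free_elt \<Rightarrow> free_elt set" where
  "cls N h k a = daha_ideal N h k +>\<^bsub>free_alg N\<^esub> a"

definition closed_subalgebra_generated ::
    "nat \<Rightarrow> complex \<Rightarrow> complex \<Rightarrow> free_elt set set \<Rightarrow> free_elt set set" where
  "closed_subalgebra_generated N h k G =
     \<Inter> {B. subring B (formal_daha N h k) \<and> range (\<lambda>c. cls N h k (scal c)) \<subseteq> B \<and>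
           adic_closed (formal_daha N h k) (cls N h k fps_X) B \<and> G \<subseteq> B}"

definition daha_pi :: "nat \<Rightarrow> complex \<Rightarrow> complex \<Rightarrow> free_elt set" where
  "daha_pi N h k = cls N h k (fX 1 * prod_list (map (fT k) [1..<N]))"

text \<open>
  Since \<open>e\<^bsup>\<epsilon>y\<^esup> - e\<^bsup>\<epsilon>z\<^esup>\<close> has vanishing constant coefficient, \<open>fps_shift 1\<close> is the division by \<open>\<epsilon>\<close>.
\<close>

definition cyclotomic_factor :: "complex \<Rightarrow> free_elt" where
  "cyclotomic_factor z = fps_shift 1 (fY 1 - scal (fps_exp z))"

definition cyclotomic_daha ::
    "nat \<Rightarrow> nat \<Rightarrow> (nat \<Rightarrow> complex) \<Rightarrow> complex \<Rightarrow> complex \<Rightarrow> free_elt set set" where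
  "cyclotomic_daha N l z h k =
     closed_subalgebra_generated N h k
       ((\<lambda>i. cls N h k (fT k i)) ` {1..<N} \<union> (\<lambda>i. cls N h k (fy i)) ` {1..N} \<union>
        {daha_pi N h k,
         inv\<^bsub>formal_daha N h k\<^esub> (daha_pi N h k) \<otimes>\<^bsub>formal_daha N h k\<^esub>
           cls N h k (prod_list (map (\<lambda>i. cyclotomic_factor (z i)) [1..<Suc l]))})"

text \<open>
  An exponent vector \<open>a\<close> encodes the monomial \<open>\<Prod>\<^sub>j X\<^sub>j\<^bsup>a j\<^esup>\<close>.
\<close>

type_synonym expo = "nat \<Rightarrow>\<^sub>0 int"
type_synonym laurent = "(expo \<Rightarrow>\<^sub>0 complex) fps"

definition PP :: "nat \<Rightarrow> laurent set" where
  "PP N = {f. \<forall>n. \<forall>a\<in>Poly_Mapping.keys (fps_nth f n). Poly_Mapping.keys a \<subseteq> {1..N}}"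

definition PP_plus :: "nat \<Rightarrow> laurent set" where
  "PP_plus N =
     {f\<in>PP N. \<forall>n. \<forall>a\<in>Poly_Mapping.keys (fps_nth f n). \<forall>j. 0 \<le> Poly_Mapping.lookup a j}"

definition mono_X :: "expo \<Rightarrow> laurent" where
  "mono_X a = fps_const (Poly_Mapping.single a 1)"

text \<open>
  The continuous operator, linear over power series in \<open>\<epsilon>\<close>, that maps each monomial \<open>mono_X a\<close>
  to \<open>\<phi> a\<close>.
\<close>

definition lin_ext :: "(expo \<Rightarrow> laurent) \<Rightarrow> laurent \<Rightarrow> laurent" where
  "lin_ext \<phi> f = Abs_fps (\<lambda>n. \<Sum>m\<le>n. \<Sum>a\<in>Poly_Mapping.keys (fps_nth f m).
     Poly_Mapping.single 0 (Poly_Mapping.lookup (fps_nth f m) a) * fps_nth (\<phi> a) (n - m))"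

text \<open>The effect on exponents of the substitution \<open>X\<^sub>j \<mapsto> X\<^bsub>\<sigma> j\<^esub>\<close>.\<close>

definition subst_expo :: "(nat \<Rightarrow> nat) \<Rightarrow> expo \<Rightarrow> expo" where
  "subst_expo \<sigma> a =
     (\<Sum>j\<in>Poly_Mapping.keys a. Poly_Mapping.single (\<sigma> j) (Poly_Mapping.lookup a j))"

definition s_op :: "nat \<Rightarrow> laurent \<Rightarrow> laurent" where
  "s_op i = lin_ext (\<lambda>a. mono_X (subst_expo (transpose i (i+1)) a))"

definition X_op :: "nat \<Rightarrow> laurent \<Rightarrow> laurent" where
  "X_op i f = mono_X (Poly_Mapping.single i 1) * f"

text \<open>The quotient in the Demazure--Lusztig operator is the exact quotient of Laurent polynomials.\<close>

definition T_op :: "complex \<Rightarrow> nat \<Rightarrow> laurent \<Rightarrow> laurent" where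
  "T_op k i f = scal (tpar k) * s_op i f + scal (tpar k - inverse (tpar k)) *
     (THE g. (mono_X (Poly_Mapping.single i 1 - Poly_Mapping.single (i+1) 1) - 1) * g = s_op i f - f)"

text \<open>
  An element \<open>(\<Prod>\<^sub>j X\<^sub>j)\<^sup>u f\<close> of the twisted space \<open>(\<Prod>\<^sub>j X\<^sub>j)\<^sup>u \<P>\<close> is represented by \<open>f\<close>, so the twist
  by \<open>u\<close> appears only as the factor \<open>q\<^sup>u\<close> in \<open>\<omega>\<close>; the factor \<open>q\<^bsup>a 1\<^esup>\<close> comes from the substitution
  \<open>X\<^sub>1 \<mapsto> q X\<^sub>N\<close>, with \<open>q = e\<^bsup>\<epsilon>\<hbar>\<^esup>\<close>.
\<close>

definition omega_op :: "nat \<Rightarrow> complex \<Rightarrow> complex \<Rightarrow> laurent \<Rightarrow> laurent" where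
  "omega_op N h u = lin_ext (\<lambda>a. scal (fps_exp (h * (of_int (Poly_Mapping.lookup a 1) + u))) *
     mono_X (subst_expo (\<lambda>j. if j = 1 then N else j - 1) a))"

definition T_inv_op :: "nat \<Rightarrow> complex \<Rightarrow> nat \<Rightarrow> laurent \<Rightarrow> laurent" where
  "T_inv_op N k i = inv_into (PP N) (T_op k i)"

definition Y_op :: "nat \<Rightarrow> complex \<Rightarrow> complex \<Rightarrow> complex \<Rightarrow> nat \<Rightarrow> laurent \<Rightarrow> laurent" where
  "Y_op N h k u i f = scal (tpar k ^ (N - 1)) *
     (foldr (\<circ>) (map (T_inv_op N k) [i..<N]) id \<circ> omega_op N h u \<circ>
      foldr (\<circ>) (map (T_op k) [1..<i]) id) f"

definition End_PP :: "nat \<Rightarrow> (laurent \<Rightarrow> laurent) ring" where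
  "End_PP N =
     \<lparr>carrier = {\<phi> \<in> PP N \<rightarrow>\<^sub>E PP N.
        (\<forall>f\<in>PP N. \<forall>g\<in>PP N. \<phi> (f + g) = \<phi> f + \<phi> g) \<and>
        (\<forall>c. \<forall>f\<in>PP N. \<phi> (scal c * f) = scal c * \<phi> f)},
      mult = compose (PP N), one = (\<lambda>f\<in>PP N. f),
      zero = (\<lambda>f\<in>PP N. 0), add = (\<lambda>\<phi> \<psi>. \<lambda>f\<in>PP N. \<phi> f + \<psi> f)\<rparr>"

text \<open>
  An action of the formal DAHA is determined by the operators of \<open>X\<^sub>i\<close>, \<open>T\<^sub>i\<close> and \<open>Y\<^sub>i\<close>: the operators
  of \<open>s\<^sub>i\<close> and \<open>y\<^sub>i\<close> are recovered from \<open>T\<^sub>i = s\<^sub>i e\<^bsup>-\<epsilon>ks\<^sub>i/2\<^esup>\<close> and \<open>Y\<^sub>i = e\<^bsup>\<epsilon>y\<^sub>i\<^esup>\<close>, and linearity over power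
  series in \<open>\<epsilon>\<close> implies continuity.
\<close>

definition is_poly_rep ::
    "nat \<Rightarrow> complex \<Rightarrow> complex \<Rightarrow> complex \<Rightarrow> (free_elt set \<Rightarrow> laurent \<Rightarrow> laurent) \<Rightarrow> bool" where
  "is_poly_rep N h k u \<rho> \<longleftrightarrow>
     \<rho> \<in> extensional (carrier (formal_daha N h k)) \<and>
     \<rho> \<in> ring_hom (formal_daha N h k) (End_PP N) \<and>
     (\<forall>c. \<forall>f\<in>PP N. \<rho> (cls N h k (scal c)) f = scal c * f) \<and>
     (\<forall>i\<in>{1..N}. \<forall>f\<in>PP N. \<rho> (cls N h k (fX i)) f = X_op i f) \<and>
     (\<forall>i\<in>{1..<N}. \<forall>f\<in>PP N. \<rho> (cls N h k (fT k i)) f = T_op k i f) \<and>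
     (\<forall>i\<in>{1..N}. \<forall>f\<in>PP N. \<rho> (cls N h k (fY i)) f = Y_op N h k u i f)"

definition poly_rep ::
    "nat \<Rightarrow> complex \<Rightarrow> complex \<Rightarrow> complex \<Rightarrow> free_elt set \<Rightarrow> laurent \<Rightarrow> laurent" where
  "poly_rep N h k u = (THE \<rho>. is_poly_rep N h k u \<rho>)"

definition preserves_plus ::
    "nat \<Rightarrow> complex \<Rightarrow> complex \<Rightarrow> complex \<Rightarrow> free_elt set \<Rightarrow> bool" where
  "preserves_plus N h k u a \<longleftrightarrow> (\<forall>f\<in>PP_plus N. poly_rep N h k u a f \<in> PP_plus N)"

end

theory Submission
  imports Defs "HOL-Computational_Algebra.Polynomial"
begin

text \<open>
  Modulo \<open>\<epsilon>\<close> an element of the DAHA is a noncommutative polynomial in \<open>s\<^sub>i\<close>, \<open>X\<^sub>i\<close>, \<open>X\<^sub>i\<inverse>\<close>, \<open>y\<^sub>i\<close>, filtered by the number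
  of factors \<open>y\<^sub>i\<close>; its leading words are determined, up to lower terms, by an exponent \<open>a\<close>, a degree \<open>b\<close> and
  a permutation.  The polynomial representation turns the leading part into a differential operator
  \<open>\<Sum> X\<^sup>a (X \<partial>\<^sub>X + u)\<^sup>b w\<close>.  If it preserves polynomials for every \<open>u = z\<^sub>j\<close>, then, evaluated at \<open>X\<^sub>i\<close>-degrees below \<open>- a\<^sub>i\<close>, the
  symbol has \<open>l (- a\<^sub>i)\<close> distinct zeros \<open>n + z\<^sub>j\<close>, so only terms with \<open>l a\<^sub>i + b\<^sub>i \<ge> 0\<close> survive; these are exactly the
  leading words of products of the generators, since \<open>\<pi>\<inverse> \<Prod> (e\<^bsup>\<epsilon>y\<^esup> - e\<^bsup>\<epsilon>z\<^esup>) / \<epsilon>\<close> has leading word \<open>X\<^sub>1\<inverse> y\<^sub>1\<^sup>l\<close> up to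
  permutations.  Induction on the filtration and then on the power of \<open>\<epsilon>\<close> gives the theorem for every \<open>k\<close>.
\<close>

section \<open>Formal operators on Laurent polynomials and evaluation of the completed free
  algebra\<close>

section \<open>Power series over noncommutative rings\<close>

text \<open>No basis theorem for the algebra is proved. Modulo \<epsilon>, words yield only
  congruences: two words with the same data (a, b, w) differ by terms with fewer y. The
  representation supplies the complement: for inadmissible data, the coefficients of all words with
  these data sum to zero. The two statements fit together, since such a sum of words is then itself
  of lower order. The obstacle is that y_i acts as X_i d/dX_i + u plus Demazure quotients, whose
  denominators X_i - X_j destroy the coefficient polynomials of a differential operator. They are
  cleared by a power of a symmetric discriminant, zeros are counted for the cleared operator, and
  the discriminant is divided out again; this is possible because the inadmissible exponents stay
  inadmissible when one coordinate decreases. The order-zero part of y_i does not depend on u, so a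
  single symbol serves all twists, and the zeros are distinct because z_i - z_j is never an integer.
  The passage through powers of \<epsilon> rests on saturation: f preserves polynomials as soon as
  \<epsilon> f does.\<close>

lemma fps_decomp: "f = fps_const (fps_nth f 0) + fps_X * fps_shift 1 (f :: 'a::ring_1 fps)"
  by (rule fps_ext) (auto simp: fps_shift_def)

text \<open>An \<open>\<epsilon>\<close>-bilinear map vanishes as soon as it vanishes on constants.\<close>

lemma bilinear_fps_zero:
  fixes Z :: "'a::ring_1 fps \<Rightarrow> 'b::ring_1 fps \<Rightarrow> 'c::ring_1 fps"
  assumes add1: "\<And>f f' g. Z (f + f') g = Z f g + Z f' g"
    and add2: "\<And>f g g'. Z f (g + g') = Z f g + Z f g'"
    and X1: "\<And>f g. Z (fps_X * f) g = fps_X * Z f g"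
    and X2: "\<And>f g. Z f (fps_X * g) = fps_X * Z f g"
    and c: "\<And>a b. Z (fps_const a) (fps_const b) = 0"
  shows "Z f g = 0"
proof (rule fps_ext)
  fix n show "fps_nth (Z f g) n = fps_nth 0 n"
  proof (induction n arbitrary: f g rule: less_induct)
    case (less n)
    define f0 f1 g0 g1 where "f0 = fps_const (fps_nth f 0)" and "f1 = fps_shift 1 f"
      and "g0 = fps_const (fps_nth g 0)" and "g1 = fps_shift 1 g"
    have f: "f = f0 + fps_X * f1" and g: "g = g0 + fps_X * g1"
      using fps_decomp[of f] fps_decomp[of g] by (simp_all add: f0_def f1_def g0_def g1_def)
    have "Z f g = fps_X * (Z f0 g1 + Z f1 g0 + Z f1 (fps_X * g1))"
      unfolding f g add1 add2 X1
      by (simp add: f0_def g0_def c X1 X2 distrib_left)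
    then show ?case using less by (cases n) simp_all
  qed
qed

text \<open>Splitting off the constant term repeatedly reaches every coefficient after finitely many
  steps, so additivity and compatibility with \<epsilon> leave only the values on constants
  free.\<close>

lemma linear_fps_eq:
  fixes F G :: "'a::ring_1 fps \<Rightarrow> 'b::ring_1 fps"
  assumes "\<And>f g. F (f + g) = F f + F g" "\<And>f g. G (f + g) = G f + G g"
    and "\<And>f. F (fps_X * f) = fps_X * F f" "\<And>f. G (fps_X * f) = fps_X * G f"
    and "\<And>a. F (fps_const a) = G (fps_const a)"
  shows "F f = G f"
proof (rule fps_ext)
  fix n show "fps_nth (F f) n = fps_nth (G f) n"
  proof (induction n arbitrary: f)
    case 0
    show ?case using arg_cong[OF fps_decomp[of f], of F] arg_cong[OF fps_decomp[of f], of G] assms by simp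
  next
    case (Suc n)
    show ?case using arg_cong[OF fps_decomp[of f], of F] arg_cong[OF fps_decomp[of f], of G] assms Suc by simp
  qed
qed

text \<open>\<open>collapse A\<close> is the \<open>\<epsilon>\<close>-adic sum of \<open>\<epsilon>\<^sup>n A\<^sub>n\<close>.\<close>

definition collapse :: "'r::ring_1 fps fps \<Rightarrow> 'r fps" where
  "collapse A = Abs_fps (\<lambda>n. \<Sum>m\<le>n. fps_nth (fps_nth A m) (n - m))"

lemma collapse_add: "collapse (A + B) = collapse A + collapse B"
  by (rule fps_ext) (simp add: collapse_def sum.distrib)

lemma collapse_const [simp]: "collapse (fps_const a) = a"
proof (rule fps_ext)
  fix n
  have "(\<Sum>m\<le>n. fps_nth (fps_nth (fps_const a) m) (n - m)) = (\<Sum>m\<le>n. if m = 0 then fps_nth a n else 0)"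
    by (rule sum.cong) auto
  then show "fps_nth (collapse (fps_const a)) n = fps_nth a n" by (simp add: collapse_def)
qed

lemma collapse_X: "collapse (fps_X * A) = fps_X * collapse A"
proof (rule fps_ext)
  fix n show "fps_nth (collapse (fps_X * A)) n = fps_nth (fps_X * collapse A) n"
  proof (cases n)
    case (Suc k)
    have "(\<Sum>m\<le>Suc k. fps_nth (fps_nth (fps_X * A) m) (Suc k - m)) = (\<Sum>m\<le>k. fps_nth (fps_nth A m) (k - m))"
      by (subst sum.atMost_Suc_shift) simp
    then show ?thesis by (simp add: collapse_def Suc)
  qed (simp add: collapse_def)
qed

lemma collapse_decomp: "collapse A = fps_nth A 0 + fps_X * collapse (fps_shift 1 A)"
  by (subst fps_decomp[of A]) (simp add: collapse_add collapse_X)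

text \<open>The outer variable becomes the central \<epsilon> of the inner series, so both sides are
  bilinear over \<epsilon>, and they coincide on constant outer series.\<close>

lemma collapse_mult: "collapse (A * B) = collapse A * collapse B"
proof -
  let ?Z = "\<lambda>A B. collapse (A * B) - collapse A * collapse B"
  have "?Z A B = 0"
  proof (rule bilinear_fps_zero[where Z = ?Z])
    fix f g :: "'a fps fps"
    show "?Z f (fps_X * g) = fps_X * ?Z f g"
    proof -
      have "f * (fps_X * g) = fps_X * (f * g)"
        by (metis fps_mult_fps_X_commute mult.assoc)
      moreover have "collapse f * (fps_X * collapse g) = fps_X * (collapse f * collapse g)"
        by (metis fps_mult_fps_X_commute mult.assoc)
      ultimately show ?thesis by (simp add: collapse_X right_diff_distrib)
    qed
  qed (simp_all add: collapse_add collapse_X algebra_simps)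
  then show ?thesis by simp
qed

definition fmap :: "('a::zero \<Rightarrow> 'b::zero) \<Rightarrow> 'a fps \<Rightarrow> 'b fps" where
  "fmap h A = Abs_fps (\<lambda>n. h (fps_nth A n))"

lemma fmap_nth [simp]: "fps_nth (fmap h A) n = h (fps_nth A n)"
  by (simp add: fmap_def)

lemma fmap_const: "h 0 = 0 \<Longrightarrow> fmap h (fps_const a) = fps_const (h a)"
  by (rule fps_ext) simp

lemma fmap_add: "(\<And>a b. h (a + b) = h a + h b) \<Longrightarrow> fmap h (A + B) = fmap h A + fmap h B"
  for h :: "'a::ab_group_add \<Rightarrow> 'b::ab_group_add"
  by (rule fps_ext) simp

lemma fmap_X: "h 0 = 0 \<Longrightarrow> fmap h (fps_X * A) = fps_X * fmap h A"
  for h :: "'a::ring_1 \<Rightarrow> 'b::ring_1"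
  by (rule fps_ext) simp

lemma additive_zero: "(\<And>a b. h (a + b) = h a + h b) \<Longrightarrow> h 0 = 0"
  for h :: "'a::ab_group_add \<Rightarrow> 'b::ab_group_add"
  by (metis add_cancel_right_right)

lemma additive_sum: "(\<And>a b. h (a + b) = h a + h b) \<Longrightarrow> h (sum f S) = (\<Sum>x\<in>S. h (f x))"
  for h :: "'a::ab_group_add \<Rightarrow> 'b::ab_group_add"
  by (induction S rule: infinite_finite_induct) (simp_all add: additive_zero)

lemma fmap_mult:
  fixes h :: "'a::ring_1 \<Rightarrow> 'b::ring_1"
  assumes "\<And>a b. h (a + b) = h a + h b" "\<And>a b. h (a * b) = h a * h b"
  shows "fmap h (A * B) = fmap h A * fmap h B"
  by (rule fps_ext) (simp add: fps_mult_nth additive_sum[of h] assms)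

section \<open>Linear extension from monomials\<close>

lemma poly_mapping_decomp: "p = (\<Sum>a\<in>Poly_Mapping.keys p. Poly_Mapping.single a (Poly_Mapping.lookup p a))"
proof (rule poly_mapping_eqI)
  fix k
  have "(\<Sum>a\<in>Poly_Mapping.keys p. Poly_Mapping.lookup (Poly_Mapping.single a (Poly_Mapping.lookup p a)) k) =
        (\<Sum>a\<in>Poly_Mapping.keys p. if a = k then Poly_Mapping.lookup p k else 0)"
    by (rule sum.cong) (auto simp: lookup_single when_def)
  also have "\<dots> = Poly_Mapping.lookup p k"
    by (simp add: in_keys_iff)
  finally show "Poly_Mapping.lookup p k = Poly_Mapping.lookup
     (\<Sum>a\<in>Poly_Mapping.keys p. Poly_Mapping.single a (Poly_Mapping.lookup p a)) k"
    by (simp add: lookup_sum)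
qed

text \<open>The case \<open>single\<close> is restricted to keys of the given element, so that facts
  known only for these keys, such as validity and degree bounds, can be used in it.\<close>

lemma poly_mapping_additive_induct [case_names zero single add]:
  fixes p :: "'a \<Rightarrow>\<^sub>0 'b::comm_monoid_add"
  assumes "P 0" "\<And>a c. a \<in> Poly_Mapping.keys p \<Longrightarrow> P (Poly_Mapping.single a c)" "\<And>p q. P p \<Longrightarrow> P q \<Longrightarrow> P (p + q)"
  shows "P p"
proof -
  have "finite S \<Longrightarrow> S \<subseteq> Poly_Mapping.keys p \<Longrightarrow>
      P (\<Sum>a\<in>S. Poly_Mapping.single a (Poly_Mapping.lookup p a))" for S
    by (induction S rule: finite_induct) (auto simp: assms)
  then show ?thesis using poly_mapping_decomp[of p] by (metis finite_keys order_refl)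
qed

text \<open>The scalar embedding \<open>sc\<close> is a parameter because the same extension is
  needed with values in Laurent polynomials (\<open>con\<close>), operators (\<open>cst\<close>) and
  formal operators (\<open>cE\<close>).\<close>

definition lext :: "(complex \<Rightarrow> 'r::ring_1) \<Rightarrow> ('m \<Rightarrow> 'r) \<Rightarrow> ('m \<Rightarrow>\<^sub>0 complex) \<Rightarrow> 'r" where
  "lext sc \<phi> p = (\<Sum>a\<in>Poly_Mapping.keys p. sc (Poly_Mapping.lookup p a) * \<phi> a)"

locale scalar_hom =
  fixes sc :: "complex \<Rightarrow> 'r::ring_1"
  assumes sc_add: "sc (a + b) = sc a + sc b"
    and sc_mult: "sc (a * b) = sc a * sc b"
    and sc_one: "sc 1 = 1"
    and sc_central: "sc a * x = x * sc a"
begin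

lemma sc_zero [simp]: "sc 0 = 0" by (rule additive_zero[OF sc_add])
lemma sc_minus: "sc (- a) = - sc a" by (metis add.inverse_unique add.right_inverse sc_add sc_zero)
lemma sc_diff: "sc (a - b) = sc a - sc b" using sc_add[of a "- b"] by (simp add: sc_minus)
lemma sc_left_commute: "x * (sc a * y) = sc a * (x * y)"
  using arg_cong[OF sc_central[of a x], of "\<lambda>t. t * y"] by (simp add: mult.assoc)
lemma lext_superset:
  assumes "finite S" "Poly_Mapping.keys p \<subseteq> S"
  shows "lext sc \<phi> p = (\<Sum>a\<in>S. sc (Poly_Mapping.lookup p a) * \<phi> a)"
  unfolding lext_def by (rule sum.mono_neutral_left) (use assms in \<open>auto simp: in_keys_iff\<close>)

lemma lext_zero [simp]: "lext sc \<phi> 0 = 0" by (simp add: lext_def)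

lemma lext_add: "lext sc \<phi> (p + q) = lext sc \<phi> p + lext sc \<phi> q"
proof -
  let ?S = "Poly_Mapping.keys p \<union> Poly_Mapping.keys q"
  have "Poly_Mapping.keys (p + q) \<subseteq> ?S" by (rule Poly_Mapping.keys_add)
  then show ?thesis
    by (subst (1 2 3) lext_superset[of ?S]) (auto simp: lookup_add sc_add distrib_right sum.distrib)
qed

lemma lext_single [simp]: "lext sc \<phi> (Poly_Mapping.single a c) = sc c * \<phi> a"
  by (subst lext_superset[of "{a}"]) auto

lemma lext_scalar: "lext sc \<phi> (Poly_Mapping.single 0 c * p) = sc c * lext sc \<phi> p"
proof (induction p rule: poly_mapping_additive_induct)
  case (single a d) then show ?case by (simp add: mult_single sc_mult mult.assoc)
qed (simp_all add: distrib_left lext_add)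

lemma lext_mult:
  assumes "\<And>a b. \<phi> (a + b) = \<phi> a * \<phi> b"
  shows "lext sc \<phi> (p * q) = lext sc \<phi> p * lext sc \<phi> q"
proof (induction p rule: poly_mapping_additive_induct)
  case (single a c)
  show ?case
  proof (induction q rule: poly_mapping_additive_induct)
    case (single b d)
    have "\<phi> a * (sc d * \<phi> b) = sc d * (\<phi> a * \<phi> b)" by (rule sc_left_commute)
    moreover have "sc (c * d) = sc c * sc d" by (rule sc_mult)
    ultimately show ?case by (simp add: mult_single assms mult.assoc)
  qed (simp_all add: distrib_left lext_add)
qed (simp_all add: distrib_right lext_add)

end

interpretation scalar_single: scalar_hom "\<lambda>c. Poly_Mapping.single (0::'m::monoid_add) c"
proof
  fix a and x :: "'m \<Rightarrow>\<^sub>0 complex"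
  show "Poly_Mapping.single 0 a * x = x * Poly_Mapping.single 0 a"
    by (induction x rule: poly_mapping_additive_induct) (simp_all add: mult_single mult.commute distrib_left distrib_right)
qed (simp_all add: single_add mult_single)

section \<open>Linear operators on Laurent polynomials\<close>

type_synonym lpoly = "expo \<Rightarrow>\<^sub>0 complex"

abbreviation con :: "complex \<Rightarrow> lpoly" where "con c \<equiv> Poly_Mapping.single 0 c"
abbreviation mnm :: "expo \<Rightarrow> lpoly" where "mnm a \<equiv> Poly_Mapping.single a 1"

text \<open>The variables are indexed by all natural numbers; the restriction to X_1, ..., X_N is
  imposed later through invariant sets of exponents. As a type of class \<open>ring_1\<close>,
  \<open>lop\<close> can be the coefficient ring of \<open>lop fps\<close>, in which the generators
  act.\<close>

typedef lop = "{f :: lpoly \<Rightarrow> lpoly. (\<forall>p q. f (p + q) = f p + f q) \<and> (\<forall>c p. f (con c * p) = con c * f p)}"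
  morphisms app Lop
  by (rule exI[of _ "\<lambda>p. 0"]) simp

setup_lifting type_definition_lop

lemma app_add: "app A (p + q) = app A p + app A q" using app[of A] by simp
lemma app_con: "app A (con c * p) = con c * app A p" using app[of A] by simp
lemma app_zero [simp]: "app A 0 = 0" by (rule additive_zero[OF app_add])
lemma app_minus: "app A (- p) = - app A p" by (metis add.inverse_unique add.right_inverse app_add app_zero)
lemma app_diff: "app A (p - q) = app A p - app A q" using app_add[of A p "- q"] by (simp add: app_minus)
lemma app_sum: "app A (sum f S) = (\<Sum>x\<in>S. app A (f x))" by (rule additive_sum[OF app_add])
lemma app_single: "app A (Poly_Mapping.single a c) = con c * app A (mnm a)"
  by (simp add: app_con[symmetric] mult_single)

instantiation lop :: ring_1
begin
lift_definition zero_lop :: lop is "\<lambda>p. 0" by simp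
lift_definition one_lop :: lop is "\<lambda>p. p" by simp
lift_definition plus_lop :: "lop \<Rightarrow> lop \<Rightarrow> lop" is "\<lambda>f g p. f p + g p" by (simp add: algebra_simps)
lift_definition minus_lop :: "lop \<Rightarrow> lop \<Rightarrow> lop" is "\<lambda>f g p. f p - g p" by (simp add: algebra_simps)
lift_definition uminus_lop :: "lop \<Rightarrow> lop" is "\<lambda>f p. - f p" by (simp add: algebra_simps)
lift_definition times_lop :: "lop \<Rightarrow> lop \<Rightarrow> lop" is "\<lambda>f g p. f (g p)" by simp
instance
proof
  show "(0::lop) \<noteq> 1"
  proof (transfer, rule notI)
    assume "(\<lambda>p::lpoly. 0) = (\<lambda>p. p)"
    from fun_cong[OF this, of 1] show False by simp
  qed
qed (transfer, simp add: fun_eq_iff algebra_simps)+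
end

lemma app_0 [simp]: "app 0 p = 0" by transfer simp
lemma app_1 [simp]: "app 1 p = p" by transfer simp
lemma app_plus [simp]: "app (A + B) p = app A p + app B p" by transfer simp
lemma app_minus' [simp]: "app (A - B) p = app A p - app B p" by transfer simp
lemma app_uminus [simp]: "app (- A) p = - app A p" by transfer simp
lemma app_times [simp]: "app (A * B) p = app A (app B p)" by transfer simp
lemma app_sum_op: "app (sum F S) p = (\<Sum>x\<in>S. app (F x) p)"
  by (induction S rule: infinite_finite_induct) simp_all

lemma lop_eqI: "(\<And>a. app A (mnm a) = app B (mnm a)) \<Longrightarrow> A = B"
proof -
  assume *: "\<And>a. app A (mnm a) = app B (mnm a)"
  have "app A p = app B p" for p
  proof (induction p rule: poly_mapping_additive_induct)
    case (single a c) show ?case using * by (metis app_single)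
  qed (simp_all add: app_add)
  then show ?thesis by (simp add: app_inject[symmetric] fun_eq_iff)
qed

definition mulop :: "lpoly \<Rightarrow> lop" where "mulop p = Lop ((*) p)"
definition mono_op :: "(expo \<Rightarrow> lpoly) \<Rightarrow> lop" where "mono_op \<phi> = Lop (lext con \<phi>)"

lemma app_mulop [simp]: "app (mulop p) q = p * q"
  unfolding mulop_def by (subst Lop_inverse) (simp_all add: distrib_left mult.left_commute)
lemma app_mono_op: "app (mono_op \<phi>) p = lext con \<phi> p"
  unfolding mono_op_def
  by (subst Lop_inverse) (simp_all only: mem_Collect_eq scalar_single.lext_add scalar_single.lext_scalar simp_thms)
lemma app_mono_op_single [simp]: "app (mono_op \<phi>) (Poly_Mapping.single a c) = con c * \<phi> a"
  unfolding app_mono_op by (rule scalar_single.lext_single)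

lemma mulop_add: "mulop (p + q) = mulop p + mulop q" by (rule lop_eqI) (simp add: algebra_simps)
lemma mulop_diff: "mulop (p - q) = mulop p - mulop q" by (rule lop_eqI) (simp add: algebra_simps)
lemma mulop_mult: "mulop (p * q) = mulop p * mulop q" by (rule lop_eqI) (simp add: algebra_simps)
lemma mulop_one [simp]: "mulop 1 = 1" by (rule lop_eqI) simp
lemma mulop_zero [simp]: "mulop 0 = 0" by (rule lop_eqI) simp
lemma mulop_commute: "mulop p * mulop q = mulop q * mulop p" by (simp flip: mulop_mult add: mult.commute)
abbreviation cst :: "complex \<Rightarrow> lop" where "cst c \<equiv> mulop (con c)"

interpretation cst: scalar_hom cst
proof
  fix a and A :: lop
  show "cst a * A = A * cst a" by (rule lop_eqI) (simp add: app_con)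
qed (simp_all add: single_add mulop_add mulop_mult[symmetric] mult_single)

section \<open>Formal operators\<close>

definition scE :: "complex fps \<Rightarrow> lop fps" where "scE = fmap cst"

lemma scE_nth [simp]: "fps_nth (scE c) n = cst (fps_nth c n)" by (simp add: scE_def)
lemma scE_add: "scE (a + b) = scE a + scE b" unfolding scE_def by (rule fmap_add) (rule cst.sc_add)
lemma scE_diff: "scE (a - b) = scE a - scE b" by (rule fps_ext) (simp add: cst.sc_diff)
lemma scE_mult: "scE (a * b) = scE a * scE b"
  unfolding scE_def by (rule fmap_mult) (simp_all add: cst.sc_add cst.sc_mult)
lemma scE_const: "scE (fps_const a) = fps_const (cst a)" unfolding scE_def by (rule fmap_const) simp
lemma scE_one [simp]: "scE 1 = 1" by (rule fps_ext) (simp add: cst.sc_one)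
lemma scE_X [simp]: "scE fps_X = fps_X" by (rule fps_ext) (simp add: cst.sc_one)
lemma scE_central: "scE c * A = A * scE c"
proof -
  let ?Z = "\<lambda>c A. scE c * A - A * scE c"
  have "?Z c A = 0"
  proof (rule bilinear_fps_zero[where Z = ?Z])
    show "?Z (fps_const a) (fps_const b) = 0" for a b by (simp add: scE_const cst.sc_central)
    show "?Z f (fps_X * g) = fps_X * ?Z f g" for f g
      by (metis (no_types, lifting) fps_mult_fps_X_commute mult.assoc right_diff_distrib)
    show "?Z (fps_X * f) g = fps_X * ?Z f g" for f g
      by (metis (no_types, lifting) fps_mult_fps_X_commute mult.assoc right_diff_distrib scE_mult scE_X)
  qed (simp_all add: scE_add algebra_simps)
  then show ?thesis by simp
qed

lemma scE_left_commute: "A * (scE c * B) = scE c * (A * B)"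
  using arg_cong[OF scE_central[of c A], of "\<lambda>t. t * B"] by (simp add: mult.assoc)

definition act :: "lop fps \<Rightarrow> laurent \<Rightarrow> laurent" where
  "act A f = Abs_fps (\<lambda>n. \<Sum>i\<le>n. app (fps_nth A i) (fps_nth f (n - i)))"

lemma act_nth: "fps_nth (act A f) n = (\<Sum>i\<le>n. app (fps_nth A i) (fps_nth f (n - i)))"
  by (simp add: act_def)

lemma act_add_left: "act (A + B) f = act A f + act B f"
  by (rule fps_ext) (simp add: act_nth sum.distrib)
lemma act_diff_left: "act (A - B) f = act A f - act B f"
  by (rule fps_ext) (simp add: act_nth sum_subtractf)
lemma act_add: "act A (f + g) = act A f + act A g"
  by (rule fps_ext) (simp add: act_nth sum.distrib app_add)
lemma act_zero [simp]: "act A 0 = 0" by (rule fps_ext) (simp add: act_nth)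

lemma act_const: "fps_nth (act (fps_const A) f) n = app A (fps_nth f n)"
proof -
  have "(\<Sum>i\<le>n. app (fps_nth (fps_const A) i) (fps_nth f (n - i))) = (\<Sum>i\<le>n. if i = 0 then app A (fps_nth f n) else 0)"
    by (rule sum.cong) auto
  then show ?thesis by (simp add: act_nth)
qed

lemma act_const_const: "act (fps_const A) (fps_const p) = fps_const (app A p)"
  by (rule fps_ext) (simp add: act_const)

lemma act_X_left: "act (fps_X * A) f = fps_X * act A f"
proof (rule fps_ext)
  fix n show "fps_nth (act (fps_X * A) f) n = fps_nth (fps_X * act A f) n"
  proof (cases n)
    case (Suc k)
    show ?thesis unfolding act_nth Suc by (subst sum.atMost_Suc_shift) (simp add: act_nth)
  qed (simp add: act_nth)
qed

lemma act_X: "act A (fps_X * f) = fps_X * act A f"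
proof (rule fps_ext)
  fix n show "fps_nth (act A (fps_X * f)) n = fps_nth (fps_X * act A f) n"
  proof (cases n)
    case (Suc k)
    show ?thesis unfolding act_nth Suc by (subst sum.atMost_Suc) (simp add: act_nth Suc_diff_le)
  qed (simp add: act_nth)
qed

lemma act_one [simp]: "act 1 f = f"
  by (rule fps_ext) (simp add: act_const flip: fps_const_1_eq_1)

lemma act_mult: "act (A * B) f = act A (act B f)"
proof -
  let ?Z = "\<lambda>B f. act (A * B) f - act A (act B f)"
  have "?Z B f = 0"
  proof (rule bilinear_fps_zero[where Z = ?Z])
    fix b p
    show "?Z (fps_const b) (fps_const p) = 0"
    proof -
      have "act (A * fps_const b) (fps_const p) = act A (act (fps_const b) (fps_const p))"
        by (rule linear_fps_eq[where F = "\<lambda>A. act (A * fps_const b) (fps_const p)"])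
          (simp_all add: act_const_const distrib_right act_add_left mult.assoc act_X_left)
      then show ?thesis by simp
    qed
    show "?Z f (fps_X * g) = fps_X * ?Z f g" for f g
      by (simp add: act_X right_diff_distrib)
    show "?Z (fps_X * f) g = fps_X * ?Z f g" for f g
    proof -
      have "A * (fps_X * f) = fps_X * (A * f)" by (metis fps_mult_fps_X_commute mult.assoc)
      then show ?thesis by (simp add: act_X act_X_left right_diff_distrib)
    qed
  qed (simp_all add: act_add act_add_left distrib_left)
  then show ?thesis by simp
qed

lemma act_scE: "act (scE c) f = scal c * f"
  by (rule fps_ext) (simp add: act_nth scal_def fps_mult_nth atLeast0AtMost)

lemma act_scal: "act A (scal c * f) = scal c * act A f"
  using arg_cong[OF scE_central[of c A], of "\<lambda>t. act t f"] by (simp add: act_mult act_scE)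

lemma formal_op_eqI:
  assumes "\<And>a. act A (fps_const (mnm a)) = act B (fps_const (mnm a))" shows "A = B"
proof (rule fps_ext, rule lop_eqI)
  fix n a
  have *: "fps_nth (act A (fps_const (mnm a))) n = app (fps_nth A n) (mnm a)" for A
  proof -
    have "(\<Sum>i\<le>n. app (fps_nth A i) (fps_nth (fps_const (mnm a)) (n - i))) =
        (\<Sum>i\<le>n. if i = n then app (fps_nth A n) (mnm a) else 0)" by (rule sum.cong) auto
    then show ?thesis by (simp add: act_nth)
  qed
  show "app (fps_nth A n) (mnm a) = app (fps_nth B n) (mnm a)" using assms[of a] by (simp flip: *)
qed

section \<open>Solving implicit power series equations\<close>

definition eq_upto :: "nat \<Rightarrow> 'a::zero fps \<Rightarrow> 'a fps \<Rightarrow> bool" where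
  "eq_upto n A B \<longleftrightarrow> (\<forall>i<n. fps_nth A i = fps_nth B i)"

lemma eq_upto_refl [simp]: "eq_upto n A A" by (simp add: eq_upto_def)
lemma eq_upto_trans: "eq_upto n A B \<Longrightarrow> eq_upto n B C \<Longrightarrow> eq_upto n A C" by (simp add: eq_upto_def)
lemma eq_upto_mono: "eq_upto n A B \<Longrightarrow> m \<le> n \<Longrightarrow> eq_upto m A B" by (simp add: eq_upto_def)

lemma eq_upto_mult:
  fixes A :: "'a::ring_1 fps"
  shows "eq_upto n A B \<Longrightarrow> eq_upto n C D \<Longrightarrow> eq_upto n (A * C) (B * D)"
  by (auto simp: eq_upto_def fps_mult_nth intro!: sum.cong)

lemma eq_upto_power:
  fixes A :: "'a::ring_1 fps"
  shows "eq_upto n A B \<Longrightarrow> eq_upto n (A ^ k) (B ^ k)"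
  by (induction k) (auto intro: eq_upto_mult)

lemma eq_upto_X:
  fixes A :: "'a::ring_1 fps"
  shows "eq_upto n A B \<Longrightarrow> eq_upto (Suc n) (C - fps_X * A) (C - fps_X * B)"
  by (auto simp: eq_upto_def)

lemma eq_upto_collapse:
  assumes "\<And>m. eq_upto n (fps_nth A m) (fps_nth B m)"
  shows "eq_upto n (collapse A) (collapse B)"
  using assms unfolding eq_upto_def collapse_def by (auto intro!: sum.cong)

text \<open>The intended examples are the operators that preserve the span of a set of monomials.
  Power series equations are solved relative to such a set, so that the solution preserves the same
  span as the data.\<close>

definition subalg :: "lop set \<Rightarrow> bool" where
  "subalg R \<longleftrightarrow> (\<forall>c. cst c \<in> R) \<and> (\<forall>a\<in>R. \<forall>b\<in>R. a + b \<in> R \<and> a * b \<in> R)"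

definition ops :: "'a set \<Rightarrow> 'a::zero fps set" where
  "ops R = {A. \<forall>n. fps_nth A n \<in> R}"

context
  fixes R assumes R: "subalg R"
begin

lemma subalg_cst: "cst c \<in> R" using R by (simp add: subalg_def)
lemma subalg_zero: "0 \<in> R" using subalg_cst[of 0] by simp
lemma subalg_one: "1 \<in> R" using subalg_cst[of 1] by simp
lemma subalg_add: "a \<in> R \<Longrightarrow> b \<in> R \<Longrightarrow> a + b \<in> R" using R by (simp add: subalg_def)
lemma subalg_mult: "a \<in> R \<Longrightarrow> b \<in> R \<Longrightarrow> a * b \<in> R" using R by (simp add: subalg_def)
lemma subalg_diff: "a \<in> R \<Longrightarrow> b \<in> R \<Longrightarrow> a - b \<in> R"
  using subalg_add[of a "cst (-1) * b"] subalg_mult[OF subalg_cst[of "-1"], of b]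
  by (simp add: cst.sc_minus cst.sc_one)
lemma subalg_sum: "(\<And>x. x \<in> S \<Longrightarrow> f x \<in> R) \<Longrightarrow> sum f S \<in> R"
  by (induction S rule: infinite_finite_induct) (auto simp: subalg_zero subalg_add)

lemma ops_add: "A \<in> ops R \<Longrightarrow> B \<in> ops R \<Longrightarrow> A + B \<in> ops R" by (simp add: ops_def subalg_add)
lemma ops_diff: "A \<in> ops R \<Longrightarrow> B \<in> ops R \<Longrightarrow> A - B \<in> ops R" by (simp add: ops_def subalg_diff)
lemma ops_mult: "A \<in> ops R \<Longrightarrow> B \<in> ops R \<Longrightarrow> A * B \<in> ops R"
  by (auto simp: ops_def fps_mult_nth intro!: subalg_sum subalg_mult)
lemma ops_scE: "scE c \<in> ops R" by (simp add: ops_def subalg_cst)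
lemma ops_const: "a \<in> R \<Longrightarrow> fps_const a \<in> ops R" by (simp add: ops_def subalg_zero)
lemma ops_one: "1 \<in> ops R" using ops_scE[of 1] by simp
lemma ops_zero: "0 \<in> ops R" by (simp add: ops_def subalg_zero)
lemma ops_power: "A \<in> ops R \<Longrightarrow> A ^ n \<in> ops R" by (induction n) (simp_all add: ops_one ops_mult)
lemma ops_X: "A \<in> ops R \<Longrightarrow> fps_X * A \<in> ops R" using ops_mult[OF ops_scE[of fps_X]] by simp
lemma ops_collapse: "(\<And>m. fps_nth A m \<in> ops R) \<Longrightarrow> collapse A \<in> ops R"
  by (auto simp: ops_def collapse_def intro!: subalg_sum)
lemma ops_sum: "(\<And>x. x \<in> S \<Longrightarrow> f x \<in> ops R) \<Longrightarrow> sum f S \<in> ops R"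
  by (induction S rule: infinite_finite_induct) (auto simp: ops_zero ops_add)
lemma ops_prod_list: "(\<And>x. x \<in> set xs \<Longrightarrow> x \<in> ops R) \<Longrightarrow> prod_list xs \<in> ops R"
  by (induction xs) (auto simp: ops_one ops_mult)
end

abbreviation cE :: "complex \<Rightarrow> lop fps" where "cE c \<equiv> scE (fps_const c)"

interpretation cE: scalar_hom cE
proof
  show "cE a * x = x * cE a" for a x by (rule scE_central)
qed (simp_all flip: scE_add scE_mult)

text \<open>Both substitutions in the definition of the algebra have this shape: s
  e^(-\<epsilon>ks/2) for c_j = (-k/2)^j / j!, and (e^(\<epsilon>y) - 1) / \<epsilon> for c_j = 1 /
  (j+1)!.\<close>

definition pser :: "(nat \<Rightarrow> complex) \<Rightarrow> lop fps \<Rightarrow> lop fps" where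
  "pser c A = collapse (Abs_fps (\<lambda>j. cE (c j) * A ^ Suc j))"

text \<open>Because c_0 = 1, the series is y + \<epsilon> H(y), so the equation reads y = Z -
  \<epsilon> H(y). The right-hand side is a contraction for the \<epsilon>-adic topology, and its
  iterates from 0 stay in the subalgebra coefficient by coefficient.\<close>

lemma exists_pser:
  assumes c: "c 0 = 1" and R: "subalg R" and Z: "Z \<in> ops R"
  shows "\<exists>y\<in>ops R. pser c y = Z"
proof -
  define H where "H y = collapse (Abs_fps (\<lambda>j. cE (c (Suc j)) * y ^ (j + 2)))" for y
  have pser: "pser c y = y + fps_X * H y" for y
  proof -
    have "fps_shift 1 (Abs_fps (\<lambda>j. cE (c j) * y ^ Suc j)) = Abs_fps (\<lambda>j. cE (c (Suc j)) * y ^ (j + 2))"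
      by (rule fps_ext) simp
    then show ?thesis unfolding pser_def H_def by (subst collapse_decomp) (simp add: c)
  qed
  have H_eq: "eq_upto n (H A) (H B)" if "eq_upto n A B" for n A B
    unfolding H_def by (rule eq_upto_collapse) (simp, intro eq_upto_mult eq_upto_refl eq_upto_power that)
  have H_R: "H A \<in> ops R" if "A \<in> ops R" for A
    unfolding H_def
    by (rule ops_collapse[OF R]) (simp del: power_Suc add: ops_mult[OF R] ops_power[OF R] ops_scE[OF R] that)
  define it where "it m = ((\<lambda>A. Z - fps_X * H A) ^^ m) 0" for m
  have it_Suc: "it (Suc m) = Z - fps_X * H (it m)" for m by (simp add: it_def)
  have step: "eq_upto m (it m) (it (Suc m))" for m
  proof (induction m)
    case (Suc m) then show ?case unfolding it_Suc[of "Suc m"] by (subst it_Suc) (rule eq_upto_X[OF H_eq])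
  qed (simp add: eq_upto_def)
  have conv: "eq_upto m (it m) (it (m + k))" for m k
  proof (induction k)
    case (Suc k)
    have "eq_upto m (it (m + k)) (it (m + Suc k))"
      using eq_upto_mono[OF step[of "m + k"], of m] by simp
    then show ?case using Suc by (rule eq_upto_trans[rotated])
  qed simp
  \<comment> \<open>Coefficient n is read off from iterate n + 1, from which point on it no longer
    changes.\<close>
  define y where "y = Abs_fps (\<lambda>n. fps_nth (it (Suc n)) n)"
  have y: "eq_upto m y (it m)" for m
    unfolding eq_upto_def
  proof (intro allI impI)
    fix i assume "i < m"
    then obtain k where "m = Suc i + k" using less_eq_Suc_le le_Suc_ex by metis
    then show "fps_nth y i = fps_nth (it m) i" using conv[of "Suc i" k] by (simp add: y_def eq_upto_def)
  qed
  have "y = Z - fps_X * H y"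
  proof (rule fps_ext)
    fix n
    have "eq_upto (Suc n) y (it (Suc n))" by (rule y)
    moreover have "eq_upto (Suc n) (Z - fps_X * H y) (it (Suc n))"
      unfolding it_Suc by (rule eq_upto_X[OF H_eq[OF y]])
    ultimately show "fps_nth y n = fps_nth (Z - fps_X * H y) n" by (simp add: eq_upto_def)
  qed
  then have "pser c y = Z" unfolding pser by (metis diff_add_cancel)
  moreover have "it m \<in> ops R" for m
    by (induction m) (simp_all add: it_Suc ops_diff[OF R] Z H_R ops_X[OF R], simp add: it_def ops_zero[OF R])
  then have "y \<in> ops R" by (simp add: y_def ops_def)
  ultimately show ?thesis by blast
qed

section \<open>Operators attached to elements of the free algebra\<close>

definition word_op :: "(gen \<Rightarrow> lop fps) \<Rightarrow> gen free_monoid \<Rightarrow> lop fps" where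
  "word_op G w = prod_list (map G (letters w))"

lemma word_op_zero [simp]: "word_op G 0 = 1" by (simp add: word_op_def zero_free_monoid_def)
lemma word_op_add: "word_op G (v + w) = word_op G v * word_op G w"
  by (simp add: word_op_def plus_free_monoid_def)

definition poly_op :: "(gen \<Rightarrow> lop fps) \<Rightarrow> (gen free_monoid \<Rightarrow>\<^sub>0 complex) \<Rightarrow> lop fps" where
  "poly_op G = lext cE (word_op G)"

lemma poly_op_add: "poly_op G (p + q) = poly_op G p + poly_op G q"
  by (simp add: poly_op_def cE.lext_add)
lemma poly_op_mult: "poly_op G (p * q) = poly_op G p * poly_op G q"
  unfolding poly_op_def by (rule cE.lext_mult) (rule word_op_add)
lemma poly_op_single [simp]: "poly_op G (Poly_Mapping.single w c) = cE c * word_op G w"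
  by (simp add: poly_op_def)
lemma poly_op_letter [simp]: "poly_op G (letter g) = G g"
  by (simp add: letter_def word_op_def)
lemma poly_op_zero [simp]: "poly_op G 0 = 0" by (simp add: poly_op_def)
lemma poly_op_one [simp]: "poly_op G 1 = 1"
  using poly_op_single[of G 0 1] by (simp del: poly_op_single)
lemma poly_op_power: "poly_op G (p ^ n) = poly_op G p ^ n"
  by (induction n) (simp_all add: poly_op_mult)

text \<open>Evaluation at operators for the letters. A coefficient of a series is sent to a formal
  operator, itself a series in \<epsilon>, so the result is a double series that has to be summed
  along the total power of \<epsilon>.\<close>

definition rep :: "(gen \<Rightarrow> lop fps) \<Rightarrow> free_elt \<Rightarrow> lop fps" where
  "rep G f = collapse (fmap (poly_op G) f)"

lemma rep_add: "rep G (f + g) = rep G f + rep G g"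
proof -
  have "fmap (poly_op G) (f + g) = fmap (poly_op G) f + fmap (poly_op G) g"
    by (rule fmap_add) (rule poly_op_add)
  then show ?thesis by (simp add: rep_def collapse_add)
qed
lemma rep_mult: "rep G (f * g) = rep G f * rep G g"
proof -
  have "fmap (poly_op G) (f * g) = fmap (poly_op G) f * fmap (poly_op G) g"
    by (rule fmap_mult) (rule poly_op_add poly_op_mult)+
  then show ?thesis by (simp add: rep_def collapse_mult)
qed
lemma rep_const: "rep G (fps_const p) = poly_op G p"
  by (simp add: rep_def fmap_const)
lemma rep_one [simp]: "rep G 1 = 1" using rep_const[of G 1] by simp
lemma rep_zero [simp]: "rep G 0 = 0" by (rule additive_zero[OF rep_add])
lemma rep_minus: "rep G (- f) = - rep G f"
  by (metis add.inverse_unique add.right_inverse rep_add rep_zero)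
lemma rep_diff: "rep G (f - g) = rep G f - rep G g"
  using rep_add[of G f "- g"] by (simp add: rep_minus)
lemma rep_X: "rep G (fps_X * f) = fps_X * rep G f"
proof -
  have "fmap (poly_op G) (fps_X * f) = fps_X * fmap (poly_op G) f" by (rule fmap_X) simp
  then show ?thesis by (simp add: rep_def collapse_X)
qed
lemma rep_prod_list: "rep G (prod_list xs) = prod_list (map (rep G) xs)"
  by (induction xs) (simp_all add: rep_mult)

lemma scal_const: "scal (fps_const c) = fps_const (Poly_Mapping.single 0 c)"
  by (rule fps_ext) (simp add: scal_def)
lemma scal_add: "scal (a + b) = scal a + scal b"
  by (rule fps_ext) (simp add: scal_def single_add)
lemma scal_nth [simp]: "fps_nth (scal c) n = Poly_Mapping.single 0 (fps_nth c n)" by (simp add: scal_def)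
lemma scal_X: "scal (fps_X * c) = fps_X * (scal c :: ('m::monoid_add \<Rightarrow>\<^sub>0 complex) fps)"
  by (rule fps_ext) simp
lemma scal_one [simp]: "scal 1 = (1 :: ('m::monoid_add \<Rightarrow>\<^sub>0 complex) fps)"
  by (rule fps_ext) simp
lemma scal_fps_X [simp]: "scal fps_X = (fps_X :: ('m::monoid_add \<Rightarrow>\<^sub>0 complex) fps)"
  using scal_X[of 1, where 'm='m] by simp

lemma scal_mult: "scal (a * b) = scal a * (scal b :: ('m::monoid_add \<Rightarrow>\<^sub>0 complex) fps)"
  by (rule fps_ext) (simp add: fps_mult_nth mult_single additive_sum[of "Poly_Mapping.single 0"] single_add)

lemma scal_central: "scal c * f = f * (scal c :: ('m::monoid_add \<Rightarrow>\<^sub>0 complex) fps)"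
proof -
  let ?Z = "\<lambda>c f. scal c * f - f * (scal c :: ('m \<Rightarrow>\<^sub>0 complex) fps)"
  have "?Z c f = 0"
  proof (rule bilinear_fps_zero[where Z = ?Z])
    show "?Z (fps_const a) (fps_const b) = 0" for a b
      by (simp add: scal_const scalar_single.sc_central)
    show "?Z f (fps_X * g) = fps_X * ?Z f g" for f g
      by (metis (no_types, lifting) fps_mult_fps_X_commute mult.assoc right_diff_distrib)
    show "?Z (fps_X * f) g = fps_X * ?Z f g" for f g
      by (metis (no_types, lifting) fps_mult_fps_X_commute mult.assoc right_diff_distrib scal_X)
  qed (simp_all add: scal_add algebra_simps)
  then show ?thesis by simp
qed

lemma rep_scal [simp]: "rep G (scal c) = scE c"
  by (rule linear_fps_eq[where F = "\<lambda>c. rep G (scal c)"])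
    (simp_all add: scal_add rep_add scE_add scal_X rep_X scE_mult scal_const rep_const)

lemma eexp_add: "eexp c a * eexp d a = eexp (c + d) a"
proof (rule fps_ext)
  fix n
  let ?s = "Poly_Mapping.single (0 :: gen free_monoid) :: complex \<Rightarrow> _"
  \<comment> \<open>The powers of the single element \<open>a\<close> commute, so the binomial
    identity can be taken over from the exponential series over the complex numbers.\<close>
  have bin: "(\<Sum>i=0..n. c ^ i / fact i * (d ^ (n - i) / fact (n - i))) = (c + d) ^ n / fact n"
    using arg_cong[OF fps_exp_add_mult[of c d], of "\<lambda>f. fps_nth f n"] by (simp add: fps_mult_nth)
  have "fps_nth (eexp c a * eexp d a) n =
      (\<Sum>i=0..n. ?s (c ^ i / fact i * (d ^ (n - i) / fact (n - i))) * a ^ n)"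
    unfolding fps_mult_nth eexp_def fps_nth_Abs_fps
  proof (rule sum.cong)
    fix i assume "i \<in> {0..n}"
    then have "a ^ n = a ^ i * a ^ (n - i)" by (simp flip: power_add)
    then show "?s (c ^ i / fact i) * a ^ i * (?s (d ^ (n - i) / fact (n - i)) * a ^ (n - i)) =
        ?s (c ^ i / fact i * (d ^ (n - i) / fact (n - i))) * a ^ n"
      by (simp only: scalar_single.sc_mult mult.assoc scalar_single.sc_left_commute[of "a ^ i"])
  qed simp
  also have "\<dots> = ?s (\<Sum>i=0..n. c ^ i / fact i * (d ^ (n - i) / fact (n - i))) * a ^ n"
    unfolding additive_sum[of ?s, OF single_add] sum_distrib_right ..
  finally show "fps_nth (eexp c a * eexp d a) n = fps_nth (eexp (c + d) a) n"
    unfolding bin by (simp add: eexp_def)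
qed

lemma eexp_zero [simp]: "eexp 0 a = 1"
  by (rule fps_ext) (simp add: eexp_def power_0_left)

lemma fY_fYinv: "fY i * fYinv i = 1" "fYinv i * fY i = 1"
  by (simp_all add: fY_def fYinv_def eexp_add)

lemma rep_fT: "rep G (fT k i) = pser (\<lambda>j. (- k / 2) ^ j / fact j) (G (GS i))"
proof -
  have "fmap (poly_op G) (fT k i) = Abs_fps (\<lambda>j. cE ((- k / 2) ^ j / fact j) * G (GS i) ^ Suc j)"
    by (rule fps_ext) (simp add: fT_def eexp_def poly_op_mult poly_op_power cE.sc_left_commute del: fps_const_divide)
  then show ?thesis by (simp add: rep_def pser_def)
qed

lemma rep_fY: "rep G (fY i) = 1 + fps_X * pser (\<lambda>j. 1 / fact (Suc j)) (G (GY i))"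
proof -
  let ?A = "fmap (poly_op G) (fY i)"
  have "fps_shift 1 ?A = Abs_fps (\<lambda>j. cE (1 / fact (Suc j)) * G (GY i) ^ Suc j)"
    by (rule fps_ext) (simp add: fY_def eexp_def poly_op_mult poly_op_power del: fps_const_divide)
  moreover have "fps_nth ?A 0 = 1" by (simp add: fY_def eexp_def)
  ultimately show ?thesis unfolding rep_def pser_def by (subst collapse_decomp) simp
qed

lemma rep_fX: "rep G (fX i) = G (GX i)" by (simp add: fX_def rep_const)
lemma rep_fXinv: "rep G (fXinv i) = G (GXinv i)" by (simp add: fXinv_def rep_const)
lemma rep_fy: "rep G (fy i) = G (GY i)" by (simp add: fy_def rep_const)

lemma rep_ops:
  assumes R: "subalg R" and f: "f \<in> carrier (free_alg N)" and G: "\<And>g. g \<in> gens N \<Longrightarrow> G g \<in> ops R"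
  shows "rep G f \<in> ops R"
  unfolding rep_def
proof (rule ops_collapse[OF R])
  fix m
  have "\<forall>w\<in>Poly_Mapping.keys (fps_nth f m). set (letters w) \<subseteq> gens N" using f by (simp add: free_alg_def)
  then show "fps_nth (fmap (poly_op G) f) m \<in> ops R"
    unfolding fmap_nth poly_op_def lext_def word_op_def
    by (intro ops_sum[OF R] ops_mult[OF R] ops_scE[OF R] ops_prod_list[OF R]) (auto intro: G)
qed

section \<open>Demazure-Lusztig operators, Cherednik operators and their relations\<close>

section \<open>The commuting elements of an affine braid group\<close>

lemma upt_split_pair: "i \<le> j \<Longrightarrow> j + 1 < n \<Longrightarrow> [i..<n] = [i..<j] @ [j, j + 1] @ [j + 2..<n]"
  using upt_add_eq_append[of i j "n - j"] by (simp add: upt_conv_Cons)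

lemma intertwine_mult: "a * x = x * b \<Longrightarrow> b * y = y * c \<Longrightarrow> a * (x * y) = x * y * c"
  for a :: "'a::monoid_mult"
  by (metis mult.assoc)

text \<open>Relations modelled on the extended affine braid group of type GL_N, where
  \<open>om\<close> plays the rotation of the affine diagram. The affine node is avoided: carrying
  T_1 past \<open>om\<close> would produce it, while past \<open>om * om\<close> it reappears as
  T_(N-1).\<close>

locale affine_braid =
  fixes N :: nat and T Ti :: "nat \<Rightarrow> 'a::monoid_mult" and om :: 'a
  assumes T_Ti: "i \<in> {1..<N} \<Longrightarrow> T i * Ti i = 1" and Ti_T: "i \<in> {1..<N} \<Longrightarrow> Ti i * T i = 1"
    and braid: "1 \<le> i \<Longrightarrow> i + 1 < N \<Longrightarrow> T i * T (i + 1) * T i = T (i + 1) * T i * T (i + 1)"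
    and T_T: "i \<in> {1..<N} \<Longrightarrow> j \<in> {1..<N} \<Longrightarrow> i + 2 \<le> j \<or> j + 2 \<le> i \<Longrightarrow> T i * T j = T j * T i"
    and om_T: "1 \<le> i \<Longrightarrow> i + 1 < N \<Longrightarrow> om * T (i + 1) = T i * om"
    and om_om_T: "2 \<le> N \<Longrightarrow> om * om * T 1 = T (N - 1) * (om * om)"
begin

definition P where "P i = prod_list (map Ti [i..<N])"
definition G where "G i = P i * om"
definition A where "A i = prod_list (map T [1..<i])"
definition Y where "Y i = G i * A i"

lemma Ti_T_assoc: "i \<in> {1..<N} \<Longrightarrow> Ti i * (T i * x) = x"
  by (simp flip: mult.assoc add: Ti_T)
lemma T_Ti_assoc: "i \<in> {1..<N} \<Longrightarrow> T i * (Ti i * x) = x"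
  by (simp flip: mult.assoc add: T_Ti)

lemma inverse_commute: "i \<in> {1..<N} \<Longrightarrow> x * T i = T i * x \<Longrightarrow> x * Ti i = Ti i * x"
  by (metis T_Ti Ti_T mult.assoc mult_1_left mult_1_right)

lemma T_cancel_left: "i \<in> {1..<N} \<Longrightarrow> T i * x = T i * y \<Longrightarrow> x = y" by (metis Ti_T_assoc)

lemma T_Ti_commute: "i \<in> {1..<N} \<Longrightarrow> j \<in> {1..<N} \<Longrightarrow> i + 2 \<le> j \<or> j + 2 \<le> i \<Longrightarrow> T i * Ti j = Ti j * T i"
  by (rule inverse_commute) (auto intro: T_T)

lemma T_prod_T: "i \<in> {1..<N} \<Longrightarrow> set js \<subseteq> {1..<N} \<Longrightarrow> (\<And>j. j \<in> set js \<Longrightarrow> i + 2 \<le> j \<or> j + 2 \<le> i) \<Longrightarrow>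
    T i * prod_list (map T js) = prod_list (map T js) * T i"
proof (induction js)
  case (Cons j js)
  have "T i * (T j * prod_list (map T js)) = T j * (T i * prod_list (map T js))"
    using T_T[of i j] Cons.prems by (simp flip: mult.assoc)
  then show ?case using Cons by (simp add: mult.assoc)
qed simp

lemma T_prod_Ti: "i \<in> {1..<N} \<Longrightarrow> set js \<subseteq> {1..<N} \<Longrightarrow> (\<And>j. j \<in> set js \<Longrightarrow> i + 2 \<le> j \<or> j + 2 \<le> i) \<Longrightarrow>
    T i * prod_list (map Ti js) = prod_list (map Ti js) * T i"
proof (induction js)
  case (Cons j js)
  have "T i * (Ti j * prod_list (map Ti js)) = Ti j * (T i * prod_list (map Ti js))"
    using T_Ti_commute[of i j] Cons.prems by (simp flip: mult.assoc)
  then show ?case using Cons by (simp add: mult.assoc)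
qed simp

lemma P_rec: "i \<in> {1..<N} \<Longrightarrow> P i = Ti i * P (i + 1)"
  by (simp add: P_def upt_conv_Cons)
lemma G_rec: "i \<in> {1..<N} \<Longrightarrow> T i * G i = G (i + 1)"
  by (simp add: G_def P_rec mult.assoc T_Ti_assoc)
lemma A_rec: "1 \<le> i \<Longrightarrow> A (i + 1) = A i * T i"
  by (simp add: A_def)
lemma A_one [simp]: "A (Suc 0) = 1" by (simp add: A_def)

lemma Y_rec: "i \<in> {1..<N} \<Longrightarrow> T i * Y i * T i = Y (i + 1)"
  using A_rec[of i] G_rec[of i] by (simp add: Y_def mult.assoc[symmetric])

lemma braid_inv: "1 \<le> j \<Longrightarrow> j + 1 < N \<Longrightarrow> T (j + 1) * (Ti j * Ti (j + 1)) = Ti j * Ti (j + 1) * T j"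
proof -
  assume j: "1 \<le> j" "j + 1 < N"
  have "T (j + 1) * (T j * (T (j + 1) * (Ti j * Ti (j + 1)))) = (T (j + 1) * T j * T (j + 1)) * (Ti j * Ti (j + 1))"
    by (simp add: mult.assoc)
  also have "\<dots> = T j * T (j + 1) * T j * (Ti j * Ti (j + 1))" using braid[OF j] by simp
  also have "\<dots> = T j" using j by (simp add: mult.assoc T_Ti_assoc T_Ti)
  finally have "T (j + 1) * (T j * (T (j + 1) * (Ti j * Ti (j + 1)))) = T (j + 1) * (T j * (Ti j * Ti (j + 1) * T j))"
    using j by (simp add: mult.assoc T_Ti_assoc)
  moreover have "j + 1 \<in> {1..<N}" "j \<in> {1..<N}" using j by auto
  ultimately show ?thesis using T_cancel_left by blast
qed

text \<open>T_(j+1) commutes with the inverse factors of index below j, passes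
  \<open>Ti j * Ti (j + 1)\<close> by the braid relation and comes out as T_j, which commutes with
  the remaining factors.\<close>

lemma T_P: "1 \<le> i \<Longrightarrow> i \<le> j \<Longrightarrow> j + 1 < N \<Longrightarrow> T (j + 1) * P i = P i * T j"
proof -
  assume ij: "1 \<le> i" "i \<le> j" "j + 1 < N"
  have "[i..<N] = [i..<j] @ [j, j + 1] @ [j + 2..<N]" by (rule upt_split_pair) (use ij in auto)
  then have P: "P i = prod_list (map Ti [i..<j]) * (Ti j * Ti (j + 1)) * prod_list (map Ti [j+2..<N])"
    by (simp add: P_def mult.assoc)
  have 1: "T (j + 1) * prod_list (map Ti [i..<j]) = prod_list (map Ti [i..<j]) * T (j + 1)"
    by (rule T_prod_Ti) (use ij in auto)
  have 2: "T j * prod_list (map Ti [j+2..<N]) = prod_list (map Ti [j+2..<N]) * T j"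
    by (rule T_prod_Ti) (use ij in auto)
  have "T (j + 1) * P i = prod_list (map Ti [i..<j]) * (T (j + 1) * (Ti j * Ti (j + 1))) * prod_list (map Ti [j+2..<N])"
    unfolding P using 1 by (simp flip: mult.assoc)
  also have "\<dots> = prod_list (map Ti [i..<j]) * (Ti j * Ti (j + 1)) * (T j * prod_list (map Ti [j+2..<N]))"
    using ij by (simp only: braid_inv mult.assoc)
  finally show ?thesis unfolding 2 P by (simp add: mult.assoc)
qed

lemma T_A: "1 \<le> i \<Longrightarrow> i + 1 < j \<Longrightarrow> j \<le> N \<Longrightarrow> T (i + 1) * A j = A j * T i"
proof -
  assume ij: "1 \<le> i" "i + 1 < j" "j \<le> N"
  have "[1..<j] = [1..<i] @ [i, i + 1] @ [i + 2..<j]" by (rule upt_split_pair) (use ij in auto)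
  then have A: "A j = prod_list (map T [1..<i]) * (T i * T (i + 1)) * prod_list (map T [i+2..<j])"
    by (simp add: A_def mult.assoc)
  have 1: "T (i + 1) * prod_list (map T [1..<i]) = prod_list (map T [1..<i]) * T (i + 1)"
    by (rule T_prod_T) (use ij in auto)
  have 2: "T i * prod_list (map T [i+2..<j]) = prod_list (map T [i+2..<j]) * T i"
    by (rule T_prod_T) (use ij in auto)
  have "T (i + 1) * A j = prod_list (map T [1..<i]) * (T (i + 1) * T i * T (i + 1)) * prod_list (map T [i+2..<j])"
    unfolding A using 1 by (simp flip: mult.assoc)
  also have "T (i + 1) * T i * T (i + 1) = T i * T (i + 1) * T i" using braid ij by simp
  also have "prod_list (map T [1..<i]) * (T i * T (i + 1) * T i) * prod_list (map T [i+2..<j]) =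
      prod_list (map T [1..<i]) * (T i * T (i + 1)) * (T i * prod_list (map T [i+2..<j]))"
    by (simp only: mult.assoc)
  finally show ?thesis unfolding 2 A by (simp add: mult.assoc)
qed

lemma G_T_less: "1 \<le> i \<Longrightarrow> i + 1 < j \<Longrightarrow> j \<le> N \<Longrightarrow> G j * T (i + 1) = T i * G j"
proof -
  assume ij: "1 \<le> i" "i + 1 < j" "j \<le> N"
  have "T i * P j = P j * T i" unfolding P_def by (rule T_prod_Ti) (use ij in auto)
  then have "T i * G j = P j * (T i * om)" by (simp add: G_def flip: mult.assoc)
  then show ?thesis using om_T[of i] ij by (simp add: G_def mult.assoc)
qed

lemma G_T_greater: "1 \<le> j \<Longrightarrow> j < i \<Longrightarrow> i < N \<Longrightarrow> G j * T i = T i * G j"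
proof -
  assume ij: "1 \<le> j" "j < i" "i < N"
  then obtain m where m: "i = m + 1" "j \<le> m" by (metis add.commute less_imp_Suc_add le_add1 plus_1_eq_Suc)
  have "T (m + 1) * P j = P j * T m" by (rule T_P) (use ij m in auto)
  then have "T (m + 1) * G j = P j * (T m * om)" by (simp add: G_def flip: mult.assoc)
  then show ?thesis using om_T[of m] ij m by (simp add: G_def mult.assoc)
qed

lemma T_Y: "i \<in> {1..<N} \<Longrightarrow> j \<in> {1..N} \<Longrightarrow> j \<noteq> i \<Longrightarrow> j \<noteq> i + 1 \<Longrightarrow> T i * Y j = Y j * T i"
proof -
  assume ij: "i \<in> {1..<N}" "j \<in> {1..N}" "j \<noteq> i" "j \<noteq> i + 1"
  consider "j < i" | "i + 1 < j" using ij by linarith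
  then show ?thesis
  proof cases
    case 1
    have "T i * A j = A j * T i" unfolding A_def by (rule T_prod_T) (use 1 ij in auto)
    moreover have "T i * G j = G j * T i" using G_T_greater[of j i] 1 ij by auto
    ultimately show ?thesis unfolding Y_def by (rule intertwine_mult[rotated])
  next
    case 2
    have "T i * G j = G j * T (i + 1)" using G_T_less[of i j] 2 ij by simp
    moreover have "T (i + 1) * A j = A j * T i" using T_A[of i j] 2 ij by simp
    ultimately show ?thesis unfolding Y_def by (rule intertwine_mult)
  qed
qed

lemma om_prod_Ti: "set js \<subseteq> {1..<N - 1} \<Longrightarrow> om * prod_list (map Ti (map Suc js)) = prod_list (map Ti js) * om"
proof (induction js)
  case (Cons j js)
  have j: "1 \<le> j" "j + 1 < N" using Cons.prems by auto
  have "T j * (om * Ti (j + 1)) = om * T (j + 1) * Ti (j + 1)" using om_T[OF j] by (simp flip: mult.assoc)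
  also have "\<dots> = T j * (Ti j * om)" using j by (simp add: mult.assoc T_Ti T_Ti_assoc)
  finally have *: "om * Ti (j + 1) = Ti j * om" by (rule T_cancel_left[rotated]) (use j in auto)
  have "om * (Ti (j + 1) * prod_list (map Ti (map Suc js))) = Ti j * (om * prod_list (map Ti (map Suc js)))"
    using * by (simp flip: mult.assoc)
  then show ?case using Cons by (simp add: mult.assoc)
qed simp

text \<open>The case i = 1 of \<open>Y_Y_Suc\<close> in disguise: G_2 = T_1 G_1 and G_1 = Y_1, so
  cancelling one T_1 gives T_1 Y_1 T_1 Y_1 = Y_1 T_1 Y_1 T_1. It rests on G_2^2 = P_2 P' om^2, where
  P_2 P' carries T_(N-1) to T_1 just as om^2 carries T_1 to T_(N-1).\<close>

lemma G2_T: "2 \<le> N \<Longrightarrow> T 1 * (G 2 * G 2) = G 2 * G 2 * T 1"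
proof -
  assume N: "2 \<le> N"
  define P' where "P' = prod_list (map Ti [1..<N - 1])"
  have *: "map Suc [1..<N - 1] = [2..<N]" using N by (simp add: map_Suc_upt numeral_2_eq_2)
  have "om * P 2 = P' * om"
    unfolding P_def P'_def *[symmetric] by (rule om_prod_Ti) auto
  then have "P 2 * (om * P 2) * om = P 2 * (P' * om) * om" by simp
  then have GG: "G 2 * G 2 = P 2 * P' * (om * om)" by (simp add: G_def mult.assoc)
  have "[1..<N] = [1..<N - 1] @ [N - 1]" using N by (cases N) simp_all
  then have P1: "P 1 = P' * Ti (N - 1)" by (simp add: P_def P'_def)
  have P1': "P 1 = Ti 1 * P 2" using P_rec[of 1] N by (simp add: numeral_2_eq_2)
  have "set js \<subseteq> {1..<N - 1} \<Longrightarrow> P 1 * prod_list (map Ti js) = prod_list (map Ti (map Suc js)) * P 1" for js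
  proof (induction js)
    case (Cons j js)
    have j: "1 \<le> j" "j + 1 < N" using Cons.prems by auto
    have "T (j + 1) * (P 1 * Ti j) = P 1 * T j * Ti j" using T_P[of 1 j] j by (simp flip: mult.assoc)
    also have "\<dots> = T (j + 1) * (Ti (j + 1) * P 1)" using j by (simp add: mult.assoc T_Ti T_Ti_assoc)
    finally have *: "P 1 * Ti j = Ti (j + 1) * P 1" by (rule T_cancel_left[rotated]) (use j in auto)
    have "P 1 * (Ti j * prod_list (map Ti js)) = Ti (j + 1) * (P 1 * prod_list (map Ti js))"
      using * by (simp flip: mult.assoc)
    then show ?case using Cons by (simp add: mult.assoc)
  qed simp
  from this[of "[1..<N - 1]"] have "P 1 * P' = P 2 * P 1"
    unfolding * by (auto simp: P'_def P_def)
  moreover have "Ti 1 * (P 2 * P') = P 1 * P'" unfolding P1' by (simp only: mult.assoc)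
  ultimately have "P 2 * P' = T 1 * (P 2 * P 1)" using N T_Ti_assoc[of 1 "P 2 * P'"] by auto
  then have "P 2 * P' * T (N - 1) = T 1 * (P 2 * (P 1 * T (N - 1)))" by (simp only: mult.assoc)
  also have "P 1 * T (N - 1) = P'" unfolding P1 using N Ti_T[of "N - 1"] by (simp add: mult.assoc)
  finally have "T 1 * (P 2 * P') = P 2 * P' * T (N - 1)" by simp
  then show ?thesis unfolding GG by (rule intertwine_mult[OF _ om_om_T[OF N, symmetric]])
qed

text \<open>Commutation of Y_i with Y_(i+1) = T_i Y_i T_i, written without inverses. The induction
  step only uses the braid relation and that T_(i+1) commutes with Y_i.\<close>

lemma Y_Y_Suc: "i \<in> {1..<N} \<Longrightarrow> Y i * T i * Y i * T i = T i * Y i * T i * Y i"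
proof (induction i)
  case (Suc i)
  show ?case
  proof (cases "i = 0")
    case True
    have N: "2 \<le> N" and 1: "1 \<in> {1..<N}" using Suc.prems by auto
    have G2: "G 2 = T 1 * G 1" using G_rec[OF 1] by (simp add: numeral_2_eq_2)
    have "T 1 * (G 1 * T 1 * G 1 * T 1) = T 1 * (T 1 * G 1 * T 1 * G 1)"
      using G2_T[OF N] unfolding G2 by (simp add: mult.assoc)
    then show ?thesis using T_cancel_left[OF 1] True by (simp add: Y_def)
  next
    case False
    then have i: "i \<in> {1..<N}" "1 \<le> i" "i + 1 < N" using Suc.prems by auto
    let ?T = "T i" and ?U = "T (i + 1)" and ?y = "Y i"
    have IH: "?y * ?T * ?y * ?T = ?T * ?y * ?T * ?y" using Suc i by simp
    have UY: "?U * ?y = ?y * ?U" by (rule T_Y) (use i in auto)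
    have br: "?T * ?U * ?T = ?U * ?T * ?U" using braid i by simp
    have Y: "Y (Suc i) = ?T * ?y * ?T" using Y_rec[OF i(1)] by simp
    have "Y (i + 1) * ?U * Y (i + 1) * ?U = ?T * ?y * (?T * ?U * ?T) * ?y * ?T * ?U" by (simp add: Y mult.assoc)
    also have "\<dots> = ?T * (?y * ?U) * ?T * (?U * ?y) * ?T * ?U" unfolding br by (simp add: mult.assoc)
    also have "\<dots> = ?T * (?U * ?y) * ?T * (?y * ?U) * ?T * ?U" unfolding UY by simp
    also have "\<dots> = ?T * ?U * ?y * ?T * ?y * (?U * ?T * ?U)" by (simp add: mult.assoc)
    also have "\<dots> = ?T * ?U * (?y * ?T * ?y * ?T) * ?U * ?T" unfolding br[symmetric] by (simp add: mult.assoc)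
    also have "\<dots> = (?T * ?U * ?T) * ?y * ?T * (?y * ?U) * ?T" unfolding IH by (simp add: mult.assoc)
    also have "\<dots> = ?U * ?T * (?U * ?y) * ?T * (?U * ?y) * ?T" unfolding br UY[symmetric] by (simp add: mult.assoc)
    also have "\<dots> = ?U * ?T * (?y * ?U) * ?T * (?U * ?y) * ?T" unfolding UY by simp
    also have "\<dots> = ?U * ?T * ?y * (?U * ?T * ?U) * ?y * ?T" by (simp add: mult.assoc)
    also have "\<dots> = ?U * Y (i + 1) * ?U * Y (i + 1)" unfolding br[symmetric] by (simp add: Y mult.assoc)
    finally show ?thesis by simp
  qed
qed simp

lemma Y_commute_less: "1 \<le> i \<Longrightarrow> i < j \<Longrightarrow> j \<le> N \<Longrightarrow> Y i * Y j = Y j * Y i"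
proof (induction j)
  case (Suc j)
  have Yj: "Y (Suc j) = T j * Y j * T j" using Y_rec[of j] Suc.prems by simp
  show ?case
  proof (cases "i = j")
    case True
    then show ?thesis unfolding Yj using Y_Y_Suc[of i] Suc.prems by (simp add: mult.assoc)
  next
    case False
    then have "T j * Y i = Y i * T j" by (intro T_Y) (use Suc.prems in auto)
    moreover have "Y i * Y j = Y j * Y i" using Suc False by simp
    ultimately have "Y i * (T j * (Y j * T j)) = T j * (Y j * T j) * Y i"
      by (intro intertwine_mult[where b = "Y i"]) simp_all
    then show ?thesis unfolding Yj by (simp only: mult.assoc)
  qed
qed simp

lemma Y_commute: "i \<in> {1..N} \<Longrightarrow> j \<in> {1..N} \<Longrightarrow> Y i * Y j = Y j * Y i"
  using Y_commute_less[of i j] Y_commute_less[of j i] by (cases i j rule: linorder_cases) auto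

text \<open>The last T turns one G_j into G_(j+1); the other factors then move to the right of it
  with their indices raised by one, which recreates the product for the next power.\<close>

lemma prod_T_G: "j \<in> {1..<N} \<Longrightarrow> m \<le> j \<Longrightarrow>
    prod_list (map T [j + 1 - m..<j + 1]) * G j ^ m = G (j + 1) ^ m"
proof (induction m)
  case (Suc m)
  let ?a = "j + 1 - Suc m"
  have shift: "set is \<subseteq> {1..<j} \<Longrightarrow> prod_list (map T is) * G (j + 1) = G (j + 1) * prod_list (map T (map Suc is))" for "is"
  proof (induction "is")
    case (Cons a "is")
    then have "T a * G (j + 1) = G (j + 1) * T (a + 1)" using G_T_less[of a "j + 1"] Suc.prems by auto
    then have "T a * (G (j + 1) * prod_list (map T (map Suc is))) = G (j + 1) * (T (a + 1) * prod_list (map T (map Suc is)))"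
      by (simp flip: mult.assoc)
    then show ?case using Cons by (simp add: mult.assoc)
  qed simp
  have a: "1 \<le> ?a" "?a \<le> j" "Suc ?a = j + 1 - m" using Suc.prems by auto
  have upt: "[?a..<j + 1] = [?a..<j] @ [j]" using a by simp
  have map: "map Suc [?a..<j] = [j + 1 - m..<j + 1]" unfolding map_Suc_upt using a by simp
  have sh: "prod_list (map T [?a..<j]) * G (j + 1) = G (j + 1) * prod_list (map T [j + 1 - m..<j + 1])"
    by (rule shift[of "[?a..<j]", unfolded map]) (use a in auto)
  have "prod_list (map T [?a..<j + 1]) * G j ^ Suc m = prod_list (map T [?a..<j]) * (T j * G j) * G j ^ m"
    unfolding upt by (simp add: mult.assoc)
  also have "\<dots> = G (j + 1) * (prod_list (map T [j + 1 - m..<j + 1]) * G j ^ m)"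
    unfolding G_rec[OF Suc.prems(1)] sh by (rule mult.assoc)
  also have "prod_list (map T [j + 1 - m..<j + 1]) * G j ^ m = G (j + 1) ^ m" using Suc by simp
  finally show ?case by simp
qed simp

text \<open>Since the Y commute, the new factor may be put in front, and its tail T_1 ... T_j turns
  the power of G_j into the same power of G_(j+1). For j = N this ends with G_N =
  \<open>om\<close>.\<close>

lemma prod_Y: "j \<in> {1..N} \<Longrightarrow> prod_list (map Y [1..<Suc j]) = G j ^ j"
proof (induction j)
  case (Suc j)
  show ?case
  proof (cases "j = 0")
    case True then show ?thesis by (simp add: Y_def)
  next
    case False
    have comm: "set is \<subseteq> {1..N} \<Longrightarrow> prod_list (map Y is) * Y (Suc j) = Y (Suc j) * prod_list (map Y is)" for "is"
    proof (induction "is")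
      case (Cons a "is")
      then have "Y a * Y (Suc j) = Y (Suc j) * Y a" using Y_commute Suc.prems by auto
      then have "Y a * (Y (Suc j) * prod_list (map Y is)) = Y (Suc j) * (Y a * prod_list (map Y is))"
        by (simp flip: mult.assoc)
      then show ?case using Cons by (simp add: mult.assoc)
    qed simp
    have "prod_list (map Y [1..<Suc (Suc j)]) = prod_list (map Y [1..<Suc j]) * Y (Suc j)" by simp
    also have "\<dots> = Y (Suc j) * prod_list (map Y [1..<Suc j])" by (rule comm) (use Suc.prems in auto)
    also have "prod_list (map Y [1..<Suc j]) = G j ^ j" using Suc False by simp
    also have "Y (Suc j) * G j ^ j = G (Suc j) * (prod_list (map T [j + 1 - j..<j + 1]) * G j ^ j)"
      by (simp add: Y_def A_def mult.assoc)
    also have "\<dots> = G (Suc j) ^ Suc j" by (subst prod_T_G) (use False Suc.prems in auto)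
    finally show ?thesis .
  qed
qed simp

lemma prod_all_Y: "1 \<le> N \<Longrightarrow> prod_list (map Y [1..<Suc N]) = om ^ N"
  using prod_Y[of N] by (simp add: G_def P_def)

end

section \<open>Substitutions of variables\<close>

lemma subst_expo_superset:
  "finite S \<Longrightarrow> Poly_Mapping.keys a \<subseteq> S \<Longrightarrow>
    subst_expo \<sigma> a = (\<Sum>j\<in>S. Poly_Mapping.single (\<sigma> j) (Poly_Mapping.lookup a j))"
  unfolding subst_expo_def by (rule sum.mono_neutral_left) (auto simp: in_keys_iff)

lemma subst_expo_add: "subst_expo \<sigma> (a + b) = subst_expo \<sigma> a + subst_expo \<sigma> b"
proof -
  let ?S = "Poly_Mapping.keys a \<union> Poly_Mapping.keys b"
  have "Poly_Mapping.keys (a + b) \<subseteq> ?S" by (rule Poly_Mapping.keys_add)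
  then show ?thesis
    by (subst (1 2 3) subst_expo_superset[of ?S]) (auto simp: lookup_add single_add sum.distrib)
qed

lemma subst_expo_zero [simp]: "subst_expo \<sigma> 0 = 0" by (simp add: subst_expo_def)

lemma subst_expo_single [simp]: "subst_expo \<sigma> (Poly_Mapping.single j n) = Poly_Mapping.single (\<sigma> j) n"
  by (subst subst_expo_superset[of "{j}"]) auto

lemma subst_expo_comp: "subst_expo \<sigma> (subst_expo \<tau> a) = subst_expo (\<sigma> \<circ> \<tau>) a"
  by (induction a rule: poly_mapping_additive_induct) (simp_all add: subst_expo_add)

lemma subst_expo_id: "subst_expo id a = a"
  by (induction a rule: poly_mapping_additive_induct) (simp_all add: subst_expo_add)

lemma subst_expo_cong: "(\<And>j. j \<in> Poly_Mapping.keys a \<Longrightarrow> \<sigma> j = \<tau> j) \<Longrightarrow> subst_expo \<sigma> a = subst_expo \<tau> a"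
  by (simp add: subst_expo_def)

lemma lookup_subst_expo: "inj \<sigma> \<Longrightarrow> Poly_Mapping.lookup (subst_expo \<sigma> a) (\<sigma> j) = Poly_Mapping.lookup a j"
  by (induction a rule: poly_mapping_additive_induct)
    (auto simp: subst_expo_add lookup_add lookup_single when_def dest: injD)

lemma lookup_subst_transpose:
  "Poly_Mapping.lookup (subst_expo (transpose i j) a) m = Poly_Mapping.lookup a (transpose i j m)"
  using lookup_subst_expo[of "transpose i j" a "transpose i j m"] by simp

lemma mnm_mult: "mnm a * mnm b = mnm (a + b)" by (simp add: mult_single)

lemma mnm_power: "mnm a ^ n = mnm (frag_cmul (int n) a)"
proof (induction n)
  case (Suc n)
  have "frag_cmul (int (Suc n)) a = a + frag_cmul (int n) a" using frag_cmul_distrib[of 1 "int n" a] by simp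
  then show ?case by (simp only: power_Suc Suc mnm_mult)
qed simp

definition sop :: "(nat \<Rightarrow> nat) \<Rightarrow> lop" where "sop \<sigma> = mono_op (\<lambda>a. mnm (subst_expo \<sigma> a))"
abbreviation Xm :: "expo \<Rightarrow> lop" where "Xm a \<equiv> mulop (mnm a)"

lemma app_sop [simp]: "app (sop \<sigma>) (Poly_Mapping.single a c) = Poly_Mapping.single (subst_expo \<sigma> a) c"
  by (simp add: sop_def mult_single)
lemma app_sop_one [simp]: "app (sop \<sigma>) 1 = 1"
  using app_sop[of \<sigma> 0 1] by (simp del: app_sop)

lemma Xm_add: "Xm (a + b) = Xm a * Xm b" by (simp flip: mulop_mult add: mnm_mult)
lemma sop_Xm: "sop \<sigma> * Xm a = Xm (subst_expo \<sigma> a) * sop \<sigma>"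
  by (rule lop_eqI) (simp add: mult_single subst_expo_add)
lemma sop_comp: "sop \<sigma> * sop \<tau> = sop (\<sigma> \<circ> \<tau>)"
  by (rule lop_eqI) (simp add: subst_expo_comp)
lemma sop_id: "sop id = 1" by (rule lop_eqI) (simp add: subst_expo_id)

section \<open>Demazure quotients\<close>

abbreviation sroot :: "nat \<Rightarrow> expo" where
  "sroot i \<equiv> Poly_Mapping.single i 1 - Poly_Mapping.single (i + 1) 1"
abbreviation sr :: "nat \<Rightarrow> nat \<Rightarrow> nat" where "sr i \<equiv> transpose i (i + 1)"

text \<open>The quotient (s_i X^a - X^a) / (X_i / X_(i+1) - 1) as a finite geometric sum along the
  root direction; the sign of a_i - a_(i+1) decides from which end the sum starts.\<close>

definition dem_mono :: "nat \<Rightarrow> expo \<Rightarrow> lpoly" where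
  "dem_mono i a = (let n = Poly_Mapping.lookup a i - Poly_Mapping.lookup a (i + 1) in
     if n \<ge> 0 then - mnm (subst_expo (sr i) a) * (\<Sum>j<nat n. mnm (sroot i) ^ j)
     else mnm a * (\<Sum>j<nat (- n). mnm (sroot i) ^ j))"

definition qop :: "nat \<Rightarrow> lop" where "qop i = mono_op (dem_mono i)"

lemma subst_transpose_eq:
  "subst_expo (sr i) a + frag_cmul (Poly_Mapping.lookup a i - Poly_Mapping.lookup a (i + 1)) (sroot i) = a"
  by (rule poly_mapping_eqI)
    (auto simp: lookup_add lookup_subst_transpose lookup_minus lookup_single when_def transpose_def)

lemma dem_mono_eq: "(mnm (sroot i) - 1) * dem_mono i a = mnm (subst_expo (sr i) a) - mnm a"
proof -
  let ?n = "Poly_Mapping.lookup a i - Poly_Mapping.lookup a (i + 1)" and ?m = "mnm (sroot i)" and ?s = "subst_expo (sr i) a"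
  have geo: "(?m - 1) * (\<Sum>j<n. ?m ^ j) = ?m ^ n - 1" for n by (rule power_diff_1_eq[symmetric])
  show ?thesis
  proof (cases "?n \<ge> 0")
    case True
    have "mnm ?s * ?m ^ nat ?n = mnm a"
      unfolding mnm_power mnm_mult using True subst_transpose_eq[of i a] by simp
    moreover have "(?m - 1) * (- mnm ?s * G) = - mnm ?s * ((?m - 1) * G)" for G by (rule mult.left_commute)
    ultimately show ?thesis using True by (simp only: dem_mono_def Let_def if_True geo) (simp add: right_diff_distrib)
  next
    case False
    have "a - frag_cmul ?n (sroot i) = ?s"
      using subst_transpose_eq[of i a] by (simp only: eq_diff_eq[symmetric])
    then have "a + frag_cmul (- ?n) (sroot i) = ?s" by (simp only: diff_conv_add_uminus minus_frag_cmul)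
    then have "mnm a * ?m ^ nat (- ?n) = mnm ?s"
      unfolding mnm_power mnm_mult using False by simp
    moreover have "(?m - 1) * (mnm a * G) = mnm a * ((?m - 1) * G)" for G by (rule mult.left_commute)
    ultimately show ?thesis using False by (simp only: dem_mono_def Let_def if_False geo) (simp add: right_diff_distrib)
  qed
qed

lemma sroot_ne: "mnm (sroot i) - 1 \<noteq> 0"
proof
  assume "mnm (sroot i) - 1 = 0"
  then have "mnm (sroot i) = mnm 0" by simp
  then have "sroot i = 0" by (metis keys_single single_one zero_neq_one singleton_inject)
  then have "Poly_Mapping.lookup (sroot i) i = 0" by simp
  then show False by (simp add: lookup_minus lookup_single)
qed

lemma qop_eq: "mulop (mnm (sroot i) - 1) * qop i = sop (sr i) - 1"
proof (rule lop_eqI)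
  fix a
  have "app (qop i) (mnm a) = dem_mono i a" by (simp add: qop_def)
  then show "app (mulop (mnm (sroot i) - 1) * qop i) (mnm a) = app (sop (sr i) - 1) (mnm a)"
    using dem_mono_eq[of i a] by simp
qed

text \<open>Laurent polynomials have no zero divisors. Identities for Demazure quotients are thus
  verified after multiplication by the denominator, where they become identities for s_i.\<close>

lemma mulop_cancel: "p \<noteq> 0 \<Longrightarrow> mulop p * A = mulop p * B \<Longrightarrow> A = B"
  by (rule lop_eqI) (metis app_mulop app_times mult_left_cancel)

lemma qop_app_eq: "(mnm (sroot i) - 1) * app (qop i) f = app (sop (sr i)) f - f"
  using arg_cong[OF qop_eq[of i], of "\<lambda>A. app A f"] by simp

lemma qop_X1: "qop i * Xm (Poly_Mapping.single i 1) =
    Xm (Poly_Mapping.single (i + 1) 1) * qop i - Xm (Poly_Mapping.single (i + 1) 1)"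
proof (rule mulop_cancel[OF sroot_ne[of i]])
  let ?x = "Xm (Poly_Mapping.single i 1)" and ?y = "Xm (Poly_Mapping.single (i + 1) 1)" and ?D = "mulop (mnm (sroot i) - 1)"
  have S: "sop (sr i) * ?x = ?y * sop (sr i)" by (simp add: sop_Xm)
  have D: "?D * ?y = ?x - ?y"
    by (simp flip: mulop_mult mulop_diff add: left_diff_distrib mnm_mult)
  have Dy: "?D * ?y = ?y * ?D" by (rule mulop_commute)
  have "?D * (qop i * ?x) = (sop (sr i) - 1) * ?x" by (simp only: mult.assoc[symmetric] qop_eq)
  also have "\<dots> = ?y * (sop (sr i) - 1) - (?x - ?y)" using S by (simp add: algebra_simps)
  also have "\<dots> = ?y * (?D * qop i) - ?D * ?y" unfolding qop_eq D ..
  also have "\<dots> = ?D * (?y * qop i - ?y)" using Dy by (simp add: right_diff_distrib flip: mult.assoc)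
  finally show "?D * (qop i * ?x) = ?D * (?y * qop i - ?y)" .
qed

lemma qop_X2: "qop i * Xm (Poly_Mapping.single (i + 1) 1) =
    Xm (Poly_Mapping.single i 1) * qop i + Xm (Poly_Mapping.single (i + 1) 1)"
proof (rule mulop_cancel[OF sroot_ne[of i]])
  let ?x = "Xm (Poly_Mapping.single i 1)" and ?y = "Xm (Poly_Mapping.single (i + 1) 1)" and ?D = "mulop (mnm (sroot i) - 1)"
  have S: "sop (sr i) * ?y = ?x * sop (sr i)" by (simp add: sop_Xm)
  have D: "?D * ?y = ?x - ?y"
    by (simp flip: mulop_mult mulop_diff add: left_diff_distrib mnm_mult)
  have Dx: "?D * ?x = ?x * ?D" by (rule mulop_commute)
  have "?D * (qop i * ?y) = (sop (sr i) - 1) * ?y" by (simp only: mult.assoc[symmetric] qop_eq)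
  also have "\<dots> = ?x * (sop (sr i) - 1) + (?x - ?y)" using S by (simp add: algebra_simps)
  also have "\<dots> = ?x * (?D * qop i) + ?D * ?y" unfolding qop_eq D ..
  also have "\<dots> = ?D * (?x * qop i + ?y)" using Dx by (simp add: distrib_left flip: mult.assoc)
  finally show "?D * (qop i * ?y) = ?D * (?x * qop i + ?y)" .
qed

text \<open>Demazure quotients are linear over the polynomials invariant under the transposition.\<close>

lemma qop_invariant:
  assumes "sop (sr i) * mulop p = mulop p * sop (sr i)"
  shows "qop i * mulop p = mulop p * qop i"
proof (rule mulop_cancel[OF sroot_ne[of i]])
  let ?D = "mulop (mnm (sroot i) - 1)"
  have "?D * (qop i * mulop p) = (sop (sr i) - 1) * mulop p" by (simp only: mult.assoc[symmetric] qop_eq)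
  also have "\<dots> = mulop p * (?D * qop i)" unfolding qop_eq using assms by (simp add: algebra_simps)
  also have "\<dots> = ?D * (mulop p * qop i)" by (simp flip: mult.assoc add: mulop_commute[of p])
  finally show "?D * (qop i * mulop p) = ?D * (mulop p * qop i)" .
qed

lemma qop_X3: "j \<noteq> i \<Longrightarrow> j \<noteq> i + 1 \<Longrightarrow>
    qop i * Xm (Poly_Mapping.single j 1) = Xm (Poly_Mapping.single j 1) * qop i"
  by (rule qop_invariant) (simp add: sop_Xm transpose_def)

section \<open>Demazure--Lusztig operators\<close>

abbreviation opX :: "nat \<Rightarrow> lop fps" where "opX j \<equiv> fps_const (Xm (Poly_Mapping.single j 1))"
abbreviation opXi :: "nat \<Rightarrow> lop fps" where "opXi j \<equiv> fps_const (Xm (- Poly_Mapping.single j 1))"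

lemma opX_opXi [simp]: "opX j * opXi j = 1" "opXi j * opX j = 1"
  by (simp_all flip: Xm_add)
lemma opX_commute: "opX i * opX j = opX j * opX i" by (simp add: mulop_commute)

definition cpar :: "complex \<Rightarrow> complex fps" where "cpar k = tpar k - inverse (tpar k)"

definition TE :: "complex \<Rightarrow> nat \<Rightarrow> lop fps" where
  "TE k i = scE (tpar k) * fps_const (sop (sr i)) + scE (cpar k) * fps_const (qop i)"

lemma tpar_inverse: "tpar k * inverse (tpar k) = 1" "inverse (tpar k) * tpar k = 1"
  by (simp_all add: tpar_def inverse_mult_eq_1 inverse_mult_eq_1')

lemma fps_const_combine:
  fixes A B :: lop
  shows "fps_const A * fps_const B = fps_const (A * B)" by simp

lemma TE_X1: "TE k i * opX i = opX (i + 1) * TE k i - scE (cpar k) * opX (i + 1)"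
proof -
  let ?t = "scE (tpar k)" and ?c = "scE (cpar k)" and ?S = "fps_const (sop (sr i))" and ?Q = "fps_const (qop i)"
  have S: "?S * opX i = opX (i + 1) * ?S" by (simp add: sop_Xm)
  have Q: "?Q * opX i = opX (i + 1) * ?Q - opX (i + 1)" by (simp add: qop_X1)
  have "TE k i * opX i = ?t * (?S * opX i) + ?c * (?Q * opX i)" by (simp add: TE_def distrib_right mult.assoc)
  also have "\<dots> = opX (i + 1) * (?t * ?S) + (opX (i + 1) * (?c * ?Q) - ?c * opX (i + 1))"
    unfolding S Q by (simp only: scE_left_commute right_diff_distrib)
  finally show ?thesis by (simp only: TE_def distrib_left add_diff_eq)
qed

lemma TE_X2: "TE k i * opX (i + 1) = opX i * TE k i + scE (cpar k) * opX (i + 1)"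
proof -
  let ?t = "scE (tpar k)" and ?c = "scE (cpar k)" and ?S = "fps_const (sop (sr i))" and ?Q = "fps_const (qop i)"
  have S: "?S * opX (i + 1) = opX i * ?S" by (simp add: sop_Xm)
  have Q: "?Q * opX (i + 1) = opX i * ?Q + opX (i + 1)" by (simp add: qop_X2[simplified])
  have "TE k i * opX (i + 1) = ?t * (?S * opX (i + 1)) + ?c * (?Q * opX (i + 1))"
    unfolding TE_def by (simp only: distrib_right mult.assoc)
  also have "\<dots> = opX i * (?t * ?S) + (opX i * (?c * ?Q) + ?c * opX (i + 1))"
    unfolding S Q by (simp only: scE_left_commute distrib_left)
  finally show ?thesis by (simp only: TE_def distrib_left add.assoc)
qed

lemma TE_X3: "j \<noteq> i \<Longrightarrow> j \<noteq> i + 1 \<Longrightarrow> TE k i * opX j = opX j * TE k i"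
proof -
  assume j: "j \<noteq> i" "j \<noteq> i + 1"
  let ?t = "scE (tpar k)" and ?c = "scE (cpar k)" and ?S = "fps_const (sop (sr i))" and ?Q = "fps_const (qop i)"
  have S: "?S * opX j = opX j * ?S" using j by (simp add: sop_Xm transpose_def)
  have Q: "?Q * opX j = opX j * ?Q" using j by (simp add: qop_X3[simplified])
  have "TE k i * opX j = ?t * (?S * opX j) + ?c * (?Q * opX j)" unfolding TE_def by (simp only: distrib_right mult.assoc)
  also have "\<dots> = opX j * TE k i" unfolding S Q TE_def by (simp only: scE_left_commute distrib_left)
  finally show ?thesis .
qed

lemma app_qop_one [simp]: "app (qop i) 1 = 0"
proof -
  have "app (qop i) (mnm 0) = 0" unfolding qop_def app_mono_op_single by (simp add: dem_mono_def)
  then show ?thesis by simp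
qed

lemma act_TE_one: "act (TE k i) 1 = scal (tpar k) * 1"
  unfolding TE_def act_add_left act_mult act_scE fps_const_1_eq_1[symmetric] act_const_const
  by simp

lemma act_TE_scal: "act (TE k i) (scal c) = scal (tpar k * c)"
  using act_scal[of "TE k i" c 1] by (simp add: act_TE_one scal_mult mult.commute)

lemma scal_diff: "scal (a - b) = scal a - scal b"
  by (rule fps_ext) (simp add: scal_def single_diff)

section \<open>Operators determined by their action on 1\<close>

lemma expo_induct [case_names zero plus minus]:
  fixes a :: expo
  assumes "P 0" "\<And>a j. P a \<Longrightarrow> P (Poly_Mapping.single j 1 + a)" "\<And>a j. P a \<Longrightarrow> P (- Poly_Mapping.single j 1 + a)"
  shows "P a"
proof -
  have nat: "P b \<Longrightarrow> P (Poly_Mapping.single j (int n) + b)" for b j n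
  proof (induction n)
    case (Suc n)
    have "Poly_Mapping.single j (int (Suc n)) + b = Poly_Mapping.single j 1 + (Poly_Mapping.single j (int n) + b)"
      by (simp add: single_add add.assoc)
    then show ?case using assms(2)[OF Suc.IH[OF Suc.prems]] by (simp only:)
  qed simp
  have neg: "P b \<Longrightarrow> P (Poly_Mapping.single j (- int n) + b)" for b j n
  proof (induction n)
    case (Suc n)
    have "Poly_Mapping.single j (- int (Suc n)) = Poly_Mapping.single j (- 1) + Poly_Mapping.single j (- int n)"
      unfolding single_add[symmetric] by simp
    then have "Poly_Mapping.single j (- int (Suc n)) + b = - Poly_Mapping.single j 1 + (Poly_Mapping.single j (- int n) + b)"
      by (simp only: single_uminus add.assoc)
    then show ?case using assms(3)[OF Suc.IH[OF Suc.prems]] by (simp only:)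
  qed simp
  have single: "P b \<Longrightarrow> P (Poly_Mapping.single j n + b)" for b j n
    using nat[of b j "nat n"] neg[of b j "nat (- n)"] by (cases "n \<ge> 0") auto
  have "\<forall>b. P b \<longrightarrow> P (a + b)"
    by (induction a rule: poly_mapping_additive_induct) (auto simp: single add.assoc)
  from this[rule_format, OF assms(1)] show ?thesis by simp
qed

text \<open>
  Relations between the Demazure--Lusztig operators are checked by moving both sides through the
  \<open>X\<^sub>j\<close>, which reduces them to the action on the constant 1.
\<close>

lemma operator_zeroI:
  assumes one: "act Z 1 = 0"
    and X: "\<And>j. \<exists>v v' m. v' * v = 1 \<and> Z * opX j = scE v * (opX m * Z)"
  shows "Z = 0"
proof (rule formal_op_eqI)
  fix a
  have "act Z (fps_const (mnm a)) = 0"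
  proof (induction a rule: expo_induct)
    case zero then show ?case using one by simp
  next
    case (plus a j)
    obtain v v' m where Z: "Z * opX j = scE v * (opX m * Z)" using X by blast
    have "act Z (fps_const (mnm (Poly_Mapping.single j 1 + a))) = act Z (act (opX j) (fps_const (mnm a)))"
      by (simp add: act_const_const mnm_mult)
    also have "\<dots> = act (scE v * (opX m * Z)) (fps_const (mnm a))" by (simp only: act_mult[symmetric] Z)
    also have "\<dots> = 0" using plus by (simp add: act_mult)
    finally show ?case .
  next
    case (minus a j)
    obtain v v' m where Z: "Z * opX j = scE v * (opX m * Z)" and v: "v' * v = 1" using X by blast
    have inv: "scE v' * (opXi m * (scE v * (opX m * A))) = A" for A
    proof -
      have "opXi m * (scE v * (opX m * A)) = scE v * (opXi m * opX m * A)"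
        unfolding scE_left_commute[of "opXi m"] by (simp only: mult.assoc)
      then have "scE v' * (opXi m * (scE v * (opX m * A))) = scE (v' * v) * A"
        by (simp only: scE_mult mult.assoc opX_opXi mult_1_left)
      then show ?thesis by (simp only: v scE_one mult_1_left)
    qed
    have "Z * opXi j = scE v' * (opXi m * (scE v * (opX m * (Z * opXi j))))" by (simp only: inv)
    also have "scE v * (opX m * (Z * opXi j)) = Z * opX j * opXi j" unfolding Z by (simp only: mult.assoc)
    also have "\<dots> = Z" by (simp only: mult.assoc opX_opXi mult_1_right)
    finally have Zi: "Z * opXi j = scE v' * (opXi m * Z)" .
    have "act Z (fps_const (mnm (- Poly_Mapping.single j 1 + a))) = act Z (act (opXi j) (fps_const (mnm a)))"
      by (simp add: act_const_const mnm_mult)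
    also have "\<dots> = act (scE v' * (opXi m * Z)) (fps_const (mnm a))" by (simp only: act_mult[symmetric] Zi)
    also have "\<dots> = 0" using minus by (simp add: act_mult)
    finally show ?case .
  qed
  then show "act Z (fps_const (mnm a)) = act 0 (fps_const (mnm a))"
    by (metis act_diff_left diff_self)
qed

lemma operator_zeroI':
  assumes one: "act Z 1 = 0" and X: "\<And>j. \<exists>m. Z * opX j = opX m * Z"
  shows "Z = 0"
proof (rule operator_zeroI[OF one])
  fix j
  obtain m where "Z * opX j = opX m * Z" using X by blast
  then have "1 * 1 = (1 :: complex fps) \<and> Z * opX j = scE 1 * (opX m * Z)" by simp
  then show "\<exists>v v' m. v' * v = 1 \<and> Z * opX j = scE v * (opX m * Z)" by blast
qed

section \<open>Hecke relations\<close>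

text \<open>Moving \<open>T\<close> to the right exchanges \<open>X\<close> and \<open>X'\<close> up
  to corrections in \<open>C\<close>; in the defect of the quadratic relation the exchanges and the
  corrections both cancel. The rules \<open>a\<close> repeat the hypotheses with a tail
  \<open>B\<close>, as rewriting of right-nested products requires.\<close>

lemma hecke_quadratic_aux:
  fixes T X X' C :: "'a::ring_1"
  assumes TX: "T * X = X' * T - C * X'" and TX': "T * X' = X * T + C * X'"
    and TC: "T * C = C * T" and XC: "X * C = C * X" and XC': "X' * C = C * X'"
  shows "(T * T - C * T - 1) * X = X * (T * T - C * T - 1)"
    and "(T * T - C * T - 1) * X' = X' * (T * T - C * T - 1)"
proof -
  have a: "T * (X * B) = X' * (T * B) - C * (X' * B)" "T * (X' * B) = X * (T * B) + C * (X' * B)"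
    "T * (C * B) = C * (T * B)" "X * (C * B) = C * (X * B)" "X' * (C * B) = C * (X' * B)" for B
    using arg_cong[OF TX, of "\<lambda>t. t * B"] arg_cong[OF TX', of "\<lambda>t. t * B"] arg_cong[OF TC, of "\<lambda>t. t * B"]
      arg_cong[OF XC, of "\<lambda>t. t * B"] arg_cong[OF XC', of "\<lambda>t. t * B"]
    by (simp_all add: distrib_right left_diff_distrib mult.assoc)
  show "(T * T - C * T - 1) * X = X * (T * T - C * T - 1)"
    "(T * T - C * T - 1) * X' = X' * (T * T - C * T - 1)"
    by (simp_all add: distrib_right distrib_left left_diff_distrib right_diff_distrib mult.assoc assms a)
qed

lemma TE_quadratic: "TE k i * TE k i = scE (cpar k) * TE k i + 1"
proof -
  let ?Z = "TE k i * TE k i - scE (cpar k) * TE k i - 1"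
  have "?Z = 0"
  proof (rule operator_zeroI')
    have "act ?Z 1 = scal (tpar k * tpar k) - scal (cpar k * tpar k) - scal 1"
      by (simp add: act_diff_left act_mult act_scE act_TE_one act_TE_scal scal_mult)
    also have "\<dots> = scal (tpar k * tpar k - cpar k * tpar k - 1)" by (simp only: scal_diff)
    also have "tpar k * tpar k - cpar k * tpar k - 1 = 0"
      by (simp add: cpar_def left_diff_distrib tpar_inverse)
    finally show "act ?Z 1 = 0" by (simp add: fps_eq_iff)
    fix j
    note aux = hecke_quadratic_aux[OF TE_X1[of k i] TE_X2[of k i] scE_central[symmetric] scE_central[symmetric] scE_central[symmetric]]
    consider "j = i" | "j = i + 1" | "j \<noteq> i" "j \<noteq> i + 1" by blast
    then show "\<exists>m. ?Z * opX j = opX m * ?Z"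
    proof cases
      case 3
      note T = TE_X3[OF 3, of k]
      have "?Z * opX j = opX j * ?Z"
        using T by (simp only: left_diff_distrib right_diff_distrib mult.assoc scE_left_commute mult_1_left mult_1_right)
          (simp only: mult.assoc[symmetric])
      then show ?thesis by blast
    qed (use aux in blast)+
  qed
  then show ?thesis by (simp add: algebra_simps)
qed

text \<open>The same normal ordering with three variables. The corrections cancel in the braid
  defect, which therefore permutes the variables like the longest element of S_3.\<close>

lemma hecke_braid_aux:
  fixes T U X Y W C :: "'a::ring_1"
  assumes r: "T * X = Y * T - C * Y" "T * Y = X * T + C * Y" "T * W = W * T"
    "U * X = X * U" "U * Y = W * U - C * W" "U * W = Y * U + C * W"
    "T * C = C * T" "U * C = C * U" "X * C = C * X" "Y * C = C * Y" "W * C = C * W"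
    "T * T = C * T + 1" "U * U = C * U + 1"
  shows "(T * U * T - U * T * U) * X = W * (T * U * T - U * T * U)"
    "(T * U * T - U * T * U) * Y = Y * (T * U * T - U * T * U)"
    "(T * U * T - U * T * U) * W = X * (T * U * T - U * T * U)"
proof -
  have a: "T * (X * B) = Y * (T * B) - C * (Y * B)" "T * (Y * B) = X * (T * B) + C * (Y * B)"
    "T * (W * B) = W * (T * B)"
    "U * (X * B) = X * (U * B)" "U * (Y * B) = W * (U * B) - C * (W * B)" "U * (W * B) = Y * (U * B) + C * (W * B)"
    "T * (C * B) = C * (T * B)" "U * (C * B) = C * (U * B)" "X * (C * B) = C * (X * B)"
    "Y * (C * B) = C * (Y * B)" "W * (C * B) = C * (W * B)"
    "T * (T * B) = C * (T * B) + B" "U * (U * B) = C * (U * B) + B" for B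
    using r[THEN arg_cong, of "\<lambda>t. t * B"]
    by (simp_all only: distrib_right left_diff_distrib mult.assoc mult_1_left)
  show "(T * U * T - U * T * U) * X = W * (T * U * T - U * T * U)"
    "(T * U * T - U * T * U) * Y = Y * (T * U * T - U * T * U)"
    "(T * U * T - U * T * U) * W = X * (T * U * T - U * T * U)"
    by (simp_all add: distrib_right distrib_left left_diff_distrib right_diff_distrib mult.assoc r a)
qed

lemma TE_braid: "TE k i * TE k (i + 1) * TE k i = TE k (i + 1) * TE k i * TE k (i + 1)"
proof -
  let ?Z = "TE k i * TE k (i + 1) * TE k i - TE k (i + 1) * TE k i * TE k (i + 1)"
  have "?Z = 0"
  proof (rule operator_zeroI')
    show "act ?Z 1 = 0"
      by (simp add: act_diff_left act_mult act_TE_one act_TE_scal)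
    fix j
    have n: "i + 2 \<noteq> i" "i + 2 \<noteq> i + 1" "i \<noteq> i + 1" "i \<noteq> i + 1 + 1" by simp_all
    have e: "i + 2 = i + 1 + 1" by simp
    note aux = hecke_braid_aux[where W = "opX (i + 2)", OF TE_X1[of k i] TE_X2[of k i] TE_X3[OF n(1,2), of k] TE_X3[OF n(3,4), of k]
      TE_X1[of k "i + 1", folded e] TE_X2[of k "i + 1", folded e]
      scE_central[symmetric] scE_central[symmetric] scE_central[symmetric] scE_central[symmetric] scE_central[symmetric]
      TE_quadratic TE_quadratic]
    consider "j = i" | "j = i + 1" | "j = i + 2" | "j \<noteq> i" "j \<noteq> i + 1" "j \<noteq> i + 2" by blast
    then show "\<exists>m. ?Z * opX j = opX m * ?Z"
    proof cases
      case 4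
      have T: "TE k i * opX j = opX j * TE k i" and U: "TE k (i + 1) * opX j = opX j * TE k (i + 1)"
        by (rule TE_X3; use 4 in simp)+
      have "opX j * (TE k i * TE k (i + 1) * TE k i) = TE k i * TE k (i + 1) * TE k i * opX j"
        "opX j * (TE k (i + 1) * TE k i * TE k (i + 1)) = TE k (i + 1) * TE k i * TE k (i + 1) * opX j"
        by (rule intertwine_mult[OF intertwine_mult[OF T[symmetric] U[symmetric]] T[symmetric]]
            intertwine_mult[OF intertwine_mult[OF U[symmetric] T[symmetric]] U[symmetric]])+
      then have "?Z * opX j = opX j * ?Z"
        by (simp only: left_diff_distrib right_diff_distrib)
      then show ?thesis by blast
    qed (use aux in blast)+
  qed
  then show ?thesis by simp
qed

lemma TE_commute: 
  assumes ij: "i + 2 \<le> j"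
  shows "TE k i * TE k j = TE k j * TE k i"
proof -
  let ?Z = "TE k i * TE k j - TE k j * TE k i"
  \<comment> \<open>\<open>M\<close> is the variable into which \<open>T\<close> turns
    \<open>X\<close>, and \<open>C * K\<close> is the correction term. When the variable belongs to
    the other operator, \<open>T\<close> and \<open>U\<close> exchange roles, which only changes the
    sign.\<close>
  have aux: "(T * U - U * T) * X = M * (T * U - U * T)"
    if "T * X = M * T + C * K" "U * X = X * U" "U * M = M * U" "U * K = K * U" "U * C = C * U"
    for T U X M C K :: "lop fps"
  proof -
    have "(T * U - U * T) * X = T * (X * U) - U * (M * T + C * K)" using that by (simp add: left_diff_distrib mult.assoc)
    also have "T * (X * U) = M * (T * U) + C * (K * U)" using that(1) by (simp flip: mult.assoc add: distrib_right)
    also have "U * (M * T + C * K) = M * (U * T) + C * (K * U)"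
    proof -
      have "U * (M * T) = M * (U * T)" using that(3) by (simp flip: mult.assoc)
      moreover have "U * (C * K) = C * (K * U)" using that(4,5) by (metis mult.assoc)
      ultimately show ?thesis by (simp add: distrib_left)
    qed
    finally show ?thesis by (simp add: right_diff_distrib)
  qed
  have "?Z = 0"
  proof (rule operator_zeroI')
    show "act ?Z 1 = 0"
      by (simp add: act_diff_left act_mult act_TE_one act_TE_scal)
    fix m
    have X: "TE k i' * opX m' = opX m' * TE k i'" if "m' \<noteq> i'" "m' \<noteq> i' + 1" for m' i' using that by (rule TE_X3)
    consider "m = i" | "m = i + 1" | "m = j" | "m = j + 1" | "m \<noteq> i" "m \<noteq> i + 1" "m \<noteq> j" "m \<noteq> j + 1" by blast
    then show "\<exists>n. ?Z * opX m = opX n * ?Z"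
    proof cases
      case 1
      have "?Z * opX i = opX (i + 1) * ?Z"
        by (rule aux[where C = "- scE (cpar k)" and K = "opX (i + 1)"])
          (use ij in \<open>simp_all add: TE_X1[simplified] TE_X3 scE_central\<close>)
      then show ?thesis using 1 by blast
    next
      case 2
      have "?Z * opX (i + 1) = opX i * ?Z"
        by (rule aux[where C = "scE (cpar k)" and K = "opX (i + 1)"])
          (use ij in \<open>simp_all add: TE_X2[simplified] TE_X3 scE_central\<close>)
      then show ?thesis using 2 by blast
    next
      case 3
      have "(TE k j * TE k i - TE k i * TE k j) * opX j = opX (j + 1) * (TE k j * TE k i - TE k i * TE k j)"
        by (rule aux[where C = "- scE (cpar k)" and K = "opX (j + 1)"])
          (use ij in \<open>simp_all add: TE_X1[simplified] TE_X3 scE_central\<close>)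
      from arg_cong[OF this, of uminus] have "?Z * opX j = opX (j + 1) * ?Z"
        by (simp only: left_diff_distrib right_diff_distrib minus_diff_eq)
      then show ?thesis using 3 by blast
    next
      case 4
      have "(TE k j * TE k i - TE k i * TE k j) * opX (j + 1) = opX j * (TE k j * TE k i - TE k i * TE k j)"
        by (rule aux[where C = "scE (cpar k)" and K = "opX (j + 1)"])
          (use ij in \<open>simp_all add: TE_X2[simplified] TE_X3 scE_central\<close>)
      from arg_cong[OF this, of uminus] have "?Z * opX (j + 1) = opX j * ?Z"
        by (simp only: left_diff_distrib right_diff_distrib minus_diff_eq)
      then show ?thesis using 4 by blast
    next
      case 5
      have "?Z * opX m = opX m * ?Z"
        by (rule aux[where C = 0 and K = 0]) (use 5 in \<open>simp_all add: TE_X3\<close>)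
      then show ?thesis by blast
    qed
  qed
  then show ?thesis by simp
qed

lemmas scE_move = scE_left_commute[of "TE k i" for k i] scE_left_commute[of "fps_const A" for A :: lop]

lemma TE_X_T: "TE k i * opX i * TE k i = opX (i + 1)"
proof -
  have "TE k i * opX i * TE k i = opX (i + 1) * (TE k i * TE k i) - opX (i + 1) * (scE (cpar k) * TE k i)"
    unfolding TE_X1 left_diff_distrib mult.assoc scE_left_commute[of "opX (i + 1)"] ..
  then show ?thesis unfolding TE_quadratic distrib_left by simp
qed

definition TEi :: "complex \<Rightarrow> nat \<Rightarrow> lop fps" where "TEi k i = TE k i - scE (cpar k)"

lemma TE_TEi [simp]: "TE k i * TEi k i = 1" "TEi k i * TE k i = 1"
  by (simp_all add: TEi_def right_diff_distrib left_diff_distrib TE_quadratic scE_central)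

section \<open>Operators given on monomials and the operator omega\<close>

definition mono_E :: "(expo \<Rightarrow> laurent) \<Rightarrow> lop fps" where
  "mono_E \<phi> = Abs_fps (\<lambda>n. mono_op (\<lambda>a. fps_nth (\<phi> a) n))"

lemma act_mono_E_mnm: "act (mono_E \<phi>) (fps_const (mnm a)) = \<phi> a"
proof (rule fps_ext)
  fix n
  have "(\<Sum>i\<le>n. app (fps_nth (mono_E \<phi>) i) (fps_nth (fps_const (mnm a)) (n - i))) =
      (\<Sum>i\<le>n. if i = n then fps_nth (\<phi> a) n else 0)"
    by (rule sum.cong) (auto simp: mono_E_def)
  then show "fps_nth (act (mono_E \<phi>) (fps_const (mnm a))) n = fps_nth (\<phi> a) n" by (simp add: act_nth)
qed

lemma lin_ext_eq_act: "lin_ext \<phi> f = act (mono_E \<phi>) f"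
proof (rule fps_ext)
  fix n
  have "(\<Sum>m\<le>n. lext con (\<lambda>a. fps_nth (\<phi> a) (n - m)) (fps_nth f m)) =
      (\<Sum>i\<le>n. lext con (\<lambda>a. fps_nth (\<phi> a) i) (fps_nth f (n - i)))"
    by (rule sum.reindex_bij_witness[of _ "\<lambda>i. n - i" "\<lambda>i. n - i"]) auto
  then show "fps_nth (lin_ext \<phi> f) n = fps_nth (act (mono_E \<phi>) f) n"
    by (simp add: lin_ext_def act_nth mono_E_def app_mono_op lext_def)
qed

lemma mono_E_const: "mono_E (\<lambda>a. mono_X (\<sigma> a)) = fps_const (mono_op (\<lambda>a. mnm (\<sigma> a)))"
proof (rule fps_ext)
  fix n
  have "mono_op (\<lambda>a. 0) = 0" by (rule lop_eqI) simp
  then show "fps_nth (mono_E (\<lambda>a. mono_X (\<sigma> a))) n = fps_nth (fps_const (mono_op (\<lambda>a. mnm (\<sigma> a)))) n"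
    by (cases n) (simp_all add: mono_E_def mono_X_def)
qed

text \<open>Agrees with the substitution in \<open>omega_op\<close> on {1..N} but fixes all other
  indices, which makes it a bijection of the natural numbers.\<close>

definition cyc :: "nat \<Rightarrow> nat \<Rightarrow> nat" where
  "cyc N j = (if j \<in> {1..N} then if j = 1 then N else j - 1 else j)"

lemma inj_cyc: "inj (cyc N)" by (auto simp: inj_def cyc_def split: if_splits)

definition omE :: "nat \<Rightarrow> complex \<Rightarrow> lop fps" where
  "omE N u = mono_E (\<lambda>a. scal (fps_exp (of_int (Poly_Mapping.lookup a 1) + u)) * mono_X (subst_expo (cyc N) a))"

lemma act_omE_mnm: "act (omE N u) (fps_const (mnm a)) =
    scal (fps_exp (of_int (Poly_Mapping.lookup a 1) + u)) * mono_X (subst_expo (cyc N) a)"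
  unfolding omE_def act_mono_E_mnm ..

lemma mono_X_add: "mono_X (a + b) = mono_X a * mono_X b"
  by (simp add: mono_X_def mnm_mult)

lemma act_opX: "act (opX j) (fps_const p) = fps_const (mnm (Poly_Mapping.single j 1) * p)"
  by (simp add: act_const_const)

lemma act_opX_mono: "act (opX j) f = mono_X (Poly_Mapping.single j 1) * f"
  by (rule fps_ext) (simp add: act_const mono_X_def fps_mult_left_const_nth)

lemma omE_X: "omE N u * opX j = scE (if j = 1 then fps_exp 1 else 1) * (opX (cyc N j) * omE N u)"
proof (rule formal_op_eqI)
  fix a
  let ?e = "Poly_Mapping.single j (1::int)"
  have "act (omE N u * opX j) (fps_const (mnm a)) = act (omE N u) (fps_const (mnm (?e + a)))"
    by (simp only: act_mult act_opX mnm_mult)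
  also have "\<dots> = scal (fps_exp (of_int (Poly_Mapping.lookup (?e + a) 1) + u)) * mono_X (subst_expo (cyc N) (?e + a))"
    by (rule act_omE_mnm)
  also have "mono_X (subst_expo (cyc N) (?e + a)) = mono_X (Poly_Mapping.single (cyc N j) 1) * mono_X (subst_expo (cyc N) a)"
    by (simp add: subst_expo_add mono_X_add)
  also have "fps_exp (of_int (Poly_Mapping.lookup (?e + a) 1) + u) =
      (if j = 1 then fps_exp 1 else 1) * (fps_exp (of_int (Poly_Mapping.lookup a 1) + u) :: complex fps)"
    by (simp add: lookup_add lookup_single when_def fps_exp_add_mult[symmetric] add_ac)
  finally have 1: "act (omE N u * opX j) (fps_const (mnm a)) =
      scal (if j = 1 then fps_exp 1 else 1) * (mono_X (Poly_Mapping.single (cyc N j) 1) *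
       (scal (fps_exp (of_int (Poly_Mapping.lookup a 1) + u)) * mono_X (subst_expo (cyc N) a)))"
    by (simp only: scal_mult mult_ac)
  show "act (omE N u * opX j) (fps_const (mnm a)) =
      act (scE (if j = 1 then fps_exp 1 else 1) * (opX (cyc N j) * omE N u)) (fps_const (mnm a))"
    unfolding 1 by (simp only: act_mult act_scE act_opX_mono act_omE_mnm)
qed

lemma act_omE_one: "act (omE N u) 1 = scal (fps_exp u)"
proof -
  have "act (omE N u) (fps_const (mnm 0)) = scal (fps_exp u)"
    unfolding act_omE_mnm by (simp add: mono_X_def)
  then show ?thesis by simp
qed

lemma act_scal_one: "act A (scal c) = scal c * act A 1" using act_scal[of A c 1] by simp

text \<open>\<open>W\<close> carries the variables along \<sigma> up to scalars. Equal scalars at a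
  and a + 1 mean that the quotient X_a / X_(a+1) is carried to X_b / X_(b+1), and T_a depends on the
  variables only through s_a and this quotient.\<close>

lemma intertwiner_T:
  assumes W: "\<And>j. W * opX j = scE (v j) * (opX (\<sigma> j) * W)" and v: "\<And>j. v' j * v j = 1"
    and \<sigma>: "inj \<sigma>" "\<sigma> a = b" "\<sigma> (a + 1) = b + 1" and va: "v (a + 1) = v a"
    and one: "act W 1 = scal w"
  shows "W * TE k a = TE k b * W"
proof -
  let ?Z = "W * TE k a - TE k b * W" and ?C = "scE (cpar k)"
  have "?Z = 0"
  proof (rule operator_zeroI)
    show "act ?Z 1 = 0"
      by (simp add: act_diff_left act_mult one act_TE_one act_scal_one[of W] act_TE_scal scal_mult mult.commute)
    fix j
    have "\<exists>m. ?Z * opX j = scE (v j) * (opX m * ?Z)"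
    proof -
      consider "j = a" | "j = a + 1" | "j \<noteq> a" "j \<noteq> a + 1" by blast
      then show ?thesis
      proof cases
        case 1
        have "W * (TE k a * opX a) = (W * opX (a + 1)) * TE k a - ?C * (W * opX (a + 1))"
          unfolding TE_X1 right_diff_distrib by (simp only: scE_move scE_left_commute[of W] mult.assoc)
        also have "\<dots> = scE (v a) * (opX (b + 1) * (W * TE k a)) - scE (v a) * (opX (b + 1) * (?C * W))"
          unfolding W va \<sigma> scE_left_commute[of ?C "v a"] by (simp only: mult.assoc scE_move scE_left_commute[of W] scE_left_commute[of ?C "v a"])
        finally have 1: "W * TE k a * opX a = scE (v a) * (opX (b + 1) * (W * TE k a - ?C * W))"
          by (simp only: right_diff_distrib mult.assoc)
        have "TE k b * (W * opX a) = scE (v a) * ((TE k b * opX b) * W)"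
          unfolding W \<sigma> by (simp only: mult.assoc scE_move scE_left_commute[of W])
        also have "\<dots> = scE (v a) * (opX (b + 1) * (TE k b * W - ?C * W))"
          unfolding TE_X1 left_diff_distrib right_diff_distrib scE_left_commute[of "opX (b + 1)"] by (simp only: mult.assoc)
        finally have 2: "TE k b * W * opX a = scE (v a) * (opX (b + 1) * (TE k b * W - ?C * W))"
          by (simp only: mult.assoc)
        have "?Z * opX a = scE (v a) * (opX (b + 1) * ?Z)"
          unfolding left_diff_distrib[of _ _ "opX a"] 1 2 by (simp only: right_diff_distrib) simp
        then show ?thesis using \<open>j = a\<close> by blast
      next
        case 2
        have "W * (TE k a * opX (a + 1)) = (W * opX a) * TE k a + ?C * (W * opX (a + 1))"
          unfolding TE_X2 distrib_left by (simp only: scE_move scE_left_commute[of W] mult.assoc)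
        also have "\<dots> = scE (v a) * (opX b * (W * TE k a)) + scE (v a) * (?C * (opX (b + 1) * W))"
          unfolding W va \<sigma> by (simp only: mult.assoc scE_left_commute[of ?C "v a"])
        finally have 1: "W * TE k a * opX (a + 1) = scE (v a) * (opX b * (W * TE k a) + ?C * (opX (b + 1) * W))"
          by (simp only: distrib_left mult.assoc)
        have "TE k b * (W * opX (a + 1)) = scE (v a) * ((TE k b * opX (b + 1)) * W)"
          unfolding W \<sigma> va by (simp only: mult.assoc scE_move scE_left_commute[of W])
        also have "\<dots> = scE (v a) * (opX b * (TE k b * W) + ?C * (opX (b + 1) * W))"
          unfolding TE_X2 distrib_right by (simp only: mult.assoc)
        finally have 2: "TE k b * W * opX (a + 1) = scE (v a) * (opX b * (TE k b * W) + ?C * (opX (b + 1) * W))"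
          by (simp only: mult.assoc)
        have "?Z * opX (a + 1) = scE (v (a + 1)) * (opX b * ?Z)"
          unfolding left_diff_distrib[of _ _ "opX (a + 1)"] 1 2 va by (simp only: right_diff_distrib distrib_left) simp
        then show ?thesis using \<open>j = a + 1\<close> by blast
      next
        case 3
        have s: "\<sigma> j \<noteq> b" "\<sigma> j \<noteq> b + 1" using 3 \<sigma> by (metis injD)+
        have 1: "W * (TE k a * opX j) = scE (v j) * (opX (\<sigma> j) * (W * TE k a))"
          unfolding TE_X3[OF 3] by (simp only: mult.assoc[symmetric] W)
        have 2: "TE k b * (W * opX j) = scE (v j) * (opX (\<sigma> j) * (TE k b * W))"
          unfolding W scE_left_commute[of "TE k b"] by (simp only: mult.assoc[symmetric] TE_X3[OF s])
        have "?Z * opX j = scE (v j) * (opX (\<sigma> j) * ?Z)"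
          using 1 2 by (simp only: left_diff_distrib right_diff_distrib mult.assoc)
        then show ?thesis by blast
      qed
    qed
    then show "\<exists>c c' m. c' * c = 1 \<and> ?Z * opX j = scE c * (opX m * ?Z)" using v by blast
  qed
  then show ?thesis by simp
qed

lemma fps_exp_inverse: "fps_exp (- c) * fps_exp c = (1 :: complex fps)"
  by (simp flip: fps_exp_add_mult)

lemma omE_T: "1 \<le> i \<Longrightarrow> i + 1 < N \<Longrightarrow> omE N u * TE k (i + 1) = TE k i * omE N u"
  by (rule intertwiner_T[OF omE_X, where v' = "\<lambda>j. if j = 1 then fps_exp (- 1) else 1", OF _ inj_cyc _ _ _ act_omE_one])
    (auto simp: fps_exp_inverse cyc_def)

text \<open>A single \<omega> multiplies X_1 by q but not X_2. After two steps both have acquired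
  the factor q, and the pair has become (X_(N-1), X_N), so the intertwining criterion
  applies.\<close>

lemma omE_omE_T: "2 \<le> N \<Longrightarrow> omE N u * omE N u * TE k 1 = TE k (N - 1) * (omE N u * omE N u)"
proof (rule intertwiner_T[where \<sigma> = "cyc N \<circ> cyc N"
      and v = "\<lambda>j. (if j = 1 then fps_exp 1 else 1) * (if cyc N j = 1 then fps_exp 1 else 1)"
      and v' = "\<lambda>j. (if j = 1 then fps_exp (- 1) else 1) * (if cyc N j = 1 then fps_exp (- 1) else 1)"])
  assume N: "2 \<le> N"
  fix j
  show "omE N u * omE N u * opX j =
      scE ((if j = 1 then fps_exp 1 else 1) * (if cyc N j = 1 then fps_exp 1 else 1)) *
      (opX ((cyc N \<circ> cyc N) j) * (omE N u * omE N u))"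
    unfolding mult.assoc omE_X[of N u j] scE_mult comp_apply
    unfolding scE_left_commute[of "omE N u"]
    unfolding mult.assoc[symmetric, of "omE N u"] omE_X[of N u "cyc N j"]
    by (simp only: mult.assoc)
  show "(if j = 1 then fps_exp (- 1) else 1) * (if cyc N j = 1 then fps_exp (- 1) else 1) *
      ((if j = 1 then fps_exp 1 else 1) * (if cyc N j = 1 then fps_exp 1 else (1 :: complex fps))) = 1"
    by (simp flip: fps_exp_add_mult)
  show "inj (cyc N \<circ> cyc N)" by (intro inj_compose inj_cyc)
  show "(cyc N \<circ> cyc N) 1 = N - 1" "(cyc N \<circ> cyc N) (1 + 1) = N - 1 + 1" using N by (auto simp: cyc_def)
  show "(if (1::nat) + 1 = 1 then fps_exp 1 else 1) * (if cyc N (1 + 1) = 1 then fps_exp 1 else 1) =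
    (if (1::nat) = 1 then fps_exp 1 else 1) * (if cyc N 1 = 1 then fps_exp 1 else (1 :: complex fps))"
    using N by (auto simp: cyc_def)
  show "act (omE N u * omE N u) 1 = scal (fps_exp u * fps_exp u)"
    by (simp only: act_mult act_omE_one act_scal_one[of "omE N u"] scal_mult)
qed

interpretation aff: affine_braid N "TE k" "TEi k" "omE N u" for N k u
proof
  show "TE k i * TE k j = TE k j * TE k i" if "i \<in> {1..<N}" "j \<in> {1..<N}" "i + 2 \<le> j \<or> j + 2 \<le> i" for i j
    using that TE_commute[of i j k] TE_commute[of j i k] by auto
qed (simp_all add: TE_braid omE_T[simplified] omE_omE_T[simplified] del: One_nat_def, simp_all add: TE_braid[simplified] omE_T[simplified] omE_omE_T[simplified])

definition YE :: "nat \<Rightarrow> complex \<Rightarrow> complex \<Rightarrow> nat \<Rightarrow> lop fps" where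
  "YE N k u i = scE (tpar k ^ (N - 1)) * aff.Y N k u i"

lemma YE_rec: "i \<in> {1..<N} \<Longrightarrow> TE k i * YE N k u i * TE k i = YE N k u (i + 1)"
  unfolding YE_def scE_move mult.assoc by (simp only: aff.Y_rec mult.assoc[symmetric])
lemma YE_T: "i \<in> {1..<N} \<Longrightarrow> j \<in> {1..N} \<Longrightarrow> j \<noteq> i \<Longrightarrow> j \<noteq> i + 1 \<Longrightarrow> TE k i * YE N k u j = YE N k u j * TE k i"
  unfolding YE_def scE_move mult.assoc using aff.T_Y[of i N j k u] by simp
lemma YE_commute: "i \<in> {1..N} \<Longrightarrow> j \<in> {1..N} \<Longrightarrow> YE N k u i * YE N k u j = YE N k u j * YE N k u i"
proof -
  assume ij: "i \<in> {1..N}" "j \<in> {1..N}"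
  let ?c = "scE (tpar k ^ (N - 1))"
  have "YE N k u i * YE N k u j = ?c * (?c * (aff.Y N k u i * aff.Y N k u j))" for i j
    unfolding YE_def mult.assoc scE_left_commute[of "aff.Y N k u i"] ..
  then show ?thesis using aff.Y_commute[OF ij] by simp
qed

lemma TEi_X: "j \<noteq> i \<Longrightarrow> j \<noteq> i + 1 \<Longrightarrow> opX j * TEi k i = TEi k i * opX j"
  unfolding TEi_def left_diff_distrib right_diff_distrib using TE_X3[of j i k] by (simp add: scE_central)

lemma prod_TEi_X: "(\<And>i. i \<in> set is \<Longrightarrow> j \<noteq> i \<and> j \<noteq> i + 1) \<Longrightarrow>
    opX j * prod_list (map (TEi k) is) = prod_list (map (TEi k) is) * opX j"
proof (induction "is")
  case (Cons i "is")
  have "opX j * (TEi k i * prod_list (map (TEi k) is)) = TEi k i * prod_list (map (TEi k) is) * opX j"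
    by (rule intertwine_mult[OF TEi_X]) (use Cons in auto)
  then show ?case by simp
qed simp

text \<open>The inverse factors in Y_2 have index at least 2 and commute with X_1, \<omega> turns
  X_2 on its right into X_1 on its left, and X_2 T_1 = T_1 X_1 T_1^2 by
  \<open>TE_X_T\<close>.\<close>

lemma X_YE: "2 \<le> N \<Longrightarrow> opX 1 * YE N k u 2 = YE N k u 2 * (opX 1 * (TE k 1 * TE k 1))"
proof -
  assume N: "2 \<le> N"
  have P: "opX 1 * aff.P N k 2 = aff.P N k 2 * opX 1"
    unfolding aff.P_def by (rule prod_TEi_X) auto
  have "omE N u * opX 2 = opX 1 * omE N u" using omE_X[of N u 2] N by (simp add: cyc_def)
  from intertwine_mult[OF P this[symmetric]] have G: "opX 1 * aff.G N k u 2 = aff.G N k u 2 * opX 2"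
    by (simp add: aff.G_def)
  have A: "aff.A k 2 = TE k 1" by (simp add: aff.A_def numeral_2_eq_2)
  have e: "(2::nat) = 1 + 1" by simp
  have "opX 2 * TE k 1 = TE k 1 * (opX 1 * (TE k 1 * TE k 1))"
    unfolding e TE_X_T[of k 1, symmetric] by (simp only: mult.assoc)
  with G have "opX 1 * aff.Y N k u 2 = aff.Y N k u 2 * (opX 1 * (TE k 1 * TE k 1))"
    unfolding aff.Y_def A by (rule intertwine_mult[where b = "opX 2", THEN trans]) simp
  then show ?thesis unfolding YE_def scE_left_commute[of "opX 1"] by (simp only: mult.assoc)
qed

lemma omE_power_X: "m < j \<Longrightarrow> j \<le> N \<Longrightarrow> omE N u ^ m * opX j = opX (j - m) * omE N u ^ m"
proof (induction m)
  case (Suc m)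
  have "omE N u * opX (j - m) = opX (j - Suc m) * omE N u"
  proof -
    have "j - m \<noteq> 1" "cyc N (j - m) = j - Suc m" using Suc.prems by (auto simp: cyc_def)
    then show ?thesis using omE_X[of N u "j - m"] by simp
  qed
  then have "omE N u * (opX (j - m) * omE N u ^ m) = opX (j - Suc m) * (omE N u * omE N u ^ m)"
    by (simp only: mult.assoc[symmetric])
  then show ?case using Suc by (simp add: mult.assoc)
qed simp

text \<open>In N steps every variable passes through index 1 exactly once, where it picks up the
  factor q, and returns to its place.\<close>

lemma omE_power_N_X: "j \<in> {1..N} \<Longrightarrow> omE N u ^ N * opX j = scE (fps_exp 1) * (opX j * omE N u ^ N)"
proof -
  assume j: "j \<in> {1..N}"
  let ?o = "omE N u" and ?q = "scE (fps_exp 1)"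
  have pw: "?o ^ N = ?o ^ (N - j) * (?o * ?o ^ (j - 1))"
  proof -
    have "?o ^ N = ?o ^ (N - j + Suc (j - 1))" using j by simp
    then show ?thesis by (simp only: power_add power_Suc)
  qed
  have 1: "?o ^ (j - 1) * opX j = opX 1 * ?o ^ (j - 1)" using omE_power_X[of "j - 1" j N u] j by simp
  have 2: "?o * opX 1 = ?q * (opX N * ?o)" using omE_X[of N u 1] j by (simp add: cyc_def)
  have 3: "?o ^ (N - j) * opX N = opX j * ?o ^ (N - j)"
  proof (cases "j = N")
    case False then show ?thesis using omE_power_X[of "N - j" N N u] j by simp
  qed simp
  have "?o ^ N * opX j = ?o ^ (N - j) * (?o * (?o ^ (j - 1) * opX j))" unfolding pw by (simp only: mult.assoc)
  also have "\<dots> = ?o ^ (N - j) * ((?o * opX 1) * ?o ^ (j - 1))" unfolding 1 by (simp only: mult.assoc)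
  also have "\<dots> = ?q * ((?o ^ (N - j) * opX N) * (?o * ?o ^ (j - 1)))"
    unfolding 2 mult.assoc scE_left_commute[of "?o ^ (N - j)"] ..
  also have "\<dots> = ?q * (opX j * ?o ^ N)" unfolding 3 pw by (simp only: mult.assoc)
  finally show ?thesis .
qed

lemma prod_YE: "1 \<le> N \<Longrightarrow> \<exists>c. prod_list (map (YE N k u) [1..<Suc N]) = scE c * omE N u ^ N"
proof -
  assume N: "1 \<le> N"
  have "prod_list (map (YE N k u) is) = scE ((tpar k ^ (N - 1)) ^ length is) * prod_list (map (aff.Y N k u) is)" for "is"
  proof (induction "is")
    case (Cons i "is")
    show ?case unfolding list.map prod_list.Cons list.size Cons.IH YE_def[of N k u i]
      by (simp only: add_Suc_right add_0_right power_Suc scE_mult mult.assoc scE_left_commute[of "aff.Y N k u i"])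
  qed simp
  then show ?thesis using aff.prod_all_Y[OF N] by metis
qed

lemma X_prod_YE: "1 \<le> N \<Longrightarrow> j \<in> {1..N} \<Longrightarrow>
    opX j * prod_list (map (YE N k u) [1..<Suc N]) =
    scE (inverse (fps_exp 1)) * (prod_list (map (YE N k u) [1..<Suc N]) * opX j)"
proof -
  assume N: "1 \<le> N" and j: "j \<in> {1..N}"
  obtain c where c: "prod_list (map (YE N k u) [1..<Suc N]) = scE c * omE N u ^ N" using prod_YE[OF N] by blast
  have "scE (inverse (fps_exp 1)) * (scE c * (omE N u ^ N * opX j)) =
      scE (inverse (fps_exp 1)) * (scE (fps_exp 1) * (scE c * (opX j * omE N u ^ N)))"
    unfolding omE_power_N_X[OF j] scE_left_commute[of "scE c" "fps_exp 1"] ..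
  also have "\<dots> = scE (inverse (fps_exp 1) * fps_exp 1) * (scE c * (opX j * omE N u ^ N))"
    by (simp only: scE_mult mult.assoc)
  also have "inverse (fps_exp 1) * fps_exp 1 = (1 :: complex fps)" by (simp add: inverse_mult_eq_1)
  finally show ?thesis unfolding c scE_left_commute[of "opX j"] by (simp only: mult.assoc scE_one mult_1_left)
qed

lemma prod_X_T: "i \<in> {1..<N} \<Longrightarrow> TE k i * prod_list (map opX [1..<Suc N]) = prod_list (map opX [1..<Suc N]) * TE k i"
proof -
  assume i: "i \<in> {1..<N}"
  have comm: "TE k i * prod_list (map opX js) = prod_list (map opX js) * TE k i"
    if "\<And>j. j \<in> set js \<Longrightarrow> j \<noteq> i \<and> j \<noteq> i + 1" for js
    using that
  proof (induction js)
    case (Cons j js)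
    have "TE k i * (opX j * prod_list (map opX js)) = opX j * prod_list (map opX js) * TE k i"
      by (rule intertwine_mult[OF TE_X3]) (use Cons in auto)
    then show ?case by simp
  qed simp
  have mid: "TE k i * (opX i * opX (i + 1)) = opX i * opX (i + 1) * TE k i"
  proof -
    have "TE k i * opX i * opX (i + 1) = opX (i + 1) * (TE k i * opX (i + 1)) - scE (cpar k) * (opX (i + 1) * opX (i + 1))"
      unfolding TE_X1 left_diff_distrib by (simp only: mult.assoc)
    also have "\<dots> = opX (i + 1) * opX i * TE k i"
      unfolding TE_X2 distrib_left scE_left_commute[of "opX (i + 1)"] by (simp only: mult.assoc add_diff_cancel_right')
    finally show ?thesis unfolding opX_commute[of "i + 1" i] by (simp only: mult.assoc)
  qed
  have "[1..<Suc N] = [1..<i] @ [i, i + 1] @ [i + 2..<Suc N]" by (rule upt_split_pair) (use i in auto)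
  then have e: "prod_list (map opX [1..<Suc N]) =
      prod_list (map opX [1..<i]) * ((opX i * opX (i + 1)) * prod_list (map opX [i+2..<Suc N]))"
    by (simp only: map_append prod_list.append list.map prod_list.Cons prod_list.Nil mult.assoc mult_1_right mult_1_left)
  show ?thesis unfolding e
    by (rule intertwine_mult[OF comm intertwine_mult[OF mid comm]]) auto
qed

lemma prod_X_om: "1 \<le> N \<Longrightarrow> omE N u * prod_list (map opX [1..<Suc N]) =
    scE (fps_exp 1) * (prod_list (map opX [1..<Suc N]) * omE N u)"
proof -
  assume N: "1 \<le> N"
  have shift: "omE N u * prod_list (map opX (map Suc js)) = prod_list (map opX js) * omE N u" if "set js \<subseteq> {1..<N}" for js
    using that
  proof (induction js)
    case (Cons j js)
    have "omE N u * opX (Suc j) = opX j * omE N u" using omE_X[of N u "Suc j"] Cons.prems by (simp add: cyc_def)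
    then have "omE N u * (opX (Suc j) * prod_list (map opX (map Suc js))) = opX j * (omE N u * prod_list (map opX (map Suc js)))"
      by (simp only: mult.assoc[symmetric])
    then show ?case using Cons by (simp add: mult.assoc)
  qed simp
  have comm: "opX N * prod_list (map opX js) = prod_list (map opX js) * opX N" for js
  proof (induction js)
    case (Cons j js)
    have "opX N * (opX j * prod_list (map opX js)) = opX j * prod_list (map opX js) * opX N"
      by (rule intertwine_mult[OF opX_commute Cons])
    then show ?case by simp
  qed simp
  have l: "[1..<Suc N] = 1 # map Suc [1..<N]" using N by (simp add: map_Suc_upt upt_conv_Cons del: upt_Suc)
  have 1: "omE N u * opX 1 = scE (fps_exp 1) * (opX N * omE N u)" using omE_X[of N u 1] N by (simp add: cyc_def)
  have "omE N u * prod_list (map opX [1..<Suc N]) = (omE N u * opX 1) * prod_list (map opX (map Suc [1..<N]))"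
    unfolding l by (simp add: mult.assoc)
  also have "\<dots> = scE (fps_exp 1) * (opX N * (omE N u * prod_list (map opX (map Suc [1..<N]))))"
    unfolding 1 by (simp only: mult.assoc)
  also have "\<dots> = scE (fps_exp 1) * ((opX N * prod_list (map opX [1..<N])) * omE N u)"
    by (subst shift) (simp_all only: mult.assoc, auto)
  also have "opX N * prod_list (map opX [1..<N]) = prod_list (map opX [1..<Suc N])"
    unfolding comm using N by simp
  finally show ?thesis .
qed

lemma YE_prod_X: "1 \<le> N \<Longrightarrow> i \<in> {1..N} \<Longrightarrow> YE N k u i * prod_list (map opX [1..<Suc N]) =
    scE (fps_exp 1) * (prod_list (map opX [1..<Suc N]) * YE N k u i)"
proof -
  assume N: "1 \<le> N" and i: "i \<in> {1..N}"
  let ?X = "prod_list (map opX [1..<Suc N])" and ?q = "scE (fps_exp 1)"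
  have Ti: "TEi k j * ?X = ?X * TEi k j" if "j \<in> {1..<N}" for j
    unfolding TEi_def left_diff_distrib right_diff_distrib by (simp only: prod_X_T[OF that] scE_central)
  have A: "prod_list (map (TE k) js) * ?X = ?X * prod_list (map (TE k) js)" if "set js \<subseteq> {1..<N}" for js
    using that
  proof (induction js)
    case (Cons j js)
    then have j: "j \<in> {1..<N}" and IH: "prod_list (map (TE k) js) * ?X = ?X * prod_list (map (TE k) js)"
      by (simp_all del: upt_Suc)
    show ?case using intertwine_mult[OF prod_X_T[OF j, symmetric] IH[symmetric]] by (simp only: list.map prod_list.Cons)
  qed simp
  have P: "prod_list (map (TEi k) js) * ?X = ?X * prod_list (map (TEi k) js)" if "set js \<subseteq> {1..<N}" for js
    using that
  proof (induction js)
    case (Cons j js)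
    then have j: "j \<in> {1..<N}" and IH: "prod_list (map (TEi k) js) * ?X = ?X * prod_list (map (TEi k) js)"
      by (simp_all del: upt_Suc)
    show ?case using intertwine_mult[OF Ti[OF j, symmetric] IH[symmetric]] by (simp only: list.map prod_list.Cons)
  qed simp
  have A': "aff.A k i * ?X = ?X * aff.A k i" unfolding aff.A_def by (rule A) (use i in auto)
  have P': "aff.P N k i * ?X = ?X * aff.P N k i" unfolding aff.P_def by (rule P) (use i in auto)
  have "aff.Y N k u i * ?X = aff.P N k i * (omE N u * (aff.A k i * ?X))"
    unfolding aff.Y_def aff.G_def by (simp only: mult.assoc)
  also have "\<dots> = aff.P N k i * ((omE N u * ?X) * aff.A k i)" unfolding A' by (simp only: mult.assoc)
  also have "\<dots> = ?q * ((aff.P N k i * ?X) * (omE N u * aff.A k i))"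
    unfolding prod_X_om[OF N] mult.assoc scE_left_commute[of "aff.P N k i"] ..
  also have "\<dots> = ?q * (?X * aff.Y N k u i)" unfolding P' aff.Y_def aff.G_def by (simp only: mult.assoc)
  finally have "scE (tpar k ^ (N - 1)) * (aff.Y N k u i * ?X) = scE (tpar k ^ (N - 1)) * (?q * (?X * aff.Y N k u i))" by simp
  then show ?thesis unfolding YE_def scE_left_commute[of ?X] scE_left_commute[of "scE (tpar k ^ (N - 1))" "fps_exp 1"]
    by (simp only: mult.assoc)
qed

section \<open>Polynomial subspaces, comparison with the defining formulas, logarithms\<close>

section \<open>Subspaces spanned by monomials\<close>

definition presv :: "expo set \<Rightarrow> lop set" where
  "presv K = {A. \<forall>a\<in>K. Poly_Mapping.keys (app A (mnm a)) \<subseteq> K}"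

lemma keys_con_mult: "Poly_Mapping.keys (con c * p) \<subseteq> Poly_Mapping.keys p"
  using keys_mult[of "con c" p] by (auto split: if_splits)

lemma presvD: "A \<in> presv K \<Longrightarrow> Poly_Mapping.keys p \<subseteq> K \<Longrightarrow> Poly_Mapping.keys (app A p) \<subseteq> K"
proof -
  assume A: "A \<in> presv K" and p: "Poly_Mapping.keys p \<subseteq> K"
  have e: "app A p = (\<Sum>a\<in>Poly_Mapping.keys p. con (Poly_Mapping.lookup p a) * app A (mnm a))"
    by (subst poly_mapping_decomp[of p]) (simp only: app_sum app_single[symmetric])
  show ?thesis unfolding e
    using A p keys_con_mult by (intro order_trans[OF keys_sum] UN_least) (fastforce simp: presv_def)
qed

lemma subalg_presv: "subalg (presv K)"
  unfolding subalg_def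
proof (intro conjI allI ballI)
  show "cst c \<in> presv K" for c by (auto simp: presv_def mult_single split: if_splits)
  fix A B assume A: "A \<in> presv K" and B: "B \<in> presv K"
  show "A + B \<in> presv K"
    using A B Poly_Mapping.keys_add by (fastforce simp: presv_def)
  show "A * B \<in> presv K" using presvD[OF A] B by (simp add: presv_def)
qed

lemma subalg_Int: "subalg R \<Longrightarrow> subalg R' \<Longrightarrow> subalg (R \<inter> R')" by (simp add: subalg_def)

definition EN :: "nat \<Rightarrow> expo set" where "EN N = {a. Poly_Mapping.keys a \<subseteq> {1..N}}"
definition ENp :: "nat \<Rightarrow> expo set" where "ENp N = {a\<in>EN N. \<forall>j. 0 \<le> Poly_Mapping.lookup a j}"

text \<open>\<open>RV\<close> refers to Laurent polynomials, \<open>RP\<close> to polynomials as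
  well. The twist is absorbed into the operators, so the same sets of exponents describe the twisted
  spaces for every u.\<close>

abbreviation RV :: "nat \<Rightarrow> lop set" where "RV N \<equiv> presv (EN N)"
abbreviation RP :: "nat \<Rightarrow> lop set" where "RP N \<equiv> presv (EN N) \<inter> presv (ENp N)"

lemma subalg_RP: "subalg (RP N)" by (intro subalg_Int subalg_presv)

lemma PP_eq: "PP N = {f. \<forall>n. Poly_Mapping.keys (fps_nth f n) \<subseteq> EN N}"
  by (auto simp: PP_def EN_def)
lemma PP_plus_eq: "PP_plus N = {f. \<forall>n. Poly_Mapping.keys (fps_nth f n) \<subseteq> ENp N}"
  by (auto simp: PP_plus_def PP_def EN_def ENp_def)

lemma act_presv: "A \<in> ops (presv K) \<Longrightarrow> \<forall>n. Poly_Mapping.keys (fps_nth f n) \<subseteq> K \<Longrightarrow>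
    \<forall>n. Poly_Mapping.keys (fps_nth (act A f) n) \<subseteq> K"
  unfolding act_nth by (intro allI order_trans[OF keys_sum] UN_least presvD) (auto simp: ops_def)

lemma act_PP: "A \<in> ops (RV N) \<Longrightarrow> f \<in> PP N \<Longrightarrow> act A f \<in> PP N"
  unfolding PP_eq mem_Collect_eq by (rule act_presv)
lemma ops_RP_RV: "A \<in> ops (RP N) \<Longrightarrow> A \<in> ops (RV N)" by (simp add: ops_def)

lemma EN_iff: "a \<in> EN N \<longleftrightarrow> (\<forall>j. j \<notin> {1..N} \<longrightarrow> Poly_Mapping.lookup a j = 0)"
  by (auto simp: EN_def in_keys_iff)

lemma EN_add: "a \<in> EN N \<Longrightarrow> b \<in> EN N \<Longrightarrow> a + b \<in> EN N" by (simp add: EN_iff lookup_add)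
lemma ENp_add: "a \<in> ENp N \<Longrightarrow> b \<in> ENp N \<Longrightarrow> a + b \<in> ENp N" by (simp add: ENp_def EN_add lookup_add)

lemma mulop_EN: "Poly_Mapping.keys p \<subseteq> EN N \<Longrightarrow> mulop p \<in> RV N"
  unfolding presv_def using keys_mult[of p] EN_add by (auto, fastforce)
lemma mulop_ENp: "Poly_Mapping.keys p \<subseteq> ENp N \<Longrightarrow> mulop p \<in> RP N"
proof -
  assume p: "Poly_Mapping.keys p \<subseteq> ENp N"
  then have "Poly_Mapping.keys p \<subseteq> EN N" by (auto simp: ENp_def)
  then have "mulop p \<in> RV N" by (rule mulop_EN)
  moreover have "mulop p \<in> presv (ENp N)"
    unfolding presv_def using keys_mult[of p] p ENp_add by (auto, fastforce)
  ultimately show ?thesis by blast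
qed

lemma unit_ENp: "j \<in> {1..N} \<Longrightarrow> Poly_Mapping.single j 1 \<in> ENp N"
  by (auto simp: ENp_def EN_iff lookup_single when_def)
lemma unit_EN: "j \<in> {1..N} \<Longrightarrow> - Poly_Mapping.single j 1 \<in> EN N"
  by (auto simp: EN_iff lookup_single when_def)

lemma opX_RP: "j \<in> {1..N} \<Longrightarrow> opX j \<in> ops (RP N)"
  by (intro ops_const[OF subalg_RP] mulop_ENp) (simp add: unit_ENp del: One_nat_def)
lemma opXi_RV: "j \<in> {1..N} \<Longrightarrow> opXi j \<in> ops (RV N)"
  by (intro ops_const[OF subalg_presv] mulop_EN) (simp add: unit_EN del: One_nat_def)

lemma subst_expo_EN:
  assumes \<sigma>: "bij \<sigma>" "\<sigma> ` {1..N} = {1..N}" and a: "a \<in> EN N"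
  shows "subst_expo \<sigma> a \<in> EN N" and "a \<in> ENp N \<Longrightarrow> subst_expo \<sigma> a \<in> ENp N"
proof -
  have l: "Poly_Mapping.lookup (subst_expo \<sigma> a) j = Poly_Mapping.lookup a (inv_into UNIV \<sigma> j)" for j
    using lookup_subst_expo[of \<sigma> a "inv_into UNIV \<sigma> j"] \<sigma>(1) by (simp add: bij_is_inj bij_is_surj surj_f_inv_f)
  have m: "inv_into UNIV \<sigma> j \<in> {1..N} \<Longrightarrow> j \<in> {1..N}" for j
    using imageI[of "inv_into UNIV \<sigma> j" "{1..N}" \<sigma>] unfolding \<sigma>(2) surj_f_inv_f[OF bij_is_surj[OF \<sigma>(1)]] .
  show "subst_expo \<sigma> a \<in> EN N" unfolding EN_iff l using a[unfolded EN_iff] m by blast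
  then show "a \<in> ENp N \<Longrightarrow> subst_expo \<sigma> a \<in> ENp N" by (simp add: ENp_def l)
qed

lemma sop_RP:
  assumes \<sigma>: "bij \<sigma>" "\<sigma> ` {1..N} = {1..N}" shows "sop \<sigma> \<in> RP N"
  using subst_expo_EN[OF \<sigma>] by (auto simp: presv_def ENp_def)

lemma sr_perm: "i \<in> {1..<N} \<Longrightarrow> sr i ` {1..N} = {1..N}" by (simp add: transpose_image_eq)

lemma bij_cyc: "bij (cyc N)" and cyc_image: "cyc N ` {1..N} = {1..N}"
proof -
  have sub: "cyc N ` {1..N} \<subseteq> {1..N}" by (auto simp: cyc_def)
  show im: "cyc N ` {1..N} = {1..N}"
    by (rule endo_inj_surj[OF _ sub]) (use inj_cyc in \<open>auto intro: inj_on_subset\<close>)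
  have "y \<in> range (cyc N)" for y
  proof (cases "y \<in> {1..N}")
    case True then show ?thesis using im by blast
  next
    case False then have "cyc N y = y" unfolding cyc_def by (rule if_not_P)
    then show ?thesis by (metis rangeI)
  qed
  then have "surj (cyc N)" by auto
  with inj_cyc show "bij (cyc N)" by (simp add: bij_def)
qed

text \<open>The Demazure quotient by the simple root is divisible by \<open>X\<^sub>i\<^sub>+\<^sub>1\<close> on polynomials.\<close>

definition qop' :: "nat \<Rightarrow> lop" where "qop' i = Xm (- Poly_Mapping.single (i + 1) 1) * qop i"

lemma qop_qop': "qop i = Xm (Poly_Mapping.single (i + 1) 1) * qop' i"
  by (simp add: qop'_def mult.assoc[symmetric] flip: Xm_add)

lemma keys_geometric: "Poly_Mapping.keys (mnm b * (\<Sum>j<n. mnm e ^ j)) \<subseteq> (\<lambda>j. b + frag_cmul (int j) e) ` {..<n}"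
  unfolding sum_distrib_left mnm_power mnm_mult by (rule order_trans[OF keys_sum]) auto

text \<open>In the geometric sum the step j stays below the difference of the two exponents, so
  coordinate i + 1 exceeds the smaller of them by at least one. This is exactly the room needed to
  divide by X_(i+1).\<close>

lemma qop'_RP:
  assumes i: "i \<in> {1..<N}" shows "qop' i \<in> RP N"
proof -
  let ?e = "Poly_Mapping.single (i + 1) (1::int)"
  have sub: "subst_expo (sr i) a \<in> EN N" if "a \<in> EN N" for a
    by (rule subst_expo_EN) (use that sr_perm[OF i] in auto)
  have main: "\<exists>b j. k = - ?e + (b + frag_cmul (int j) (sroot i)) \<and>
      ((b = subst_expo (sr i) a \<and> int j < Poly_Mapping.lookup a i - Poly_Mapping.lookup a (i + 1)) \<or>
       (b = a \<and> int j < Poly_Mapping.lookup a (i + 1) - Poly_Mapping.lookup a i))"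
    if k: "k \<in> Poly_Mapping.keys (app (qop' i) (mnm a))" for k a
  proof -
    let ?n = "Poly_Mapping.lookup a i - Poly_Mapping.lookup a (i + 1)"
    have "app (qop' i) (mnm a) = mnm (- ?e) * dem_mono i a" by (simp add: qop'_def qop_def)
    then obtain k' where k': "k = - ?e + k'" "k' \<in> Poly_Mapping.keys (dem_mono i a)"
      using k keys_mult[of "mnm (- ?e)" "dem_mono i a"] by auto
    show ?thesis
    proof (cases "?n \<ge> 0")
      case True
      then have "dem_mono i a = - (mnm (subst_expo (sr i) a) * (\<Sum>j<nat ?n. mnm (sroot i) ^ j))"
        by (simp add: dem_mono_def)
      then have "k' \<in> Poly_Mapping.keys (mnm (subst_expo (sr i) a) * (\<Sum>j<nat ?n. mnm (sroot i) ^ j))"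
        using k'(2) by simp
      then obtain j where "j < nat ?n" "k' = subst_expo (sr i) a + frag_cmul (int j) (sroot i)"
        using keys_geometric by blast
      then show ?thesis using k'(1) by (intro exI[of _ "subst_expo (sr i) a"] exI[of _ j]) auto
    next
      case False
      then have "dem_mono i a = mnm a * (\<Sum>j<nat (- ?n). mnm (sroot i) ^ j)"
        by (simp add: dem_mono_def)
      then have "k' \<in> Poly_Mapping.keys (mnm a * (\<Sum>j<nat (- ?n). mnm (sroot i) ^ j))"
        using k'(2) by simp
      then obtain j where "j < nat (- ?n)" "k' = a + frag_cmul (int j) (sroot i)"
        using keys_geometric by blast
      then show ?thesis using k'(1) by (intro exI[of _ a] exI[of _ j]) auto
    qed
  qed
  have N: "k \<in> EN N" if a: "a \<in> EN N" and k: "k \<in> Poly_Mapping.keys (app (qop' i) (mnm a))" for a k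
  proof -
    obtain b j where b: "k = - ?e + (b + frag_cmul (int j) (sroot i))" "b = subst_expo (sr i) a \<or> b = a"
      using main[OF k] by blast
    have "b \<in> EN N" using b(2) a sub by auto
    then show ?thesis using i unfolding b(1) by (auto simp: EN_iff lookup_add lookup_minus lookup_single when_def)
  qed
  moreover have "k \<in> ENp N" if a: "a \<in> ENp N" and k: "k \<in> Poly_Mapping.keys (app (qop' i) (mnm a))" for a k
  proof -
    have "0 \<le> Poly_Mapping.lookup k m" for m
    proof -
      obtain b j where b: "k = - ?e + (b + frag_cmul (int j) (sroot i))"
        "(b = subst_expo (sr i) a \<and> int j < Poly_Mapping.lookup a i - Poly_Mapping.lookup a (i + 1)) \<or>
         (b = a \<and> int j < Poly_Mapping.lookup a (i + 1) - Poly_Mapping.lookup a i)"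
        using main[OF k] by blast
      have a0: "0 \<le> Poly_Mapping.lookup a m" for m using a by (simp add: ENp_def)
      consider "m = i" | "m = i + 1" | "m \<noteq> i" "m \<noteq> i + 1" by blast
      then show ?thesis
      proof cases
        case 1
        then show ?thesis using b(2) a0[of i] a0[of "i + 1"] unfolding b(1)
          by (auto simp: lookup_add lookup_minus lookup_single when_def lookup_subst_transpose)
      next
        case 2
        then show ?thesis using b(2) a0[of i] a0[of "i + 1"] unfolding b(1)
          by (auto simp: lookup_add lookup_minus lookup_single when_def lookup_subst_transpose)
      next
        case 3
        then show ?thesis using b(2) a0[of m] unfolding b(1)
          by (auto simp: lookup_add lookup_minus lookup_single when_def lookup_subst_transpose transpose_def)
      qed
    qed
    then show ?thesis using N[OF _ k] a by (simp add: ENp_def)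
  qed
  ultimately show ?thesis by (auto simp: presv_def)
qed

lemma TE_RP: "i \<in> {1..<N} \<Longrightarrow> TE k i \<in> ops (RP N)"
  unfolding TE_def qop_qop' using subalg_RP[of N]
  by (intro ops_add ops_mult ops_scE ops_const subalg_mult sop_RP qop'_RP mulop_ENp)
    (simp_all add: sr_perm unit_ENp[of "i + 1" N, simplified])

lemma TEi_RP: "i \<in> {1..<N} \<Longrightarrow> TEi k i \<in> ops (RP N)"
  unfolding TEi_def by (intro ops_diff ops_scE TE_RP subalg_RP)

lemma omE_nth: "app (fps_nth (omE N u) n) (mnm a) =
    con (fps_nth (fps_exp (of_int (Poly_Mapping.lookup a 1) + u)) n) * mnm (subst_expo (cyc N) a)"
  by (simp add: omE_def mono_E_def mono_X_def)

lemma omE_RP: "omE N u \<in> ops (RP N)"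
proof -
  have "fps_nth (omE N u) n \<in> RP N" for n
    using subst_expo_EN[OF bij_cyc cyc_image, of _ N] keys_con_mult
    unfolding presv_def by (auto simp: omE_nth mult_single ENp_def split: if_splits)
  then show ?thesis by (simp add: ops_def)
qed

lemma YE_RP: "i \<in> {1..N} \<Longrightarrow> YE N k u i \<in> ops (RP N)"
proof -
  assume i: "i \<in> {1..N}"
  have P: "aff.P N k i \<in> ops (RP N)" unfolding aff.P_def
    by (rule ops_prod_list[OF subalg_RP]) (use i in \<open>auto intro!: TEi_RP\<close>)
  have A: "aff.A k i \<in> ops (RP N)" unfolding aff.A_def
    by (rule ops_prod_list[OF subalg_RP]) (use i in \<open>auto intro!: TE_RP\<close>)
  show ?thesis unfolding YE_def aff.Y_def aff.G_def
    by (intro ops_mult[OF subalg_RP] ops_scE[OF subalg_RP] P A omE_RP)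
qed

section \<open>Comparison with the defining formulas\<close>

lemma s_op_eq: "s_op i f = act (fps_const (sop (sr i))) f"
  by (simp add: s_op_def lin_ext_eq_act mono_E_const sop_def)

lemma T_op_eq: "T_op k i f = act (TE k i) f"
proof -
  let ?D = "mono_X (Poly_Mapping.single i 1 - Poly_Mapping.single (i + 1) 1) - 1"
  have D: "?D = fps_const (mnm (sroot i) - 1)"
    by (simp add: mono_X_def flip: fps_const_1_eq_1)
  have D0: "?D \<noteq> 0" unfolding D fps_const_eq_0_iff by (rule sroot_ne)
  have g: "?D * act (fps_const (qop i)) f = s_op i f - f"
  proof (rule fps_ext)
    fix n
    show "fps_nth (?D * act (fps_const (qop i)) f) n = fps_nth (s_op i f - f) n"
      unfolding D s_op_eq fps_mult_left_const_nth fps_sub_nth act_const by (rule qop_app_eq)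
  qed
  \<comment> \<open>The denominator is nonzero and power series over Laurent polynomials have no
    zero divisors, so the exact quotient is unique.\<close>
  have "(THE g. ?D * g = s_op i f - f) = act (fps_const (qop i)) f"
  proof (rule the_equality, rule g)
    fix h assume "?D * h = s_op i f - f"
    then have "?D * h = ?D * act (fps_const (qop i)) f" using g by simp
    then show "h = act (fps_const (qop i)) f" using D0 by simp
  qed
  then show ?thesis
    unfolding T_op_def by (simp add: TE_def act_add_left act_mult act_scE s_op_eq cpar_def)
qed

lemma T_inv_op_eq: "i \<in> {1..<N} \<Longrightarrow> f \<in> PP N \<Longrightarrow> T_inv_op N k i f = act (TEi k i) f"
  unfolding T_inv_op_def
proof (rule inv_into_f_eq)
  assume i: "i \<in> {1..<N}" and f: "f \<in> PP N"
  show "inj_on (T_op k i) (PP N)"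
  proof (rule inj_onI)
    fix f g assume "T_op k i f = T_op k i g"
    then have "act (TEi k i) (act (TE k i) f) = act (TEi k i) (act (TE k i) g)" by (simp add: T_op_eq)
    then show "f = g" by (simp flip: act_mult)
  qed
  show "act (TEi k i) f \<in> PP N" using act_PP[OF ops_RP_RV[OF TEi_RP[OF i]] f] .
  show "T_op k i (act (TEi k i) f) = f" by (simp add: T_op_eq flip: act_mult)
qed

lemma omega_op_eq: "f \<in> PP N \<Longrightarrow> omega_op N 1 u f = act (omE N u) f"
proof -
  assume f: "f \<in> PP N"
  have "lin_ext (\<lambda>a. scal (fps_exp (1 * (of_int (Poly_Mapping.lookup a 1) + u))) *
      mono_X (subst_expo (\<lambda>j. if j = 1 then N else j - 1) a)) f =
    lin_ext (\<lambda>a. scal (fps_exp (of_int (Poly_Mapping.lookup a 1) + u)) * mono_X (subst_expo (cyc N) a)) f"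
  proof -
    have "subst_expo (\<lambda>j. if j = 1 then N else j - 1) a = subst_expo (cyc N) a"
      if "a \<in> Poly_Mapping.keys (fps_nth f m)" for a m
      by (rule subst_expo_cong) (use f that in \<open>auto simp: PP_def cyc_def subset_iff\<close>)
    then show ?thesis unfolding lin_ext_def by (intro arg_cong[of _ _ Abs_fps] ext sum.cong) auto
  qed
  then show ?thesis unfolding omega_op_def lin_ext_eq_act omE_def by simp
qed

lemma Y_op_eq: "i \<in> {1..N} \<Longrightarrow> f \<in> PP N \<Longrightarrow> Y_op N 1 k u i f = act (YE N k u i) f"
proof -
  assume i: "i \<in> {1..N}" and f: "f \<in> PP N"
  have T: "foldr (\<circ>) (map (T_op k) js) id f = act (prod_list (map (TE k) js)) f" for js f
    by (induction js) (simp_all add: T_op_eq act_mult)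
  have Ti: "foldr (\<circ>) (map (T_inv_op N k) js) id f = act (prod_list (map (TEi k) js)) f"
    if "set js \<subseteq> {1..<N}" "f \<in> PP N" for js f
    using that
  proof (induction js)
    case (Cons j js)
    have "act (prod_list (map (TEi k) js)) f \<in> PP N"
      using Cons.prems by (intro act_PP ops_RP_RV ops_prod_list[OF subalg_RP]) (auto intro!: TEi_RP)
    then show ?case using Cons by (simp add: T_inv_op_eq act_mult)
  qed simp
  have 1: "act (prod_list (map (TE k) [1..<i])) f \<in> PP N"
    using i f by (intro act_PP ops_RP_RV ops_prod_list[OF subalg_RP]) (auto intro!: TE_RP)
  have 2: "act (omE N u) (act (prod_list (map (TE k) [1..<i])) f) \<in> PP N"
    by (intro act_PP ops_RP_RV omE_RP 1)
  have "set [i..<N] \<subseteq> {1..<N}" using i by auto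
  from Ti[OF this 2] show ?thesis
    unfolding Y_op_def comp_apply T omega_op_eq[OF 1]
    by (simp add: YE_def aff.Y_def aff.G_def aff.P_def aff.A_def act_mult act_scE)
qed

section \<open>Logarithms of the operators\<close>

lemma TE_nth_0: "fps_nth (TE k i) 0 = sop (sr i)"
proof -
  have "fps_nth (tpar k) 0 = 1" by (simp add: tpar_def)
  then show ?thesis by (simp add: TE_def cpar_def cst.sc_one)
qed

lemma TEi_nth_0: "fps_nth (TEi k i) 0 = sop (sr i)"
  by (simp add: TEi_def TE_nth_0) (simp add: cpar_def tpar_def)

lemma omE_nth_0: "fps_nth (omE N u) 0 = sop (cyc N)"
  by (rule lop_eqI) (simp only: omE_nth, simp)

lemma sr_cyc: "m \<in> {1..<N} \<Longrightarrow> sr m \<circ> cyc (m + 1) = cyc m"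
  by (auto simp: fun_eq_iff cyc_def transpose_def)

text \<open>For m = N - 1 the right-hand side is the identity, which says that T_1^-1 ... T_(N-1)^-1
  \<omega> is the identity at \<epsilon> = 0.\<close>

lemma prod_sop_cyc: "m < N \<Longrightarrow> prod_list (map (\<lambda>i. sop (sr i)) [N - m..<N]) * sop (cyc N) = sop (cyc (N - m))"
proof (induction m)
  case (Suc m)
  have l: "[N - Suc m..<N] = (N - Suc m) # [N - m..<N]" using Suc.prems by (simp add: upt_conv_Cons Suc_diff_Suc)
  have "sop (sr (N - Suc m)) * sop (cyc (N - m)) = sop (cyc (N - Suc m))"
    using sr_cyc[of "N - Suc m" N] Suc.prems by (simp add: sop_comp Suc_diff_Suc)
  then show ?case unfolding l using Suc by (simp add: mult.assoc)
qed simp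

text \<open>Makes (Y_i - 1) / \<epsilon> available, so that y_i can be found as a logarithm. The
  value for i = 1 is the cyclic product; larger i follow by conjugation with s_i.\<close>

lemma YE_nth_0: "1 \<le> N \<Longrightarrow> i \<in> {1..N} \<Longrightarrow> fps_nth (YE N k u i) 0 = 1"
proof (induction i)
  case (Suc i)
  show ?case
  proof (cases "i = 0")
    case True
    have P: "fps_nth (prod_list (map (TEi k) js)) 0 = prod_list (map (\<lambda>i. sop (sr i)) js)" for js
      by (induction js) (simp_all add: TEi_nth_0)
    have "cyc 1 = id" by (auto simp: cyc_def)
    then have "prod_list (map (\<lambda>i. sop (sr i)) [1..<N]) * sop (cyc N) = 1"
      using prod_sop_cyc[of "N - 1" N] Suc.prems by (simp add: sop_id)
    moreover have "fps_nth (tpar k ^ (N - 1)) 0 = 1" by (simp add: tpar_def fps_nth_power_0)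
    ultimately show ?thesis
      using True by (simp add: YE_def aff.Y_def aff.G_def aff.P_def P omE_nth_0 cst.sc_one)
  next
    case False
    then have i: "i \<in> {1..<N}" using Suc.prems by auto
    have "fps_nth (YE N k u (Suc i)) 0 = sop (sr i) * 1 * sop (sr i)"
      using YE_rec[OF i, of k u, symmetric] Suc False by (simp add: TE_nth_0)
    then show ?thesis by (simp add: sop_comp sop_id)
  qed
qed simp

text \<open>The formulas of the representation only give T_i and Y_i. Operators for the generators
  s_i and y_i are solutions of the implicit equations, chosen to preserve polynomials;
  \<open>yE\<close> is the analogue for y_i.\<close>

definition sE :: "nat \<Rightarrow> complex \<Rightarrow> nat \<Rightarrow> lop fps" where
  "sE N k i = (SOME y. y \<in> ops (RP N) \<and> pser (\<lambda>j. (- k / 2) ^ j / fact j) y = TE k i)"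

definition yE :: "nat \<Rightarrow> complex \<Rightarrow> complex \<Rightarrow> nat \<Rightarrow> lop fps" where
  "yE N k u i = (SOME y. y \<in> ops (RP N) \<and> pser (\<lambda>j. 1 / fact (Suc j)) y = fps_shift 1 (YE N k u i))"

lemma sE: "i \<in> {1..<N} \<Longrightarrow> sE N k i \<in> ops (RP N) \<and> pser (\<lambda>j. (- k / 2) ^ j / fact j) (sE N k i) = TE k i"
  unfolding sE_def by (rule someI_ex)
    (use exists_pser[OF _ subalg_RP[of N] TE_RP[of i N k], of "\<lambda>j. (- k / 2) ^ j / fact j"] in auto)

lemma yE: "i \<in> {1..N} \<Longrightarrow> yE N k u i \<in> ops (RP N) \<and> pser (\<lambda>j. 1 / fact (Suc j)) (yE N k u i) = fps_shift 1 (YE N k u i)"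
  unfolding yE_def
proof (rule someI_ex)
  assume i: "i \<in> {1..N}"
  have "fps_shift 1 (YE N k u i) \<in> ops (RP N)" using YE_RP[OF i, of k u] by (simp add: ops_def)
  from exists_pser[OF _ subalg_RP[of N] this, of "\<lambda>j. 1 / fact (Suc j)"]
  show "\<exists>y. y \<in> ops (RP N) \<and> pser (\<lambda>j. 1 / fact (Suc j)) y = fps_shift 1 (YE N k u i)" by auto
qed

definition gE :: "nat \<Rightarrow> complex \<Rightarrow> complex \<Rightarrow> gen \<Rightarrow> lop fps" where
  "gE N k u g = (case g of GS i \<Rightarrow> sE N k i | GX i \<Rightarrow> opX i | GXinv i \<Rightarrow> opXi i | GY i \<Rightarrow> yE N k u i)"

abbreviation repE :: "nat \<Rightarrow> complex \<Rightarrow> complex \<Rightarrow> free_elt \<Rightarrow> lop fps" where "repE N k u \<equiv> rep (gE N k u)"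

lemma gE_RV: "g \<in> gens N \<Longrightarrow> gE N k u g \<in> ops (RV N)"
  using sE yE by (auto simp: gens_def gE_def opX_RP[THEN ops_RP_RV, simplified] opXi_RV[simplified] ops_RP_RV)

lemma gE_RP: "g \<in> gens N \<Longrightarrow> g \<notin> range GXinv \<Longrightarrow> gE N k u g \<in> ops (RP N)"
  using sE yE opX_RP by (auto simp: gens_def gE_def)

lemma repE_fT: "i \<in> {1..<N} \<Longrightarrow> repE N k u (fT k i) = TE k i"
  unfolding rep_fT gE_def gen.case using sE[of i N k] by blast
lemma repE_fY: "i \<in> {1..N} \<Longrightarrow> repE N k u (fY i) = YE N k u i"
proof -
  assume i: "i \<in> {1..N}"
  have "repE N k u (fY i) = 1 + fps_X * fps_shift 1 (YE N k u i)"
    unfolding rep_fY using yE[OF i, of k u] by (simp add: gE_def)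
  also have "\<dots> = YE N k u i" using fps_decomp[of "YE N k u i"] YE_nth_0[of N i k u] i by simp
  finally show ?thesis .
qed
lemma repE_fX: "repE N k u (fX i) = opX i" by (simp add: rep_fX gE_def)
lemma repE_fXinv: "repE N k u (fXinv i) = opXi i" by (simp add: rep_fXinv gE_def)

lemma repE_rels:
  assumes N: "1 \<le> N" and r: "r \<in> daha_rels N 1 k" shows "repE N k u r = 0"
  using r
proof cases
  case (X_Xinv i) show ?thesis unfolding X_Xinv(1) rep_diff rep_mult repE_fX repE_fXinv opX_opXi by simp
next
  case (Xinv_X i) show ?thesis unfolding Xinv_X(1) rep_diff rep_mult repE_fX repE_fXinv opX_opXi by simp
next
  case (T_quadratic i)
  let ?t = "tpar k" and ?i = "inverse (tpar k)"
  have "repE N k u r = (TE k i - scE ?t) * (TE k i + scE ?i)"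
    using T_quadratic by (simp add: rep_diff rep_add rep_mult repE_fT)
  also have "\<dots> = TE k i * TE k i + scE ?i * TE k i - scE ?t * TE k i - scE (?t * ?i)"
    by (simp add: distrib_left left_diff_distrib scE_mult scE_central[of ?i] algebra_simps)
  also have "\<dots> = 0" unfolding TE_quadratic tpar_inverse by (simp add: cpar_def scE_diff left_diff_distrib)
  finally show ?thesis .
next
  case (T_braid i) then show ?thesis by (simp add: rep_diff rep_mult repE_fT TE_braid[simplified])
next
  case (T_T i j) then show ?thesis using aff.T_T[of i N j k] by (simp add: rep_diff rep_mult repE_fT)
next
  case (T_X_T i) then show ?thesis by (simp add: rep_diff rep_mult repE_fT repE_fX TE_X_T[simplified])
next
  case (T_X i j) then show ?thesis using TE_X3[of j i k] by (simp add: rep_diff rep_mult repE_fT repE_fX)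
next
  case (T_Y_T i) then show ?thesis using YE_rec[of i N k u] by (simp add: rep_diff rep_mult repE_fT repE_fY)
next
  case (T_Y i j) then show ?thesis using YE_T[of i N j k u] by (simp add: rep_diff rep_mult repE_fT repE_fY)
next
  case X_Y_T
  \<comment> \<open>There is no explicit operator for Y_2^-1; all that is needed is that the series
    for e^(-\<epsilon>y_2) evaluates to a left inverse.\<close>
  have "repE N k u (fYinv 2 * fY 2) = 1" by (simp add: fY_fYinv)
  then have i: "repE N k u (fYinv 2) * YE N k u 2 = 1" using X_Y_T by (simp add: rep_mult repE_fY)
  have "opXi 1 * (repE N k u (fYinv 2) * (opX 1 * YE N k u 2)) = TE k 1 * TE k 1"
    unfolding X_YE[OF X_Y_T(2)] mult.assoc[symmetric, of "repE N k u (fYinv 2)"] i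
    by (simp only: mult.assoc[symmetric] opX_opXi mult_1_left mult_1_right)
  then show ?thesis using X_Y_T by (simp add: rep_diff rep_mult repE_fT repE_fY repE_fX repE_fXinv mult.assoc)
next
  case (Y_Xtilde i)
  have "repE N k u (fXtilde N) = prod_list (map opX [1..<Suc N])"
    unfolding fXtilde_def rep_prod_list by (simp add: repE_fX comp_def del: upt_Suc)
  then show ?thesis using Y_Xtilde YE_prod_X[OF N, of i k u]
    by (simp add: rep_diff rep_mult repE_fY mult.assoc del: upt_Suc)
next
  case (X_Ytilde i)
  have "repE N k u (fYtilde N) = prod_list (map (YE N k u) [1..<Suc N])"
    unfolding fYtilde_def rep_prod_list map_map
    by (rule arg_cong[of _ _ prod_list]) (auto simp: repE_fY simp del: upt_Suc)
  then show ?thesis using X_Ytilde X_prod_YE[OF N, of i k u]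
    by (simp add: rep_diff rep_mult repE_fX mult.assoc del: upt_Suc)
next
  case (X_X i j) then show ?thesis using opX_commute[of i j] by (simp add: rep_diff rep_mult repE_fX)
next
  case (Y_Y i j) then show ?thesis using YE_commute[of i N j k u] by (simp add: rep_diff rep_mult repE_fY)
qed

section \<open>The quotient algebra and the uniqueness of its polynomial representation\<close>

section \<open>The free algebra as a ring with carrier\<close>

definition okp :: "nat \<Rightarrow> (gen free_monoid \<Rightarrow>\<^sub>0 complex) set" where
  "okp N = {p. \<forall>w\<in>Poly_Mapping.keys p. set (letters w) \<subseteq> gens N}"

abbreviation FF :: "nat \<Rightarrow> free_elt set" where "FF N \<equiv> ops (okp N)"

lemma free_alg_simps [simp]:
  "carrier (free_alg N) = FF N" "mult (free_alg N) = (*)" "one (free_alg N) = 1"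
  "zero (free_alg N) = 0" "add (free_alg N) = (+)"
  by (simp_all add: free_alg_def okp_def ops_def)

lemma okp_zero: "0 \<in> okp N" by (simp add: okp_def)
lemma okp_add: "p \<in> okp N \<Longrightarrow> q \<in> okp N \<Longrightarrow> p + q \<in> okp N"
  using Poly_Mapping.keys_add[of p q] by (auto simp: okp_def)
lemma okp_single: "set (letters w) \<subseteq> gens N \<Longrightarrow> Poly_Mapping.single w c \<in> okp N"
  by (simp add: okp_def)
lemma okp_scalar: "Poly_Mapping.single 0 c \<in> okp N"
  by (rule okp_single) (simp add: zero_free_monoid_def)
lemma okp_one: "1 \<in> okp N" using okp_scalar[of 1] by simp
lemma okp_mult: "p \<in> okp N \<Longrightarrow> q \<in> okp N \<Longrightarrow> p * q \<in> okp N"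
  using keys_mult[of p q] by (fastforce simp: okp_def plus_free_monoid_def)
lemma okp_minus: "p \<in> okp N \<Longrightarrow> - p \<in> okp N"
  using okp_mult[OF okp_scalar[of "-1"], of p N] by (simp add: single_uminus)
lemma okp_diff: "p \<in> okp N \<Longrightarrow> q \<in> okp N \<Longrightarrow> p - q \<in> okp N"
  using okp_add[OF _ okp_minus] by fastforce
lemma okp_letter: "g \<in> gens N \<Longrightarrow> letter g \<in> okp N"
  unfolding letter_def by (rule okp_single) simp
lemma okp_power: "p \<in> okp N \<Longrightarrow> p ^ n \<in> okp N"
  by (induction n) (auto intro: okp_one okp_mult)
lemma okp_sum: "(\<And>x. x \<in> S \<Longrightarrow> f x \<in> okp N) \<Longrightarrow> sum f S \<in> okp N"
  by (induction S rule: infinite_finite_induct) (auto intro: okp_zero okp_add)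

lemma FF_add: "f \<in> FF N \<Longrightarrow> g \<in> FF N \<Longrightarrow> f + g \<in> FF N" by (simp add: ops_def okp_add)
lemma FF_diff: "f \<in> FF N \<Longrightarrow> g \<in> FF N \<Longrightarrow> f - g \<in> FF N" by (simp add: ops_def okp_diff)
lemma FF_minus: "f \<in> FF N \<Longrightarrow> - f \<in> FF N" by (simp add: ops_def okp_minus)
lemma FF_mult: "f \<in> FF N \<Longrightarrow> g \<in> FF N \<Longrightarrow> f * g \<in> FF N"
  by (auto simp: ops_def fps_mult_nth intro!: okp_sum okp_mult)
lemma FF_const: "p \<in> okp N \<Longrightarrow> fps_const p \<in> FF N" by (simp add: ops_def okp_zero)
lemma FF_scal: "scal c \<in> FF N" by (simp add: ops_def okp_scalar)
lemma FF_zero: "0 \<in> FF N" by (simp add: ops_def okp_zero)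
lemma FF_one: "1 \<in> FF N" using FF_scal[of 1] by simp
lemma FF_X: "fps_X \<in> FF N" using FF_scal[of fps_X] by simp
lemma FF_Xpow: "fps_X ^ n \<in> FF N" by (induction n) (auto intro: FF_one FF_mult FF_X)
lemma FF_shift: "f \<in> FF N \<Longrightarrow> fps_shift n f \<in> FF N" by (simp add: ops_def)
lemma FF_prod_list: "(\<And>x. x \<in> set xs \<Longrightarrow> x \<in> FF N) \<Longrightarrow> prod_list xs \<in> FF N"
  by (induction xs) (auto intro: FF_one FF_mult)
lemma FF_eexp: "p \<in> okp N \<Longrightarrow> eexp c p \<in> FF N"
  by (auto simp: ops_def eexp_def intro!: okp_mult okp_scalar okp_power)

lemma gens_simps [simp]:
  "GS i \<in> gens N \<longleftrightarrow> i \<in> {1..<N}" "GX i \<in> gens N \<longleftrightarrow> i \<in> {1..N}"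
  "GXinv i \<in> gens N \<longleftrightarrow> i \<in> {1..N}" "GY i \<in> gens N \<longleftrightarrow> i \<in> {1..N}"
  by (auto simp: gens_def)

lemma FF_fX: "i \<in> {1..N} \<Longrightarrow> fX i \<in> FF N" unfolding fX_def by (intro FF_const okp_letter) simp
lemma FF_fXinv: "i \<in> {1..N} \<Longrightarrow> fXinv i \<in> FF N" unfolding fXinv_def by (intro FF_const okp_letter) simp
lemma FF_fy: "i \<in> {1..N} \<Longrightarrow> fy i \<in> FF N" unfolding fy_def by (intro FF_const okp_letter) simp
lemma FF_fY: "i \<in> {1..N} \<Longrightarrow> fY i \<in> FF N" unfolding fY_def by (intro FF_eexp okp_letter) simp
lemma FF_fYinv: "i \<in> {1..N} \<Longrightarrow> fYinv i \<in> FF N" unfolding fYinv_def by (intro FF_eexp okp_letter) simp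
lemma FF_fT: "i \<in> {1..<N} \<Longrightarrow> fT k i \<in> FF N"
  unfolding fT_def by (intro FF_mult FF_const FF_eexp okp_letter) simp_all

lemmas FF_intros = FF_add FF_diff FF_minus FF_mult FF_scal FF_zero FF_one FF_X FF_Xpow FF_fX FF_fXinv FF_fy FF_fY FF_fYinv FF_fT

lemma daha_rels_FF: "daha_rels N h k \<subseteq> FF N"
proof
  fix r assume "r \<in> daha_rels N h k"
  then show "r \<in> FF N"
  proof cases
    case (Y_Xtilde i)
    moreover have "fXtilde N \<in> FF N" unfolding fXtilde_def by (rule FF_prod_list) (auto intro!: FF_fX)
    ultimately show ?thesis by (auto intro!: FF_intros)
  next
    case (X_Ytilde i)
    moreover have "fYtilde N \<in> FF N" unfolding fYtilde_def by (rule FF_prod_list) (auto intro!: FF_fY)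
    ultimately show ?thesis by (auto intro!: FF_intros)
  qed (auto intro!: FF_intros)
qed

lemma free_alg_ring: "ring (free_alg N)"
proof (rule ringI)
  show "abelian_group (free_alg N)"
  proof (rule abelian_groupI)
    fix x assume "x \<in> carrier (free_alg N)"
    then show "\<exists>y\<in>carrier (free_alg N). y \<oplus>\<^bsub>free_alg N\<^esub> x = \<zero>\<^bsub>free_alg N\<^esub>"
      by (intro bexI[of _ "- x"]) (auto intro: FF_minus)
  qed (auto intro: FF_add FF_zero)
  show "monoid (free_alg N)" by (rule monoidI) (auto intro: FF_mult FF_one simp: mult.assoc)
qed (simp_all add: distrib_left distrib_right)

lemma free_alg_nat_pow: "f [^]\<^bsub>free_alg N\<^esub> (n::nat) = f ^ n"
  by (induction n) (simp_all add: nat_pow_def power_commutes)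

lemma free_alg_minus: "f \<in> FF N \<Longrightarrow> g \<in> FF N \<Longrightarrow> f \<ominus>\<^bsub>free_alg N\<^esub> g = f - g"
proof -
  assume f: "f \<in> FF N" and g: "g \<in> FF N"
  interpret ring "free_alg N" by (rule free_alg_ring)
  have "\<ominus>\<^bsub>free_alg N\<^esub> g = - g" by (rule minus_equality) (use g FF_minus in auto)
  then show ?thesis by (simp add: a_minus_def)
qed

lemma idealI':
  assumes "I \<subseteq> FF N" "0 \<in> I" "\<And>a b. a \<in> I \<Longrightarrow> b \<in> I \<Longrightarrow> a + b \<in> I"
    "\<And>a x. a \<in> I \<Longrightarrow> x \<in> FF N \<Longrightarrow> x * a \<in> I" "\<And>a x. a \<in> I \<Longrightarrow> x \<in> FF N \<Longrightarrow> a * x \<in> I"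
  shows "ideal I (free_alg N)"
proof (rule idealI[OF free_alg_ring])
  interpret ring "free_alg N" by (rule free_alg_ring)
  have minus: "\<ominus>\<^bsub>free_alg N\<^esub> a = - a" if "a \<in> I" for a
    by (rule minus_equality) (use that assms(1) FF_minus in auto)
  have neg: "- a \<in> I" if "a \<in> I" for a using assms(4)[OF that FF_minus[OF FF_one]] by simp
  show "subgroup I (add_monoid (free_alg N))"
    by (rule add.subgroupI) (use assms minus neg in \<open>auto simp: a_inv_def[symmetric]\<close>)
qed (use assms in auto)

text \<open>The family of ideals whose intersection defines the DAHA, as a predicate. Two members
  matter: the whole free algebra, which makes the family nonempty, and the kernel of a
  representation.\<close>

definition daha_idealish :: "nat \<Rightarrow> complex \<Rightarrow> free_elt set \<Rightarrow> bool" where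
  "daha_idealish N k J \<longleftrightarrow> ideal J (free_alg N) \<and> adic_closed (free_alg N) fps_X J \<and>
    (\<forall>a\<in>carrier (free_alg N). fps_X * a \<in> J \<longrightarrow> a \<in> J) \<and> daha_rels N 1 k \<subseteq> J"

abbreviation JJ :: "nat \<Rightarrow> complex \<Rightarrow> free_elt set" where "JJ N k \<equiv> daha_ideal N 1 k"
abbreviation HH :: "nat \<Rightarrow> complex \<Rightarrow> free_elt set ring" where "HH N k \<equiv> formal_daha N 1 k"
abbreviation cl :: "nat \<Rightarrow> complex \<Rightarrow> free_elt \<Rightarrow> free_elt set" where "cl N k \<equiv> cls N 1 k"

lemma JJ_eq: "JJ N k = \<Inter> {J. daha_idealish N k J}" by (simp add: daha_ideal_def daha_idealish_def)

lemma daha_idealish_carrier: "daha_idealish N k (FF N)"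
  unfolding daha_idealish_def
  using idealI'[of "FF N" N] daha_rels_FF[of N 1 k]
  by (auto simp: adic_closed_def intro: FF_intros)

lemma JJ_ideal: "ideal (JJ N k) (free_alg N)"
  unfolding JJ_eq by (rule ring.i_Intersect[OF free_alg_ring])
    (use daha_idealish_carrier[of N k] in \<open>auto simp: daha_idealish_def\<close>)

lemma JJ_rels: "daha_rels N 1 k \<subseteq> JJ N k" unfolding JJ_eq by (auto simp: daha_idealish_def)
lemma JJ_saturated: "a \<in> FF N \<Longrightarrow> fps_X * a \<in> JJ N k \<Longrightarrow> a \<in> JJ N k"
  unfolding JJ_eq by (auto simp: daha_idealish_def)
lemma JJ_FF: "a \<in> JJ N k \<Longrightarrow> a \<in> FF N"
  unfolding JJ_eq using daha_idealish_carrier by blast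
lemma JJ_zero: "0 \<in> JJ N k"
  using additive_subgroup.zero_closed[OF ideal.axioms(1)[OF JJ_ideal[of N k]]] by simp
lemma JJ_add: "a \<in> JJ N k \<Longrightarrow> b \<in> JJ N k \<Longrightarrow> a + b \<in> JJ N k"
  using additive_subgroup.a_closed[OF ideal.axioms(1)[OF JJ_ideal[of N k]]] by simp
lemma JJ_left: "a \<in> JJ N k \<Longrightarrow> x \<in> FF N \<Longrightarrow> x * a \<in> JJ N k"
  using ideal.I_l_closed[OF JJ_ideal[of N k]] by simp
lemma JJ_right: "a \<in> JJ N k \<Longrightarrow> x \<in> FF N \<Longrightarrow> a * x \<in> JJ N k"
  using ideal.I_r_closed[OF JJ_ideal[of N k]] by simp
lemma JJ_minus: "a \<in> JJ N k \<Longrightarrow> - a \<in> JJ N k"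
  using JJ_left[OF _ FF_minus[OF FF_one]] by fastforce
lemma JJ_diff: "a \<in> JJ N k \<Longrightarrow> b \<in> JJ N k \<Longrightarrow> a - b \<in> JJ N k"
  using JJ_add[OF _ JJ_minus] by fastforce

lemma HH_ring: "ring (HH N k)"
  unfolding formal_daha_def by (rule ideal.quotient_is_ring[OF JJ_ideal])

lemma HH_carrier: "carrier (HH N k) = cl N k ` FF N"
  by (auto simp: formal_daha_def FactRing_def A_RCOSETS_def' cls_def)

lemma cl_hom: "cl N k \<in> ring_hom (free_alg N) (HH N k)"
proof -
  have "cl N k = (+>\<^bsub>free_alg N\<^esub>) (JJ N k)" by (simp add: fun_eq_iff cls_def)
  then show ?thesis using ideal.rcos_ring_hom[OF JJ_ideal[of N k]] by (simp add: formal_daha_def)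
qed

lemma cl_mult: "f \<in> FF N \<Longrightarrow> g \<in> FF N \<Longrightarrow> cl N k f \<otimes>\<^bsub>HH N k\<^esub> cl N k g = cl N k (f * g)"
  using ring_hom_mult[OF cl_hom] by fastforce
lemma cl_add: "f \<in> FF N \<Longrightarrow> g \<in> FF N \<Longrightarrow> cl N k f \<oplus>\<^bsub>HH N k\<^esub> cl N k g = cl N k (f + g)"
  using ring_hom_add[OF cl_hom] by fastforce
lemma cl_one: "\<one>\<^bsub>HH N k\<^esub> = cl N k 1"
  using ring_hom_one[OF cl_hom] by fastforce
lemma cl_eq_iff: "f \<in> FF N \<Longrightarrow> g \<in> FF N \<Longrightarrow> cl N k f = cl N k g \<longleftrightarrow> f - g \<in> JJ N k"
  using ring.quotient_eq_iff_same_a_r_cos[OF free_alg_ring JJ_ideal, of f N g k]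
  by (simp add: free_alg_minus cls_def)
lemma cl_carrier: "f \<in> FF N \<Longrightarrow> cl N k f \<in> carrier (HH N k)" by (simp add: HH_carrier)
lemma cl_zero: "\<zero>\<^bsub>HH N k\<^esub> = cl N k 0"
proof -
  interpret ring "HH N k" by (rule HH_ring)
  have "cl N k 0 \<oplus>\<^bsub>HH N k\<^esub> cl N k 0 = cl N k 0" by (simp add: cl_add FF_zero)
  then show ?thesis using cl_carrier[OF FF_zero] by (metis add.l_cancel_one' zero_closed l_zero)
qed
lemma cl_pow: "f \<in> FF N \<Longrightarrow> cl N k f [^]\<^bsub>HH N k\<^esub> (n::nat) = cl N k (f ^ n)"
proof (induction n)
  case 0 then show ?case by (simp add: nat_pow_def cl_one)
next
  case (Suc n)
  have "f ^ n \<in> FF N" using Suc.prems by (induction n) (auto intro: FF_intros)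
  then show ?case using Suc by (simp add: nat_pow_def cl_mult power_commutes)
qed
lemma cl_uminus: "f \<in> FF N \<Longrightarrow> \<ominus>\<^bsub>HH N k\<^esub> cl N k f = cl N k (- f)"
proof -
  assume f: "f \<in> FF N"
  interpret ring "HH N k" by (rule HH_ring)
  show ?thesis by (rule minus_equality) (simp_all add: cl_add cl_zero cl_carrier f FF_minus)
qed

section \<open>The polynomial representation\<close>

definition ker_rep :: "nat \<Rightarrow> complex \<Rightarrow> complex \<Rightarrow> free_elt set" where
  "ker_rep N k u = {f\<in>FF N. repE N k u f = 0}"

lemma rep_Xpow: "rep G (fps_X ^ n * f) = fps_X ^ n * rep G f"
  by (induction n arbitrary: f) (simp_all add: mult.assoc rep_X)

text \<open>Formal operators form an \<epsilon>-torsion-free and separated ring, so the kernel of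
  evaluation is saturated and closed. Hence it contains the defining ideal, and the evaluation
  descends to the DAHA.\<close>

lemma daha_idealish_ker: "1 \<le> N \<Longrightarrow> daha_idealish N k (ker_rep N k u)"
  unfolding daha_idealish_def
proof (intro conjI ballI impI)
  assume N: "1 \<le> N"
  show "ideal (ker_rep N k u) (free_alg N)"
    by (rule idealI') (auto simp: ker_rep_def rep_add rep_mult intro: FF_intros)
  show "daha_rels N 1 k \<subseteq> ker_rep N k u"
    using repE_rels[OF N] daha_rels_FF[of N 1 k] by (auto simp: ker_rep_def)
  show "a \<in> ker_rep N k u" if "a \<in> carrier (free_alg N)" "fps_X * a \<in> ker_rep N k u" for a
  proof -
    have "fps_X * repE N k u a = 0" using that(2) by (simp add: ker_rep_def rep_X)
    then have "fps_nth (fps_X * repE N k u a) (Suc n) = 0" for n by simp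
    then have "repE N k u a = 0" by (simp add: fps_eq_iff)
    then show ?thesis using that(1) by (simp add: ker_rep_def)
  qed
  show "adic_closed (free_alg N) fps_X (ker_rep N k u)"
    unfolding adic_closed_def
  proof (intro ballI impI)
    fix a assume a: "a \<in> carrier (free_alg N)"
      and *: "\<forall>n::nat. \<exists>s\<in>ker_rep N k u. \<exists>r\<in>carrier (free_alg N).
        a = s \<oplus>\<^bsub>free_alg N\<^esub> (fps_X [^]\<^bsub>free_alg N\<^esub> n) \<otimes>\<^bsub>free_alg N\<^esub> r"
    have "fps_nth (repE N k u a) n = 0" for n
    proof -
      obtain s r where "s \<in> ker_rep N k u" "a = s + fps_X ^ Suc n * r"
        using *[rule_format, of "Suc n"] unfolding free_alg_nat_pow free_alg_simps by blast
      then have "repE N k u a = fps_X ^ Suc n * repE N k u r"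
        by (simp add: ker_rep_def rep_add rep_Xpow del: power_Suc)
      then show ?thesis by (simp add: fps_X_power_mult_nth del: power_Suc)
    qed
    then show "a \<in> ker_rep N k u" using a by (simp add: ker_rep_def fps_eq_iff)
  qed
qed

lemma rep_JJ: "1 \<le> N \<Longrightarrow> f \<in> JJ N k \<Longrightarrow> repE N k u f = 0"
proof -
  assume "1 \<le> N" "f \<in> JJ N k"
  then have "f \<in> ker_rep N k u" using daha_idealish_ker[of N k u] unfolding JJ_eq by blast
  then show ?thesis by (simp add: ker_rep_def)
qed

definition poly_act :: "nat \<Rightarrow> complex \<Rightarrow> complex \<Rightarrow> free_elt set \<Rightarrow> laurent \<Rightarrow> laurent" where
  "poly_act N k u = (\<lambda>a\<in>carrier (HH N k). \<lambda>g\<in>PP N. act (repE N k u (SOME f. f \<in> FF N \<and> a = cl N k f)) g)"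

lemma poly_act_cl: "1 \<le> N \<Longrightarrow> f \<in> FF N \<Longrightarrow> poly_act N k u (cl N k f) = (\<lambda>g\<in>PP N. act (repE N k u f) g)"
proof -
  assume N: "1 \<le> N" and f: "f \<in> FF N"
  define f' where "f' = (SOME f'. f' \<in> FF N \<and> cl N k f = cl N k f')"
  have f': "f' \<in> FF N \<and> cl N k f = cl N k f'" unfolding f'_def by (rule someI[of _ f]) (simp add: f)
  then have "f - f' \<in> JJ N k" using f cl_eq_iff by blast
  then have "repE N k u f = repE N k u f'" using rep_JJ[OF N] by (metis rep_diff eq_iff_diff_eq_0)
  then show ?thesis using cl_carrier[OF f] by (simp add: poly_act_def f'_def[symmetric])
qed

lemma repE_RV: "f \<in> FF N \<Longrightarrow> repE N k u f \<in> ops (RV N)"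
  by (rule rep_ops[OF subalg_presv]) (auto intro: gE_RV)

lemma scal_PP: "f \<in> PP N \<Longrightarrow> scal c * f \<in> PP N"
  using act_PP[OF ops_scE[OF subalg_presv, of c]] by (simp add: act_scE)
lemma PP_add: "f \<in> PP N \<Longrightarrow> g \<in> PP N \<Longrightarrow> f + g \<in> PP N"
  using Poly_Mapping.keys_add unfolding PP_eq by fastforce
lemma PP_diff: "f \<in> PP N \<Longrightarrow> g \<in> PP N \<Longrightarrow> f - g \<in> PP N"
  using keys_diff unfolding PP_eq by fastforce

lemma is_poly_rep_poly_act: "1 \<le> N \<Longrightarrow> is_poly_rep N 1 k u (poly_act N k u)"
  unfolding is_poly_rep_def
proof (intro conjI ballI allI)
  assume N: "1 \<le> N"
  note pa = poly_act_cl[OF N]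
  show "poly_act N k u \<in> extensional (carrier (HH N k))" by (simp add: poly_act_def)
  show "poly_act N k u \<in> ring_hom (HH N k) (End_PP N)"
  proof (rule ring_hom_memI)
    fix a assume "a \<in> carrier (HH N k)"
    then obtain f where f: "f \<in> FF N" "a = cl N k f" by (auto simp: HH_carrier)
    show "poly_act N k u a \<in> carrier (End_PP N)"
      unfolding f(2) pa[OF f(1)] End_PP_def
      using act_PP[OF repE_RV[OF f(1)]] by (simp add: PP_add scal_PP act_add act_scal)
  next
    fix a b assume "a \<in> carrier (HH N k)" "b \<in> carrier (HH N k)"
    then obtain f g where f: "f \<in> FF N" "a = cl N k f" and g: "g \<in> FF N" "b = cl N k g" by (auto simp: HH_carrier)
    show "poly_act N k u (a \<otimes>\<^bsub>HH N k\<^esub> b) = poly_act N k u a \<otimes>\<^bsub>End_PP N\<^esub> poly_act N k u b"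
      unfolding f(2) g(2) cl_mult[OF f(1) g(1)] pa[OF f(1)] pa[OF g(1)] pa[OF FF_mult[OF f(1) g(1)]]
      using act_PP[OF repE_RV[OF g(1)]]
      by (auto simp: End_PP_def compose_def rep_mult act_mult fun_eq_iff restrict_def)
    show "poly_act N k u (a \<oplus>\<^bsub>HH N k\<^esub> b) = poly_act N k u a \<oplus>\<^bsub>End_PP N\<^esub> poly_act N k u b"
      unfolding f(2) g(2) cl_add[OF f(1) g(1)] pa[OF f(1)] pa[OF g(1)] pa[OF FF_add[OF f(1) g(1)]]
      by (auto simp: End_PP_def rep_add act_add_left fun_eq_iff restrict_def)
  next
    show "poly_act N k u \<one>\<^bsub>HH N k\<^esub> = \<one>\<^bsub>End_PP N\<^esub>"
      unfolding cl_one pa[OF FF_one] by (simp add: End_PP_def restrict_def cong: if_cong)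
  qed
  show "poly_act N k u (cl N k (scal c)) f = scal c * f" if "f \<in> PP N" for c f
    using that by (simp add: pa FF_scal act_scE)
  show "poly_act N k u (cl N k (fX i)) f = X_op i f" if "i \<in> {1..N}" "f \<in> PP N" for i f
    using that by (simp add: pa FF_fX repE_fX X_op_def act_opX_mono[simplified])
  show "poly_act N k u (cl N k (fT k i)) f = T_op k i f" if "i \<in> {1..<N}" "f \<in> PP N" for i f
    using that by (simp add: pa FF_fT repE_fT T_op_eq)
  show "poly_act N k u (cl N k (fY i)) f = Y_op N 1 k u i f" if "i \<in> {1..N}" "f \<in> PP N" for i f
    using that by (simp add: pa FF_fY repE_fY Y_op_eq)
qed

text \<open>As \<open>poly_rep\<close> is given by \<open>THE\<close>, an arbitrary action with the
  prescribed operators has to be compared with the explicit one. \<open>Ag n f\<close> records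
  agreement modulo \<epsilon>^n; continuity is replaced by proving this for every n.\<close>

locale daha_action =
  fixes N :: nat and k u :: complex and \<rho>
  assumes N: "1 \<le> N" and rep: "is_poly_rep N 1 k u \<rho>"
begin

definition \<phi> where "\<phi> f = \<rho> (cl N k f)"
definition Ag where "Ag n f \<longleftrightarrow> (\<forall>g\<in>PP N. eq_upto n (\<phi> f g) (act (repE N k u f) g))"

lemma hom: "\<rho> \<in> ring_hom (HH N k) (End_PP N)" using rep by (simp add: is_poly_rep_def)

lemma phi_End: "f \<in> FF N \<Longrightarrow> \<phi> f \<in> carrier (End_PP N)"
  unfolding \<phi>_def by (rule ring_hom_closed[OF hom cl_carrier])
lemma phi_PP: "f \<in> FF N \<Longrightarrow> g \<in> PP N \<Longrightarrow> \<phi> f g \<in> PP N"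
  using phi_End[of f] by (auto simp: End_PP_def)
lemma phi_arg_add: "f \<in> FF N \<Longrightarrow> g \<in> PP N \<Longrightarrow> h \<in> PP N \<Longrightarrow> \<phi> f (g + h) = \<phi> f g + \<phi> f h"
  using phi_End[of f] by (auto simp: End_PP_def)
lemma phi_arg_scal: "f \<in> FF N \<Longrightarrow> g \<in> PP N \<Longrightarrow> \<phi> f (scal c * g) = scal c * \<phi> f g"
  using phi_End[of f] by (auto simp: End_PP_def)
lemma phi_mult: "f \<in> FF N \<Longrightarrow> f' \<in> FF N \<Longrightarrow> g \<in> PP N \<Longrightarrow> \<phi> (f * f') g = \<phi> f (\<phi> f' g)"
  using ring_hom_mult[OF hom cl_carrier cl_carrier, of f f']
  by (simp add: \<phi>_def cl_mult End_PP_def compose_def)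
lemma phi_add: "f \<in> FF N \<Longrightarrow> f' \<in> FF N \<Longrightarrow> g \<in> PP N \<Longrightarrow> \<phi> (f + f') g = \<phi> f g + \<phi> f' g"
  using ring_hom_add[OF hom cl_carrier cl_carrier, of f f']
  by (simp add: \<phi>_def cl_add End_PP_def)
lemma phi_scal: "g \<in> PP N \<Longrightarrow> \<phi> (scal c) g = scal c * g"
  using rep by (simp add: is_poly_rep_def \<phi>_def)

lemma Ag_scal: "Ag n (scal c)" by (simp add: Ag_def phi_scal act_scE)
lemma Ag_add: "f \<in> FF N \<Longrightarrow> f' \<in> FF N \<Longrightarrow> Ag n f \<Longrightarrow> Ag n f' \<Longrightarrow> Ag n (f + f')"
  by (auto simp: Ag_def phi_add rep_add act_add_left eq_upto_def)

lemma eq_uptoE: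
  assumes "eq_upto n a b" "a \<in> PP N" "b \<in> PP N"
  obtains x where "x \<in> PP N" "a = b + scal (fps_X ^ n) * x"
proof
  have e: "(scal (fps_X ^ n) :: laurent) = fps_X ^ n"
    by (rule fps_ext) (simp add: fps_X_power_nth)
  show "fps_shift n (a - b) \<in> PP N" using PP_diff[OF assms(2,3)] by (simp add: PP_def)
  show "a = b + scal (fps_X ^ n) * fps_shift n (a - b)"
    unfolding e by (rule fps_ext) (use assms(1) in \<open>auto simp: fps_X_power_mult_nth eq_upto_def\<close>)
qed

lemma eq_upto_Xpow: "eq_upto n (a + scal (fps_X ^ n) * x) (a :: laurent)"
proof -
  have e: "(scal (fps_X ^ n) :: laurent) = fps_X ^ n"
    by (rule fps_ext) (simp add: fps_X_power_nth)
  show ?thesis unfolding e by (simp add: eq_upto_def fps_X_power_mult_nth)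
qed

text \<open>Agreement for \<open>f'\<close> is rewritten as an equation with remainder \<epsilon>^n
  x; linearity over power series carries this remainder through the action of
  \<open>f\<close>.\<close>

lemma Ag_mult: "f \<in> FF N \<Longrightarrow> f' \<in> FF N \<Longrightarrow> Ag n f \<Longrightarrow> Ag n f' \<Longrightarrow> Ag n (f * f')"
  unfolding Ag_def
proof
  fix g assume f: "f \<in> FF N" "f' \<in> FF N"
    and A: "\<forall>g\<in>PP N. eq_upto n (\<phi> f g) (act (repE N k u f) g)" "\<forall>g\<in>PP N. eq_upto n (\<phi> f' g) (act (repE N k u f') g)"
    and g: "g \<in> PP N"
  have P: "act (repE N k u f') g \<in> PP N" by (rule act_PP[OF repE_RV[OF f(2)] g])
  obtain x where x: "x \<in> PP N" "\<phi> f' g = act (repE N k u f') g + scal (fps_X ^ n) * x"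
    using A(2) g phi_PP[OF f(2) g] P eq_uptoE by metis
  have "\<phi> (f * f') g = \<phi> f (act (repE N k u f') g) + scal (fps_X ^ n) * \<phi> f x"
    using f g P x by (simp add: phi_mult phi_arg_add phi_arg_scal scal_PP)
  then have "eq_upto n (\<phi> (f * f') g) (\<phi> f (act (repE N k u f') g))" by (simp only: eq_upto_Xpow)
  then show "eq_upto n (\<phi> (f * f') g) (act (repE N k u (f * f')) g)"
    unfolding rep_mult act_mult using A(1) P eq_upto_trans by blast
qed

lemma Ag_X: "f \<in> FF N \<Longrightarrow> Ag n f \<Longrightarrow> Ag (Suc n) (fps_X * f)"
  unfolding Ag_def
proof
  fix g assume f: "f \<in> FF N" "\<forall>g\<in>PP N. eq_upto n (\<phi> f g) (act (repE N k u f) g)" and g: "g \<in> PP N"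
  have "\<phi> (fps_X * f) g = fps_X * \<phi> f g"
    using phi_mult[OF FF_X f(1) g] phi_scal[OF phi_PP[OF f(1) g], of fps_X] by simp
  then show "eq_upto (Suc n) (\<phi> (fps_X * f) g) (act (repE N k u (fps_X * f)) g)"
    using f(2) g by (auto simp: rep_X act_X_left eq_upto_def)
qed

lemma Ag_X_cancel: "f \<in> FF N \<Longrightarrow> Ag (Suc n) (fps_X * f) \<Longrightarrow> Ag n f"
  unfolding Ag_def
proof
  fix g assume f: "f \<in> FF N" "\<forall>g\<in>PP N. eq_upto (Suc n) (\<phi> (fps_X * f) g) (act (repE N k u (fps_X * f)) g)"
    and g: "g \<in> PP N"
  have "\<phi> (fps_X * f) g = fps_X * \<phi> f g"
    using phi_mult[OF FF_X f(1) g] phi_scal[OF phi_PP[OF f(1) g], of fps_X] by simp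
  then have *: "eq_upto (Suc n) (fps_X * \<phi> f g) (fps_X * act (repE N k u f) g)"
    using f(2)[rule_format, OF g] by (simp only: rep_X act_X_left)
  show "eq_upto n (\<phi> f g) (act (repE N k u f) g)"
    unfolding eq_upto_def
  proof (intro allI impI)
    fix i assume "i < n"
    then show "fps_nth (\<phi> f g) i = fps_nth (act (repE N k u f) g) i"
      using *[unfolded eq_upto_def, rule_format, of "Suc i"] by simp
  qed
qed

lemma Ag_mono: "Ag n f \<Longrightarrow> m \<le> n \<Longrightarrow> Ag m f"
  unfolding Ag_def using eq_upto_mono by blast

lemma Ag_minus: "f \<in> FF N \<Longrightarrow> Ag n f \<Longrightarrow> Ag n (- f)"
proof -
  assume "f \<in> FF N" "Ag n f"
  then have "Ag n (scal (- 1) * f)" by (intro Ag_mult FF_scal Ag_scal)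
  moreover have "scal (- 1) = - (1 :: free_elt)" by (rule fps_ext) (simp add: single_uminus)
  ultimately show ?thesis by simp
qed

text \<open>The tail of a series carries a factor \<epsilon>, which gains one order of agreement;
  this is how linearity replaces continuity.\<close>

lemma Ag_series: "f \<in> FF N \<Longrightarrow> (\<And>i. Ag n (fps_const (fps_nth f i))) \<Longrightarrow> Ag n f"
proof (induction n arbitrary: f)
  case 0 show ?case by (simp add: Ag_def eq_upto_def)
next
  case (Suc n)
  have c: "fps_const (fps_nth f 0) \<in> FF N" by (rule FF_const) (use Suc.prems(1) in \<open>simp add: ops_def\<close>)
  have s: "fps_shift 1 f \<in> FF N" by (rule FF_shift[OF Suc.prems(1)])
  have "Ag n (fps_shift 1 f)" by (rule Suc.IH[OF s]) (use Suc.prems(2) Ag_mono[of "Suc n" _ n] in simp)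
  then have "Ag (Suc n) (fps_const (fps_nth f 0) + fps_X * fps_shift 1 f)"
    using Suc.prems(2) by (intro Ag_add Ag_X c s FF_mult FF_X)
  then show ?case by (simp only: fps_decomp[symmetric])
qed

lemma Ag_const_mult: "p \<in> okp N \<Longrightarrow> q \<in> okp N \<Longrightarrow> Ag n (fps_const p) \<Longrightarrow> Ag n (fps_const q) \<Longrightarrow> Ag n (fps_const (p * q))"
  using Ag_mult[OF FF_const FF_const, of p q n] by simp
lemma Ag_const_scalar: "Ag n (fps_const (Poly_Mapping.single 0 c))"
  using Ag_scal[of n "fps_const c"] by (simp only: scal_const)

lemma Ag_const_power: "p \<in> okp N \<Longrightarrow> Ag n (fps_const p) \<Longrightarrow> Ag n (fps_const (p ^ m))"
proof (induction m)
  case 0 show ?case using Ag_const_scalar[of n 1] by simp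
next
  case (Suc m) then show ?case unfolding power_Suc by (intro Ag_const_mult okp_power)
qed

text \<open>\<open>F\<close> is p plus \<epsilon> times a series in powers of p. Agreement for p to
  order n therefore gives agreement for the correction to order n + 1, and with \<open>F\<close>
  known to all orders also for p.\<close>

lemma Ag_implicit:
  assumes p: "p \<in> okp N" and c: "c 0 = 1" and F: "F = Abs_fps (\<lambda>j. Poly_Mapping.single 0 (c j) * p ^ Suc j)"
    and A: "\<And>n. Ag n F"
  shows "Ag n (fps_const p)"
proof (induction n)
  case 0 show ?case by (simp add: Ag_def eq_upto_def)
next
  case (Suc n)
  have FF: "F \<in> FF N" unfolding F by (auto simp: ops_def intro!: okp_mult okp_scalar okp_power p simp del: power_Suc)
  have "Ag n (fps_shift 1 F)"
    by (rule Ag_series[OF FF_shift[OF FF]])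
      (simp add: F del: power_Suc fps_const_mult, intro Ag_const_mult Ag_const_scalar Ag_const_power okp_scalar okp_power p Suc)
  then have "Ag (Suc n) (F + - (fps_X * fps_shift 1 F))"
    by (intro Ag_add Ag_minus Ag_X A FF FF_shift FF_intros)
  moreover have "F = fps_const p + fps_X * fps_shift 1 F"
    using fps_decomp[of F] c by (simp add: F)
  ultimately show ?case by (metis add_diff_cancel_right' diff_conv_add_uminus)
qed

lemma Ag_letter: "g \<in> gens N \<Longrightarrow> Ag n (fps_const (letter g))"
proof (cases g)
  case (GX i)
  assume "g \<in> gens N"
  then have "\<phi> (fX i) f = act (repE N k u (fX i)) f" if "f \<in> PP N" for f
    using rep that GX by (simp add: is_poly_rep_def \<phi>_def repE_fX X_op_def act_opX_mono[simplified])
  then show ?thesis by (simp add: Ag_def GX fX_def)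
next
  case (GXinv i)
  assume "g \<in> gens N"
  then have i: "i \<in> {1..N}" using GXinv by simp
  have "\<phi> (fXinv i) f = act (repE N k u (fXinv i)) f" if f: "f \<in> PP N" for f
  proof -
    define h where "h = act (opXi i) f"
    have h: "h \<in> PP N" unfolding h_def by (rule act_PP[OF opXi_RV[OF i] f])
    have "\<phi> (fX i) h = act (opX i) h"
      using rep h i by (simp add: is_poly_rep_def \<phi>_def X_op_def act_opX_mono[simplified])
    also have "\<dots> = f" unfolding h_def by (simp only: act_mult[symmetric] opX_opXi act_one)
    finally have "\<phi> (fXinv i) f = \<phi> (fXinv i * fX i) h" using phi_mult[OF FF_fXinv[OF i] FF_fX[OF i] h] by simp
    also have "cl N k (fXinv i * fX i) = cl N k 1"
      unfolding cl_eq_iff[OF FF_mult[OF FF_fXinv[OF i] FF_fX[OF i]] FF_one]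
      using JJ_rels[of N k] daha_rels.Xinv_X[OF i, of 1 k] by blast
    then have "\<phi> (fXinv i * fX i) h = h" using phi_scal[OF h, of 1] by (simp add: \<phi>_def)
    finally show ?thesis by (simp add: h_def repE_fXinv)
  qed
  then show ?thesis by (simp add: Ag_def GXinv fXinv_def)
next
  case (GS i)
  assume g: "g \<in> gens N"
  then have i: "i \<in> {1..<N}" using GS by simp
  have A: "Ag n (fT k i)" for n
    using rep i by (simp add: Ag_def is_poly_rep_def \<phi>_def repE_fT T_op_eq)
  have "fT k i = Abs_fps (\<lambda>j. Poly_Mapping.single 0 ((- k / 2) ^ j / fact j) * letter g ^ Suc j)"
    by (rule fps_ext) (simp add: fT_def eexp_def GS scalar_single.sc_left_commute)
  from Ag_implicit[OF okp_letter[OF g] _ this A] show ?thesis by simp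
next
  case (GY i)
  assume g: "g \<in> gens N"
  then have i: "i \<in> {1..N}" using GY by simp
  define F where "F = fps_shift 1 (fY i)"
  have F: "F = Abs_fps (\<lambda>j. Poly_Mapping.single 0 (1 / fact (Suc j)) * letter g ^ Suc j)"
    by (rule fps_ext) (simp add: fY_def eexp_def GY F_def)
  have FF: "F \<in> FF N" unfolding F_def by (intro FF_shift FF_fY i)
  have "Ag n (fY i)" for n
    using rep i by (simp add: Ag_def is_poly_rep_def \<phi>_def repE_fY Y_op_eq)
  \<comment> \<open>Dividing Y_i - 1 by \<epsilon> costs one order, hence the agreement is
    established at \<open>Suc n\<close>.\<close>
  then have "Ag (Suc n) (fY i + scal (- 1))" for n by (intro Ag_add Ag_scal FF_scal FF_fY i)
  moreover have "fY i + scal (- 1) = fps_X * F"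
    unfolding F_def by (rule fps_ext) (auto simp: fY_def eexp_def single_uminus)
  ultimately have A: "Ag n F" for n using Ag_X_cancel[OF FF] by metis
  from Ag_implicit[OF okp_letter[OF g] _ F A] show ?thesis by simp
qed

lemma Ag_word: "set ws \<subseteq> gens N \<Longrightarrow> Ag n (fps_const (Poly_Mapping.single (Word ws) 1))"
proof (induction ws)
  case Nil
  then show ?case using Ag_const_scalar[of n 1] by (simp add: zero_free_monoid_def[symmetric])
next
  case (Cons g ws)
  have "Poly_Mapping.single (Word (g # ws)) 1 = letter g * Poly_Mapping.single (Word ws) 1"
    by (simp add: letter_def mult_single plus_free_monoid_def)
  then show ?case using Cons by (auto intro!: Ag_const_mult Ag_letter okp_letter okp_single)
qed

lemma Ag_const: "p \<in> okp N \<Longrightarrow> Ag n (fps_const p)"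
proof -
  assume p: "p \<in> okp N"
  have "finite S \<Longrightarrow> S \<subseteq> Poly_Mapping.keys p \<Longrightarrow>
      Ag n (fps_const (\<Sum>a\<in>S. Poly_Mapping.single a (Poly_Mapping.lookup p a)))" for S
  proof (induction S rule: finite_induct)
    case empty show ?case using Ag_const_scalar[of n 0] by simp
  next
    case (insert w S)
    let ?c = "Poly_Mapping.lookup p w"
    have w: "set (letters w) \<subseteq> gens N" using p insert.prems by (auto simp: okp_def)
    have "Poly_Mapping.single w ?c = Poly_Mapping.single 0 ?c * Poly_Mapping.single w 1" by (simp add: mult_single)
    then have "Ag n (fps_const (Poly_Mapping.single w ?c))"
      using Ag_word[of "letters w" n] w by (auto intro!: Ag_const_mult Ag_const_scalar okp_scalar okp_single)
    moreover have "(\<Sum>a\<in>S. Poly_Mapping.single a (Poly_Mapping.lookup p a)) \<in> okp N"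
      using p insert.prems by (intro okp_sum okp_single) (auto simp: okp_def)
    ultimately show ?case using insert w
      by (simp flip: fps_const_add) (intro Ag_add FF_const okp_single; simp)
  qed
  from this[OF finite_keys order_refl] show ?thesis by (simp only: poly_mapping_decomp[symmetric])
qed

lemma phi_eq: "f \<in> FF N \<Longrightarrow> g \<in> PP N \<Longrightarrow> \<phi> f g = act (repE N k u f) g"
proof (rule fps_ext)
  fix n assume f: "f \<in> FF N" and g: "g \<in> PP N"
  have "Ag (Suc n) f" by (rule Ag_series[OF f]) (rule Ag_const, use f in \<open>simp add: ops_def\<close>)
  then show "fps_nth (\<phi> f g) n = fps_nth (act (repE N k u f) g) n" using g by (simp add: Ag_def eq_upto_def)
qed

lemma rho_eq: "\<rho> = poly_act N k u"
proof
  fix a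
  show "\<rho> a = poly_act N k u a"
  proof (cases "a \<in> carrier (HH N k)")
    case True
    then obtain f where f: "f \<in> FF N" "a = cl N k f" by (auto simp: HH_carrier)
    have "\<phi> f \<in> extensional (PP N)" using phi_End[OF f(1)] by (simp add: End_PP_def PiE_def)
    then have "\<phi> f = (\<lambda>g\<in>PP N. act (repE N k u f) g)"
      using phi_eq[OF f(1)] by (auto simp: fun_eq_iff extensional_def)
    then show ?thesis by (simp add: f(2) poly_act_cl[OF N f(1)] \<phi>_def)
  next
    case False
    then show ?thesis using rep by (simp add: is_poly_rep_def poly_act_def extensional_def)
  qed
qed

end

lemma poly_rep_eq: "1 \<le> N \<Longrightarrow> poly_rep N 1 k u = poly_act N k u"
  unfolding poly_rep_def
  by (rule the_equality) (simp_all add: is_poly_rep_poly_act daha_action.rho_eq daha_action.intro)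

lemma PP_plus_PP: "f \<in> PP_plus N \<Longrightarrow> f \<in> PP N" by (simp add: PP_plus_def)

lemma preserves_plus_cl: "1 \<le> N \<Longrightarrow> f \<in> FF N \<Longrightarrow>
    preserves_plus N 1 k u (cl N k f) \<longleftrightarrow> (\<forall>g\<in>PP_plus N. act (repE N k u f) g \<in> PP_plus N)"
  by (simp add: preserves_plus_def poly_rep_eq poly_act_cl PP_plus_PP)

section \<open>Congruences between words: the algebra modulo \<epsilon> and its associated graded
  monoid\<close>

section \<open>The algebra modulo \<open>\<epsilon>\<close>\<close>

type_synonym fpoly = "gen free_monoid \<Rightarrow>\<^sub>0 complex"

text \<open>Constant terms of the defining ideal. Saturation allows division by \<epsilon>, so a
  relation without constant term contributes its first nonzero coefficient; this is how the
  degenerate (trigonometric) relations arise.\<close>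

definition J0 :: "nat \<Rightarrow> complex \<Rightarrow> fpoly set" where
  "J0 N k = (\<lambda>f. fps_nth f 0) ` JJ N k"

lemma J0_okp: "p \<in> J0 N k \<Longrightarrow> p \<in> okp N" using JJ_FF by (fastforce simp: J0_def ops_def)
lemma J0_zero: "0 \<in> J0 N k" using JJ_zero[of N k] by (force simp: J0_def)
lemma J0_add: "p \<in> J0 N k \<Longrightarrow> q \<in> J0 N k \<Longrightarrow> p + q \<in> J0 N k"
proof -
  assume "p \<in> J0 N k" "q \<in> J0 N k"
  then obtain f g where f: "f \<in> JJ N k" "p = fps_nth f 0" and g: "g \<in> JJ N k" "q = fps_nth g 0" by (auto simp: J0_def)
  have "fps_nth (f + g) 0 \<in> J0 N k" unfolding J0_def by (rule imageI[OF JJ_add[OF f(1) g(1)]])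
  then show ?thesis using f g by simp
qed
lemma J0_left: "p \<in> J0 N k \<Longrightarrow> x \<in> okp N \<Longrightarrow> x * p \<in> J0 N k"
proof -
  assume "p \<in> J0 N k" and x: "x \<in> okp N"
  then obtain f where f: "f \<in> JJ N k" "p = fps_nth f 0" by (auto simp: J0_def)
  have "fps_const x * f \<in> JJ N k" by (rule JJ_left[OF f(1) FF_const[OF x]])
  then show ?thesis unfolding J0_def f(2) by (rule rev_image_eqI) simp
qed
lemma J0_right: "p \<in> J0 N k \<Longrightarrow> x \<in> okp N \<Longrightarrow> p * x \<in> J0 N k"
proof -
  assume "p \<in> J0 N k" and x: "x \<in> okp N"
  then obtain f where f: "f \<in> JJ N k" "p = fps_nth f 0" by (auto simp: J0_def)
  have "f * fps_const x \<in> JJ N k" by (rule JJ_right[OF f(1) FF_const[OF x]])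
  then show ?thesis unfolding J0_def f(2) by (rule rev_image_eqI) simp
qed

lemma JJ_nth_0: "f \<in> JJ N k \<Longrightarrow> fps_nth f 0 \<in> J0 N k" by (simp add: J0_def)
lemma JJ_shift: "f \<in> JJ N k \<Longrightarrow> fps_nth f 0 = 0 \<Longrightarrow> fps_shift 1 f \<in> JJ N k"
  using JJ_saturated[OF FF_shift[OF JJ_FF], of f N k 1] fps_decomp[of f] by simp
lemma JJ_nth_1: "f \<in> JJ N k \<Longrightarrow> fps_nth f 0 = 0 \<Longrightarrow> fps_nth f 1 \<in> J0 N k"
  using JJ_nth_0[OF JJ_shift, of f N k] by simp
lemma JJ_nth_2: "f \<in> JJ N k \<Longrightarrow> fps_nth f 0 = 0 \<Longrightarrow> fps_nth f 1 = 0 \<Longrightarrow> fps_nth f 2 \<in> J0 N k"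
  using JJ_nth_1[OF JJ_shift, of f N k] by (simp add: numeral_2_eq_2)

lemma fps_mult_nth_1': "fps_nth (a * b) 1 = fps_nth a 0 * fps_nth b 1 + fps_nth a 1 * fps_nth b 0"
  for a b :: "'a::ring_1 fps"
  by (simp add: fps_mult_nth)
lemma fps_mult_nth_2: "fps_nth (a * b) 2 = fps_nth a 0 * fps_nth b 2 + fps_nth a 1 * fps_nth b 1 + fps_nth a 2 * fps_nth b 0"
  for a b :: "'a::ring_1 fps"
  by (simp add: fps_mult_nth numeral_2_eq_2 add.assoc)

abbreviation ls where "ls i \<equiv> letter (GS i)"
abbreviation lx where "lx i \<equiv> letter (GX i)"
abbreviation lxi where "lxi i \<equiv> letter (GXinv i)"
abbreviation ly where "ly i \<equiv> letter (GY i)"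

definition kap :: "complex \<Rightarrow> fpoly" where "kap k = Poly_Mapping.single 0 (- k / 2)"

lemma kap_central: "kap k * p = p * kap k" unfolding kap_def by (rule scalar_single.sc_central)

lemma kap_left: "p * (kap k * q) = kap k * (p * q)" unfolding kap_def by (rule scalar_single.sc_left_commute)

lemma fT_nths: "fps_nth (fT k i) 0 = ls i" "fps_nth (fT k i) 1 = kap k * (ls i * ls i)"
  by (simp_all add: fT_def eexp_def kap_def scalar_single.sc_left_commute)
lemma fY_nths: "fps_nth (fY i) 0 = 1" "fps_nth (fY i) 1 = ly i"
  by (simp_all add: fY_def eexp_def)
lemma fYinv_nths: "fps_nth (fYinv i) 0 = 1" "fps_nth (fYinv i) 1 = - ly i"
  by (simp_all add: fYinv_def eexp_def single_uminus)
lemma fX_nths: "fps_nth (fX i) 0 = lx i" "fps_nth (fX i) 1 = 0" by (simp_all add: fX_def)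
lemma fXinv_nths: "fps_nth (fXinv i) 0 = lxi i" "fps_nth (fXinv i) 1 = 0" by (simp_all add: fXinv_def)
lemma tpar_nths: "fps_nth (tpar k) 0 = 1" "fps_nth (tpar k) 1 = - k / 2"
  "fps_nth (inverse (tpar k)) 0 = 1" "fps_nth (inverse (tpar k)) 1 = k / 2"
proof -
  have "inverse (tpar k) = fps_exp (k / 2)" using fps_exp_neg[of "k / 2"] by (simp add: tpar_def fps_exp_neg)
  then show "fps_nth (tpar k) 0 = 1" "fps_nth (tpar k) 1 = - k / 2"
    "fps_nth (inverse (tpar k)) 0 = 1" "fps_nth (inverse (tpar k)) 1 = k / 2" by (simp_all add: tpar_def)
qed

lemma scal_tpar_nths: "fps_nth (scal (tpar k)) 0 = (1::fpoly)" "fps_nth (scal (tpar k)) 1 = kap k"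
  "fps_nth (scal (inverse (tpar k))) 0 = (1::fpoly)" "fps_nth (scal (inverse (tpar k))) 1 = - kap k"
  by (simp_all only: scal_nth tpar_nths single_one kap_def) (simp add: single_uminus)

lemmas nths = fT_nths fY_nths fYinv_nths fX_nths fXinv_nths scal_tpar_nths fps_mult_nth_0 fps_mult_nth_1' fps_sub_nth fps_add_nth

context
  fixes N :: nat and k :: complex
begin

abbreviation "quad i \<equiv> (fT k i - scal (tpar k)) * (fT k i + scal (inverse (tpar k)))"

lemma quad_JJ: "i \<in> {1..<N} \<Longrightarrow> quad i \<in> JJ N k"
  using JJ_rels[of N k] daha_rels.T_quadratic by blast
lemma quad_nth_0: "fps_nth (quad i) 0 = ls i * ls i - 1"
  by (simp only: nths) (simp add: algebra_simps)
lemma rel_ss: "i \<in> {1..<N} \<Longrightarrow> ls i * ls i - 1 \<in> J0 N k"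
  using JJ_nth_0[OF quad_JJ[of i]] by (simp only: quad_nth_0)

lemma rel_braid: "1 \<le> i \<Longrightarrow> i + 1 < N \<Longrightarrow> ls i * ls (i + 1) * ls i - ls (i + 1) * ls i * ls (i + 1) \<in> J0 N k"
proof -
  assume i: "1 \<le> i" "i + 1 < N"
  have "fT k i * fT k (i+1) * fT k i - fT k (i+1) * fT k i * fT k (i+1) \<in> JJ N k"
    using JJ_rels[of N k] daha_rels.T_braid[OF i] by blast
  from JJ_nth_0[OF this] show ?thesis by (simp only: nths)
qed

lemma rel_st: "i \<in> {1..<N} \<Longrightarrow> j \<in> {1..<N} \<Longrightarrow> i + 2 \<le> j \<or> j + 2 \<le> i \<Longrightarrow> ls i * ls j - ls j * ls i \<in> J0 N k"
proof -
  assume i: "i \<in> {1..<N}" "j \<in> {1..<N}" "i + 2 \<le> j \<or> j + 2 \<le> i"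
  have "fT k i * fT k j - fT k j * fT k i \<in> JJ N k"
    using JJ_rels[of N k] daha_rels.T_T[OF i] by blast
  from JJ_nth_0[OF this] show ?thesis by (simp only: nths)
qed

lemma rel_sxs: "i \<in> {1..<N} \<Longrightarrow> ls i * lx i * ls i - lx (i + 1) \<in> J0 N k"
proof -
  assume i: "i \<in> {1..<N}"
  have "fT k i * fX i * fT k i - fX (i + 1) \<in> JJ N k"
    using JJ_rels[of N k] daha_rels.T_X_T[OF i] by blast
  from JJ_nth_0[OF this] show ?thesis by (simp only: nths)
qed

lemma rel_sx: "i \<in> {1..<N} \<Longrightarrow> j \<in> {1..N} \<Longrightarrow> j \<noteq> i \<Longrightarrow> j \<noteq> i + 1 \<Longrightarrow> ls i * lx j - lx j * ls i \<in> J0 N k"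
proof -
  assume i: "i \<in> {1..<N}" "j \<in> {1..N}" "j \<noteq> i" "j \<noteq> i + 1"
  have "fT k i * fX j - fX j * fT k i \<in> JJ N k"
    using JJ_rels[of N k] daha_rels.T_X[OF i] by blast
  from JJ_nth_0[OF this] show ?thesis by (simp only: nths)
qed

lemma rel_xx: "i \<in> {1..N} \<Longrightarrow> j \<in> {1..N} \<Longrightarrow> lx i * lx j - lx j * lx i \<in> J0 N k"
proof -
  assume i: "i \<in> {1..N}" "j \<in> {1..N}"
  have "fX i * fX j - fX j * fX i \<in> JJ N k"
    using JJ_rels[of N k] daha_rels.X_X[OF i] by blast
  from JJ_nth_0[OF this] show ?thesis by (simp only: nths)
qed

lemma rel_xxi: "i \<in> {1..N} \<Longrightarrow> lx i * lxi i - 1 \<in> J0 N k" "i \<in> {1..N} \<Longrightarrow> lxi i * lx i - 1 \<in> J0 N k"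
proof -
  assume i: "i \<in> {1..N}"
  have "fX i * fXinv i - 1 \<in> JJ N k" "fXinv i * fX i - 1 \<in> JJ N k"
    using JJ_rels[of N k] daha_rels.X_Xinv[OF i] daha_rels.Xinv_X[OF i] by blast+
  from this[THEN JJ_nth_0] show "lx i * lxi i - 1 \<in> J0 N k" "lxi i * lx i - 1 \<in> J0 N k"
    by (simp_all only: nths fps_one_nth if_True refl)
qed

lemma rel_yy: "i \<in> {1..N} \<Longrightarrow> j \<in> {1..N} \<Longrightarrow> ly i * ly j - ly j * ly i \<in> J0 N k"
proof -
  assume i: "i \<in> {1..N}" "j \<in> {1..N}"
  have *: "fY i * fY j - fY j * fY i \<in> JJ N k"
    using JJ_rels[of N k] daha_rels.Y_Y[OF i] by blast
  have "fps_nth (fY i * fY j - fY j * fY i) 2 \<in> J0 N k"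
    by (rule JJ_nth_2[OF *]) (simp_all only: nths, simp_all)
  then show ?thesis by (simp only: fps_sub_nth fps_mult_nth_2 nths) (simp add: algebra_simps)
qed

lemma rel_sy: "i \<in> {1..<N} \<Longrightarrow> j \<in> {1..N} \<Longrightarrow> j \<noteq> i \<Longrightarrow> j \<noteq> i + 1 \<Longrightarrow> ls i * ly j - ly j * ls i \<in> J0 N k"
proof -
  assume i: "i \<in> {1..<N}" "j \<in> {1..N}" "j \<noteq> i" "j \<noteq> i + 1"
  have *: "fT k i * fY j - fY j * fT k i \<in> JJ N k"
    using JJ_rels[of N k] daha_rels.T_Y[OF i] by blast
  have "fps_nth (fT k i * fY j - fY j * fT k i) 1 \<in> J0 N k"
    by (rule JJ_nth_1[OF *]) (simp only: nths, simp)
  then show ?thesis by (simp only: nths) (simp add: algebra_simps)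
qed

lemma rel_sys: "i \<in> {1..<N} \<Longrightarrow> ls i * ly i * ls i - ly (i + 1) + kap k * (ls i + ls i) \<in> J0 N k"
proof -
  assume i: "i \<in> {1..<N}"
  \<comment> \<open>Both T Y T - Y' and the quadratic relation have constant term s^2 - 1; their
    difference is divisible by \<epsilon>, and its linear coefficient is the wanted
    relation.\<close>
  let ?r = "fT k i * fY i * fT k i - fY (i + 1) - quad i"
  have "fT k i * fY i * fT k i - fY (i + 1) \<in> JJ N k"
    using JJ_rels[of N k] daha_rels.T_Y_T[OF i] by blast
  then have *: "?r \<in> JJ N k" by (rule JJ_diff[OF _ quad_JJ[OF i]])
  have 0: "fps_nth ?r 0 = 0" by (simp only: nths) (simp add: algebra_simps)
  have a: "ls i * (kap k * B) = kap k * (ls i * B)" "ls i * kap k = kap k * ls i" for B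
    by (rule kap_left kap_central[symmetric])+
  have "fps_nth ?r 1 = ls i * ly i * ls i - ly (i + 1) + kap k * (ls i + ls i)"
    by (simp only: nths) (simp add: algebra_simps a)
  then show ?thesis using JJ_nth_1[OF * 0] by (simp only:)
qed

lemma rel_xy21: "2 \<le> N \<Longrightarrow> lxi 1 * (lx 1 * ly 2 - ly 2 * lx 1) - kap k * (ls 1 + ls 1) \<in> J0 N k"
proof -
  assume N: "2 \<le> N"
  \<comment> \<open>The quadratic relation and the relation for X_1^-1 X_1 cancel the constant term,
    so that division by \<epsilon> is possible.\<close>
  let ?r = "fXinv 1 * fYinv 2 * fX 1 * fY 2 - fT k 1 * fT k 1 + quad 1 - (fXinv 1 * fX 1 - 1)"
  have "fXinv 1 * fYinv 2 * fX 1 * fY 2 - fT k 1 * fT k 1 \<in> JJ N k"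
    using JJ_rels[of N k] daha_rels.X_Y_T[OF N] by blast
  moreover have "fXinv 1 * fX 1 - 1 \<in> JJ N k" using JJ_rels[of N k] daha_rels.Xinv_X[of 1 N] N by auto
  moreover have "quad 1 \<in> JJ N k" by (rule quad_JJ) (use N in auto)
  ultimately have *: "?r \<in> JJ N k" by (intro JJ_diff[OF JJ_add])
  have 0: "fps_nth ?r 0 = 0" by (simp only: nths fps_one_nth if_True refl) (simp add: algebra_simps)
  have a: "ls i * (kap k * B) = kap k * (ls i * B)" "ls i * kap k = kap k * ls i" for B i
    by (rule kap_left kap_central[symmetric])+
  have "fps_nth ?r 1 = lxi 1 * (lx 1 * ly 2 - ly 2 * lx 1) - kap k * (ls 1 + ls 1)"
    by (simp only: nths fps_one_nth) (simp add: algebra_simps a)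
  then show ?thesis using JJ_nth_1[OF * 0] by (simp only:)
qed

text \<open>The part of X_i Y~ = q^-1 Y~ X_i linear in \<epsilon>, where Y~ is the product of all
  Y_j. It gives access to the commutator of x and y with equal index, once those with different
  indices are known.\<close>

lemma rel_xysum: "i \<in> {1..N} \<Longrightarrow> lx i * (\<Sum>j\<in>{1..N}. ly j) - (\<Sum>j\<in>{1..N}. ly j) * lx i + lx i \<in> J0 N k"
proof -
  assume i: "i \<in> {1..N}"
  have "fX i * fYtilde N - scal (inverse (fps_exp 1)) * fYtilde N * fX i \<in> JJ N k" (is "?r \<in> _")
    using JJ_rels[of N k] daha_rels.X_Ytilde[OF i] by blast
  moreover have e0: "fps_nth (prod_list (map fY js)) 0 = 1" for js by (induction js) (simp_all add: fY_nths)
  have e1: "fps_nth (prod_list (map fY js)) 1 = (\<Sum>j\<leftarrow>js. ly j)" for js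
  proof (induction js)
    case (Cons j js)
    then show ?case unfolding list.map prod_list.Cons fps_mult_nth_1' sum_list.Cons by (simp add: e0 fY_nths[simplified] add.commute)
  qed simp
  have s: "(\<Sum>j\<leftarrow>[1..<Suc N]. ly j) = (\<Sum>j\<in>{1..N}. ly j)"
    by (simp only: sum_list_distinct_conv_sum_set distinct_upt set_upt atLeastLessThanSuc_atLeastAtMost)
  have q: "fps_nth (scal (inverse (fps_exp 1))) 0 = (1 :: fpoly)" "fps_nth (scal (inverse (fps_exp 1))) 1 = - (1 :: fpoly)"
    unfolding scal_nth by (simp_all add: single_uminus flip: fps_exp_neg)
  have "fps_nth ?r 0 = 0"
    unfolding fYtilde_def by (simp only: nths e0 q) simp
  ultimately have "fps_nth ?r 1 \<in> J0 N k" by (intro JJ_nth_1)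
  moreover have "fps_nth ?r 1 = lx i * (\<Sum>j\<in>{1..N}. ly j) - (\<Sum>j\<in>{1..N}. ly j) * lx i + lx i"
    unfolding fYtilde_def by (simp only: nths e0 e1 s q) (simp add: algebra_simps)
  ultimately show ?thesis by (simp only:)
qed

end

section \<open>Filtration by the number of letters y\<close>

definition yc :: "gen list \<Rightarrow> nat" where "yc ws = length (filter (\<lambda>g. g \<in> range GY) ws)"

lemma yc_simps [simp]: "yc [] = 0" "yc (GS i # ws) = yc ws" "yc (GX i # ws) = yc ws" "yc (GXinv i # ws) = yc ws"
  "yc (GY i # ws) = Suc (yc ws)" "yc (ws @ vs) = yc ws + yc vs"
  by (auto simp: yc_def)

definition wp :: "gen list \<Rightarrow> fpoly" where "wp ws = Poly_Mapping.single (Word ws) 1"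

lemma wp_append: "wp (a @ b) = wp a * wp b" by (simp add: wp_def mult_single plus_free_monoid_def)
lemma wp_Nil [simp]: "wp [] = 1" by (simp add: wp_def zero_free_monoid_def[symmetric])
lemma wp_Cons: "wp (g # ws) = letter g * wp ws" using wp_append[of "[g]" ws] by (simp add: wp_def letter_def)
lemma wp_okp: "set ws \<subseteq> gens N \<Longrightarrow> wp ws \<in> okp N" unfolding wp_def by (rule okp_single) simp

text \<open>The bound is strict: \<open>Pl N r\<close> allows fewer than r letters y. Thus
  \<open>Fl N k 0\<close> is the ideal itself, and the induction on the filtration can start
  there.\<close>

definition Pl :: "nat \<Rightarrow> nat \<Rightarrow> fpoly set" where
  "Pl N r = {p\<in>okp N. \<forall>w\<in>Poly_Mapping.keys p. yc (letters w) < r}"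
definition Fl :: "nat \<Rightarrow> complex \<Rightarrow> nat \<Rightarrow> fpoly set" where
  "Fl N k r = {p + j | p j. p \<in> Pl N r \<and> j \<in> J0 N k}"

lemma Pl_zero: "0 \<in> Pl N r" by (simp add: Pl_def okp_zero)
lemma Pl_add: "p \<in> Pl N r \<Longrightarrow> q \<in> Pl N r \<Longrightarrow> p + q \<in> Pl N r"
  using Poly_Mapping.keys_add[of p q] okp_add by (auto simp: Pl_def)
lemma Pl_mono: "p \<in> Pl N r \<Longrightarrow> r \<le> s \<Longrightarrow> p \<in> Pl N s" by (auto simp: Pl_def)
lemma Pl_mult: "p \<in> Pl N (Suc m) \<Longrightarrow> q \<in> Pl N r \<Longrightarrow> p * q \<in> Pl N (m + r)"
proof -
  assume p: "p \<in> Pl N (Suc m)" and q: "q \<in> Pl N r"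
  have "yc (letters w) < m + r" if w: "w \<in> Poly_Mapping.keys (p * q)" for w
  proof -
    obtain a b where ab: "w = a + b" "a \<in> Poly_Mapping.keys p" "b \<in> Poly_Mapping.keys q"
      using w keys_mult[of p q] by blast
    then have "yc (letters a) < Suc m" "yc (letters b) < r" using p q by (auto simp: Pl_def)
    then show ?thesis by (simp add: ab(1) plus_free_monoid_def)
  qed
  then show ?thesis using p q okp_mult by (auto simp: Pl_def)
qed
lemma Pl_mult': "p \<in> Pl N r \<Longrightarrow> q \<in> Pl N (Suc m) \<Longrightarrow> p * q \<in> Pl N (r + m)"
proof -
  assume p: "p \<in> Pl N r" and q: "q \<in> Pl N (Suc m)"
  have "yc (letters w) < r + m" if w: "w \<in> Poly_Mapping.keys (p * q)" for w
  proof -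
    obtain a b where ab: "w = a + b" "a \<in> Poly_Mapping.keys p" "b \<in> Poly_Mapping.keys q"
      using w keys_mult[of p q] by blast
    then have "yc (letters a) < r" "yc (letters b) < Suc m" using p q by (auto simp: Pl_def)
    then show ?thesis by (simp add: ab(1) plus_free_monoid_def)
  qed
  then show ?thesis using p q okp_mult by (auto simp: Pl_def)
qed
lemma Pl_wp: "set ws \<subseteq> gens N \<Longrightarrow> yc ws < r \<Longrightarrow> wp ws \<in> Pl N r" by (simp add: Pl_def wp_okp) (simp add: wp_def)
lemma Pl_scalar: "0 < r \<Longrightarrow> Poly_Mapping.single 0 c \<in> Pl N r"
  by (simp add: Pl_def okp_scalar) (simp add: zero_free_monoid_def)
lemma Pl_letters: "i \<in> {1..<N} \<Longrightarrow> ls i \<in> Pl N 1" "i \<in> {1..N} \<Longrightarrow> lx i \<in> Pl N 1"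
  "i \<in> {1..N} \<Longrightarrow> lxi i \<in> Pl N 1" "i \<in> {1..N} \<Longrightarrow> ly i \<in> Pl N 2"
  by (simp_all add: Pl_def okp_letter) (simp_all add: letter_def)

lemma Fl_Pl: "p \<in> Pl N r \<Longrightarrow> p \<in> Fl N k r" unfolding Fl_def using J0_zero by force
lemma Fl_J0: "p \<in> J0 N k \<Longrightarrow> p \<in> Fl N k r" unfolding Fl_def using Pl_zero by force
lemma Fl_zero: "Fl N k 0 = J0 N k"
proof -
  have "Pl N 0 = {0}" by (auto simp: Pl_def okp_zero)
  then show ?thesis by (auto simp: Fl_def)
qed
lemma Fl_add: "p \<in> Fl N k r \<Longrightarrow> q \<in> Fl N k r \<Longrightarrow> p + q \<in> Fl N k r"
proof -
  assume "p \<in> Fl N k r" "q \<in> Fl N k r"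
  then obtain a b c d where *: "p = a + b" "q = c + d" "a \<in> Pl N r" "c \<in> Pl N r" "b \<in> J0 N k" "d \<in> J0 N k"
    by (auto simp: Fl_def)
  have "p + q = (a + c) + (b + d)" by (simp add: * algebra_simps)
  then show ?thesis unfolding Fl_def using Pl_add[OF *(3,4)] J0_add[OF *(5,6)] by blast
qed
lemma Fl_okp: "p \<in> Fl N k r \<Longrightarrow> p \<in> okp N" using J0_okp by (auto simp: Fl_def Pl_def intro!: okp_add)
lemma Fl_mono: "p \<in> Fl N k r \<Longrightarrow> r \<le> s \<Longrightarrow> p \<in> Fl N k s" using Pl_mono by (fastforce simp: Fl_def)
lemma Pl_okp: "p \<in> Pl N r \<Longrightarrow> p \<in> okp N" by (simp add: Pl_def)
lemma Fl_left: "p \<in> Pl N (Suc m) \<Longrightarrow> q \<in> Fl N k r \<Longrightarrow> p * q \<in> Fl N k (m + r)"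
proof -
  assume p: "p \<in> Pl N (Suc m)" and "q \<in> Fl N k r"
  then obtain a b where *: "q = a + b" "a \<in> Pl N r" "b \<in> J0 N k" by (auto simp: Fl_def)
  show ?thesis unfolding *(1) distrib_left Fl_def
    using Pl_mult[OF p *(2)] J0_left[OF *(3) Pl_okp[OF p]] by blast
qed
lemma Fl_right: "p \<in> Fl N k r \<Longrightarrow> q \<in> Pl N (Suc m) \<Longrightarrow> p * q \<in> Fl N k (r + m)"
proof -
  assume "p \<in> Fl N k r" and q: "q \<in> Pl N (Suc m)"
  then obtain a b where *: "p = a + b" "a \<in> Pl N r" "b \<in> J0 N k" by (auto simp: Fl_def)
  show ?thesis unfolding *(1) distrib_right Fl_def
    using Pl_mult'[OF *(2) q] J0_right[OF *(3) Pl_okp[OF q]] by blast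
qed
lemma Fl_scalar: "p \<in> Fl N k r \<Longrightarrow> Poly_Mapping.single 0 c * p \<in> Fl N k r"
  using Fl_left[OF Pl_scalar[where r = "Suc 0" and c = c], of p N k r] by simp
lemma Fl_minus: "p \<in> Fl N k r \<Longrightarrow> - p \<in> Fl N k r"
  using Fl_scalar[of p N k r "- 1"] by (simp add: single_uminus)
lemma Fl_diff: "p \<in> Fl N k r \<Longrightarrow> q \<in> Fl N k r \<Longrightarrow> p - q \<in> Fl N k r"
  using Fl_add[OF _ Fl_minus] by fastforce
lemma Fl_sum: "(\<And>x. x \<in> S \<Longrightarrow> f x \<in> Fl N k r) \<Longrightarrow> sum f S \<in> Fl N k r"
  by (induction S rule: infinite_finite_induct) (auto intro: Fl_add Fl_Pl Pl_zero)

definition cg :: "nat \<Rightarrow> complex \<Rightarrow> nat \<Rightarrow> fpoly \<Rightarrow> fpoly \<Rightarrow> bool" where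
  "cg N k r p q \<longleftrightarrow> p - q \<in> Fl N k r"

lemma cg_refl [simp]: "cg N k r p p" by (simp add: cg_def Fl_Pl Pl_zero)
lemma cg_sym: "cg N k r p q \<Longrightarrow> cg N k r q p" unfolding cg_def using Fl_minus by fastforce
lemma cg_trans [trans]: "cg N k r p q \<Longrightarrow> cg N k r q s \<Longrightarrow> cg N k r p s"
  unfolding cg_def using Fl_add[of "p - q" N k r "q - s"] by simp
lemma cg_J0: "p - q \<in> J0 N k \<Longrightarrow> cg N k r p q" unfolding cg_def by (rule Fl_J0)
lemma cg_left: "cg N k r p q \<Longrightarrow> a \<in> Pl N 1 \<Longrightarrow> cg N k r (a * p) (a * q)"
  unfolding cg_def right_diff_distrib[symmetric] using Fl_left[of a N 0] by simp
lemma cg_right: "cg N k r p q \<Longrightarrow> a \<in> Pl N 1 \<Longrightarrow> cg N k r (p * a) (q * a)"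
  unfolding cg_def left_diff_distrib[symmetric] using Fl_right[of _ N k r a 0] by simp
lemma cg_J0_left: "p - q \<in> J0 N k \<Longrightarrow> a \<in> okp N \<Longrightarrow> cg N k r (a * p) (a * q)"
  by (rule cg_J0) (simp add: J0_left flip: right_diff_distrib)
lemma cg_J0_right: "p - q \<in> J0 N k \<Longrightarrow> a \<in> okp N \<Longrightarrow> cg N k r (p * a) (q * a)"
  by (rule cg_J0) (simp add: J0_right flip: left_diff_distrib)
lemma cg_zero: "cg N k 0 p q \<longleftrightarrow> p - q \<in> J0 N k" by (simp add: cg_def Fl_zero)

text \<open>Conjugating a relation by an element that is invertible modulo the ideal.\<close>

lemma cg_inverse:
  assumes "cg N k r (a * b) (c * a)" "b * b' - 1 \<in> J0 N k" "c' * c - 1 \<in> J0 N k"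
    and "b' \<in> Pl N 1" "c' \<in> Pl N 1" "a \<in> okp N" "b \<in> okp N" "c \<in> okp N"
  shows "cg N k r (a * b') (c' * a)"
proof -
  note ok = assms(6-8) Pl_okp[OF assms(4)] Pl_okp[OF assms(5)]
  have "cg N k r (1 * (a * b')) (c' * c * (a * b'))"
    by (rule cg_sym[OF cg_J0_right[OF assms(3)]]) (intro okp_mult ok)
  also have "c' * c * (a * b') = c' * (c * a) * b'" by (simp add: mult.assoc)
  also have "cg N k r (c' * (c * a) * b') (c' * (a * b) * b')"
    by (intro cg_right cg_left cg_sym[OF assms(1)] assms)
  also have "c' * (a * b) * b' = c' * a * (b * b')" by (simp add: mult.assoc)
  also have "cg N k r (c' * a * (b * b')) (c' * a * 1)"
    by (rule cg_J0_left[OF assms(2)]) (intro okp_mult ok)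
  finally show ?thesis by simp
qed

context
  fixes N :: nat and k :: complex
begin

lemmas okl = okp_letter okp_mult okp_one

lemma sr_range: "i \<in> {1..<N} \<Longrightarrow> j \<in> {1..N} \<Longrightarrow> sr i j \<in> {1..N}" by (auto simp: transpose_def)

lemma cg_sx: "i \<in> {1..<N} \<Longrightarrow> j \<in> {1..N} \<Longrightarrow> cg N k r (ls i * lx j) (lx (sr i j) * ls i)"
proof -
  assume i: "i \<in> {1..<N}" and j: "j \<in> {1..N}"
  have ok: "ls i \<in> okp N" "lx j \<in> okp N" "lx i \<in> okp N" "lx (i + 1) \<in> okp N" using i j by (auto intro!: okl)
  consider "j = i" | "j = i + 1" | "j \<noteq> i" "j \<noteq> i + 1" by blast
  then show ?thesis
  proof cases
    case 1
    have "cg N k r (ls i * lx i * 1) (ls i * lx i * (ls i * ls i))"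
      by (rule cg_sym[OF cg_J0_left[OF rel_ss[OF i]]]) (intro okp_mult ok)
    also have "ls i * lx i * (ls i * ls i) = (ls i * lx i * ls i) * ls i" by (simp add: mult.assoc)
    also have "cg N k r \<dots> (lx (i + 1) * ls i)" by (rule cg_J0_right[OF rel_sxs[OF i] ok(1)])
    finally show ?thesis using 1 by simp
  next
    case 2
    have "cg N k r (ls i * lx (i + 1)) (ls i * (ls i * lx i * ls i))"
      by (rule cg_sym[OF cg_J0_left[OF rel_sxs[OF i] ok(1)]])
    also have "ls i * (ls i * lx i * ls i) = (ls i * ls i) * (lx i * ls i)" by (simp add: mult.assoc)
    also have "cg N k r \<dots> (1 * (lx i * ls i))" by (rule cg_J0_right[OF rel_ss[OF i]]) (intro okp_mult ok)
    finally show ?thesis using 2 by simp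
  next
    case 3
    then show ?thesis using cg_J0[OF rel_sx[OF i j 3]] by (simp add: transpose_def)
  qed
qed

lemma cg_sxi: "i \<in> {1..<N} \<Longrightarrow> j \<in> {1..N} \<Longrightarrow> cg N k r (ls i * lxi j) (lxi (sr i j) * ls i)"
proof -
  assume i: "i \<in> {1..<N}" and j: "j \<in> {1..N}"
  note j' = sr_range[OF i j]
  show ?thesis
    by (rule cg_inverse[OF cg_sx[OF i j] rel_xxi(1)[OF j] rel_xxi(2)[OF j']])
      (rule Pl_letters(3) okp_letter; use i j j' in simp)+
qed

lemma cg_sy: "i \<in> {1..<N} \<Longrightarrow> j \<in> {1..N} \<Longrightarrow> cg N k 1 (ls i * ly j) (ly (sr i j) * ls i)"
proof -
  assume i: "i \<in> {1..<N}" and j: "j \<in> {1..N}"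
  have ok: "ls i \<in> okp N" "ly j \<in> okp N" "ly i \<in> okp N" "ly (i + 1) \<in> okp N" using i j by (auto intro!: okl)
  have kap: "kap k \<in> Pl N 1" unfolding kap_def by (rule Pl_scalar) simp
  have s: "ls i \<in> Pl N 1" by (rule Pl_letters(1)[OF i])
  have sys: "cg N k 1 (ls i * ly i * ls i) (ly (i + 1))"
  proof -
    have "kap k * (ls i + ls i) \<in> Fl N k 1"
      using Fl_Pl[OF Pl_mult[of "kap k" N 0 "ls i + ls i" 1]] kap Pl_add[OF s s] by simp
    from Fl_diff[OF Fl_J0[OF rel_sys[OF i]] this] show ?thesis by (simp add: cg_def)
  qed
  consider "j = i" | "j = i + 1" | "j \<noteq> i" "j \<noteq> i + 1" by blast
  then show ?thesis
  proof cases
    case 1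
    have "cg N k 1 (ls i * ly i * 1) (ls i * ly i * (ls i * ls i))"
      by (rule cg_sym[OF cg_J0_left[OF rel_ss[OF i]]]) (intro okp_mult ok)
    also have "ls i * ly i * (ls i * ls i) = (ls i * ly i * ls i) * ls i" by (simp add: mult.assoc)
    also have "cg N k 1 \<dots> (ly (i + 1) * ls i)" by (rule cg_right[OF sys s])
    finally show ?thesis using 1 by simp
  next
    case 2
    have "cg N k 1 (ls i * ly (i + 1)) (ls i * (ls i * ly i * ls i))"
      by (rule cg_sym[OF cg_left[OF sys s]])
    also have "ls i * (ls i * ly i * ls i) = (ls i * ls i) * (ly i * ls i)" by (simp add: mult.assoc)
    also have "cg N k 1 \<dots> (1 * (ly i * ls i))" by (rule cg_J0_right[OF rel_ss[OF i]]) (intro okp_mult ok)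
    finally show ?thesis using 2 by simp
  next
    case 3
    then show ?thesis using cg_J0[OF rel_sy[OF i j 3]] by (simp add: transpose_def)
  qed
qed

text \<open>Conjugation by s_m moves both indices at once, so one known commutation can be
  transported along the symmetric group.\<close>

lemma cg_yx_conj:
  assumes i: "i \<in> {1..N}" and j: "j \<in> {1..N}" and m: "m \<in> {1..<N}" and ij: "cg N k 1 (ly i * lx j) (lx j * ly i)"
  shows "cg N k 1 (ly (sr m i) * lx (sr m j)) (lx (sr m j) * ly (sr m i))"
proof -
  let ?i = "sr m i" and ?j = "sr m j" and ?s = "ls m"
  have ij': "?i \<in> {1..N}" "?j \<in> {1..N}" using sr_range[OF m i] sr_range[OF m j] by auto
  have ok: "?s \<in> okp N" "ly i \<in> okp N" "ly ?i \<in> okp N" "lx j \<in> okp N" "lx ?j \<in> okp N"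
    using i j m ij' by (auto intro!: okp_letter)
  have P: "?s \<in> Pl N 1" "lx j \<in> Pl N 1" "lx ?j \<in> Pl N 1"
    using Pl_letters(1)[OF m] Pl_letters(2)[OF j] Pl_letters(2)[OF ij'(2)] by auto
  have xs: "lx ?j * ?s - ?s * lx j \<in> J0 N k"
    using cg_sym[OF cg_sx[OF m j, of 0]] by (simp only: cg_zero)
  have "cg N k 1 (ly ?i * lx ?j * 1) (ly ?i * lx ?j * (?s * ?s))"
    by (rule cg_sym[OF cg_J0_left[OF rel_ss[OF m]]]) (intro okp_mult ok)
  also have "ly ?i * lx ?j * (?s * ?s) = ly ?i * (lx ?j * ?s) * ?s" by (simp add: mult.assoc)
  also have "cg N k 1 \<dots> (ly ?i * (?s * lx j) * ?s)"
    by (intro cg_right P cg_J0_left[OF xs] ok)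
  also have "ly ?i * (?s * lx j) * ?s = (ly ?i * ?s) * (lx j * ?s)" by (simp add: mult.assoc)
  also have "cg N k 1 \<dots> ((?s * ly i) * (lx j * ?s))"
    by (rule cg_right[OF cg_sym[OF cg_sy[OF m i]]]) (use Pl_mult[of "lx j" N 0 ?s 1] P in simp)
  also have "(?s * ly i) * (lx j * ?s) = ?s * (ly i * lx j) * ?s" by (simp add: mult.assoc)
  also have "cg N k 1 \<dots> (?s * (lx j * ly i) * ?s)" by (intro cg_left cg_right ij P)
  also have "?s * (lx j * ly i) * ?s = (?s * lx j) * (ly i * ?s)" by (simp add: mult.assoc)
  also have "cg N k 1 \<dots> ((lx ?j * ?s) * (ly i * ?s))"
    by (rule cg_sym[OF cg_J0_right[OF xs]]) (intro okp_mult ok)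
  also have "(lx ?j * ?s) * (ly i * ?s) = lx ?j * (?s * ly i) * ?s" by (simp add: mult.assoc)
  also have "cg N k 1 \<dots> (lx ?j * (ly ?i * ?s) * ?s)" by (intro cg_left cg_right cg_sy[OF m i] P)
  also have "lx ?j * (ly ?i * ?s) * ?s = lx ?j * ly ?i * (?s * ?s)" by (simp add: mult.assoc)
  also have "cg N k 1 \<dots> (lx ?j * ly ?i * 1)"
    by (rule cg_J0_left[OF rel_ss[OF m]]) (intro okp_mult ok)
  finally show ?thesis by simp
qed

lemma cg_yx_21: "2 \<le> N \<Longrightarrow> cg N k 1 (ly 2 * lx 1) (lx 1 * ly 2)"
proof -
  assume N: "2 \<le> N"
  then have 1: "1 \<in> {1..N}" "1 \<in> {1..<N}" "2 \<in> {1..N}" by auto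
  have ok: "lx 1 \<in> okp N" "lxi 1 \<in> okp N" "ly 2 \<in> okp N" using 1 by (auto intro!: okp_letter)
  let ?d = "lx 1 * ly 2 - ly 2 * lx 1"
  have d: "?d \<in> okp N" by (intro okp_diff okp_mult ok)
  have kap: "kap k \<in> Pl N 1" unfolding kap_def by (rule Pl_scalar) simp
  have s: "ls 1 \<in> Pl N 1" by (rule Pl_letters(1)[OF 1(2)])
  have ks: "kap k * (ls 1 + ls 1) \<in> Fl N k 1"
    using Fl_Pl[OF Pl_mult[of "kap k" N 0 "ls 1 + ls 1" 1]] kap Pl_add[OF s s] by simp
  have "lxi 1 * ?d \<in> Fl N k 1" using Fl_add[OF Fl_J0[OF rel_xy21[OF N]] ks] by simp
  then have "lx 1 * (lxi 1 * ?d) \<in> Fl N k 1" using Fl_left[of "lx 1" N 0] Pl_letters(2)[OF 1(1)] by simp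
  moreover have "(lx 1 * lxi 1 - 1) * ?d \<in> Fl N k 1" by (rule Fl_J0[OF J0_right[OF rel_xxi(1)[OF 1(1)] d]])
  ultimately have "lx 1 * (lxi 1 * ?d) - (lx 1 * lxi 1 - 1) * ?d \<in> Fl N k 1" by (rule Fl_diff)
  moreover have "lx 1 * (lxi 1 * ?d) - (lx 1 * lxi 1 - 1) * ?d = ?d" by (simp add: left_diff_distrib mult.assoc)
  ultimately show ?thesis using cg_sym by (simp add: cg_def)
qed

text \<open>Transport of the pair (2, 1) by simple transpositions: raise the index of y, then that
  of x below it; exchange adjacent indices once; finally raise the index of x above that of
  y.\<close>

lemma cg_yx_ne: "i \<in> {1..N} \<Longrightarrow> j \<in> {1..N} \<Longrightarrow> i \<noteq> j \<Longrightarrow> cg N k 1 (ly i * lx j) (lx j * ly i)"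
proof -
  have i1: "2 \<le> i \<Longrightarrow> i \<le> N \<Longrightarrow> cg N k 1 (ly i * lx 1) (lx 1 * ly i)" for i
  proof (induction i rule: nat_induct_at_least)
    case base then show ?case by (rule cg_yx_21)
  next
    case (Suc i)
    then have "sr i i = Suc i" "sr i 1 = 1" by (auto simp: transpose_def)
    then show ?case using cg_yx_conj[of i 1 i] Suc by simp
  qed
  have gt: "1 \<le> j \<Longrightarrow> j < i \<Longrightarrow> i \<le> N \<Longrightarrow> cg N k 1 (ly i * lx j) (lx j * ly i)" for i j
  proof (induction j rule: nat_induct_at_least)
    case base then show ?case using i1[of i] by simp
  next
    case (Suc j)
    then have "sr j i = i" "sr j j = Suc j" by (auto simp: transpose_def)
    then show ?case using cg_yx_conj[of i j j] Suc by simp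
  qed
  have succ: "cg N k 1 (ly i * lx (Suc i)) (lx (Suc i) * ly i)" if "1 \<le> i" "Suc i \<le> N" for i
    using cg_yx_conj[of "Suc i" i i] gt[of i "Suc i"] that by simp
  have lt: "Suc i \<le> j \<Longrightarrow> 1 \<le> i \<Longrightarrow> j \<le> N \<Longrightarrow> cg N k 1 (ly i * lx j) (lx j * ly i)" for i j
  proof (induction j rule: nat_induct_at_least)
    case base then show ?case using succ by simp
  next
    case (Suc j)
    then have "sr j i = i" "sr j j = Suc j" by (auto simp: transpose_def)
    then show ?case using cg_yx_conj[of i j j] Suc by simp
  qed
  assume "i \<in> {1..N}" "j \<in> {1..N}" "i \<noteq> j"
  then show ?thesis using gt[of j i] lt[of i j] by (cases "j < i") auto
qed

text \<open>For equal indices the sum relation controls the total of the commutators of x_i with all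
  y_j. All terms with j \<noteq> i are already of lower order, hence so is the remaining
  one.\<close>

lemma cg_yx: "i \<in> {1..N} \<Longrightarrow> j \<in> {1..N} \<Longrightarrow> cg N k 1 (ly i * lx j) (lx j * ly i)"
proof (cases "i = j")
  case False
  assume "i \<in> {1..N}" "j \<in> {1..N}" then show ?thesis using False by (rule cg_yx_ne)
next
  case True
  assume i: "i \<in> {1..N}"
  let ?d = "\<lambda>j. lx i * ly j - ly j * lx i"
  have "(\<Sum>j\<in>{1..N}. ?d j) \<in> Fl N k 1"
  proof -
    have "(\<Sum>j\<in>{1..N}. ?d j) + lx i \<in> J0 N k"
      using rel_xysum[OF i, of k] by (simp add: sum_subtractf sum_distrib_left sum_distrib_right)
    from Fl_diff[OF Fl_J0[OF this] Fl_Pl[OF Pl_letters(2)[OF i]]] show ?thesis by simp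
  qed
  moreover have "(\<Sum>j\<in>{1..N} - {i}. ?d j) \<in> Fl N k 1"
    by (rule Fl_sum) (use cg_sym[OF cg_yx_ne] i in \<open>auto simp: cg_def\<close>)
  ultimately have "(\<Sum>j\<in>{1..N}. ?d j) - (\<Sum>j\<in>{1..N} - {i}. ?d j) \<in> Fl N k 1" by (rule Fl_diff)
  also have "(\<Sum>j\<in>{1..N}. ?d j) - (\<Sum>j\<in>{1..N} - {i}. ?d j) = ?d i"
    using i by (subst sum.remove[of _ i]) auto
  finally show ?thesis using cg_sym True by (simp add: cg_def)
qed

end

section \<open>Words in the generators\<close>

text \<open>Multiplication of words up to lower order: a presentation of the monoid of triples
  (exponent of X, exponent of y, permutation), with permutations acting on both exponents.
  Corrections with fewer y arise only for \<open>SY\<close>, \<open>YX\<close> and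
  \<open>YXi\<close>.\<close>

inductive weq :: "nat \<Rightarrow> gen list \<Rightarrow> gen list \<Rightarrow> bool" for N where
  same: "set a \<subseteq> gens N \<Longrightarrow> weq N a a"
| sym: "weq N a b \<Longrightarrow> weq N b a"
| trans: "weq N a b \<Longrightarrow> weq N b c \<Longrightarrow> weq N a c"
| append: "weq N a b \<Longrightarrow> weq N c d \<Longrightarrow> weq N (a @ c) (b @ d)"
| SS: "i \<in> {1..<N} \<Longrightarrow> weq N [GS i, GS i] []"
| braid: "1 \<le> i \<Longrightarrow> i + 1 < N \<Longrightarrow> weq N [GS i, GS (i + 1), GS i] [GS (i + 1), GS i, GS (i + 1)]"
| ST: "i \<in> {1..<N} \<Longrightarrow> j \<in> {1..<N} \<Longrightarrow> i + 2 \<le> j \<or> j + 2 \<le> i \<Longrightarrow> weq N [GS i, GS j] [GS j, GS i]"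
| SX: "i \<in> {1..<N} \<Longrightarrow> j \<in> {1..N} \<Longrightarrow> weq N [GS i, GX j] [GX (sr i j), GS i]"
| SXi: "i \<in> {1..<N} \<Longrightarrow> j \<in> {1..N} \<Longrightarrow> weq N [GS i, GXinv j] [GXinv (sr i j), GS i]"
| SY: "i \<in> {1..<N} \<Longrightarrow> j \<in> {1..N} \<Longrightarrow> weq N [GS i, GY j] [GY (sr i j), GS i]"
| XX: "i \<in> {1..N} \<Longrightarrow> j \<in> {1..N} \<Longrightarrow> weq N [GX i, GX j] [GX j, GX i]"
| XXi: "i \<in> {1..N} \<Longrightarrow> j \<in> {1..N} \<Longrightarrow> weq N [GX i, GXinv j] [GXinv j, GX i]"
| XiXi: "i \<in> {1..N} \<Longrightarrow> j \<in> {1..N} \<Longrightarrow> weq N [GXinv i, GXinv j] [GXinv j, GXinv i]"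
| cancel: "i \<in> {1..N} \<Longrightarrow> weq N [GX i, GXinv i] []"
| YY: "i \<in> {1..N} \<Longrightarrow> j \<in> {1..N} \<Longrightarrow> weq N [GY i, GY j] [GY j, GY i]"
| YX: "i \<in> {1..N} \<Longrightarrow> j \<in> {1..N} \<Longrightarrow> weq N [GY i, GX j] [GX j, GY i]"
| YXi: "i \<in> {1..N} \<Longrightarrow> j \<in> {1..N} \<Longrightarrow> weq N [GY i, GXinv j] [GXinv j, GY i]"

lemma wp_Cons_letters: "wp [g, h] = letter g * letter h" "wp [g, h, g'] = letter g * letter h * letter g'"
  by (simp_all add: wp_Cons mult.assoc)

text \<open>Every relation preserves the number of y, so the order of the congruence is well
  defined. For concatenation the difference is split into two products, and the unchanged word
  shifts the filtration by exactly its number of y.\<close>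

lemma weq_sound:
  "weq N a b \<Longrightarrow> yc a = yc b \<and> set a \<subseteq> gens N \<and> set b \<subseteq> gens N \<and> cg N k (yc a) (wp a) (wp b)"
proof (induction rule: weq.induct)
  case (sym a b) then show ?case using cg_sym by auto
next
  case (trans a b c) then show ?case using cg_trans by auto
next
  case (append a b c d)
  have "wp (a @ c) - wp (b @ d) = (wp a - wp b) * wp c + wp b * (wp c - wp d)"
    by (simp add: wp_append algebra_simps)
  moreover have "(wp a - wp b) * wp c \<in> Fl N k (yc a + yc c)"
    by (rule Fl_right[OF _ Pl_wp]) (use append in \<open>auto simp: cg_def\<close>)
  moreover have "wp b * (wp c - wp d) \<in> Fl N k (yc b + yc c)"
    by (rule Fl_left[OF Pl_wp]) (use append in \<open>auto simp: cg_def\<close>)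
  ultimately show ?case using append Fl_add by (auto simp: cg_def)
next
  case (SS i) then show ?case using cg_J0[OF rel_ss[of i N k]] by (simp add: wp_Cons_letters)
next
  case (braid i) then show ?case using cg_J0[OF rel_braid[of i N k]] by (simp add: wp_Cons_letters)
next
  case (ST i j) then show ?case using cg_J0[OF rel_st[of i N j k]] by (simp add: wp_Cons_letters)
next
  case (SX i j) then show ?case using sr_range[of i N j] cg_sx[of i N j k] by (simp add: wp_Cons_letters)
next
  case (SXi i j) then show ?case using sr_range[of i N j] cg_sxi[of i N j k] by (simp add: wp_Cons_letters)
next
  case (SY i j) then show ?case using sr_range[of i N j] cg_sy[of i N j k] by (simp add: wp_Cons_letters)
next
  case (XX i j) then show ?case using cg_J0[OF rel_xx[of i N j k]] by (simp add: wp_Cons_letters)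
next
  case (XXi i j)
  have "cg N k 0 (lx i * lxi j) (lxi j * lx i)"
    by (rule cg_inverse[OF cg_J0[OF rel_xx[OF XXi]] rel_xxi(1)[OF XXi(2)] rel_xxi(2)[OF XXi(2)]])
      (rule Pl_letters(3) okp_letter; use XXi in simp)+
  then show ?case using XXi by (simp add: wp_Cons_letters)
next
  case (XiXi i j)
  have h: "cg N k 0 (lx j * lxi i) (lxi i * lx j)"
    by (rule cg_inverse[OF cg_J0[OF rel_xx[OF XiXi(2,1)]] rel_xxi(1)[OF XiXi(1)] rel_xxi(2)[OF XiXi(1)]])
      (rule Pl_letters(3) okp_letter; use XiXi in simp)+
  have "cg N k 0 (lxi i * lxi j) (lxi j * lxi i)"
    by (rule cg_inverse[OF cg_sym[OF h] rel_xxi(1)[OF XiXi(2)] rel_xxi(2)[OF XiXi(2)]])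
      (rule Pl_letters(3) okp_letter; use XiXi in simp)+
  then show ?case using XiXi by (simp add: wp_Cons_letters)
next
  case (cancel i) then show ?case using cg_J0[OF rel_xxi(1)[of i N k]] by (simp add: wp_Cons_letters)
next
  case (YY i j) then show ?case using cg_J0[OF rel_yy[of i N j k]] by (simp add: wp_Cons_letters)
next
  case (YX i j) then show ?case using cg_yx[of i N j k] by (simp add: wp_Cons_letters)
next
  case (YXi i j)
  have "cg N k 1 (ly i * lxi j) (lxi j * ly i)"
    by (rule cg_inverse[OF cg_yx[OF YXi] rel_xxi(1)[OF YXi(2)] rel_xxi(2)[OF YXi(2)]])
      (rule Pl_letters(3) okp_letter; use YXi in simp)+
  then show ?case using YXi by (simp add: wp_Cons_letters)
qed simp_all

lemma weq_gens: "weq N a b \<Longrightarrow> set a \<subseteq> gens N \<and> set b \<subseteq> gens N"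
  using weq_sound[of N a b] by blast

lemma weq_append_left: "weq N a b \<Longrightarrow> set c \<subseteq> gens N \<Longrightarrow> weq N (c @ a) (c @ b)"
  by (intro weq.append weq.same)
lemma weq_append_right: "weq N a b \<Longrightarrow> set c \<subseteq> gens N \<Longrightarrow> weq N (a @ c) (b @ c)"
  by (intro weq.append weq.same)
lemma weq_Cons: "weq N a b \<Longrightarrow> g \<in> gens N \<Longrightarrow> weq N (g # a) (g # b)"
  using weq_append_left[of N a b "[g]"] by simp

lemma weq_move:
  assumes "\<And>h. h \<in> set hs \<Longrightarrow> weq N [g, h] [f h, g]" and "g \<in> gens N" "set hs \<subseteq> gens N"
  shows "weq N (g # hs) (map f hs @ [g])"
  using assms(1,3)
proof (induction hs)
  case Nil then show ?case using assms(2) by (auto intro: weq.same)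
next
  case (Cons h hs)
  have 1: "weq N ([g, h] @ hs) ([f h, g] @ hs)" by (rule weq_append_right) (use Cons.prems in auto)
  have "f h \<in> gens N" using weq_gens[OF Cons.prems(1)[of h]] by simp
  then have 2: "weq N (f h # (g # hs)) (f h # (map f hs @ [g]))" by (intro weq_Cons Cons.IH) (use Cons.prems in auto)
  show ?case using weq.trans[OF 1] 2 by simp
qed

lemma weq_move_comm:
  assumes "\<And>h. h \<in> set hs \<Longrightarrow> weq N [g, h] [h, g]" and "g \<in> gens N" "set hs \<subseteq> gens N"
  shows "weq N (g # hs) (hs @ [g])"
  using weq_move[of hs N g "\<lambda>h. h"] assms by simp

subsection \<open>Commuting letters\<close>

fun exX :: "gen \<Rightarrow> expo" where
  "exX (GX i) = Poly_Mapping.single i 1"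
| "exX (GXinv i) = - Poly_Mapping.single i 1"
| "exX _ = 0"

fun flipX :: "gen \<Rightarrow> gen" where
  "flipX (GX i) = GXinv i" | "flipX (GXinv i) = GX i" | "flipX g = g"

definition xlet :: "nat \<Rightarrow> gen set" where "xlet N = GX ` {1..N} \<union> GXinv ` {1..N}"

lemma xlet_gens: "xlet N \<subseteq> gens N" by (auto simp: xlet_def)
lemma flipX_xlet: "g \<in> xlet N \<Longrightarrow> flipX g \<in> xlet N" by (auto simp: xlet_def)
lemma xlet_comm: "g \<in> xlet N \<Longrightarrow> h \<in> xlet N \<Longrightarrow> weq N [g, h] [h, g]"
  by (auto simp: xlet_def intro: weq.XX weq.XXi weq.XiXi weq.sym[OF weq.XXi])
lemma xlet_cancel: "g \<in> xlet N \<Longrightarrow> weq N [g, flipX g] []"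
proof -
  assume g: "g \<in> xlet N"
  show ?thesis
  proof (cases g)
    case (GX i) then show ?thesis using g by (auto simp: xlet_def intro: weq.cancel)
  next
    case (GXinv i)
    then have i: "i \<in> {1..N}" using g by (auto simp: xlet_def)
    then show ?thesis using weq.trans[OF weq.sym[OF weq.XXi[OF i i]] weq.cancel[OF i]] GXinv by simp
  qed (use g in \<open>auto simp: xlet_def\<close>)
qed

definition sumX :: "gen list \<Rightarrow> expo" where "sumX xs = (\<Sum>g\<leftarrow>xs. exX g)"

lemma sumX_simps [simp]: "sumX [] = 0" "sumX (g # xs) = exX g + sumX xs" "sumX (xs @ ys) = sumX xs + sumX ys"
  by (simp_all add: sumX_def)

lemma exX_flip: "exX (flipX g) = - exX g" by (cases g) simp_all

lemma sumX_coord_pos: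
  assumes "set xs \<subseteq> xlet N" "GX i \<notin> set xs" shows "Poly_Mapping.lookup (sumX xs) i \<le> 0"
  using assms
proof (induction xs)
  case (Cons g xs)
  have "Poly_Mapping.lookup (exX g) i \<le> 0"
    using Cons.prems by (auto simp: xlet_def lookup_single when_def split: if_splits)
  then show ?case using Cons by (simp add: lookup_add)
qed simp

lemma sumX_coord_neg:
  assumes "set xs \<subseteq> xlet N" "GXinv i \<notin> set xs" shows "Poly_Mapping.lookup (sumX xs) i \<ge> 0"
  using assms
proof (induction xs)
  case (Cons g xs)
  have "Poly_Mapping.lookup (exX g) i \<ge> 0"
    using Cons.prems by (auto simp: xlet_def lookup_single when_def split: if_splits)
  then show ?case using Cons by (simp add: lookup_add)
qed simp

text \<open>The inverse of the first letter must occur later, since otherwise one coordinate of the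
  sum would keep a strict sign. Commuting the letter up to it and cancelling shortens the
  word.\<close>

lemma sumX_zero: "set xs \<subseteq> xlet N \<Longrightarrow> sumX xs = 0 \<Longrightarrow> weq N xs []"
proof (induction xs rule: length_induct)
  case (1 xs)
  show ?case
  proof (cases xs)
    case Nil then show ?thesis by (auto intro: weq.same)
  next
    case (Cons g ys)
    have g: "g \<in> xlet N" and ys: "set ys \<subseteq> xlet N" using 1 Cons by auto
    have s: "exX g + sumX ys = 0" using 1 Cons by simp
    have "flipX g \<in> set ys"
    proof (rule ccontr)
      assume n: "flipX g \<notin> set ys"
      consider i where "g = GX i" | i where "g = GXinv i" using g by (auto simp: xlet_def)
      then show False
      proof cases
        case 1
        then have "Poly_Mapping.lookup (sumX ys) i \<ge> 0" using sumX_coord_neg[OF ys] n by simp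
        moreover have "Poly_Mapping.lookup (exX g + sumX ys) i = 0" using s by simp
        ultimately show False using 1 by (simp add: lookup_add)
      next
        case 2
        then have "Poly_Mapping.lookup (sumX ys) i \<le> 0" using sumX_coord_pos[OF ys] n by simp
        moreover have "Poly_Mapping.lookup (exX g + sumX ys) i = 0" using s by simp
        ultimately show False using 2 by (simp add: lookup_add lookup_minus)
      qed
    qed
    then obtain as bs where ys_eq: "ys = as @ flipX g # bs" by (meson split_list)
    have sub: "set as \<subseteq> xlet N" "set bs \<subseteq> xlet N" using ys ys_eq by auto
    have gg: "set as \<subseteq> gens N" "set bs \<subseteq> gens N" "g \<in> gens N" "flipX g \<in> gens N"
      using sub g flipX_xlet[OF g] xlet_gens[of N] by auto
    have "weq N (g # as) (as @ [g])" by (rule weq_move_comm) (use gg sub g xlet_comm in auto)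
    from weq_append_right[OF this, of "flipX g # bs"] have "weq N xs (as @ [g, flipX g] @ bs)"
      using gg by (simp add: Cons ys_eq)
    moreover have "weq N (as @ [g, flipX g] @ bs) (as @ [] @ bs)"
      by (intro weq_append_left weq_append_right xlet_cancel g gg)
    moreover have "weq N (as @ bs) []"
    proof -
      have "sumX (as @ bs) = 0" using s by (simp add: ys_eq exX_flip algebra_simps)
      moreover have "length (as @ bs) < length xs" by (simp add: Cons ys_eq)
      ultimately show ?thesis using 1(1) sub by (metis set_append Un_least)
    qed
    ultimately show ?thesis using weq.trans by (metis append_Nil)
  qed
qed

lemma sumX_eq: "set xs \<subseteq> xlet N \<Longrightarrow> set ys \<subseteq> xlet N \<Longrightarrow> sumX xs = sumX ys \<Longrightarrow> weq N xs ys"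
proof -
  assume xs: "set xs \<subseteq> xlet N" and ys: "set ys \<subseteq> xlet N" and s: "sumX xs = sumX ys"
  let ?zs = "map flipX ys"
  have zs: "set ?zs \<subseteq> xlet N" using ys flipX_xlet by auto
  have "sumX ?zs = - sumX ys" by (induction ys) (simp_all add: exX_flip)
  then have z: "sumX (?zs @ ys) = 0" "sumX (xs @ ?zs) = 0" using s by simp_all
  have "weq N (?zs @ ys) []" by (rule sumX_zero[OF _ z(1)]) (use ys zs in simp)
  moreover have "weq N (xs @ ?zs) []" by (rule sumX_zero[OF _ z(2)]) (use xs zs in simp)
  ultimately have "weq N (xs @ ?zs @ ys) (xs @ [])" "weq N ((xs @ ?zs) @ ys) ([] @ ys)"
    using weq_append_left[of N "?zs @ ys" "[]" xs] weq_append_right[of N "xs @ ?zs" "[]" ys]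
      xs ys xlet_gens[of N] by (auto simp del: append_assoc)
  then show ?thesis using weq.trans[OF weq.sym] by (metis append_Nil append_Nil2 append_assoc)
qed

lemma weq_mset_Y: "set ys \<subseteq> GY ` {1..N} \<Longrightarrow> set zs \<subseteq> GY ` {1..N} \<Longrightarrow>
    (\<And>j. count_list ys (GY j) = count_list zs (GY j)) \<Longrightarrow> weq N ys zs"
proof (induction ys arbitrary: zs)
  case Nil
  have "zs = []"
  proof (rule ccontr)
    assume "zs \<noteq> []"
    then obtain j where "GY j \<in> set zs" using Nil by (cases zs) auto
    then show False using Nil(3)[of j] by (simp add: count_list_0_iff)
  qed
  then show ?case by (auto intro: weq.same)
next
  case (Cons g ys)
  obtain j where j: "g = GY j" "j \<in> {1..N}" using Cons.prems by auto
  have "count_list zs g \<noteq> 0" using Cons.prems(3)[of j] j by auto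
  then have "g \<in> set zs" by (metis count_list_0_iff)
  then obtain as bs where zs: "zs = as @ g # bs" by (meson split_list)
  have sub: "set as \<subseteq> GY ` {1..N}" "set bs \<subseteq> GY ` {1..N}" using Cons.prems zs by auto
  have gg: "set as \<subseteq> gens N" "set bs \<subseteq> gens N" using sub by auto
  have "count_list ys (GY i) = count_list (as @ bs) (GY i)" for i
    using Cons.prems(3)[of i] by (auto simp: zs split: if_splits)
  then have "weq N ys (as @ bs)" using Cons.IH[of "as @ bs"] Cons.prems sub by auto
  then have 1: "weq N (g # ys) (g # as @ bs)" by (rule weq_Cons) (use j in simp)
  have "weq N (g # as) (as @ [g])"
    by (rule weq_move_comm) (use gg sub j in \<open>auto intro!: weq.YY\<close>)
  from weq_append_right[OF this gg(2)] show ?case using weq.trans[OF 1] by (simp add: zs)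
qed

subsection \<open>The Coxeter presentation of the symmetric group\<close>

definition permS :: "nat list \<Rightarrow> nat \<Rightarrow> nat" where "permS is = foldr (\<lambda>i f. sr i \<circ> f) is id"

lemma permS_simps [simp]: "permS [] = id" "permS (i # is) = sr i \<circ> permS is"
  by (simp_all add: permS_def)
lemma bij_permS: "bij (permS is)"
proof (induction "is")
  case Nil
  show ?case unfolding permS_simps by (rule bij_id)
next
  case (Cons i "is")
  then show ?case unfolding permS_simps by (rule bij_comp) simp
qed

lemma permS_fix: "set is \<subseteq> {1..<n} \<Longrightarrow> n < m \<Longrightarrow> permS is m = m"
  by (induction "is") (auto simp: transpose_def)

lemma permS_cycle: "j \<le> n \<Longrightarrow> permS [j..<n] n = j"
proof (induction "n - j" arbitrary: j)
  case (Suc d)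
  then have "permS [Suc j..<n] n = Suc j" by simp
  moreover have "[j..<n] = j # [Suc j..<n]" using Suc by (simp add: upt_conv_Cons)
  ultimately show ?case by simp
qed simp

lemma weq_S_far: "i \<in> {1..<N} \<Longrightarrow> set js \<subseteq> {1..<N} \<Longrightarrow> (\<And>j. j \<in> set js \<Longrightarrow> i + 2 \<le> j \<or> j + 2 \<le> i) \<Longrightarrow>
    weq N (GS i # map GS js) (map GS js @ [GS i])"
proof (rule weq_move_comm)
  assume i: "i \<in> {1..<N}" and js: "set js \<subseteq> {1..<N}" and far: "\<And>j. j \<in> set js \<Longrightarrow> i + 2 \<le> j \<or> j + 2 \<le> i"
  show "weq N [GS i, h] [h, GS i]" if h: "h \<in> set (map GS js)" for h
  proof -
    obtain j where j: "j \<in> set js" "h = GS j" using h by auto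
    show ?thesis unfolding j(2) by (rule weq.ST[OF i _ far[OF j(1)]]) (use j js in auto)
  qed
qed auto

text \<open>The words s_j ... s_(n-1) represent the cosets of S_(n-1) in S_n. Multiplying one by s_i
  on the left commutes through, extends it, shortens it, or by the braid relation emerges on the
  right as s_(i-1); what remains on the right lies in S_(n-1).\<close>

lemma coset_step: "n \<le> N \<Longrightarrow> i \<in> {1..<n} \<Longrightarrow> j \<in> {1..n} \<Longrightarrow>
    \<exists>j'\<in>{1..n}. \<exists>is. set is \<subseteq> {1..<n - 1} \<and> weq N (GS i # map GS [j..<n]) (map GS [j'..<n] @ map GS is)"
proof -
  assume n: "n \<le> N" and i: "i \<in> {1..<n}" and j: "j \<in> {1..n}"
  consider "i + 1 < j" | "i + 1 = j" | "i = j" | "j < i" by linarith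
  then show ?thesis
  proof cases
    case 1
    have "weq N (GS i # map GS [j..<n]) (map GS [j..<n] @ map GS [i])"
      using weq_S_far[of i N "[j..<n]"] 1 n i j by auto
    then show ?thesis using 1 i j by (intro bexI[of _ j] exI[of _ "[i]"]) auto
  next
    case 2
    have "GS i # map GS [j..<n] = map GS [i..<n] @ map GS []" using 2 i by (simp add: upt_conv_Cons)
    moreover have "weq N (GS i # map GS [j..<n]) (GS i # map GS [j..<n])" using i j n by (intro weq.same) auto
    ultimately have "weq N (GS i # map GS [j..<n]) (map GS [i..<n] @ map GS [])" by metis
    then show ?thesis using i by (intro bexI[of _ i] exI[of _ "[]"]) auto
  next
    case 3
    have "weq N ([GS i, GS i] @ map GS [Suc i..<n]) ([] @ map GS [Suc i..<n])"
      by (intro weq_append_right weq.SS) (use i n in auto)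
    moreover have "[j..<n] = i # [Suc i..<n]" using 3 i by (simp add: upt_conv_Cons)
    ultimately have "weq N (GS i # map GS [j..<n]) (map GS [Suc i..<n] @ map GS [])" by simp
    then show ?thesis using i by (intro bexI[of _ "Suc i"] exI[of _ "[]"]) auto
  next
    case 4
    then obtain m where m: "i = m + 1" "j \<le> m" by (metis add.commute less_imp_Suc_add le_add1 plus_1_eq_Suc)
    have mN: "1 \<le> m" "m + 1 < n" "m + 1 < N" using i j m n by auto
    have split: "[j..<n] = [j..<m] @ [m, m + 1] @ [m + 2..<n]" by (rule upt_split_pair) (use m mN in auto)
    let ?a = "map GS [j..<m]" and ?b = "map GS [m + 2..<n]"
    have ga: "set ?a \<subseteq> gens N" "set ?b \<subseteq> gens N" using j n m mN by auto
    have g: "GS m \<in> gens N" "GS (m + 1) \<in> gens N" using mN by auto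
    have "weq N (GS (m + 1) # ?a) (?a @ [GS (m + 1)])" by (rule weq_S_far) (use m mN n j in auto)
    from weq_append_right[OF this, of "[GS m, GS (m + 1)] @ ?b"]
    have 1: "weq N (GS i # map GS [j..<n]) (?a @ [GS (m + 1), GS m, GS (m + 1)] @ ?b)"
      using ga g by (simp add: split m)
    have 2: "weq N (?a @ [GS (m + 1), GS m, GS (m + 1)] @ ?b) (?a @ [GS m, GS (m + 1), GS m] @ ?b)"
      by (intro weq_append_left weq_append_right weq.sym[OF weq.braid] ga mN)
    have "weq N (GS m # ?b) (?b @ [GS m])" by (rule weq_S_far) (use m mN n in auto)
    from weq_append_left[OF this, of "?a @ [GS m, GS (m + 1)]"]
    have 3: "weq N (?a @ [GS m, GS (m + 1), GS m] @ ?b) (map GS [j..<n] @ map GS [m])"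
      using ga g by (simp add: split)
    have "weq N (GS i # map GS [j..<n]) (map GS [j..<n] @ map GS [m])"
      using weq.trans[OF 1 weq.trans[OF 2 3]] .
    then show ?thesis using j mN by (intro bexI[of _ j] exI[of _ "[m]"]) auto
  qed
qed

lemma coset_decomp: "n \<le> N \<Longrightarrow> 1 \<le> n \<Longrightarrow> set is \<subseteq> {1..<n} \<Longrightarrow>
    \<exists>j\<in>{1..n}. \<exists>js. set js \<subseteq> {1..<n - 1} \<and> weq N (map GS is) (map GS [j..<n] @ map GS js)"
proof (induction "is")
  case Nil
  have "weq N (map GS []) (map GS [n..<n] @ map GS [])" by (simp add: weq.same)
  then show ?case using Nil by (intro bexI[of _ n] exI[of _ "[]"]) auto
next
  case (Cons i "is")
  then obtain j js where j: "j \<in> {1..n}" "set js \<subseteq> {1..<n - 1}" "weq N (map GS is) (map GS [j..<n] @ map GS js)"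
    by auto
  have i: "i \<in> {1..<n}" using Cons.prems by simp
  obtain j' ks where k: "j' \<in> {1..n}" "set ks \<subseteq> {1..<n - 1}" "weq N (GS i # map GS [j..<n]) (map GS [j'..<n] @ map GS ks)"
    using coset_step[OF Cons.prems(1) i j(1)] by auto
  have "weq N (GS i # map GS is) (GS i # (map GS [j..<n] @ map GS js))"
    by (rule weq_Cons[OF j(3)]) (use i Cons.prems in auto)
  moreover have "weq N ((GS i # map GS [j..<n]) @ map GS js) ((map GS [j'..<n] @ map GS ks) @ map GS js)"
    by (rule weq_append_right[OF k(3)]) (use j(2) Cons.prems(1) in fastforce)
  ultimately have "weq N (map GS (i # is)) (map GS [j'..<n] @ map GS (ks @ js))"
    using weq.trans by fastforce
  then show ?case using j k by (intro bexI[of _ j'] exI[of _ "ks @ js"]) auto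
qed

fun perm_gen :: "gen \<Rightarrow> nat \<Rightarrow> nat" where
  "perm_gen (GS i) = sr i" | "perm_gen _ = id"

definition imgP :: "gen list \<Rightarrow> nat \<Rightarrow> nat" where "imgP ws = foldr (\<lambda>g f. perm_gen g \<circ> f) ws id"

lemma imgP_simps [simp]: "imgP [] = id" "imgP (g # ws) = perm_gen g \<circ> imgP ws"
  by (simp_all add: imgP_def)
lemma imgP_append: "imgP (a @ b) = imgP a \<circ> imgP b" by (induction a) (simp_all add: o_assoc)
lemma imgP_GS: "imgP (map GS is) = permS is" by (induction "is") simp_all

lemma weq_imgP: "weq N a b \<Longrightarrow> imgP a = imgP b"
  by (induction rule: weq.induct) (auto simp: imgP_append fun_eq_iff transpose_def)

text \<open>After the coset decomposition, the image of the last point recovers the coset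
  representative, so equal permutations have equal representatives and the remainders are compared
  in the smaller group.\<close>

lemma weq_permS: "n \<le> N \<Longrightarrow> set is \<subseteq> {1..<n} \<Longrightarrow> set js \<subseteq> {1..<n} \<Longrightarrow> permS is = permS js \<Longrightarrow>
    weq N (map GS is) (map GS js)"
proof (induction n arbitrary: "is" js)
  case 0 then show ?case by (auto intro: weq.same)
next
  case (Suc n)
  obtain a is' where a: "a \<in> {1..Suc n}" "set is' \<subseteq> {1..<n}" "weq N (map GS is) (map GS [a..<Suc n] @ map GS is')"
    using coset_decomp[of "Suc n" N "is"] Suc.prems by auto
  obtain b js' where b: "b \<in> {1..Suc n}" "set js' \<subseteq> {1..<n}" "weq N (map GS js) (map GS [b..<Suc n] @ map GS js')"
    using coset_decomp[of "Suc n" N js] Suc.prems by auto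
  have pa: "permS is = permS [a..<Suc n] \<circ> permS is'"
    using weq_imgP[OF a(3)] by (simp only: imgP_append imgP_GS)
  have pb: "permS js = permS [b..<Suc n] \<circ> permS js'"
    using weq_imgP[OF b(3)] by (simp only: imgP_append imgP_GS)
  have fix': "permS is' (Suc n) = Suc n" "permS js' (Suc n) = Suc n"
    using permS_fix[OF a(2), of "Suc n"] permS_fix[OF b(2), of "Suc n"] by auto
  have "permS is (Suc n) = a" using permS_cycle[of a "Suc n"] a(1) fix' unfolding pa by (simp del: upt_Suc)
  moreover have "permS js (Suc n) = b" using permS_cycle[of b "Suc n"] b(1) fix' unfolding pb by (simp del: upt_Suc)
  ultimately have ab: "a = b" using Suc.prems(4) by simp
  have "permS [a..<Suc n] \<circ> permS is' = permS [a..<Suc n] \<circ> permS js'" using Suc.prems(4) pa pb ab by metis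
  then have "permS is' = permS js'" using bij_permS[THEN bij_is_inj, THEN inj_eq] by (simp add: fun_eq_iff)
  then have "weq N (map GS is') (map GS js')" using Suc a b by auto
  then have "weq N (map GS [a..<Suc n] @ map GS is') (map GS [b..<Suc n] @ map GS js')"
    unfolding ab by (rule weq_append_left) (use b(1) Suc.prems in auto)
  then show ?case using weq.trans[OF a(3)] weq.trans[OF _ weq.sym[OF b(3)]] by blast
qed

subsection \<open>Normal forms\<close>

text \<open>A transposition letter acts on everything to its right. Together with
  \<open>imgY\<close> and \<open>imgP\<close> this is the image of a word in the semidirect product
  presented by \<open>weq\<close>.\<close>

fun imgX :: "gen list \<Rightarrow> expo" where
  "imgX [] = 0"
| "imgX (g # ws) = exX g + subst_expo (perm_gen g) (imgX ws)"

fun imgY :: "gen list \<Rightarrow> nat \<Rightarrow> nat" where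
  "imgY [] = (\<lambda>j. 0)"
| "imgY (g # ws) = (\<lambda>j. (if g = GY j then 1 else 0) + imgY ws (perm_gen g j))"

lemma sumX_map_GX:
  "set xs \<subseteq> xlet N \<Longrightarrow> i \<in> {1..<N} \<Longrightarrow> \<exists>xs'. set xs' \<subseteq> xlet N \<and>
    weq N (GS i # xs) (xs' @ [GS i]) \<and> sumX xs' = subst_expo (sr i) (sumX xs)"
proof -
  assume xs: "set xs \<subseteq> xlet N" and i: "i \<in> {1..<N}"
  define f where "f g = (case g of GX j \<Rightarrow> GX (sr i j) | GXinv j \<Rightarrow> GXinv (sr i j) | _ \<Rightarrow> g)" for g
  have fx: "f g \<in> xlet N" if "g \<in> xlet N" for g using that sr_range[OF i] by (auto simp: xlet_def f_def)
  have "weq N (GS i # xs) (map f xs @ [GS i])"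
  proof (rule weq_move)
    show "weq N [GS i, h] [f h, GS i]" if "h \<in> set xs" for h
    proof -
      have "h \<in> xlet N" using that xs by auto
      then show ?thesis using i by (auto simp: xlet_def f_def intro: weq.SX[simplified] weq.SXi[simplified])
    qed
  qed (use i xs xlet_gens[of N] in auto)
  moreover have "sumX (map f xs) = subst_expo (sr i) (sumX xs)"
    using xs
  proof (induction xs)
    case (Cons g xs)
    have "exX (f g) = subst_expo (sr i) (exX g)"
      using Cons.prems by (auto simp: xlet_def f_def simp flip: single_uminus)
    then show ?case using Cons by (simp add: subst_expo_add)
  qed simp
  ultimately show ?thesis using xs fx by (intro exI[of _ "map f xs"]) auto
qed

lemma count_map_GY:
  "set ys \<subseteq> GY ` {1..N} \<Longrightarrow> i \<in> {1..<N} \<Longrightarrow> \<exists>ys'. set ys' \<subseteq> GY ` {1..N} \<and>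
    weq N (GS i # ys) (ys' @ [GS i]) \<and> (\<forall>j. count_list ys' (GY j) = count_list ys (GY (sr i j)))"
proof -
  assume ys: "set ys \<subseteq> GY ` {1..N}" and i: "i \<in> {1..<N}"
  define f where "f g = (case g of GY j \<Rightarrow> GY (sr i j) | _ \<Rightarrow> g)" for g
  have fy: "f g \<in> GY ` {1..N}" if "g \<in> GY ` {1..N}" for g using that sr_range[OF i] by (auto simp: f_def)
  have "weq N (GS i # ys) (map f ys @ [GS i])"
  proof (rule weq_move)
    show "weq N [GS i, h] [f h, GS i]" if "h \<in> set ys" for h
    proof -
      have "h \<in> GY ` {1..N}" using that ys by auto
      then show ?thesis using i by (auto simp: f_def intro: weq.SY[simplified])
    qed
  qed (use i ys in auto)
  moreover have "count_list (map f ys) (GY j) = count_list ys (GY (sr i j))" for j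
    using ys
  proof (induction ys)
    case (Cons g ys)
    then obtain m where m: "g = GY m" by auto
    have "sr i m = j \<longleftrightarrow> m = sr i j" by (metis transpose_involutory)
    then show ?case using Cons m by (simp add: f_def)
  qed simp
  ultimately show ?thesis using ys fy by (intro exI[of _ "map f ys"]) auto
qed

lemma normal_form: "set ws \<subseteq> gens N \<Longrightarrow> \<exists>xs ys is. set xs \<subseteq> xlet N \<and> set ys \<subseteq> GY ` {1..N} \<and> set is \<subseteq> {1..<N} \<and>
    weq N ws (xs @ ys @ map GS is) \<and> sumX xs = imgX ws \<and> (\<forall>j. count_list ys (GY j) = imgY ws j) \<and> permS is = imgP ws"
proof (induction ws)
  case Nil
  then show ?case by (intro exI[of _ "[]"]) (simp add: weq.same)
next
  case (Cons g ws)
  then obtain xs ys "is" where IH: "set xs \<subseteq> xlet N" "set ys \<subseteq> GY ` {1..N}" "set is \<subseteq> {1..<N}"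
    "weq N ws (xs @ ys @ map GS is)" "sumX xs = imgX ws" "\<And>j. count_list ys (GY j) = imgY ws j" "permS is = imgP ws"
    by auto
  have gg: "set xs \<subseteq> gens N" "set ys \<subseteq> gens N" "set (map GS is) \<subseteq> gens N" "g \<in> gens N"
    using IH xlet_gens[of N] Cons.prems by auto
  have w: "weq N (g # ws) (g # xs @ ys @ map GS is)" by (rule weq_Cons[OF IH(4) gg(4)])
  show ?case
  proof (cases g)
    case (GX i)
    then have "set (g # xs) \<subseteq> xlet N" using IH gg(4) by (auto simp: xlet_def)
    then show ?thesis using IH w GX
      by (intro exI[of _ "g # xs"] exI[of _ ys] exI[of _ "is"]) (simp add: subst_expo_id)
  next
    case (GXinv i)
    then have "set (g # xs) \<subseteq> xlet N" using IH gg(4) by (auto simp: xlet_def)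
    then show ?thesis using IH w GXinv
      by (intro exI[of _ "g # xs"] exI[of _ ys] exI[of _ "is"]) (simp add: subst_expo_id)
  next
    case (GY i)
    then have i: "i \<in> {1..N}" using gg(4) by simp
    have "weq N [g, h] [h, g]" if "h \<in> set xs" for h
    proof -
      have "h \<in> xlet N" using that IH(1) by auto
      then show ?thesis using i GY by (auto simp: xlet_def intro: weq.YX weq.YXi)
    qed
    then have "weq N (g # xs) (xs @ [g])" by (rule weq_move_comm) (use gg in auto)
    from weq_append_right[OF this, of "ys @ map GS is"] have "weq N (g # ws) (xs @ (g # ys) @ map GS is)"
      using weq.trans[OF w] gg by simp
    then show ?thesis using IH i GY
      by (intro exI[of _ xs] exI[of _ "g # ys"] exI[of _ "is"]) (simp add: subst_expo_id)
  next
    case (GS i)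
    then have i: "i \<in> {1..<N}" using gg(4) by simp
    obtain xs' where xs': "set xs' \<subseteq> xlet N" "weq N (GS i # xs) (xs' @ [GS i])" "sumX xs' = subst_expo (sr i) (sumX xs)"
      using sumX_map_GX[OF IH(1) i] by blast
    obtain ys' where ys': "set ys' \<subseteq> GY ` {1..N}" "weq N (GS i # ys) (ys' @ [GS i])"
      "\<And>j. count_list ys' (GY j) = count_list ys (GY (sr i j))"
      using count_map_GY[OF IH(2) i] by blast
    have g': "set xs' \<subseteq> gens N" using xs'(1) xlet_gens[of N] by auto
    have 1: "weq N ((GS i # xs) @ ys @ map GS is) ((xs' @ [GS i]) @ ys @ map GS is)"
      by (rule weq_append_right[OF xs'(2)]) (use gg in auto)
    have 2: "weq N (xs' @ (GS i # ys) @ map GS is) (xs' @ (ys' @ [GS i]) @ map GS is)"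
      by (intro weq_append_left weq_append_right ys'(2) g' gg)
    have "weq N (g # ws) (xs' @ ys' @ map GS (i # is))"
      using weq.trans[OF w] weq.trans[OF 1] 2 GS by simp
    then show ?thesis using IH i GS xs' ys'
      by (intro exI[of _ xs'] exI[of _ ys'] exI[of _ "i # is"]) simp
  qed
qed

text \<open>The image determines the three parts of the normal form, each up to relations among
  letters of one kind: cancellation of X, commutation of y, Coxeter relations.\<close>

lemma weq_complete:
  assumes "set v \<subseteq> gens N" "set w \<subseteq> gens N" "imgX v = imgX w" "imgY v = imgY w" "imgP v = imgP w"
  shows "weq N v w"
proof -
  obtain xs ys "is" where v: "set xs \<subseteq> xlet N" "set ys \<subseteq> GY ` {1..N}" "set is \<subseteq> {1..<N}"
    "weq N v (xs @ ys @ map GS is)" "sumX xs = imgX v" "\<And>j. count_list ys (GY j) = imgY v j" "permS is = imgP v"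
    using normal_form[OF assms(1)] by blast
  obtain xs' ys' is' where w: "set xs' \<subseteq> xlet N" "set ys' \<subseteq> GY ` {1..N}" "set is' \<subseteq> {1..<N}"
    "weq N w (xs' @ ys' @ map GS is')" "sumX xs' = imgX w" "\<And>j. count_list ys' (GY j) = imgY w j" "permS is' = imgP w"
    using normal_form[OF assms(2)] by blast
  have "weq N (xs @ ys @ map GS is) (xs' @ ys' @ map GS is')"
    using v w assms by (intro weq.append sumX_eq weq_mset_Y weq_permS[of N]) simp_all
  then show ?thesis using weq.trans[OF v(4)] weq.trans[OF _ weq.sym[OF w(4)]] by blast
qed

section \<open>Vanishing of coefficients: symbols of words as differential operators with
  permutations\<close>

section \<open>Differential operators with permutations\<close>

type_synonym sym = "expo \<times> (nat \<Rightarrow> nat) \<times> (nat \<Rightarrow> nat)"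

definition pw :: "nat \<Rightarrow> (nat \<Rightarrow> nat) \<Rightarrow> complex \<Rightarrow> expo \<Rightarrow> complex" where
  "pw N b u n = (\<Prod>j\<in>{1..N}. (of_int (Poly_Mapping.lookup n j) + u) ^ b j)"

definition th :: "complex \<Rightarrow> nat \<Rightarrow> lop" where
  "th u j = mono_op (\<lambda>n. con (of_int (Poly_Mapping.lookup n j) + u) * mnm n)"

text \<open>\<open>mon N u (a, b, w)\<close> is the operator \<open>X\<^bsup>a\<^esup> \<theta>\<^bsup>b\<^esup> w\<close>, where \<open>\<theta>\<^sub>j\<close> acts as \<open>X\<^sub>j d/dX\<^sub>j + u\<close>.\<close>

definition mon :: "nat \<Rightarrow> complex \<Rightarrow> sym \<Rightarrow> lop" where
  "mon N u m = (case m of (a, b, w) \<Rightarrow>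
     mono_op (\<lambda>n. con (pw N b u (subst_expo w n)) * mnm (a + subst_expo w n)))"

definition valid :: "nat \<Rightarrow> sym \<Rightarrow> bool" where
  "valid N m \<longleftrightarrow> (case m of (a, b, w) \<Rightarrow> (\<forall>j. j \<notin> {1..N} \<longrightarrow> b j = 0 \<and> w j = j) \<and> bij w)"

definition deg :: "nat \<Rightarrow> sym \<Rightarrow> nat" where "deg N m = (\<Sum>j\<in>{1..N}. fst (snd m) j)"

lemma app_mon: "app (mon N u (a, b, w)) (mnm n) =
    Poly_Mapping.single (a + subst_expo w n) (pw N b u (subst_expo w n))"
  by (simp add: mon_def mult_single)

lemma app_th: "app (th u j) (mnm n) = Poly_Mapping.single n (of_int (Poly_Mapping.lookup n j) + u)"
  by (simp add: th_def mult_single)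

lemma Xm_mon: "Xm c * mon N u (a, b, w) = mon N u (c + a, b, w)"
  by (rule lop_eqI) (simp only: app_times app_mon app_mulop mult_single mult_1_left add.assoc)

lemma Xm_sop: "Xm a * sop w = mon N u (a, (\<lambda>j. 0), w)"
  by (rule lop_eqI) (simp only: app_times app_mon app_mulop app_sop, simp add: mult_single pw_def)

lemma app_th_single: "app (th u j) (Poly_Mapping.single n c) = Poly_Mapping.single n (c * (of_int (Poly_Mapping.lookup n j) + u))"
  by (simp add: th_def mult_single)

lemma th_mon: "j \<in> {1..N} \<Longrightarrow> th u j * mon N u (a, b, w) =
    mon N u (a, b(j := Suc (b j)), w) + cst (of_int (Poly_Mapping.lookup a j)) * mon N u (a, b, w)"
proof (rule lop_eqI)
  fix n assume j: "j \<in> {1..N}"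
  let ?n = "subst_expo w n"
  have "pw N (b(j := Suc (b j))) u ?n = (of_int (Poly_Mapping.lookup ?n j) + u) * pw N b u ?n"
    unfolding pw_def using j by (simp add: prod.remove[of _ j] mult.assoc)
  then have *: "pw N b u ?n * (of_int (Poly_Mapping.lookup (a + ?n) j) + u) =
      pw N (b(j := Suc (b j))) u ?n + of_int (Poly_Mapping.lookup a j) * pw N b u ?n"
    by (simp add: lookup_add algebra_simps)
  show "app (th u j * mon N u (a, b, w)) (mnm n) = app (mon N u (a, b(j := Suc (b j)), w) +
      cst (of_int (Poly_Mapping.lookup a j)) * mon N u (a, b, w)) (mnm n)"
    by (simp only: app_times app_mon app_plus app_th_single app_mulop mult_single add_0_left single_add[symmetric] *)
qed

definition fixes_outside :: "nat \<Rightarrow> (nat \<Rightarrow> nat) \<Rightarrow> bool" where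
  "fixes_outside N \<sigma> \<longleftrightarrow> bij \<sigma> \<and> (\<forall>j. j \<notin> {1..N} \<longrightarrow> \<sigma> j = j)"

lemma fixes_outside_betw: "fixes_outside N \<sigma> \<Longrightarrow> bij_betw \<sigma> {1..N} {1..N}"
proof -
  assume \<sigma>: "fixes_outside N \<sigma>"
  then have inj: "inj \<sigma>" by (simp add: fixes_outside_def bij_is_inj)
  have "\<sigma> j \<in> {1..N}" if "j \<in> {1..N}" for j
  proof (rule ccontr)
    assume "\<sigma> j \<notin> {1..N}"
    then have "\<sigma> (\<sigma> j) = \<sigma> j" using \<sigma> unfolding fixes_outside_def by blast
    then have "\<sigma> j = j" by (rule injD[OF inj])
    then show False using \<open>\<sigma> j \<notin> {1..N}\<close> that by simp
  qed
  then have sub: "\<sigma> ` {1..N} \<subseteq> {1..N}" by blast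
  have io: "inj_on \<sigma> {1..N}" using inj by (rule inj_on_subset) simp
  have "\<sigma> ` {1..N} = {1..N}" by (rule endo_inj_surj[OF _ sub io]) simp
  with io show ?thesis by (simp add: bij_betw_def)
qed

lemma fixes_outside_sr: "i \<in> {1..<N} \<Longrightarrow> fixes_outside N (sr i)"
  by (auto simp: fixes_outside_def transpose_def)

lemma inv_sr: "inv_into UNIV (sr i) = sr i"
  by (rule inv_equality) simp_all

lemma pw_perm:
  assumes \<sigma>: "fixes_outside N \<sigma>"
  shows "pw N (\<lambda>j. b (inv_into UNIV \<sigma> j)) u (subst_expo \<sigma> n) = pw N b u n"
proof -
  have inj: "inj \<sigma>" using \<sigma> by (simp add: fixes_outside_def bij_is_inj)
  let ?f = "\<lambda>j. (of_int (Poly_Mapping.lookup (subst_expo \<sigma> n) j) + u) ^ b (inv_into UNIV \<sigma> j)"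
  have "prod ?f {1..N} = (\<Prod>j\<in>{1..N}. ?f (\<sigma> j))"
    by (rule prod.reindex_bij_betw[OF fixes_outside_betw[OF \<sigma>], symmetric])
  then show ?thesis by (simp add: pw_def lookup_subst_expo[OF inj] inv_f_f[OF inj])
qed

lemma sop_mon_perm: "fixes_outside N \<sigma> \<Longrightarrow> sop \<sigma> * mon N u (a, b, w) =
    mon N u (subst_expo \<sigma> a, (\<lambda>j. b (inv_into UNIV \<sigma> j)), \<sigma> \<circ> w)"
  by (rule lop_eqI)
    (simp only: app_times app_mon app_sop subst_expo_add subst_expo_comp[symmetric] pw_perm)

lemma sop_mon: "i \<in> {1..<N} \<Longrightarrow> sop (sr i) * mon N u (a, b, w) =
    mon N u (subst_expo (sr i) a, (\<lambda>j. b (sr i j)), sr i \<circ> w)"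
  using sop_mon_perm[OF fixes_outside_sr, of i N u a b w] by (simp only: inv_sr)

definition realize :: "nat \<Rightarrow> complex \<Rightarrow> (sym \<Rightarrow>\<^sub>0 complex) \<Rightarrow> lop" where
  "realize N u = lext cst (mon N u)"

lemma realize_add: "realize N u (d + e) = realize N u d + realize N u e"
  unfolding realize_def by (rule cst.lext_add)
lemma realize_single: "realize N u (Poly_Mapping.single m c) = cst c * mon N u m"
  unfolding realize_def by (rule cst.lext_single)
lemma realize_zero: "realize N u 0 = 0" by (simp add: realize_def)

text \<open>Families of operators, indexed by the twist, of order less than \<open>r\<close>.\<close>

definition NF :: "nat \<Rightarrow> nat \<Rightarrow> (complex \<Rightarrow> lop) set" where
  "NF N r = {F. \<exists>d. (\<forall>m\<in>Poly_Mapping.keys d. valid N m \<and> deg N m < r) \<and> F = (\<lambda>u. realize N u d)}"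

lemma NF_zero: "(\<lambda>u. 0) \<in> NF N r" unfolding NF_def by (auto intro!: exI[of _ 0] simp: realize_zero)
lemma NF_add: "F \<in> NF N r \<Longrightarrow> G \<in> NF N r \<Longrightarrow> (\<lambda>u. F u + G u) \<in> NF N r"
proof -
  assume "F \<in> NF N r" "G \<in> NF N r"
  then obtain d e where d: "\<forall>m\<in>Poly_Mapping.keys d. valid N m \<and> deg N m < r" "F = (\<lambda>u. realize N u d)"
    and e: "\<forall>m\<in>Poly_Mapping.keys e. valid N m \<and> deg N m < r" "G = (\<lambda>u. realize N u e)" unfolding NF_def by blast
  show ?thesis unfolding NF_def mem_Collect_eq
  proof (rule exI[of _ "d + e"], intro conjI ballI)
    fix m assume "m \<in> Poly_Mapping.keys (d + e)"
    then have "m \<in> Poly_Mapping.keys d \<union> Poly_Mapping.keys e" using Poly_Mapping.keys_add[of d e] by blast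
    then show "valid N m" "deg N m < r" using d(1) e(1) by blast+
  qed (simp only: d(2) e(2) realize_add)
qed
lemma NF_single: "valid N m \<Longrightarrow> deg N m < r \<Longrightarrow> (\<lambda>u. cst c * mon N u m) \<in> NF N r"
  unfolding NF_def mem_Collect_eq
  by (rule exI[of _ "Poly_Mapping.single m c"]) (simp add: realize_single)
lemma NF_mon: "valid N m \<Longrightarrow> deg N m < r \<Longrightarrow> (\<lambda>u. mon N u m) \<in> NF N r"
  using NF_single[of N m r 1] by (simp add: cst.sc_one)
lemma NF_mono: "F \<in> NF N r \<Longrightarrow> r \<le> s \<Longrightarrow> F \<in> NF N s"
  unfolding NF_def using less_le_trans by blast

lemma NF_scal: "F \<in> NF N r \<Longrightarrow> (\<lambda>u. cst c * F u) \<in> NF N r"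
proof -
  assume "F \<in> NF N r"
  then obtain d where d: "\<forall>m\<in>Poly_Mapping.keys d. valid N m \<and> deg N m < r" "F = (\<lambda>u. realize N u d)"
    unfolding NF_def by blast
  have "(\<lambda>u. cst c * realize N u d) \<in> NF N r"
  proof (induction d rule: poly_mapping_additive_induct)
    case zero show ?case by (simp only: realize_zero mult_zero_right NF_zero)
  next
    case (single m e)
    then have "valid N m" "deg N m < r" using d(1) by blast+
    from NF_single[OF this, of "c * e"] show ?case unfolding realize_single cst.sc_mult mult.assoc .
  next
    case (add p q)
    show ?case unfolding realize_add distrib_left by (rule NF_add[OF add(1,2)])
  qed
  then show ?thesis unfolding d(2) .
qed

lemma NF_map:
  assumes F: "F \<in> NF N r"
    and step: "\<And>m. valid N m \<Longrightarrow> deg N m < r \<Longrightarrow> (\<lambda>u. L u * mon N u m) \<in> NF N s"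
  shows "(\<lambda>u. L u * F u) \<in> NF N s"
proof -
  obtain d where d: "\<forall>m\<in>Poly_Mapping.keys d. valid N m \<and> deg N m < r" "F = (\<lambda>u. realize N u d)"
    using F unfolding NF_def by blast
  have "(\<lambda>u. L u * realize N u d) \<in> NF N s"
  proof (induction d rule: poly_mapping_additive_induct)
    case zero show ?case by (simp only: realize_zero mult_zero_right NF_zero)
  next
    case (single m c)
    then have "valid N m" "deg N m < r" using d(1) by blast+
    from NF_scal[OF step[OF this], of c] show ?case unfolding realize_single cst.sc_left_commute .
  next
    case (add p q)
    show ?case unfolding realize_add distrib_left by (rule NF_add[OF add(1,2)])
  qed
  then show ?thesis unfolding d(2) .
qed

lemma NF_minus: "F \<in> NF N r \<Longrightarrow> (\<lambda>u. - F u) \<in> NF N r"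
  using NF_scal[of F N r "- 1"] by (simp only: cst.sc_minus cst.sc_one mult_minus_left mult_1_left)
lemma NF_diff: "F \<in> NF N r \<Longrightarrow> G \<in> NF N r \<Longrightarrow> (\<lambda>u. F u - G u) \<in> NF N r"
  using NF_add[OF _ NF_minus, of F N r G] by (simp only: diff_conv_add_uminus)
lemma NF_sum: "(\<And>x. x \<in> S \<Longrightarrow> f x \<in> NF N r) \<Longrightarrow> (\<lambda>u. \<Sum>x\<in>S. f x u) \<in> NF N r"
proof (induction S rule: infinite_finite_induct)
  case (insert x S)
  have "(\<lambda>u. f x u + (\<Sum>x\<in>S. f x u)) \<in> NF N r"
    by (rule NF_add[OF insert.prems insert.IH]) (use insert.prems in blast)+
  then show ?case by (simp only: sum.insert[OF insert.hyps])
qed (simp_all only: sum.infinite sum.empty NF_zero not_False_eq_True)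

lemma NF_Xm: "F \<in> NF N r \<Longrightarrow> (\<lambda>u. Xm c * F u) \<in> NF N r"
proof (rule NF_map)
  fix m assume m: "valid N m" "deg N m < r"
  obtain a b w where mm: "m = (a, b, w)" by (cases m) auto
  show "(\<lambda>u. Xm c * mon N u m) \<in> NF N r"
    unfolding mm Xm_mon by (rule NF_mon) (use m in \<open>simp_all add: mm valid_def deg_def\<close>)
qed

lemma mulop_decomp: "mulop p = (\<Sum>a\<in>Poly_Mapping.keys p. cst (Poly_Mapping.lookup p a) * Xm a)"
proof -
  have "mulop p = mulop (\<Sum>a\<in>Poly_Mapping.keys p. Poly_Mapping.single a (Poly_Mapping.lookup p a))"
    by (simp only: poly_mapping_decomp[symmetric])
  also have "\<dots> = (\<Sum>a\<in>Poly_Mapping.keys p. mulop (Poly_Mapping.single a (Poly_Mapping.lookup p a)))"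
    by (rule additive_sum[OF mulop_add])
  also have "\<dots> = (\<Sum>a\<in>Poly_Mapping.keys p. cst (Poly_Mapping.lookup p a) * Xm a)"
    by (simp add: mult_single flip: mulop_mult)
  finally show ?thesis .
qed

lemma NF_mulop: "F \<in> NF N r \<Longrightarrow> (\<lambda>u. mulop p * F u) \<in> NF N r"
  unfolding mulop_decomp[of p] sum_distrib_right mult.assoc
  by (intro NF_sum NF_scal NF_Xm)

lemma valid_eq: "valid N (a, b, w) \<longleftrightarrow> (\<forall>j. j \<notin> {1..N} \<longrightarrow> b j = 0) \<and> fixes_outside N w"
  by (auto simp: valid_def fixes_outside_def)

lemma fixes_outside_comp: "fixes_outside N \<sigma> \<Longrightarrow> fixes_outside N \<tau> \<Longrightarrow> fixes_outside N (\<sigma> \<circ> \<tau>)"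
  unfolding fixes_outside_def by (auto intro: bij_comp)

lemma fixes_outside_inv: "fixes_outside N \<sigma> \<Longrightarrow> fixes_outside N (inv_into UNIV \<sigma>)"
  unfolding fixes_outside_def by (metis bij_imp_bij_inv bij_is_inj inv_f_f)

lemma deg_perm: "fixes_outside N \<sigma> \<Longrightarrow> (\<Sum>j\<in>{1..N}. b (inv_into UNIV \<sigma> j)) = (\<Sum>j\<in>{1..N}. b j :: nat)"
  by (rule sum.reindex_bij_betw[OF fixes_outside_betw[OF fixes_outside_inv]])

lemma valid_perm: "fixes_outside N \<sigma> \<Longrightarrow> valid N (a, b, w) \<Longrightarrow> valid N (a', (\<lambda>j. b (inv_into UNIV \<sigma> j)), \<sigma> \<circ> w)"
  unfolding valid_eq using fixes_outside_comp[of N \<sigma> w] fixes_outside_inv[of N \<sigma>]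
  by (auto simp: fixes_outside_def)

lemma deg_sr: "i \<in> {1..<N} \<Longrightarrow> (\<Sum>j\<in>{1..N}. b (sr i j)) = (\<Sum>j\<in>{1..N}. b j :: nat)"
  using deg_perm[OF fixes_outside_sr, of i N b] by (simp only: inv_sr)

lemma valid_sr: "i \<in> {1..<N} \<Longrightarrow> valid N (a, b, w) \<Longrightarrow> valid N (a', (\<lambda>j. b (sr i j)), sr i \<circ> w)"
  using valid_perm[OF fixes_outside_sr, of i N a b w a'] by (simp only: inv_sr)

lemma NF_perm: "fixes_outside N \<sigma> \<Longrightarrow> F \<in> NF N r \<Longrightarrow> (\<lambda>u. sop \<sigma> * F u) \<in> NF N r"
proof (rule NF_map)
  fix m assume \<sigma>: "fixes_outside N \<sigma>" and m: "valid N m" "deg N m < r"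
  obtain a b w where mm: "m = (a, b, w)" by (cases m) auto
  show "(\<lambda>u. sop \<sigma> * mon N u m) \<in> NF N r"
    unfolding mm sop_mon_perm[OF \<sigma>]
    by (rule NF_mon[OF valid_perm[OF \<sigma> m(1)[unfolded mm]]]) (use m deg_perm[OF \<sigma>, of b] in \<open>simp add: mm deg_def\<close>)
qed

lemma NF_sop: "i \<in> {1..<N} \<Longrightarrow> F \<in> NF N r \<Longrightarrow> (\<lambda>u. sop (sr i) * F u) \<in> NF N r"
  by (rule NF_perm[OF fixes_outside_sr])

lemma NF_th: "j \<in> {1..N} \<Longrightarrow> F \<in> NF N r \<Longrightarrow> (\<lambda>u. th u j * F u) \<in> NF N (Suc r)"
proof (rule NF_map)
  fix m assume j: "j \<in> {1..N}" and m: "valid N m" "deg N m < r"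
  obtain a b w where mm: "m = (a, b, w)" by (cases m) auto
  have "deg N (a, b(j := Suc (b j)), w) = Suc (deg N m)"
    using j by (simp add: deg_def mm sum.remove[of _ j])
  moreover have "valid N (a, b(j := Suc (b j)), w)" using m j by (auto simp: valid_def mm)
  ultimately show "(\<lambda>u. th u j * mon N u m) \<in> NF N (Suc r)"
    unfolding mm th_mon[OF j] using m by (intro NF_add NF_mon NF_single) (auto simp: mm)
qed

section \<open>Structure of the operators y at \<open>\<epsilon> = 0\<close>\<close>

text \<open>The product over ordered pairs is, up to sign, the square of the Vandermonde product.
  Being symmetric, it commutes with permutations, which the Vandermonde product itself would
  not.\<close>

definition dlt :: "nat \<Rightarrow> lpoly" where
  "dlt N = (\<Prod>(i, j)\<in>{(i, j). i \<in> {1..N} \<and> j \<in> {1..N} \<and> i \<noteq> j}.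
     mnm (Poly_Mapping.single i 1) - mnm (Poly_Mapping.single j 1))"

abbreviation Dl :: "nat \<Rightarrow> lop" where "Dl N \<equiv> mulop (dlt N)"

lemma finite_pairs: "finite {(i, j). i \<in> {1..N::nat} \<and> j \<in> {1..N} \<and> i \<noteq> j}"
  by (rule finite_subset[of _ "{1..N} \<times> {1..N}"]) auto

lemma sop_mulop: "sop \<sigma> * mulop p = mulop (app (sop \<sigma>) p) * sop \<sigma>"
proof (induction p rule: poly_mapping_additive_induct)
  case (single a c)
  then show ?case by (intro lop_eqI) (simp add: mult_single subst_expo_add)
qed (simp_all add: mulop_add app_add distrib_left distrib_right)

lemma app_sop_mult: "app (sop \<sigma>) (p * q) = app (sop \<sigma>) p * app (sop \<sigma>) q"
  using arg_cong[OF sop_mulop[of \<sigma> p], of "\<lambda>A. app A q"] by simp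

lemma app_sop_prod: "finite S \<Longrightarrow> app (sop \<sigma>) (prod f S) = (\<Prod>x\<in>S. app (sop \<sigma>) (f x))"
  by (induction S rule: finite_induct) (simp_all add: app_sop_mult)

lemma sop_dlt: "i \<in> {1..<N} \<Longrightarrow> app (sop (sr i)) (dlt N) = dlt N"
proof -
  assume i: "i \<in> {1..<N}"
  let ?S = "{(i, j). i \<in> {1..N} \<and> j \<in> {1..N} \<and> i \<noteq> j}"
  let ?f = "\<lambda>(i, j). mnm (Poly_Mapping.single i (1::int)) - mnm (Poly_Mapping.single j 1)"
  let ?h = "\<lambda>(p, q). (sr i p, sr i q)"
  have "app (sop (sr i)) (dlt N) = (\<Prod>x\<in>?S. ?f (?h x))"
    unfolding dlt_def app_sop_prod[OF finite_pairs]
    by (rule prod.cong) (auto simp: app_diff)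
  also have "\<dots> = prod ?f ?S"
  proof (rule prod.reindex_bij_witness[of _ ?h ?h])
    fix x assume x: "x \<in> ?S"
    then show "?h x \<in> ?S" using sr_range[OF i] by (auto dest: injD[OF inj_transpose])
    then show "?h x \<in> ?S" .
  qed auto
  finally show ?thesis by (simp add: dlt_def)
qed

lemma sop_Dl: "i \<in> {1..<N} \<Longrightarrow> sop (sr i) * Dl N = Dl N * sop (sr i)"
  by (simp only: sop_mulop sop_dlt)

lemma dlt_factor: "i \<in> {1..<N} \<Longrightarrow> \<exists>p. dlt N = p * (mnm (sroot i) - 1)"
proof -
  assume i: "i \<in> {1..<N}"
  let ?S = "{(i, j). i \<in> {1..N} \<and> j \<in> {1..N} \<and> i \<noteq> j}"
  let ?f = "\<lambda>(i, j). mnm (Poly_Mapping.single i (1::int)) - mnm (Poly_Mapping.single j 1)"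
  have "(i, i + 1) \<in> ?S" using i by auto
  then have "dlt N = ?f (i, i + 1) * prod ?f (?S - {(i, i + 1)})"
    unfolding dlt_def by (rule prod.remove[OF finite_pairs])
  also have "?f (i, i + 1) = mnm (Poly_Mapping.single (i + 1) 1) * (mnm (sroot i) - 1)"
    by (simp add: right_diff_distrib mnm_mult)
  finally have "dlt N = (mnm (Poly_Mapping.single (i + 1) 1) * prod ?f (?S - {(i, i + 1)})) * (mnm (sroot i) - 1)"
    by (simp only: mult_ac)
  then show ?thesis by blast
qed

text \<open>Operators of order zero with denominators that one factor of the discriminant clears.
  Commutation with \<open>Dl N\<close> allows powers of the discriminant to be collected on the left
  of products.\<close>

definition ZZ :: "nat \<Rightarrow> lop set" where
  "ZZ N = {A. (\<lambda>u. Dl N * A) \<in> NF N 1 \<and> A * Dl N = Dl N * A}"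

lemma valid_one: "valid N (a, (\<lambda>j. 0), id)" by (simp add: valid_def)

lemma NF_mulop_const: "(\<lambda>u. mulop p) \<in> NF N 1"
proof -
  have "(\<lambda>u. mulop p * mon N u (0, (\<lambda>j. 0), id)) \<in> NF N 1"
    by (intro NF_mulop NF_mon valid_one) (simp add: deg_def)
  then show ?thesis unfolding Xm_sop[symmetric] by (simp add: sop_id)
qed

lemma ZZ_add: "A \<in> ZZ N \<Longrightarrow> B \<in> ZZ N \<Longrightarrow> A + B \<in> ZZ N"
  unfolding ZZ_def using NF_add[of "\<lambda>u. Dl N * A" N 1 "\<lambda>u. Dl N * B"] by (simp add: distrib_left distrib_right)

lemma ZZ_scal: "A \<in> ZZ N \<Longrightarrow> cst c * A \<in> ZZ N"
  unfolding ZZ_def using NF_scal[of "\<lambda>u. Dl N * A" N 1 c]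
  by (simp add: cst.sc_left_commute mult.assoc del: mulop_mult)

lemma ZZ_one: "1 \<in> ZZ N" unfolding ZZ_def using NF_mulop_const by simp

lemma ZZ_sop_left: "i \<in> {1..<N} \<Longrightarrow> A \<in> ZZ N \<Longrightarrow> sop (sr i) * A \<in> ZZ N"
proof -
  assume i: "i \<in> {1..<N}" and A: "A \<in> ZZ N"
  have "(\<lambda>u. sop (sr i) * (Dl N * A)) \<in> NF N 1" using A by (intro NF_sop i) (simp add: ZZ_def)
  moreover have "sop (sr i) * (Dl N * A) = Dl N * (sop (sr i) * A)" by (simp only: mult.assoc[symmetric] sop_Dl[OF i])
  moreover have "sop (sr i) * A * Dl N = Dl N * (sop (sr i) * A)"
    by (rule intertwine_mult[OF sop_Dl[OF i, symmetric], symmetric]) (use A in \<open>simp add: ZZ_def\<close>)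
  ultimately show ?thesis by (simp add: ZZ_def)
qed

lemma NF_sop_right: "i \<in> {1..<N} \<Longrightarrow> (\<lambda>u. A) \<in> NF N 1 \<Longrightarrow> (\<lambda>u. A * sop (sr i)) \<in> NF N 1"
proof -
  assume i: "i \<in> {1..<N}" and "(\<lambda>u. A) \<in> NF N 1"
  then obtain d where d: "\<forall>m\<in>Poly_Mapping.keys d. valid N m \<and> deg N m < 1" "(\<lambda>u. A) = (\<lambda>u. realize N u d)"
    unfolding NF_def by blast
  have "(\<lambda>u. realize N u d * sop (sr i)) \<in> NF N 1"
  proof (induction d rule: poly_mapping_additive_induct)
    case zero show ?case by (simp only: realize_zero mult_zero_left mult_zero_right NF_zero)
  next
    case (single m c)
    obtain a b w where mm: "m = (a, b, w)" by (cases m) auto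
    have v: "valid N (a, b, w)" "deg N (a, b, w) < 1" using single d(1) mm by blast+
    have b: "b = (\<lambda>j. 0)" using v by (auto simp: valid_def deg_def fun_eq_iff)
    have "mon N u m * sop (sr i) = mon N u (a, (\<lambda>j. 0), w \<circ> sr i)" for u
      unfolding mm b Xm_sop[symmetric] mult.assoc sop_comp ..
    moreover have "valid N (a, (\<lambda>j. 0), w \<circ> sr i)"
      using v(1) fixes_outside_comp[OF _ fixes_outside_sr[OF i], of w] by (simp add: valid_eq)
    ultimately show ?case
      unfolding realize_single mult.assoc by (simp only:) (rule NF_single, auto simp: deg_def)
  next
    case (add p q)
    show ?case unfolding realize_add distrib_right by (rule NF_add[OF add(1,2)])
  qed
  moreover have "realize N u d = A" for u using fun_cong[OF d(2)] by simp
  ultimately show ?thesis by (simp only:)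
qed

lemma ZZ_sop_right: "i \<in> {1..<N} \<Longrightarrow> A \<in> ZZ N \<Longrightarrow> A * sop (sr i) \<in> ZZ N"
proof -
  assume i: "i \<in> {1..<N}" and A: "A \<in> ZZ N"
  have "(\<lambda>u. Dl N * A * sop (sr i)) \<in> NF N 1" using A by (intro NF_sop_right i) (simp add: ZZ_def)
  moreover have "Dl N * (A * sop (sr i)) = A * sop (sr i) * Dl N"
    by (rule intertwine_mult[OF _ sop_Dl[OF i, symmetric]]) (use A in \<open>simp add: ZZ_def\<close>)
  ultimately show ?thesis by (simp add: ZZ_def mult.assoc)
qed

lemma ZZ_prod_right: "A \<in> ZZ N \<Longrightarrow> set is \<subseteq> {1..<N} \<Longrightarrow> A * prod_list (map (\<lambda>i. sop (sr i)) is) \<in> ZZ N"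
proof (induction "is" arbitrary: A)
  case (Cons i "is")
  have "A * sop (sr i) \<in> ZZ N" by (rule ZZ_sop_right) (use Cons.prems in auto)
  from Cons.IH[OF this] Cons.prems(2) show ?case by (simp add: mult.assoc)
qed simp

lemma ZZ_sop: "i \<in> {1..<N} \<Longrightarrow> sop (sr i) \<in> ZZ N" using ZZ_sop_left[OF _ ZZ_one] by simp

text \<open>The discriminant contains the factor X_i - X_(i+1), which is the denominator of the
  Demazure quotient up to the unit X_(i+1).\<close>

lemma ZZ_qop: "i \<in> {1..<N} \<Longrightarrow> qop i \<in> ZZ N"
proof -
  assume i: "i \<in> {1..<N}"
  obtain p where p: "dlt N = p * (mnm (sroot i) - 1)" using dlt_factor[OF i] by blast
  have "Dl N * qop i = mulop p * (sop (sr i) - 1)"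
    unfolding p mulop_mult mult.assoc qop_eq ..
  also have "\<dots> = mulop p * sop (sr i) - mulop p" by (simp add: right_diff_distrib)
  finally have "(\<lambda>u. Dl N * qop i) \<in> NF N 1"
    using NF_diff[OF NF_sop_right[OF i NF_mulop_const] NF_mulop_const, of p p] by (simp only:)
  moreover have "qop i * Dl N = Dl N * qop i" by (rule qop_invariant[OF sop_Dl[OF i]])
  ultimately show ?thesis by (simp add: ZZ_def)
qed

lemma TE_nth_1: "fps_nth (TE k i) 1 = cst (- k / 2) * sop (sr i) + cst (fps_nth (cpar k) 1) * qop i"
  by (simp add: TE_def fps_mult_nth_1' tpar_nths[simplified])

lemma TEi_nth_1: "i \<in> {1..<N} \<Longrightarrow> fps_nth (TEi k i) 1 \<in> ZZ N"
proof -
  assume i: "i \<in> {1..<N}"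
  have "fps_nth (TEi k i) 1 = cst (- k / 2) * sop (sr i) + cst (fps_nth (cpar k) 1) * qop i + cst (- fps_nth (cpar k) 1) * 1"
    using TE_nth_1[of k i] by (simp add: TEi_def cst.sc_minus)
  then show ?thesis by (simp only:) (intro ZZ_add ZZ_scal ZZ_sop ZZ_qop ZZ_one i)
qed

lemma prod_TEi_nth_1: "set js \<subseteq> {1..<N} \<Longrightarrow> fps_nth (prod_list (map (TEi k) js)) 1 \<in> ZZ N"
proof (induction js)
  case Nil
  have "(0::lop) \<in> ZZ N" using ZZ_scal[OF ZZ_one, of 0 N] by simp
  then show ?case by simp
next
  case (Cons j js)
  have P: "fps_nth (prod_list (map (TEi k) js)) 0 = prod_list (map (\<lambda>i. sop (sr i)) js)"
    by (induction js) (simp_all add: TEi_nth_0)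
  have j: "j \<in> {1..<N}" "set js \<subseteq> {1..<N}" using Cons.prems by auto
  show ?case unfolding list.map prod_list.Cons fps_mult_nth_1' P TEi_nth_0
    by (intro ZZ_add ZZ_sop_left ZZ_prod_right TEi_nth_1 Cons.IH j)
qed

abbreviation y0 :: "nat \<Rightarrow> complex \<Rightarrow> complex \<Rightarrow> nat \<Rightarrow> lop" where "y0 N k u j \<equiv> fps_nth (YE N k u j) 1"

lemma omE_nth_1: "fps_nth (omE N u) 1 = sop (cyc N) * th u 1"
  by (rule lop_eqI) (simp add: omE_nth[simplified] app_th[simplified] mult_single)

lemma sop_th_sop: "sop (sr i) * th u i * sop (sr i) = th u (i + 1)"
  by (rule lop_eqI)
    (simp only: app_times app_sop app_th_single app_th lookup_subst_transpose subst_expo_comp transpose_comp_involutory subst_expo_id,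
      simp add: subst_expo_id)

text \<open>The Cherednik form of y_j: the Euler operator plus terms of order zero. It is computed
  directly for j = 1, and y_(j+1) is s_j y_j s_j plus a multiple of s_j. The remainder is chosen
  before u, so all twists share it.\<close>

lemma y0_form: "1 \<le> N \<Longrightarrow> j \<in> {1..N} \<Longrightarrow> \<exists>A\<in>ZZ N. \<forall>u. y0 N k u j = th u j + A"
proof (induction j)
  case (Suc j)
  show ?case
  proof (cases "j = 0")
    case True
    let ?P = "prod_list (map (TEi k) [1..<N])"
    have P0: "fps_nth (prod_list (map (TEi k) js)) 0 = prod_list (map (\<lambda>i. sop (sr i)) js)" for js
      by (induction js) (simp_all add: TEi_nth_0)
    have "cyc 1 = id" by (auto simp: cyc_def)
    then have Pc: "prod_list (map (\<lambda>i. sop (sr i)) [1..<N]) * sop (cyc N) = 1"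
      using prod_sop_cyc[of "N - 1" N] Suc.prems by (simp add: sop_id)
    have cy: "fps_nth ?P 1 * sop (cyc N) \<in> ZZ N"
    proof -
      \<comment> \<open>Inverts the product in \<open>Pc\<close>. The cyclic shift thereby becomes a
        product of simple transpositions, under which \<open>ZZ\<close> is stable on the
        right.\<close>
      have inv: "prod_list (map (\<lambda>i. sop (sr i)) (rev js)) * prod_list (map (\<lambda>i. sop (sr i)) js) = 1" for js
      proof (induction js)
        case (Cons i js)
        have "sop (sr i) * sop (sr i) = 1" by (simp add: sop_comp sop_id)
        then have "sop (sr i) * (sop (sr i) * B) = B" for B by (simp flip: mult.assoc)
        then show ?case using Cons by (simp add: mult.assoc)
      qed simp
      have "sop (cyc N) = prod_list (map (\<lambda>i. sop (sr i)) (rev [1..<N])) *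
          (prod_list (map (\<lambda>i. sop (sr i)) [1..<N]) * sop (cyc N))"
        by (simp only: mult.assoc[symmetric] inv mult_1_left)
      then have c: "sop (cyc N) = prod_list (map (\<lambda>i. sop (sr i)) (rev [1..<N]))" by (simp only: Pc mult_1_right)
      show ?thesis unfolding c by (intro ZZ_prod_right prod_TEi_nth_1) auto
    qed
    let ?t = "cst (fps_nth (tpar k ^ (N - 1)) 1)"
    have t0: "cst (fps_nth (tpar k ^ (N - 1)) 0) = 1" by (simp add: tpar_def fps_nth_power_0 cst.sc_one)
    have "y0 N k u 1 = th u 1 + (?t * 1 + fps_nth ?P 1 * sop (cyc N))" for u
    proof -
      have Y1: "YE N k u 1 = scE (tpar k ^ (N - 1)) * (?P * omE N u)"
        by (simp add: YE_def aff.Y_def aff.G_def aff.P_def)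
      have 0: "fps_nth (?P * omE N u) 0 = 1" using Pc by (simp add: P0 omE_nth_0)
      have 1: "fps_nth (?P * omE N u) 1 = th u 1 + fps_nth ?P 1 * sop (cyc N)"
        unfolding fps_mult_nth_1' omE_nth_1 omE_nth_0 P0 mult.assoc[symmetric] Pc by simp
      show ?thesis unfolding Y1 fps_mult_nth_1'[of "scE _"] 0 1 scE_nth t0 by (simp add: add_ac)
    qed
    moreover have "?t * 1 + fps_nth ?P 1 * sop (cyc N) \<in> ZZ N" by (intro ZZ_add ZZ_scal ZZ_one cy)
    ultimately show ?thesis using True by auto
  next
    case False
    then have j: "j \<in> {1..<N}" "j \<in> {1..N}" using Suc.prems by auto
    obtain A where A: "A \<in> ZZ N" "\<And>u. y0 N k u j = th u j + A" using Suc.IH[OF Suc.prems(1) j(2)] by blast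
    let ?S = "sop (sr j)" and ?c = "cst (fps_nth (cpar k) 1)"
    have c0: "fps_nth (cpar k) 0 = 0" by (simp add: cpar_def tpar_def)
    \<comment> \<open>The linear part in \<epsilon> of the quadratic relation replaces the two
      first-order terms of T_j by a multiple of s_j.\<close>
    have TT: "?S * fps_nth (TE k j) 1 + fps_nth (TE k j) 1 * ?S = ?c * ?S"
      using arg_cong[OF TE_quadratic[of k j], of "\<lambda>f. fps_nth f 1"] c0
      by (simp only: fps_mult_nth_1' TE_nth_0 fps_add_nth scE_nth) simp
    have "y0 N k u (j + 1) = th u (j + 1) + (?S * A * ?S + ?c * ?S)" for u
    proof -
      have Y0: "fps_nth (YE N k u j) 0 = 1" by (rule YE_nth_0[OF Suc.prems(1) j(2)])
      have "y0 N k u (j + 1) = ?S * fps_nth (TE k j) 1 + (?S * y0 N k u j + fps_nth (TE k j) 1) * ?S"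
        unfolding YE_rec[OF j(1), symmetric] fps_mult_nth_1' fps_mult_nth_0 TE_nth_0 Y0 by simp
      also have "\<dots> = ?S * th u j * ?S + ?S * A * ?S + (?S * fps_nth (TE k j) 1 + fps_nth (TE k j) 1 * ?S)"
        unfolding A(2) by (simp add: algebra_simps)
      finally show ?thesis unfolding TT sop_th_sop by (simp add: add_ac)
    qed
    moreover have "?S * A * ?S + ?c * ?S \<in> ZZ N"
      by (intro ZZ_add ZZ_scal ZZ_sop ZZ_sop_right ZZ_sop_left j A)
    ultimately show ?thesis by auto
  qed
qed simp

section \<open>Symbols of words\<close>

definition r0 :: "nat \<Rightarrow> complex \<Rightarrow> complex \<Rightarrow> fpoly \<Rightarrow> lop" where
  "r0 N k u p = fps_nth (poly_op (gE N k u) p) 0"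

lemma r0_add: "r0 N k u (p + q) = r0 N k u p + r0 N k u q" by (simp add: r0_def poly_op_add)
lemma r0_mult: "r0 N k u (p * q) = r0 N k u p * r0 N k u q" by (simp add: r0_def poly_op_mult)
lemma r0_one [simp]: "r0 N k u 1 = 1" by (simp add: r0_def)
lemma r0_zero [simp]: "r0 N k u 0 = 0" by (simp add: r0_def)
lemma r0_single: "r0 N k u (Poly_Mapping.single w c) = cst c * r0 N k u (Poly_Mapping.single w 1)"
  by (simp add: r0_def scE_const cst.sc_one)
lemma rep_nth_0: "fps_nth (repE N k u f) 0 = r0 N k u (fps_nth f 0)"
  by (simp add: rep_def collapse_def r0_def)
lemma r0_J0: "1 \<le> N \<Longrightarrow> p \<in> J0 N k \<Longrightarrow> r0 N k u p = 0"
proof -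
  assume N: "1 \<le> N" and "p \<in> J0 N k"
  then obtain f where f: "f \<in> JJ N k" "p = fps_nth f 0" by (auto simp: J0_def)
  show ?thesis using rep_nth_0[of N k u f] rep_JJ[OF N f(1), of u] by (simp add: f(2))
qed

lemma pser_nth_0: "c 0 = 1 \<Longrightarrow> fps_nth (pser c y) 0 = fps_nth y 0"
  by (simp add: pser_def collapse_def cst.sc_one)

lemma r0_letters:
  "r0 N k u (lx i) = Xm (Poly_Mapping.single i 1)" "r0 N k u (lxi i) = Xm (- Poly_Mapping.single i 1)"
  "i \<in> {1..<N} \<Longrightarrow> r0 N k u (ls i) = sop (sr i)"
  "i \<in> {1..N} \<Longrightarrow> r0 N k u (ly i) = y0 N k u i"
proof -
  show "r0 N k u (lx i) = Xm (Poly_Mapping.single i 1)" "r0 N k u (lxi i) = Xm (- Poly_Mapping.single i 1)"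
    by (simp_all add: r0_def gE_def)
  show "r0 N k u (ls i) = sop (sr i)" if "i \<in> {1..<N}"
    using pser_nth_0[of "\<lambda>j. (- k / 2) ^ j / fact j" "sE N k i"] sE[OF that, of k] TE_nth_0[of k i]
    by (simp add: r0_def gE_def)
  show "r0 N k u (ly i) = y0 N k u i" if "i \<in> {1..N}"
    using pser_nth_0[of "\<lambda>j. 1 / fact (Suc j)" "yE N k u i"] yE[OF that, of k u]
    by (simp add: r0_def gE_def)
qed

definition Dth :: "nat \<Rightarrow> lpoly \<Rightarrow> lpoly" where
  "Dth j p = lext con (\<lambda>a. Poly_Mapping.single a (of_int (Poly_Mapping.lookup a j))) p"

lemma th_mulop: "th u j * mulop p = mulop p * th u j + mulop (Dth j p)"
proof (induction p rule: poly_mapping_additive_induct)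
  case zero then show ?case by (simp add: Dth_def scalar_single.lext_zero)
next
  case (single a c)
  have D: "Dth j (Poly_Mapping.single a c) = Poly_Mapping.single a (c * of_int (Poly_Mapping.lookup a j))"
    unfolding Dth_def scalar_single.lext_single by (simp add: mult_single)
  show ?case
  proof (rule lop_eqI)
    fix n
    show "app (th u j * mulop (Poly_Mapping.single a c)) (mnm n) =
      app (mulop (Poly_Mapping.single a c) * th u j + mulop (Dth j (Poly_Mapping.single a c))) (mnm n)"
    proof -
      have "c * 1 * (of_int (Poly_Mapping.lookup (a + n) j) + u) =
          c * (of_int (Poly_Mapping.lookup n j) + u) + c * of_int (Poly_Mapping.lookup a j)"
        by (simp add: lookup_add algebra_simps)
      then show ?thesis unfolding D
        by (simp only: app_times app_plus app_mulop app_th mult_single app_th_single single_add[symmetric] mult_1_right mult_1_left)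
    qed
  qed
next
  case (add p q)
  have "Dth j (p + q) = Dth j p + Dth j q" unfolding Dth_def by (rule scalar_single.lext_add)
  then show ?case using add by (simp add: mulop_add distrib_left distrib_right add_ac)
qed

definition img :: "gen list \<Rightarrow> sym" where "img v = (imgX v, imgY v, imgP v)"

lemma img_valid: "set v \<subseteq> gens N \<Longrightarrow> valid N (img v) \<and> deg N (img v) = yc v"
proof (induction v)
  case Nil then show ?case by (simp add: img_def valid_def deg_def)
next
  case (Cons g v)
  then have IH: "valid N (img v)" "deg N (img v) = yc v" and g: "g \<in> gens N" by auto
  show ?case
  proof (cases g)
    case (GS i)
    then have i: "i \<in> {1..<N}" using g by simp
    have "img (g # v) = (imgX (g # v), (\<lambda>j. imgY v (sr i j)), sr i \<circ> imgP v)" using GS by (simp add: img_def)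
    then show ?thesis using valid_sr[OF i IH(1)[unfolded img_def]] deg_sr[OF i, of "imgY v"] IH(2) GS
      by (simp add: deg_def img_def)
  next
    case (GY i)
    then have i: "i \<in> {1..N}" using g by simp
    have "(\<Sum>j\<in>{1..N}. (if i = j then 1 else 0) + imgY v j) = Suc (\<Sum>j\<in>{1..N}. imgY v j)"
      using i by (simp add: sum.distrib)
    then show ?thesis using IH GY i by (auto simp: img_def valid_def deg_def)
  qed (use IH in \<open>auto simp: img_def valid_def deg_def\<close>)
qed

lemma commute_mulop_power: "A * Dl N = Dl N * A \<Longrightarrow> A * mulop (dlt N ^ M) = mulop (dlt N ^ M) * A"
proof (induction M)
  case (Suc M)
  show ?case unfolding power_Suc mulop_mult by (rule intertwine_mult[OF Suc.prems Suc.IH[OF Suc.prems]])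
qed simp

text \<open>Letters X and s leave the order unchanged. For a letter y, the Euler operator produces
  the next symbol, while its commutators with X^a and with the cleared denominator, as well as the
  order-zero part of y, fall into lower order.\<close>

lemma word_symbol:
  assumes N: "1 \<le> N"
  shows "set v \<subseteq> gens N \<Longrightarrow> \<exists>M. (\<lambda>u. mulop (dlt N ^ M) * r0 N k u (wp v) - mulop (dlt N ^ M) * mon N u (img v)) \<in> NF N (yc v)"
proof (induction v)
  case Nil
  have "mon N u (img []) = 1" for u
    using Xm_sop[of 0 id N u] by (simp add: img_def sop_id)
  then show ?case using NF_zero by (intro exI[of _ 0]) simp
next
  case (Cons g v)
  then obtain M where M: "(\<lambda>u. mulop (dlt N ^ M) * r0 N k u (wp v) - mulop (dlt N ^ M) * mon N u (img v)) \<in> NF N (yc v)"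
    and g: "g \<in> gens N" and v: "set v \<subseteq> gens N" by auto
  let ?P = "mulop (dlt N ^ M)"
  have r: "r0 N k u (wp (g # v)) = r0 N k u (letter g) * r0 N k u (wp v)" for u by (simp add: wp_Cons r0_mult)
  have degree0: ?case if comm: "A * ?P = ?P * A" and L: "\<And>u. r0 N k u (letter g) = A" and yc: "yc (g # v) = yc v"
    and NF: "\<And>F. F \<in> NF N (yc v) \<Longrightarrow> (\<lambda>u. A * F u) \<in> NF N (yc v)" and m: "\<And>u. A * mon N u (img v) = mon N u (img (g # v))" for A
  proof (rule exI[of _ M])
    have "A * (?P * r0 N k u (wp v) - ?P * mon N u (img v)) = ?P * r0 N k u (wp (g # v)) - ?P * mon N u (img (g # v))" for u
      unfolding r L m[symmetric] right_diff_distrib mult.assoc[symmetric] comm ..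
    then show "(\<lambda>u. ?P * r0 N k u (wp (g # v)) - ?P * mon N u (img (g # v))) \<in> NF N (yc (g # v))"
      using NF[OF M] by (simp add: yc)
  qed
  show ?case
  proof (cases g)
    case (GX i)
    show ?thesis
      by (rule degree0[of "Xm (Poly_Mapping.single i 1)", OF mulop_commute])
        (simp_all only: GX r0_letters yc_simps NF_Xm, simp add: img_def Xm_mon subst_expo_id)
  next
    case (GXinv i)
    show ?thesis
      by (rule degree0[of "Xm (- Poly_Mapping.single i 1)", OF mulop_commute])
        (simp_all only: GXinv r0_letters yc_simps NF_Xm, simp add: img_def Xm_mon subst_expo_id)
  next
    case (GS i)
    then have i: "i \<in> {1..<N}" using g by simp
    have "sop (sr i) * ?P = ?P * sop (sr i)"
      by (rule commute_mulop_power[OF sop_Dl[OF i]])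
    then show ?thesis
      by (rule degree0) (use GS i in \<open>simp_all add: r0_letters[simplified] NF_sop[simplified] img_def sop_mon[simplified]\<close>)
  next
    case (GY j)
    then have j: "j \<in> {1..N}" using g by simp
    obtain A where A: "A \<in> ZZ N" "\<And>u. y0 N k u j = th u j + A" using y0_form[OF N j] by blast
    let ?r = "yc v" and ?D = "Dl N" and ?m = "\<lambda>u. mon N u (img v)" and ?dP = "mulop (Dth j (dlt N ^ M))"
    let ?L = "\<lambda>u. ?P * r0 N k u (wp v) - ?P * ?m u"
    have m: "valid N (img v)" "deg N (img v) = ?r" using img_valid[OF v] by auto
    have mNF: "(\<lambda>u. ?m u) \<in> NF N (Suc ?r)" by (rule NF_mon[OF m(1)]) (simp add: m(2))
    have AP: "A * ?P = ?P * A"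
      by (rule commute_mulop_power) (use A(1) in \<open>simp add: ZZ_def\<close>)
    have DA: "(\<lambda>u. ?D * A * F u) \<in> NF N s" if F: "F \<in> NF N s" for F s
    proof -
      have "(\<lambda>u. ?D * A) \<in> NF N 1" using A(1) by (simp add: ZZ_def)
      then obtain d where d: "\<forall>m\<in>Poly_Mapping.keys d. valid N m \<and> deg N m < 1" "(\<lambda>u. ?D * A) = (\<lambda>u. realize N u d)"
        unfolding NF_def by blast
      have "(\<lambda>u. realize N u d * F u) \<in> NF N s"
      proof (induction d rule: poly_mapping_additive_induct)
        case zero show ?case by (simp only: realize_zero mult_zero_left mult_zero_right NF_zero)
      next
        case (single m c)
        obtain a b w where mm: "m = (a, b, w)" by (cases m) auto
        have v: "valid N (a, b, w)" "deg N (a, b, w) < 1" using single d(1) mm by blast+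
        have b: "b = (\<lambda>j. 0)" using v by (auto simp: valid_def deg_def fun_eq_iff)
        have w: "fixes_outside N w" using v(1) by (simp add: valid_eq)
        have "(\<lambda>u. sop w * F u) \<in> NF N s" by (rule NF_perm[OF w F])
        then have "(\<lambda>u. cst c * (Xm a * (sop w * F u))) \<in> NF N s" by (intro NF_scal NF_Xm)
        then show ?case unfolding realize_single mm b Xm_sop[symmetric] by (simp only: mult.assoc)
      next
        case (add p q)
        show ?case unfolding realize_add distrib_right by (rule NF_add[OF add(1,2)])
      qed
      moreover have "realize N u d = ?D * A" for u using fun_cong[OF d(2)] by simp
      ultimately show ?thesis by (simp only:)
    qed
    \<comment> \<open>The exponent grows from M to 2M + 1: one copy of \<open>?P\<close> clears the
      earlier denominators, a second one does so for the term in which \<theta>_j differentiates the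
      first copy, and one further discriminant clears \<open>A\<close>.\<close>
    have key: "mulop (dlt N ^ Suc (M + M)) * r0 N k u (wp (g # v)) - mulop (dlt N ^ Suc (M + M)) * mon N u (img (g # v)) =
       (?D * (?P * (th u j * ?L u)) - ?D * (?dP * ?L u) + ?P * (?D * A * ?L u)) +
       (?D * (?P * (?P * (cst (of_int (Poly_Mapping.lookup (imgX v) j)) * ?m u))) + ?P * (?D * A * (?P * ?m u)))" for u
    proof -
      have e: "mulop (dlt N ^ Suc (M + M)) = ?D * (?P * ?P)" by (simp only: power_Suc power_add mulop_mult)
      have thP: "th u j * (?P * B) = ?P * (th u j * B) + ?dP * B" for B
        using arg_cong[OF th_mulop[of u j "dlt N ^ M"], of "\<lambda>t. t * B"] by (simp only: mult.assoc distrib_right)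
      have DP: "?D * (?P * B) = ?P * (?D * B)" for B
        by (simp only: mult.assoc[symmetric] mulop_commute[of "dlt N"])
      have PA: "?P * (?D * (A * (?P * B))) = ?D * (?P * (?P * (A * B)))" for B
        using arg_cong[OF AP, of "\<lambda>t. t * B"] by (simp only: mult.assoc DP)
      have PdP: "?P * (?dP * B) = ?dP * (?P * B)" for B
        by (simp only: mult.assoc[symmetric] mulop_commute[of "dlt N ^ M"])
      have mg: "th u j * ?m u = mon N u (img (g # v)) + cst (of_int (Poly_Mapping.lookup (imgX v) j)) * ?m u"
      proof -
        have "(\<lambda>i. (if g = GY i then 1 else 0) + imgY v i) = (imgY v)(j := Suc (imgY v j))" using GY by (auto simp: fun_eq_iff)
        then show ?thesis unfolding img_def th_mon[OF j] by (simp add: GY subst_expo_id)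
      qed
      then have mg': "mon N u (img (g # v)) = th u j * ?m u - cst (of_int (Poly_Mapping.lookup (imgX v) j)) * ?m u" by simp
      have lg: "r0 N k u (letter g) = th u j + A" using r0_letters(4)[OF j, of k u] A(2)[of u] GY by simp
      have lhs: "r0 N k u (wp (g # v)) = th u j * r0 N k u (wp v) + A * r0 N k u (wp v)"
        unfolding r lg distrib_right ..
      show ?thesis unfolding e mg' lhs
        by (simp only: right_diff_distrib distrib_left mult.assoc thP PA PdP) simp
    qed
    have "(\<lambda>u. mulop (dlt N ^ Suc (M + M)) * r0 N k u (wp (g # v)) - mulop (dlt N ^ Suc (M + M)) * mon N u (img (g # v))) \<in> NF N (Suc ?r)"
      unfolding key
      by (intro NF_add NF_diff NF_mulop NF_scal mNF NF_th j M NF_mono[OF NF_mulop[OF M]] NF_mono[OF NF_mulop[OF NF_mulop[OF M]]] DA NF_mono[OF M]) simp_all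
    then show ?thesis using GY by (intro exI[of _ "Suc (M + M)"]) simp
  qed
qed

section \<open>Vanishing of symbols\<close>

text \<open>Terms with the same exponent are collected into one coefficient of a univariate
  polynomial, which has infinitely many zeros.\<close>

lemma univariate_vanish:
  fixes f :: "'b \<Rightarrow> complex"
  assumes B: "finite B" and inf: "infinite S" and van: "\<And>x. x \<in> S \<Longrightarrow> (\<Sum>b\<in>B. f b * x ^ h b) = 0"
  shows "(\<Sum>b\<in>{b\<in>B. h b = \<beta>}. f b) = 0"
proof -
  define p where "p = (\<Sum>b\<in>B. monom (f b) (h b))"
  have "S \<subseteq> {x. poly p x = 0}" using van by (auto simp: p_def poly_sum poly_monom)
  then have "p = 0" using inf poly_roots_finite finite_subset by blast
  then have "0 = coeff p \<beta>" by simp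
  also have "\<dots> = (\<Sum>b\<in>B. if h b = \<beta> then f b else 0)" by (simp add: p_def coeff_sum)
  also have "\<dots> = (\<Sum>b\<in>{b\<in>B. h b = \<beta>}. f b)" using B by (simp add: sum.inter_filter)
  finally show ?thesis by simp
qed

text \<open>Exponents that decrease along the list with gaps larger than \<open>K\<close>. The gaps
  keep bounded shifts from imitating a permutation, while the head of the list may still be any
  sufficiently large number, which provides infinitely many values for its elimination.\<close>

primrec chain :: "nat \<Rightarrow> nat list \<Rightarrow> (nat \<Rightarrow> nat) \<Rightarrow> bool" where
  "chain K [] n \<longleftrightarrow> True"
| "chain K (j # js) n \<longleftrightarrow> (\<forall>m\<in>set js. n m + K < n j) \<and> chain K js n"

lemma chain_cong: "(\<And>j. j \<in> set js \<Longrightarrow> n j = n' j) \<Longrightarrow> chain K js n = chain K js n'"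
  by (induction js) auto

lemma chain_spread: "chain K js n \<Longrightarrow> i \<in> set js \<Longrightarrow> j \<in> set js \<Longrightarrow> i \<noteq> j \<Longrightarrow> int K < \<bar>int (n i) - int (n j)\<bar>"
  by (induction js) fastforce+

text \<open>Elimination of one variable after the other, the current one ranging over all large values.\<close>

lemma elim_vars:
  fixes e :: "(nat \<Rightarrow> nat) \<Rightarrow> complex"
  assumes "distinct js" "i \<notin> set js" "finite B"
    and "\<And>n. chain K (js @ [i]) n \<Longrightarrow> n i = c \<Longrightarrow> (\<Sum>b\<in>B. e b * (\<Prod>j\<in>set js. (of_nat (n j) + u) ^ b j)) = 0"
  shows "(\<Sum>b\<in>{b\<in>B. \<forall>j\<in>set js. b j = \<gamma> j}. e b) = 0"
  using assms
proof (induction js arbitrary: B)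
  case Nil
  then show ?case using Nil(4)[of "\<lambda>_. c"] by simp
next
  case (Cons j js)
  let ?B = "{b\<in>B. b j = \<gamma> j}"
  have "(\<Sum>b\<in>?B. e b * (\<Prod>m\<in>set js. (of_nat (n m) + u) ^ b m)) = 0"
    if n: "chain K (js @ [i]) n" "n i = c" for n
  proof -
    define T where "T = (\<Sum>m\<in>set (js @ [i]). n m) + K"
    have "(\<Sum>b\<in>B. e b * (\<Prod>m\<in>set js. (of_nat (n m) + u) ^ b m) * (x ^ b j)) = 0"
      if x: "x \<in> (\<lambda>t. of_nat t + u) ` {T<..}" for x
    proof -
      obtain t where t: "T < t" "x = of_nat t + u" using x by auto
      let ?n = "n(j := t)"
      have same: "m \<in> set (js @ [i]) \<Longrightarrow> ?n m = n m" for m using Cons.prems by auto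
      have "n m \<le> (\<Sum>m\<in>set (js @ [i]). n m)" if "m \<in> set (js @ [i])" for m
        by (rule member_le_sum[OF that]) auto
      then have "n m + K < t" if "m \<in> set (js @ [i])" for m using that t(1) unfolding T_def by fastforce
      then have "\<forall>m\<in>set (js @ [i]). ?n m + K < ?n j" using same by simp
      moreover have "chain K (js @ [i]) ?n" using n(1) chain_cong[of "js @ [i]" ?n n K] same by blast
      ultimately have "chain K ((j # js) @ [i]) ?n" by simp
      moreover have "?n i = c" using n(2) Cons.prems by simp
      ultimately have z: "(\<Sum>b\<in>B. e b * (\<Prod>m\<in>set (j # js). (of_nat (?n m) + u) ^ b m)) = 0" by (rule Cons.prems(4))
      have pr: "(\<Prod>m\<in>set (j # js). (of_nat (?n m) + u) ^ b m) = x ^ b j * (\<Prod>m\<in>set js. (of_nat (n m) + u) ^ b m)" for b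
      proof -
        have "(\<Prod>m\<in>set js. (of_nat (?n m) + u) ^ b m) = (\<Prod>m\<in>set js. (of_nat (n m) + u) ^ b m)"
          by (rule prod.cong) (use Cons.prems in auto)
        then show ?thesis using Cons.prems(1) t(2) by simp
      qed
      show ?thesis using z unfolding pr by (simp only: mult_ac)
    qed
    moreover have "infinite ((\<lambda>t. of_nat t + u) ` {T<..})"
      by (subst finite_image_iff) (auto simp: inj_on_def infinite_Ioi)
    ultimately show ?thesis
      by (intro univariate_vanish[OF Cons.prems(3), where S = "(\<lambda>t. of_nat t + u) ` {T<..}" and h = "\<lambda>b. b j"])
  qed
  then have "(\<Sum>b\<in>{b\<in>?B. \<forall>j\<in>set js. b j = \<gamma> j}. e b) = 0"
    using Cons.prems by (intro Cons.IH) auto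
  moreover have "{b\<in>?B. \<forall>j\<in>set js. b j = \<gamma> j} = {b\<in>B. \<forall>j\<in>set (j # js). b j = \<gamma> j}" by auto
  ultimately show ?case by simp
qed

definition nu :: "nat \<Rightarrow> (nat \<Rightarrow> nat) \<Rightarrow> expo" where
  "nu N n = (\<Sum>j\<in>{1..N}. Poly_Mapping.single j (int (n j)))"

lemma lookup_nu: "Poly_Mapping.lookup (nu N n) j = (if j \<in> {1..N} then int (n j) else 0)"
  unfolding nu_def lookup_sum lookup_single when_def by simp

lemma nu_ENp: "nu N n \<in> ENp N" by (simp add: ENp_def EN_iff lookup_nu)

text \<open>If a permutation moved some j, the exponents at j and at its image would differ only by
  a shift of size at most \<open>K\<close>, although all gaps are larger. Once the permutation is
  trivial, the shifts must agree.\<close>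

lemma position_unique:
  assumes \<tau>: "fixes_outside N \<tau>" and eq: "a + subst_expo \<tau> (nu N n) = a' + nu N n"
    and spread: "\<And>i j. i \<in> {1..N} \<Longrightarrow> j \<in> {1..N} \<Longrightarrow> i \<noteq> j \<Longrightarrow> int K < \<bar>int (n i) - int (n j)\<bar>"
    and K: "\<And>j. j \<in> {1..N} \<Longrightarrow> \<bar>Poly_Mapping.lookup a j - Poly_Mapping.lookup a' j\<bar> \<le> int K"
  shows "\<tau> = id \<and> a = a'"
proof -
  have inj: "inj \<tau>" using \<tau> by (simp add: fixes_outside_def bij_is_inj)
  have "\<tau> j = j" for j
  proof (rule ccontr)
    assume ne: "\<tau> j \<noteq> j"
    have j: "j \<in> {1..N}" using \<tau> ne unfolding fixes_outside_def by blast
    then have tj: "\<tau> j \<in> {1..N}" using fixes_outside_betw[OF \<tau>] by (auto simp: bij_betw_def)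
    have "Poly_Mapping.lookup (a + subst_expo \<tau> (nu N n)) (\<tau> j) = Poly_Mapping.lookup (a' + nu N n) (\<tau> j)"
      unfolding eq ..
    then have "Poly_Mapping.lookup a (\<tau> j) + int (n j) = Poly_Mapping.lookup a' (\<tau> j) + int (n (\<tau> j))"
      unfolding lookup_add lookup_subst_expo[OF inj] lookup_nu using j tj by simp
    then show False using spread[OF tj j ne] K[OF tj] by linarith
  qed
  then have "\<tau> = id" by auto
  then show ?thesis using eq by (simp add: subst_expo_id)
qed

lemma app_realize: "app (realize N u d) (mnm v) = (\<Sum>m\<in>Poly_Mapping.keys d.
    con (Poly_Mapping.lookup d m) * app (mon N u m) (mnm v))"
  by (simp add: realize_def lext_def app_sum_op)

text \<open>When n_i < - a0_i, the monomial X^(a0 + n) is not a polynomial, so its coefficient in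
  the image of X^(w0^-1 n) is zero. This coefficient is a polynomial in n + u; elimination of the
  other variables leaves degree at most b0_i in n_i + u, too small for the number of zeros.\<close>

lemma symbol_vanish:
  assumes z: "\<forall>i\<in>{1..l}. \<forall>j\<in>{1..l}. i \<noteq> j \<longrightarrow> z i - z j \<notin> \<int>"
    and d: "\<forall>m\<in>Poly_Mapping.keys d. valid N m \<and> deg N m < Suc R"
    and pres: "\<forall>j\<in>{1..l}. realize N (z j) d \<in> presv (ENp N)"
    and m0: "deg N (a0, b0, w0) = R" and i: "i \<in> {1..N}"
    and bad: "int l * Poly_Mapping.lookup a0 i + int (b0 i) < 0"
  shows "Poly_Mapping.lookup d (a0, b0, w0) = 0"
proof (rule ccontr)
  assume nz: "Poly_Mapping.lookup d (a0, b0, w0) \<noteq> 0"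
  then have in_d: "(a0, b0, w0) \<in> Poly_Mapping.keys d" by (simp add: in_keys_iff)
  then have w0: "fixes_outside N w0" and b0: "\<And>j. j \<notin> {1..N} \<Longrightarrow> b0 j = 0" using d by (auto simp: valid_eq)
  have w0i: "fixes_outside N (inv_into UNIV w0)" by (rule fixes_outside_inv[OF w0])
  define B where "B = {b. (a0, b, w0) \<in> Poly_Mapping.keys d}"
  have finB: "finite B"
  proof -
    have "B \<subseteq> (\<lambda>m. fst (snd m)) ` Poly_Mapping.keys d" by (force simp: B_def)
    then show ?thesis by (rule finite_subset) simp
  qed
  \<comment> \<open>Bounds the distance from a0 of all exponents that occur, coordinate by
    coordinate; gaps beyond it make the position argument applicable.\<close>
  define K where "K = (\<Sum>m\<in>Poly_Mapping.keys d. \<Sum>j\<in>{1..N}. nat \<bar>Poly_Mapping.lookup (fst m) j - Poly_Mapping.lookup a0 j\<bar>)"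
  have K: "\<bar>Poly_Mapping.lookup (fst m) j - Poly_Mapping.lookup a0 j\<bar> \<le> int K"
    if m: "m \<in> Poly_Mapping.keys d" and j: "j \<in> {1..N}" for m j
  proof -
    have "nat \<bar>Poly_Mapping.lookup (fst m) j - Poly_Mapping.lookup a0 j\<bar> \<le>
        (\<Sum>j\<in>{1..N}. nat \<bar>Poly_Mapping.lookup (fst m) j - Poly_Mapping.lookup a0 j\<bar>)"
      by (rule member_le_sum[OF j]) auto
    also have "\<dots> \<le> K" unfolding K_def
      by (rule member_le_sum[OF m, of "\<lambda>m. \<Sum>j\<in>{1..N}. nat \<bar>Poly_Mapping.lookup (fst m) j - Poly_Mapping.lookup a0 j\<bar>"]) auto
    finally show ?thesis by linarith
  qed
  obtain js where js: "set js = {1..N} - {i}" "distinct js" using finite_distinct_list[of "{1..N} - {i}"] by auto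
  \<comment> \<open>The number of exponents c \<ge> 0 that X^a0 pushes below zero at i.\<close>
  define M where "M = nat (- Poly_Mapping.lookup a0 i)"
  let ?e = "\<lambda>b. Poly_Mapping.lookup d (a0, b, w0)"
  have key: "(\<Sum>b\<in>B. ?e b * (of_nat c + z q) ^ b i * (\<Prod>j\<in>set js. (of_nat (n j) + z q) ^ b j)) = 0"
    if q: "q \<in> {1..l}" and c: "c < M" and n: "chain K (js @ [i]) n" "n i = c" for q c n
  proof -
    \<comment> \<open>The exponent is chosen so that w0 carries it to n. Because of the gaps, no
      other pair of exponent and permutation occurring in \<open>d\<close> can reach a0 + n.\<close>
    let ?u = "z q" and ?v = "subst_expo (inv_into UNIV w0) (nu N n)"
    have spread: "int K < \<bar>int (n p) - int (n p')\<bar>" if "p \<in> {1..N}" "p' \<in> {1..N}" "p \<noteq> p'" for p p'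
      by (rule chain_spread[OF n(1)]) (use that js(1) in auto)
    have v: "?v \<in> ENp N"
    proof (rule subst_expo_EN(2))
      show "bij (inv_into UNIV w0)" using w0i by (simp add: fixes_outside_def)
      show "inv_into UNIV w0 ` {1..N} = {1..N}" using fixes_outside_betw[OF w0i] by (simp add: bij_betw_def)
    qed (use nu_ENp[of N n] in \<open>auto simp: ENp_def\<close>)
    let ?x = "a0 + nu N n"
    have "Poly_Mapping.lookup ?x i < 0" using i c n(2) by (simp add: lookup_add lookup_nu M_def)
    then have "?x \<notin> ENp N" by (auto simp: ENp_def not_le intro!: exI[of _ i])
    moreover have "Poly_Mapping.keys (app (realize N ?u d) (mnm ?v)) \<subseteq> ENp N"
      using bspec[OF pres q] v unfolding presv_def by blast
    ultimately have "Poly_Mapping.lookup (app (realize N ?u d) (mnm ?v)) ?x = 0"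
      unfolding not_in_keys_iff_lookup_eq_zero[symmetric] by blast
    moreover have "Poly_Mapping.lookup (con (Poly_Mapping.lookup d m) * app (mon N ?u m) (mnm ?v)) ?x =
        (if fst m = a0 \<and> snd (snd m) = w0 then Poly_Mapping.lookup d m * pw N (fst (snd m)) ?u (nu N n) else 0)"
      if m: "m \<in> Poly_Mapping.keys d" for m
    proof -
      obtain a b w where mm: "m = (a, b, w)" by (cases m) auto
      have w: "fixes_outside N w" using d m mm by (auto simp: valid_eq)
      have comp: "subst_expo w ?v = subst_expo (w \<circ> inv_into UNIV w0) (nu N n)" by (rule subst_expo_comp)
      have iff: "a + subst_expo w ?v = ?x \<longleftrightarrow> a = a0 \<and> w = w0"
      proof
        assume "a + subst_expo w ?v = ?x"
        then have "w \<circ> inv_into UNIV w0 = id \<and> a = a0" unfolding comp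
          by (rule position_unique[OF fixes_outside_comp[OF w w0i] _ spread]) (use K[OF m] mm in auto)
        moreover from this have "w = w0" using w0
          by (metis bij_is_inj comp_assoc comp_id fixes_outside_def id_comp inv_o_cancel)
        ultimately show "a = a0 \<and> w = w0" by blast
      next
        assume "a = a0 \<and> w = w0"
        moreover have "w0 \<circ> inv_into UNIV w0 = id" using w0 by (auto simp: fixes_outside_def bij_is_surj surj_f_inv_f)
        ultimately show "a + subst_expo w ?v = ?x" unfolding comp by (simp add: subst_expo_id)
      qed
      have eqv: "a = a0 \<and> w = w0 \<Longrightarrow> subst_expo w ?v = nu N n" using iff by simp
      show ?thesis unfolding mm app_mon mult_single
        using iff eqv by (auto simp: lookup_single when_def)
    qed
    ultimately have "0 = (\<Sum>m\<in>Poly_Mapping.keys d. if fst m = a0 \<and> snd (snd m) = w0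
        then Poly_Mapping.lookup d m * pw N (fst (snd m)) ?u (nu N n) else 0)"
      unfolding app_realize lookup_sum by simp
    also have "\<dots> = (\<Sum>m\<in>{m\<in>Poly_Mapping.keys d. fst m = a0 \<and> snd (snd m) = w0}.
        Poly_Mapping.lookup d m * pw N (fst (snd m)) ?u (nu N n))"
      by (simp add: sum.inter_filter)
    also have "\<dots> = (\<Sum>b\<in>B. ?e b * pw N b ?u (nu N n))"
      by (rule sum.reindex_bij_witness[of _ "\<lambda>b. (a0, b, w0)" "\<lambda>m. fst (snd m)"]) (auto simp: B_def)
    also have "\<dots> = (\<Sum>b\<in>B. ?e b * (of_nat c + ?u) ^ b i * (\<Prod>j\<in>set js. (of_nat (n j) + ?u) ^ b j))"
    proof (rule sum.cong[OF refl])
      fix b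
      have "pw N b ?u (nu N n) = (\<Prod>j\<in>{1..N}. (of_nat (n j) + ?u) ^ b j)"
        unfolding pw_def by (rule prod.cong) (auto simp: lookup_nu)
      also have "\<dots> = (of_nat c + ?u) ^ b i * (\<Prod>j\<in>set js. (of_nat (n j) + ?u) ^ b j)"
        unfolding js(1) using i n(2) by (subst prod.remove[of _ i]) auto
      finally show "?e b * pw N b ?u (nu N n) = ?e b * (of_nat c + ?u) ^ b i * (\<Prod>j\<in>set js. (of_nat (n j) + ?u) ^ b j)"
        by (simp add: mult.assoc)
    qed
    finally show ?thesis by simp
  qed
  define C where "C = {b\<in>B. \<forall>j\<in>set js. b j = b0 j}"
  have finC: "finite C" using finB by (simp add: C_def)
  have root: "(\<Sum>b\<in>C. ?e b * (of_nat c + z q) ^ b i) = 0" if "q \<in> {1..l}" "c < M" for q c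
    unfolding C_def
  proof (rule elim_vars[OF js(2) _ finB])
    show "i \<notin> set js" using js(1) by simp
    fix n assume "chain K (js @ [i]) n" "n i = c"
    then show "(\<Sum>b\<in>B. ?e b * (of_nat c + z q) ^ b i * (\<Prod>j\<in>set js. (of_nat (n j) + z q) ^ b j)) = 0"
      using key that by blast
  qed
  have split: "deg N (a, b, w) = b i + (\<Sum>j\<in>set js. b j)" for a b w
    unfolding deg_def js(1) using i by (simp add: sum.remove[of _ i])
  \<comment> \<open>The total degree is at most R, with equality for b0; agreement with b0 away from
    i therefore bounds the exponent at i. This is where the top degree of the symbol is
    used.\<close>
  have le: "b i \<le> b0 i" if "b \<in> C" for b
  proof -
    have "(\<Sum>j\<in>set js. b j) = (\<Sum>j\<in>set js. b0 j)" using that by (auto simp: C_def)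
    moreover have "deg N (a0, b, w0) \<le> R" using d that by (auto simp: C_def B_def)
    ultimately show ?thesis using m0 split[of a0 b w0] split[of a0 b0 w0] by linarith
  qed
  define p where "p = (\<Sum>b\<in>C. monom (?e b) (b i))"
  have pdeg: "degree p \<le> b0 i" unfolding p_def
    by (rule degree_sum_le[OF finC]) (meson degree_monom_le le order_trans)
  \<comment> \<open>The zeros c + z_q. Two of them with different q would make a difference of the z
    integral, so there are M l distinct ones, more than b0_i by the assumption
    \<open>bad\<close>.\<close>
  let ?S = "(\<lambda>(c, q). of_nat c + z q) ` ({..<M} \<times> {1..l})"
  have inj: "inj_on (\<lambda>(c, q). of_nat c + z q) ({..<M} \<times> {1..l})"
  proof (rule inj_onI, clarify)
    fix c q c' q' assume mem: "q \<in> {1..l}" "q' \<in> {1..l}" and eq: "of_nat c + z q = of_nat c' + z q'"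
    have "z q - z q' = of_int (int c' - int c)" using eq by (simp add: algebra_simps)
    then have "z q - z q' \<in> \<int>" by (metis Ints_of_int)
    then have "q = q'" using z mem by blast
    then show "c = c' \<and> q = q'" using eq by simp
  qed
  have cardS: "card ?S = M * l" using card_image[OF inj] by (simp add: card_cartesian_product)
  have "int (b0 i) < int (M * l)"
  proof -
    have "Poly_Mapping.lookup a0 i < 0"
    proof (rule ccontr)
      assume "\<not> Poly_Mapping.lookup a0 i < 0"
      then have "0 \<le> int l * Poly_Mapping.lookup a0 i" by simp
      then show False using bad by simp
    qed
    then have "int M = - Poly_Mapping.lookup a0 i" by (simp add: M_def)
    then show ?thesis using bad by (simp add: algebra_simps)
  qed
  then have big: "b0 i < card ?S" unfolding cardS by linarith
  have "p = 0"
  proof (rule ccontr)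
    assume "p \<noteq> 0"
    then have fin: "finite {x. poly p x = 0}" and c: "card {x. poly p x = 0} \<le> degree p"
      using poly_roots_finite card_poly_roots_bound by auto
    have "?S \<subseteq> {x. poly p x = 0}" using root by (auto simp: p_def poly_sum poly_monom)
    then have "card ?S \<le> card {x. poly p x = 0}" by (rule card_mono[OF fin])
    then show False using c pdeg big by linarith
  qed
  then have "0 = coeff p (b0 i)" by simp
  also have "\<dots> = (\<Sum>b\<in>C. if b i = b0 i then ?e b else 0)" by (simp add: p_def coeff_sum)
  also have "\<dots> = (\<Sum>b\<in>C. if b = b0 then ?e b else 0)"
  proof (rule sum.cong[OF refl])
    fix b assume b: "b \<in> C"
    have "b = b0" if "b i = b0 i"
    proof
      fix j
      have "valid N (a0, b, w0)" using b d by (auto simp: C_def B_def)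
      then show "b j = b0 j" using b b0 that js(1) by (cases "j \<in> {1..N}") (auto simp: C_def valid_eq)
    qed
    then show "(if b i = b0 i then ?e b else 0) = (if b = b0 then ?e b else 0)" by auto
  qed
  also have "\<dots> = ?e b0" using in_d finC by (simp add: C_def B_def)
  finally show False using nz by simp
qed

section \<open>Division by the discriminant\<close>

lemma lookup_mnm_mult: "Poly_Mapping.lookup (mnm e * f) (e + a) = Poly_Mapping.lookup f a"
  by (induction f rule: poly_mapping_additive_induct)
    (simp_all add: distrib_left lookup_add mult_single lookup_single when_def)

text \<open>Where the product with X_i - X_j vanishes, the coefficients of f are constant along the
  direction e_j - e_i or its opposite. Following the direction that does not increase coordinate m
  stays in the region, and finite support forces the constant to be zero.\<close>

lemma divide_difference:
  assumes ij: "i \<noteq> j" and down: "\<And>s t. Q s \<Longrightarrow> t \<le> s \<Longrightarrow> Q (t :: int)"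
    and van: "\<And>a. Q (Poly_Mapping.lookup a m) \<Longrightarrow>
      Poly_Mapping.lookup ((mnm (Poly_Mapping.single i 1) - mnm (Poly_Mapping.single j 1)) * f) a = 0"
  shows "Q (Poly_Mapping.lookup a m) \<Longrightarrow> Poly_Mapping.lookup f a = 0"
proof -
  \<comment> \<open>The argument walks in direction e_j - e_i and so needs m \<noteq> j. The case m
    = j is obtained by exchanging i and j, which only changes a sign.\<close>
  have main: "Poly_Mapping.lookup f a = 0"
    if Qa: "Q (Poly_Mapping.lookup a m)" and ij: "i \<noteq> j" and mj: "m \<noteq> j"
      and van: "\<And>a. Q (Poly_Mapping.lookup a m) \<Longrightarrow>
        Poly_Mapping.lookup ((mnm (Poly_Mapping.single i 1) - mnm (Poly_Mapping.single j 1)) * f) a = 0"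
    for i j a
  proof (rule ccontr)
    assume nz: "Poly_Mapping.lookup f a \<noteq> 0"
    let ?e = "Poly_Mapping.single i (1::int)" and ?g = "Poly_Mapping.single j (1::int)"
    let ?a = "\<lambda>n::nat. a + frag_cmul (int n) (?g - ?e)"
    have Qn: "Q (Poly_Mapping.lookup (?a n) m)" for n
      by (rule down[OF Qa]) (use mj in \<open>auto simp: lookup_add lookup_minus lookup_single when_def\<close>)
    have "Poly_Mapping.lookup f (?a n) = Poly_Mapping.lookup f a" for n
    proof (induction n)
      case (Suc n)
      have next_a: "?g + ?a n = ?e + ?a (Suc n)"
        by (rule poly_mapping_eqI) (simp add: lookup_add lookup_minus algebra_simps)
      have "Q (Poly_Mapping.lookup (?g + ?a n) m)" using Qn[of n] mj by (simp add: lookup_add lookup_single)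
      then have "Poly_Mapping.lookup (mnm ?e * f) (?e + ?a (Suc n)) = Poly_Mapping.lookup (mnm ?g * f) (?g + ?a n)"
        using van[of "?g + ?a n"] unfolding next_a[symmetric] by (simp only: left_diff_distrib lookup_minus right_minus_eq)
      then show ?case unfolding lookup_mnm_mult using Suc by simp
    qed simp
    then have sub: "range ?a \<subseteq> Poly_Mapping.keys f" using nz by (auto simp: in_keys_iff)
    have "inj ?a"
    proof (rule injI)
      fix n n' assume "?a n = ?a n'"
      then have "Poly_Mapping.lookup (?a n) i = Poly_Mapping.lookup (?a n') i" by simp
      then show "n = n'" using ij by (simp add: lookup_add lookup_minus lookup_single)
    qed
    then show False using finite_subset[OF sub] range_inj_infinite by auto
  qed
  assume Qa: "Q (Poly_Mapping.lookup a m)"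
  show ?thesis
  proof (cases "m = j")
    case False
    from main[OF Qa ij this van] show ?thesis by simp
  next
    case True
    then have "m \<noteq> i" using ij by simp
    then show ?thesis
    proof (rule main[OF Qa ij[symmetric]])
      fix a assume "Q (Poly_Mapping.lookup a m)"
      from van[OF this] show "Poly_Mapping.lookup ((mnm (Poly_Mapping.single j 1) - mnm (Poly_Mapping.single i 1)) * f) a = 0"
        by (simp add: left_diff_distrib lookup_minus)
    qed
  qed
qed

lemma divide_dlt:
  assumes down: "\<And>s t. Q s \<Longrightarrow> t \<le> s \<Longrightarrow> Q (t :: int)"
    and van: "\<And>a. Q (Poly_Mapping.lookup a m) \<Longrightarrow> Poly_Mapping.lookup (dlt N * f) a = 0"
    and Qa: "Q (Poly_Mapping.lookup a m)"
  shows "Poly_Mapping.lookup f a = 0"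
proof -
  let ?f = "\<lambda>(i, j). mnm (Poly_Mapping.single i (1::int)) - mnm (Poly_Mapping.single j 1)"
  have "finite S \<Longrightarrow> (\<And>i j. (i, j) \<in> S \<Longrightarrow> i \<noteq> j) \<Longrightarrow>
      (\<And>a. Q (Poly_Mapping.lookup a m) \<Longrightarrow> Poly_Mapping.lookup (prod ?f S * f) a = 0) \<Longrightarrow>
      Q (Poly_Mapping.lookup a m) \<Longrightarrow> Poly_Mapping.lookup f a = 0" for S a
  proof (induction S arbitrary: a rule: finite_induct)
    case (insert x S)
    obtain i j where x: "x = (i, j)" by (cases x)
    have ij: "i \<noteq> j" using insert.prems(1) x by blast
    have "Poly_Mapping.lookup (prod ?f S * f) b = 0" if "Q (Poly_Mapping.lookup b m)" for b
    proof (rule divide_difference[where Q = Q and m = m, OF ij])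
      show "Q t" if "Q s" "t \<le> s" for s t using down that .
      show "Q (Poly_Mapping.lookup b m)" by fact
      fix a assume "Q (Poly_Mapping.lookup a m)"
      from insert.prems(2)[OF this] insert.hyps
      show "Poly_Mapping.lookup ((mnm (Poly_Mapping.single i 1) - mnm (Poly_Mapping.single j 1)) * (prod ?f S * f)) a = 0"
        by (simp add: x mult.assoc)
    qed
    then show ?case using insert.IH insert.prems by blast
  qed simp
  from this[OF finite_pairs, of N a] show ?thesis using van Qa by (auto simp: dlt_def)
qed

lemma divide_dlt_power:
  assumes down: "\<And>s t. Q s \<Longrightarrow> t \<le> s \<Longrightarrow> Q (t :: int)"
    and van: "\<And>a. Q (Poly_Mapping.lookup a m) \<Longrightarrow> Poly_Mapping.lookup (dlt N ^ M * f) a = 0"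
  shows "Q (Poly_Mapping.lookup a m) \<Longrightarrow> Poly_Mapping.lookup f a = 0"
  using van
proof (induction M arbitrary: a)
  case (Suc M)
  have "Poly_Mapping.lookup (dlt N ^ M * f) b = 0" if "Q (Poly_Mapping.lookup b m)" for b
    by (rule divide_dlt[where Q = Q and m = m and N = N]) (use down Suc.prems(2) that in \<open>simp_all add: mult.assoc\<close>)
  then show ?case using Suc.IH Suc.prems(1) by blast
qed simp

section \<open>Symbols of elements preserving polynomials\<close>

definition emb :: "(nat \<Rightarrow> nat) \<Rightarrow> (nat \<Rightarrow> nat) \<Rightarrow> lpoly \<Rightarrow> (sym \<Rightarrow>\<^sub>0 complex)" where
  "emb b w q = (\<Sum>a\<in>Poly_Mapping.keys q. Poly_Mapping.single (a, b, w) (Poly_Mapping.lookup q a))"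

lemma lookup_emb: "Poly_Mapping.lookup (emb b w q) (a, b', w') = (if b' = b \<and> w' = w then Poly_Mapping.lookup q a else 0)"
proof -
  have "Poly_Mapping.lookup (emb b w q) (a, b', w') =
      (\<Sum>x\<in>Poly_Mapping.keys q. if x = a then (if b' = b \<and> w' = w then Poly_Mapping.lookup q a else 0) else 0)"
    unfolding emb_def lookup_sum by (rule sum.cong) (auto simp: lookup_single when_def)
  then show ?thesis by (simp add: in_keys_iff)
qed

lemma keys_emb: "m \<in> Poly_Mapping.keys (emb b w q) \<Longrightarrow> \<exists>a. m = (a, b, w)"
  by (cases m) (auto simp: in_keys_iff lookup_emb split: if_splits)

lemma realize_sum: "realize N u (sum f S) = (\<Sum>x\<in>S. realize N u (f x))"
  by (induction S rule: infinite_finite_induct) (simp_all add: realize_zero realize_add)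

lemma realize_emb: "realize N u (emb b w q) = mulop q * mon N u (0, b, w)"
  unfolding emb_def realize_sum realize_single mulop_decomp[of q] sum_distrib_right mult.assoc Xm_mon by simp

lemma r0_decomp: "r0 N k u p = (\<Sum>w\<in>Poly_Mapping.keys p. cst (Poly_Mapping.lookup p w) * r0 N k u (wp (letters w)))"
proof -
  have "r0 N k u p = r0 N k u (\<Sum>w\<in>Poly_Mapping.keys p. Poly_Mapping.single w (Poly_Mapping.lookup p w))"
    by (simp only: poly_mapping_decomp[symmetric])
  also have "\<dots> = (\<Sum>w\<in>Poly_Mapping.keys p. r0 N k u (Poly_Mapping.single w (Poly_Mapping.lookup p w)))"
    by (rule additive_sum[OF r0_add])
  also have "\<dots> = (\<Sum>w\<in>Poly_Mapping.keys p. cst (Poly_Mapping.lookup p w) * r0 N k u (wp (letters w)))"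
    by (rule sum.cong) (simp_all add: r0_single[of N k u _ "Poly_Mapping.lookup p _"] wp_def)
  finally show ?thesis .
qed

lemma mulop_prod_subalg:
  assumes R: "subalg R" and S: "finite S" "\<And>x. x \<in> S \<Longrightarrow> mulop (f x) \<in> R"
  shows "mulop (prod f S) \<in> R"
  using S
proof (induction S rule: finite_induct)
  case empty
  show ?case by (simp only: prod.empty mulop_one subalg_one[OF R])
next
  case (insert x S)
  then have "mulop (f x) \<in> R" "mulop (prod f S) \<in> R" by auto
  then show ?case unfolding prod.insert[OF insert.hyps] mulop_mult by (rule subalg_mult[OF R])
qed

lemma dlt_ENp: "mulop (dlt N ^ M) \<in> RP N"
proof -
  have "mulop ((\<lambda>(i, j). mnm (Poly_Mapping.single i 1) - mnm (Poly_Mapping.single j 1)) x) \<in> RP N"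
    if "x \<in> {(i, j). i \<in> {1..N} \<and> j \<in> {1..N}}" for x :: "nat \<times> nat"
    unfolding split_def mulop_diff
    by (rule subalg_diff[OF subalg_RP]; rule mulop_ENp) (use unit_ENp that in \<open>auto simp del: One_nat_def\<close>)
  then have "mulop (dlt N) \<in> RP N" unfolding dlt_def
    by (intro mulop_prod_subalg[OF subalg_RP finite_pairs]) auto
  then have "mulop (\<Prod>_\<in>{..<M}. dlt N) \<in> RP N"
    by (intro mulop_prod_subalg[OF subalg_RP]) auto
  then show ?thesis by simp
qed

text \<open>The symbol sees words only through their image, hence the sum over all words with the
  given one. After multiplication by a power of the discriminant, p acts as a differential operator
  with polynomial coefficients, to which the zero count applies; division by that power then returns
  to the original coefficients.\<close>

theorem top_coefficients:
  assumes N: "1 \<le> N"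
    and z: "\<forall>i\<in>{1..l}. \<forall>j\<in>{1..l}. i \<noteq> j \<longrightarrow> z i - z j \<notin> \<int>"
    and p: "p \<in> Pl N (Suc R)"
    and pres: "\<forall>j\<in>{1..l}. r0 N k (z j) p \<in> presv (ENp N)"
    and m0: "deg N (a0, b0, w0) = R" and i: "i \<in> {1..N}"
    and bad: "int l * Poly_Mapping.lookup a0 i + int (b0 i) < 0"
  shows "(\<Sum>w\<in>{w\<in>Poly_Mapping.keys p. img (letters w) = (a0, b0, w0)}. Poly_Mapping.lookup p w) = 0"
proof -
  let ?I = "\<lambda>w. img (letters w)"
  have word: "set (letters w) \<subseteq> gens N" "yc (letters w) \<le> R" if "w \<in> Poly_Mapping.keys p" for w
    using p that by (auto simp: Pl_def okp_def)
  define fam where "fam M w = (\<lambda>u. mulop (dlt N ^ M) * r0 N k u (wp (letters w)) - mulop (dlt N ^ M) * mon N u (?I w))" for M w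
  have "\<exists>M. fam M w \<in> NF N R" if "w \<in> Poly_Mapping.keys p" for w
    using word_symbol[OF N word(1)[OF that], of k] NF_mono[OF _ word(2)[OF that]] unfolding fam_def by blast
  then obtain Mf where Mf: "\<And>w. w \<in> Poly_Mapping.keys p \<Longrightarrow> fam (Mf w) w \<in> NF N R" by metis
  \<comment> \<open>One exponent for all words is needed; the sum dominates each of the individual
    ones.\<close>
  define M where "M = (\<Sum>w\<in>Poly_Mapping.keys p. Mf w)"
  have M: "fam M w \<in> NF N R" if w: "w \<in> Poly_Mapping.keys p" for w
  proof -
    have "Mf w \<le> M" unfolding M_def by (rule member_le_sum[OF w]) auto
    then obtain s where s: "M = s + Mf w" using le_Suc_ex by (metis add.commute)
    have "fam M w = (\<lambda>u. mulop (dlt N ^ s) * fam (Mf w) w u)"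
      unfolding fam_def s power_add mulop_mult by (simp add: right_diff_distrib mult.assoc)
    then show ?thesis using NF_mulop[OF Mf[OF w]] by simp
  qed
  let ?c = "Poly_Mapping.lookup p" and ?D = "dlt N ^ M"
  define D where "D = (\<Sum>w\<in>Poly_Mapping.keys p.
    emb (imgY (letters w)) (imgP (letters w)) (con (?c w) * (?D * mnm (imgX (letters w)))))"
  have realD: "realize N u D = (\<Sum>w\<in>Poly_Mapping.keys p. cst (?c w) * (mulop ?D * mon N u (?I w)))" for u
    unfolding D_def realize_sum realize_emb mulop_mult mult.assoc Xm_mon img_def by simp
  have "(\<lambda>u. \<Sum>w\<in>Poly_Mapping.keys p. cst (?c w) * fam M w u) \<in> NF N R"
    by (intro NF_sum NF_scal M)
  moreover have "(\<Sum>w\<in>Poly_Mapping.keys p. cst (?c w) * fam M w u) = mulop ?D * r0 N k u p - realize N u D" for u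
    unfolding realD r0_decomp[of N k u p] sum_distrib_left sum_subtractf[symmetric] fam_def right_diff_distrib
      cst.sc_left_commute[of "mulop ?D"] ..
  ultimately have "(\<lambda>u. mulop ?D * r0 N k u p - realize N u D) \<in> NF N R" by (simp only:)
  then obtain d' where d': "\<forall>m\<in>Poly_Mapping.keys d'. valid N m \<and> deg N m < R"
    and real': "(\<lambda>u. mulop ?D * r0 N k u p - realize N u D) = (\<lambda>u. realize N u d')"
    unfolding NF_def by blast
  have real: "realize N u (D + d') = mulop ?D * r0 N k u p" for u
    unfolding realize_add using fun_cong[OF real', of u] by (simp add: algebra_simps)
  have keysD: "valid N m \<and> deg N m < Suc R" if mD: "m \<in> Poly_Mapping.keys D" for m
  proof -
    obtain w where w: "w \<in> Poly_Mapping.keys p"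
      "m \<in> Poly_Mapping.keys (emb (imgY (letters w)) (imgP (letters w)) (con (?c w) * (?D * mnm (imgX (letters w)))))"
      using subsetD[OF Poly_Mapping.keys_sum mD[unfolded D_def]] by blast
    then obtain a where m: "m = (a, imgY (letters w), imgP (letters w))" using keys_emb by blast
    show ?thesis using img_valid[OF word(1)[OF w(1)]] word(2)[OF w(1)] by (simp add: m img_def valid_def deg_def)
  qed
  have keys: "\<forall>m\<in>Poly_Mapping.keys (D + d'). valid N m \<and> deg N m < Suc R"
  proof
    fix m assume "m \<in> Poly_Mapping.keys (D + d')"
    then have "m \<in> Poly_Mapping.keys D \<union> Poly_Mapping.keys d'" using Poly_Mapping.keys_add[of D d'] by blast
    then show "valid N m \<and> deg N m < Suc R" using keysD d' less_SucI by blast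
  qed
  have pres': "\<forall>j\<in>{1..l}. realize N (z j) (D + d') \<in> presv (ENp N)"
    unfolding real using pres dlt_ENp[of N M] subalg_mult[OF subalg_presv] by blast
  \<comment> \<open>The coefficient polynomial of \<theta>^b0 w0 before denominators are cleared; in
    \<open>D\<close> it appears multiplied by the power of the discriminant.\<close>
  define q where "q = (\<Sum>w\<in>{w\<in>Poly_Mapping.keys p. imgY (letters w) = b0 \<and> imgP (letters w) = w0}. con (?c w) * mnm (imgX (letters w)))"
  have qD: "Poly_Mapping.lookup (?D * q) a = Poly_Mapping.lookup D (a, b0, w0)" for a
  proof -
    have "Poly_Mapping.lookup (?D * q) a = (\<Sum>w\<in>{w\<in>Poly_Mapping.keys p. imgY (letters w) = b0 \<and> imgP (letters w) = w0}.
        Poly_Mapping.lookup (con (?c w) * (?D * mnm (imgX (letters w)))) a)"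
      unfolding q_def sum_distrib_left lookup_sum by (simp only: mult.left_commute)
    also have "\<dots> = (\<Sum>w\<in>Poly_Mapping.keys p. if imgY (letters w) = b0 \<and> imgP (letters w) = w0 then
        Poly_Mapping.lookup (con (?c w) * (?D * mnm (imgX (letters w)))) a else 0)"
      by (rule sum.inter_filter) simp
    also have "\<dots> = Poly_Mapping.lookup D (a, b0, w0)"
      unfolding D_def lookup_sum lookup_emb by (rule sum.cong) auto
    finally show ?thesis .
  qed
  have "Poly_Mapping.lookup q a0 = 0"
  \<comment> \<open>Inadmissibility depends on the single coordinate i and persists when this
    coordinate decreases, which is what division by the discriminant requires.\<close>
  proof (rule divide_dlt_power[of "\<lambda>s. int l * s + int (b0 i) < 0" i N M q a0])
    show "int l * t + int (b0 i) < 0" if "int l * s + int (b0 i) < 0" "t \<le> s" for s t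
      using that mult_left_mono[of t s "int l"] by linarith
    fix a assume a: "int l * Poly_Mapping.lookup a i + int (b0 i) < 0"
    have dg: "deg N (a, b0, w0) = R" using m0 by (simp add: deg_def)
    have "Poly_Mapping.lookup (D + d') (a, b0, w0) = 0"
      by (rule symbol_vanish[OF z keys pres' dg i a])
    moreover have "Poly_Mapping.lookup d' (a, b0, w0) = 0" using d' dg by (auto simp: in_keys_iff)
    ultimately show "Poly_Mapping.lookup (?D * q) a = 0" unfolding qD by (simp add: lookup_add)
  qed (rule bad)
  moreover have "Poly_Mapping.lookup q a0 = (\<Sum>w\<in>{w\<in>Poly_Mapping.keys p. img (letters w) = (a0, b0, w0)}. ?c w)"
  proof -
    have "Poly_Mapping.lookup q a0 = (\<Sum>w\<in>{w\<in>Poly_Mapping.keys p. imgY (letters w) = b0 \<and> imgP (letters w) = w0}.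
        if imgX (letters w) = a0 then ?c w else 0)"
      unfolding q_def lookup_sum by (rule sum.cong) (auto simp: mult_single lookup_single when_def)
    also have "\<dots> = (\<Sum>w\<in>{w\<in>{w\<in>Poly_Mapping.keys p. imgY (letters w) = b0 \<and> imgP (letters w) = w0}. imgX (letters w) = a0}. ?c w)"
      by (rule sum.inter_filter[symmetric]) simp
    also have "{w\<in>{w\<in>Poly_Mapping.keys p. imgY (letters w) = b0 \<and> imgP (letters w) = w0}. imgX (letters w) = a0} =
        {w\<in>Poly_Mapping.keys p. img (letters w) = (a0, b0, w0)}" by (auto simp: img_def)
    finally show ?thesis .
  qed
  ultimately show ?thesis by simp
qed

section \<open>Stability: the cyclotomic generators and the closed subalgebra of stabilizing
  elements\<close>

section \<open>The generators preserve polynomials\<close>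

text \<open>Modulo left multiples of X_i, the inverse of T_i is t^-1 s_i, with t standing for
  \<open>tpar k\<close>. Indeed (X_i / X_(i+1) - 1) times the quotient equals X_i
  \<open>qop'\<close> - \<open>qop\<close>, so that \<open>qop\<close> becomes 1 - s_i up to a left
  multiple of X_i.\<close>

lemma TEi_split:
  "TEi k i = scE (inverse (tpar k)) * fps_const (sop (sr i)) + opX i * (scE (cpar k) * fps_const (qop' i))"
proof -
  have "mulop (mnm (sroot i) - 1) * qop i =
      (Xm (Poly_Mapping.single i 1) - Xm (Poly_Mapping.single (i + 1) 1)) * qop' i"
    unfolding qop_qop'[of i] mult.assoc[symmetric] mulop_mult[symmetric] mulop_diff[symmetric]
    by (simp only: left_diff_distrib mnm_mult diff_add_cancel mult_1)
  then have "sop (sr i) - 1 = Xm (Poly_Mapping.single i 1) * qop' i - qop i"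
    unfolding qop_eq left_diff_distrib qop_qop'[symmetric] .
  moreover have "q = 1 + a - s" if "s - 1 = a - q" for q a s :: lop
  proof -
    have "1 + a - s = a - (s - 1)" by simp
    then show ?thesis unfolding that by simp
  qed
  ultimately have q0: "qop i = 1 + Xm (Poly_Mapping.single i 1) * qop' i - sop (sr i)" by blast
  have q: "fps_const (qop i) = 1 + opX i * fps_const (qop' i) - fps_const (sop (sr i))"
    unfolding fps_const_combine q0 by (simp only: fps_const_1_eq_1[symmetric] fps_const_add fps_const_sub)
  have t: "scE (inverse (tpar k)) = scE (tpar k) - scE (cpar k)" by (simp add: cpar_def scE_diff)
  have ring_id: "t * s + c * (1 + y - s) - c = (t - c) * s + c * y" for t s c y :: "lop fps"
    by (simp add: left_diff_distrib right_diff_distrib distrib_left)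
  show ?thesis unfolding TEi_def TE_def q t scE_left_commute[of "opX i"]
    by (rule ring_id)
qed

lemma split_step:
  fixes a S x r c s y q :: "'a::ring_1"
  assumes "S * c = c * S" "S * y = x * S" "a * x = x * a"
  shows "(a * S + x * r) * (c * s + y * q) = a * c * (S * s) + x * (a * (S * q) + r * (c * s + y * q))"
proof -
  have "a * S * (c * s) = a * (S * c) * s" "a * S * (y * q) = a * (S * y) * q" by (simp_all only: mult.assoc)
  moreover have "a * (x * S) * q = a * x * (S * q)" by (simp only: mult.assoc)
  ultimately have "a * S * (c * s) = a * c * (S * s)" "a * S * (y * q) = x * a * (S * q)"
    unfolding assms by (simp_all only: mult.assoc)
  then show ?thesis by (simp only: distrib_left distrib_right mult.assoc add_ac)
qed

text \<open>The permutations already collected carry X_(m+1) to X_1, so the remainders of all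
  factors become left multiples of the single variable X_1.\<close>

lemma prod_TEi_split:
  "m < N \<Longrightarrow> \<exists>r\<in>ops (RP N). prod_list (map (TEi k) [1..<Suc m]) =
     scE (inverse (tpar k) ^ m) * fps_const (prod_list (map (\<lambda>i. sop (sr i)) [1..<Suc m])) + opX 1 * r"
proof (induction m)
  case 0
  show ?case by (intro bexI[of _ 0] ops_zero[OF subalg_RP]) (simp add: scE_one)
next
  case (Suc m)
  let ?S = "\<lambda>m. fps_const (prod_list (map (\<lambda>i. sop (sr i)) [1..<Suc m]))"
  let ?c = "inverse (tpar k)" and ?s = "fps_const (sop (sr (Suc m)))"
    and ?q = "scE (cpar k) * fps_const (qop' (Suc m))"
  from Suc obtain r where r: "r \<in> ops (RP N)"
    "prod_list (map (TEi k) [1..<Suc m]) = scE (?c ^ m) * ?S m + opX 1 * r" by auto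
  have move: "prod_list (map (\<lambda>i. sop (sr i)) [1..<Suc n]) * Xm (Poly_Mapping.single (Suc n) 1) =
      Xm (Poly_Mapping.single 1 1) * prod_list (map (\<lambda>i. sop (sr i)) [1..<Suc n])" for n
  proof (induction n)
    case (Suc n)
    have "sop (sr (Suc n)) * Xm (Poly_Mapping.single (Suc (Suc n)) 1) = Xm (Poly_Mapping.single (Suc n) 1) * sop (sr (Suc n))"
      by (simp add: sop_Xm)
    from intertwine_mult[OF Suc.IH[symmetric] this[symmetric]] show ?case by simp
  qed simp
  have moveS: "?S m * opX (Suc m) = opX 1 * ?S m" by (simp only: fps_const_combine move)
  have S: "?S m \<in> ops (RP N)" "?s \<in> ops (RP N)" "fps_const (qop' (Suc m)) \<in> ops (RP N)"
  proof -
    have sop: "sop (sr i) \<in> RP N" if "i \<in> {1..<N}" for i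
      using that by (intro sop_RP sr_perm) auto
    have "set is \<subseteq> {1..<N} \<Longrightarrow> prod_list (map (\<lambda>i. sop (sr i)) is) \<in> RP N" for "is"
    proof (induction "is")
      case Nil
      show ?case using subalg_one[OF subalg_RP] by simp
    next
      case (Cons i "is")
      then show ?case using subalg_mult[OF subalg_RP sop[of i]] by simp
    qed
    then show "?S m \<in> ops (RP N)" using Suc.prems by (intro ops_const[OF subalg_RP]) (auto simp del: upt_Suc)
    show "?s \<in> ops (RP N)" using sop[of "Suc m"] Suc.prems by (intro ops_const[OF subalg_RP]) simp
    show "fps_const (qop' (Suc m)) \<in> ops (RP N)" using Suc.prems by (intro ops_const[OF subalg_RP] qop'_RP) auto
  qed
  let ?r = "scE (?c ^ m) * (?S m * ?q) + r * (scE ?c * ?s + opX (Suc m) * ?q)"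
  have snoc: "[1..<Suc (Suc m)] = [1..<Suc m] @ [Suc m]" by simp
  have "prod_list (map (TEi k) [1..<Suc (Suc m)]) =
      (scE (?c ^ m) * ?S m + opX 1 * r) * (scE ?c * ?s + opX (Suc m) * ?q)"
    unfolding snoc map_append prod_list.append r(2) by (simp only: list.map prod_list.Cons prod_list.Nil mult_1_right TEi_split)
  also have "\<dots> = scE (?c ^ m) * scE ?c * (?S m * ?s) + opX 1 * ?r"
    by (rule split_step[OF scE_central[symmetric] moveS scE_central])
  also have "scE (?c ^ m) * scE ?c * (?S m * ?s) = scE (?c ^ Suc m) * ?S (Suc m)"
    unfolding snoc map_append prod_list.append scE_mult[symmetric] fps_const_combine power_Suc2
    by (simp only: list.map prod_list.Cons prod_list.Nil mult_1_right)
  finally have "prod_list (map (TEi k) [1..<Suc (Suc m)]) = scE (?c ^ Suc m) * ?S (Suc m) + opX 1 * ?r" .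
  moreover have "?r \<in> ops (RP N)" using Suc.prems
    by (intro ops_add[OF subalg_RP] ops_mult[OF subalg_RP] ops_scE[OF subalg_RP] r(1) S opX_RP) auto
  ultimately show ?case by blast
qed

text \<open>Explains the shape of the last generator: Y_1 - e^(\<epsilon>u) maps polynomials to
  multiples of X_1, so that X_1^-1 may be applied afterwards.\<close>

lemma YE_1_split: assumes N: "1 \<le> N" shows "\<exists>r\<in>ops (RP N). YE N k u 1 = scE (fps_exp u) + opX 1 * r"
proof -
  let ?S = "prod_list (map (\<lambda>i. sop (sr i)) [1..<N])"
  \<comment> \<open>The part of Y_1 without left multiples of X_1. The permutations undo the cyclic
    shift in \<omega>, so this operator is diagonal, with eigenvalue e^(\<epsilon>(a_1 + u)) on
    X^a.\<close>
  define D where "D = fps_const ?S * omE N u"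
  have D: "app (fps_nth D n) (mnm a) = con (fps_nth (fps_exp (of_int (Poly_Mapping.lookup a 1) + u)) n) * mnm a" for n a
  proof -
    have "?S * sop (cyc N) = sop (cyc 1)" using prod_sop_cyc[of "N - 1" N] N by simp
    moreover have "cyc 1 = id" by (auto simp: cyc_def fun_eq_iff)
    ultimately have "?S * sop (cyc N) = 1" by (simp add: sop_id)
    then have "app ?S (app (sop (cyc N)) (mnm a)) = mnm a" by (metis app_times app_1)
    then have "app ?S (mnm (subst_expo (cyc N) a)) = mnm a" by (simp only: app_sop)
    then show ?thesis unfolding D_def fps_mult_left_const_nth app_times omE_nth app_con by simp
  qed
  \<comment> \<open>For a_1 = 0 the eigenvalue is e^(\<epsilon>u) and the difference vanishes; hence
    division by X_1 keeps polynomials polynomial.\<close>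
  define r where "r = opXi 1 * (D - scE (fps_exp u))"
  have r_nth: "app (fps_nth r n) (mnm a) =
      con (fps_nth (fps_exp (of_int (Poly_Mapping.lookup a 1) + u)) n - fps_nth (fps_exp u) n) * mnm (a - Poly_Mapping.single 1 1)" for n a
  proof -
    have "app (fps_nth r n) (mnm a) = mnm (- Poly_Mapping.single 1 1) * (app (fps_nth D n) (mnm a) - con (fps_nth (fps_exp u) n) * mnm a)"
      unfolding r_def fps_mult_left_const_nth fps_sub_nth app_times app_minus' app_mulop scE_nth app_mulop ..
    also have "\<dots> = mnm (- Poly_Mapping.single 1 1) * ((con (fps_nth (fps_exp (of_int (Poly_Mapping.lookup a 1) + u)) n) - con (fps_nth (fps_exp u) n)) * mnm a)"
      unfolding D left_diff_distrib ..
    also have "\<dots> = con (fps_nth (fps_exp (of_int (Poly_Mapping.lookup a 1) + u)) n - fps_nth (fps_exp u) n) * mnm (- Poly_Mapping.single 1 1 + a)"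
      unfolding single_diff by (simp add: mult_single)
    finally show ?thesis by simp
  qed
  have mem: "Poly_Mapping.keys (app (fps_nth r n) (mnm a)) \<subseteq> K" if "Poly_Mapping.lookup a 1 \<noteq> 0 \<longrightarrow> a - Poly_Mapping.single 1 1 \<in> K" for n a K
  proof (cases "Poly_Mapping.lookup a 1 = 0")
    case True
    then show ?thesis unfolding r_nth by simp
  next
    case False
    have "Poly_Mapping.keys (app (fps_nth r n) (mnm a)) \<subseteq> Poly_Mapping.keys (mnm (a - Poly_Mapping.single 1 1))"
      unfolding r_nth by (rule keys_con_mult)
    then show ?thesis using that False by auto
  qed
  have EN: "a - Poly_Mapping.single 1 1 \<in> EN N" if "a \<in> EN N" for a
    using that N by (auto simp: EN_iff lookup_minus lookup_single when_def)
  have ENp: "a - Poly_Mapping.single 1 1 \<in> ENp N" if a: "a \<in> ENp N" and a1: "Poly_Mapping.lookup a 1 \<noteq> 0" for a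
  proof -
    have "0 \<le> Poly_Mapping.lookup a j" for j using a by (simp add: ENp_def)
    moreover from this[of 1] a1 have "1 \<le> Poly_Mapping.lookup a 1" by linarith
    ultimately have "0 \<le> Poly_Mapping.lookup (a - Poly_Mapping.single 1 1) j" for j
      by (cases "j = 1") (simp_all add: lookup_minus lookup_single)
    then show ?thesis using a EN by (simp add: ENp_def)
  qed
  have "fps_nth r n \<in> RP N" for n
  proof
    show "fps_nth r n \<in> RV N" unfolding presv_def by (intro CollectI ballI mem impI EN)
    show "fps_nth r n \<in> presv (ENp N)" unfolding presv_def by (intro CollectI ballI mem impI ENp)
  qed
  then have r: "r \<in> ops (RP N)" by (simp add: ops_def)
  have "opX 1 * r = (opX 1 * opXi 1) * (D - scE (fps_exp u))" unfolding r_def by (simp only: mult.assoc)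
  then have Dr: "D = scE (fps_exp u) + opX 1 * r" unfolding opX_opXi by simp
  obtain r' where r': "r' \<in> ops (RP N)"
    "prod_list (map (TEi k) [1..<N]) = scE (inverse (tpar k) ^ (N - 1)) * fps_const ?S + opX 1 * r'"
    using prod_TEi_split[of "N - 1" N k] N by auto
  have tt: "scE (tpar k ^ (N - 1)) * scE (inverse (tpar k) ^ (N - 1)) = 1"
    unfolding scE_mult[symmetric] power_mult_distrib[symmetric] tpar_inverse by simp
  have "YE N k u 1 = scE (tpar k ^ (N - 1)) * (prod_list (map (TEi k) [1..<N]) * omE N u)"
    by (simp add: YE_def aff.Y_def aff.G_def aff.P_def aff.A_def)
  also have "\<dots> = (scE (tpar k ^ (N - 1)) * scE (inverse (tpar k) ^ (N - 1))) * D
      + opX 1 * (scE (tpar k ^ (N - 1)) * (r' * omE N u))"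
    unfolding r' D_def by (simp only: distrib_left distrib_right mult.assoc scE_left_commute[of "opX 1"])
  finally have "YE N k u 1 = scE (fps_exp u) + opX 1 * (r + scE (tpar k ^ (N - 1)) * (r' * omE N u))"
    unfolding tt Dr by (simp only: mult_1_left distrib_left add.assoc)
  moreover have "r + scE (tpar k ^ (N - 1)) * (r' * omE N u) \<in> ops (RP N)"
    by (intro ops_add[OF subalg_RP] ops_mult[OF subalg_RP] ops_scE[OF subalg_RP] r r'(1) omE_RP)
  ultimately show ?thesis by blast
qed

abbreviation cyc_prod :: "nat \<Rightarrow> (nat \<Rightarrow> complex) \<Rightarrow> free_elt" where
  "cyc_prod l z \<equiv> prod_list (map (\<lambda>i. cyclotomic_factor (z i)) [1..<Suc l])"

lemma cyclotomic_factor_X: "fps_X * cyclotomic_factor x = fY 1 - scal (fps_exp x)"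
  by (rule fps_ext) (simp add: cyclotomic_factor_def fY_nths split: nat.split)

lemma FF_cyclotomic_factor: "1 \<le> N \<Longrightarrow> cyclotomic_factor x \<in> FF N"
  unfolding cyclotomic_factor_def by (intro FF_shift FF_intros) simp

lemma FF_cyc_prod: "1 \<le> N \<Longrightarrow> cyc_prod l z \<in> FF N"
  by (rule FF_prod_list) (auto intro: FF_cyclotomic_factor)

lemma repE_cyclotomic_factor:
  assumes N: "1 \<le> N"
  shows "\<exists>c. \<exists>r\<in>ops (RP N). repE N k u (cyclotomic_factor x) = scE c + opX 1 * r \<and> (x = u \<longrightarrow> c = 0)"
proof -
  obtain r where r: "r \<in> ops (RP N)" "YE N k u 1 = scE (fps_exp u) + opX 1 * r" using YE_1_split[OF N] by blast
  let ?A = "repE N k u (cyclotomic_factor x)"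
  have "fps_X * ?A = scE (fps_exp u) + opX 1 * r - scE (fps_exp x)"
    unfolding rep_X[symmetric] cyclotomic_factor_X using N r(2) by (simp add: rep_diff repE_fY)
  then have "fps_X * ?A = scE (fps_exp u - fps_exp x) + opX 1 * r" by (simp add: scE_diff)
  then have "fps_nth (fps_X * ?A) (Suc n) = fps_nth (scE (fps_exp u - fps_exp x) + opX 1 * r) (Suc n)" for n by simp
  then have "?A = scE (fps_shift 1 (fps_exp u - fps_exp x)) + opX 1 * fps_shift 1 r"
    by (intro fps_ext) (simp add: fps_mult_left_const_nth)
  moreover have "fps_shift 1 r \<in> ops (RP N)" using r(1) by (simp add: ops_def)
  moreover have "x = u \<longrightarrow> fps_shift 1 (fps_exp u - fps_exp x) = 0" by simp
  ultimately show ?thesis by blast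
qed

text \<open>Each factor is a scalar plus a left multiple of X_1, and the scalar is zero for the
  factor that matches the twist. The factors before it keep the divisibility, because scalars
  commute with X_1, and the factors after it are harmless on the right.\<close>

lemma repE_cyc_prod:
  assumes N: "1 \<le> N" and u: "u \<in> z ` {1..l}"
  shows "\<exists>r\<in>ops (RP N). repE N k u (cyc_prod l z) = opX 1 * r"
proof -
  have X1: "opX 1 \<in> ops (RP N)" using N by (intro opX_RP) simp
  have RP: "repE N k u (cyclotomic_factor x) \<in> ops (RP N)" for x
  proof -
    obtain c r where r: "r \<in> ops (RP N)" and e: "repE N k u (cyclotomic_factor x) = scE c + opX 1 * r"
      using repE_cyclotomic_factor[OF N] by blast
    show ?thesis unfolding e by (intro ops_add[OF subalg_RP] ops_mult[OF subalg_RP] ops_scE[OF subalg_RP] X1 r)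
  qed
  have "u \<in> set xs \<Longrightarrow> \<exists>r\<in>ops (RP N). prod_list (map (\<lambda>x. repE N k u (cyclotomic_factor x)) xs) = opX 1 * r" for xs
  proof (induction xs)
    case (Cons x xs)
    obtain c r where cr: "r \<in> ops (RP N)" "repE N k u (cyclotomic_factor x) = scE c + opX 1 * r" "x = u \<longrightarrow> c = 0"
      using repE_cyclotomic_factor[OF N] by blast
    let ?p = "prod_list (map (\<lambda>x. repE N k u (cyclotomic_factor x)) xs)"
    show ?case
    proof (cases "x = u")
      case True
      have "?p \<in> ops (RP N)" by (rule ops_prod_list[OF subalg_RP]) (auto simp: RP)
      then have "r * ?p \<in> ops (RP N)" by (rule ops_mult[OF subalg_RP cr(1)])
      moreover have "prod_list (map (\<lambda>x. repE N k u (cyclotomic_factor x)) (x # xs)) = opX 1 * (r * ?p)"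
      proof -
        have "scE 0 = 0" by (rule fps_ext) simp
        then have "repE N k u (cyclotomic_factor x) = opX 1 * r" using cr True by (simp only:) simp
        then show ?thesis by (simp only: list.map prod_list.Cons mult.assoc)
      qed
      ultimately show ?thesis by blast
    next
      case False
      then obtain r' where r': "r' \<in> ops (RP N)" "?p = opX 1 * r'" using Cons by auto
      have "prod_list (map (\<lambda>x. repE N k u (cyclotomic_factor x)) (x # xs)) = (scE c + opX 1 * r) * (opX 1 * r')"
        using cr(2) r'(2) by simp
      also have "\<dots> = opX 1 * (scE c * r' + r * (opX 1 * r'))"
        by (simp only: distrib_left distrib_right mult.assoc scE_left_commute[of "opX 1"])
      finally have "prod_list (map (\<lambda>x. repE N k u (cyclotomic_factor x)) (x # xs)) = opX 1 * (scE c * r' + r * (opX 1 * r'))" .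
      moreover have "scE c * r' + r * (opX 1 * r') \<in> ops (RP N)"
        by (intro ops_add[OF subalg_RP] ops_mult[OF subalg_RP] ops_scE[OF subalg_RP] cr(1) r'(1) X1)
      ultimately show ?thesis by blast
    qed
  qed simp
  moreover have "u \<in> set (map z [1..<Suc l])" using u by (simp only: set_map set_upt atLeastLessThanSuc_atLeastAtMost)
  ultimately have "\<exists>r\<in>ops (RP N). prod_list (map (\<lambda>x. repE N k u (cyclotomic_factor x)) (map z [1..<Suc l])) = opX 1 * r" by blast
  then show ?thesis by (simp only: rep_prod_list map_map o_def)
qed

definition fTi :: "complex \<Rightarrow> nat \<Rightarrow> free_elt" where "fTi k i = fT k i - scal (cpar k)"

lemma FF_fTi: "i \<in> {1..<N} \<Longrightarrow> fTi k i \<in> FF N" unfolding fTi_def by (intro FF_intros)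

lemma repE_fTi: "i \<in> {1..<N} \<Longrightarrow> repE N k u (fTi k i) = TEi k i" by (simp add: fTi_def rep_diff repE_fT TEi_def)

lemma fT_fTi: assumes i: "i \<in> {1..<N}"
  shows "fT k i * fTi k i - 1 \<in> JJ N k" "fTi k i * fT k i - 1 \<in> JJ N k"
proof -
  have e: "scal (tpar k) * scal (inverse (tpar k)) = (1 :: free_elt)" by (simp flip: scal_mult add: tpar_inverse)
  have "t * (t - (a - b)) - 1 = (t - a) * (t + b)" if "a * b = 1" "a * t = t * a" for t a b :: free_elt
    using that by (simp add: left_diff_distrib right_diff_distrib distrib_left)
  from this[OF e scal_central] have "fT k i * fTi k i - 1 = (fT k i - scal (tpar k)) * (fT k i + scal (inverse (tpar k)))" unfolding fTi_def cpar_def scal_diff .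
  then show "fT k i * fTi k i - 1 \<in> JJ N k" using subsetD[OF JJ_rels daha_rels.T_quadratic[OF i]] by simp
  moreover have "fTi k i * fT k i = fT k i * fTi k i"
    unfolding fTi_def left_diff_distrib right_diff_distrib scal_central[of "cpar k" "fT k i"] ..
  ultimately show "fTi k i * fT k i - 1 \<in> JJ N k" by simp
qed

definition inverse_pair :: "nat \<Rightarrow> complex \<Rightarrow> free_elt \<Rightarrow> free_elt \<Rightarrow> bool" where
  "inverse_pair N k f g \<longleftrightarrow> f \<in> FF N \<and> g \<in> FF N \<and> f * g - 1 \<in> JJ N k \<and> g * f - 1 \<in> JJ N k"

lemma inverse_pair_mult:
  assumes "inverse_pair N k f g" "inverse_pair N k f' g'"
  shows "inverse_pair N k (f * f') (g' * g)"
proof -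
  have e: "f * f' * (g' * g) - 1 = f * (f' * g' - 1) * g + (f * g - 1)"
    "g' * g * (f * f') - 1 = g' * (g * f - 1) * f' + (g' * f' - 1)"
    by (simp_all add: left_diff_distrib right_diff_distrib mult.assoc)
  show ?thesis using assms unfolding inverse_pair_def e
    by (intro conjI FF_mult JJ_add JJ_right[OF JJ_left]) simp_all
qed

lemma inverse_pair_prod_list:
  "(\<And>i. i \<in> set is \<Longrightarrow> inverse_pair N k (f i) (g i)) \<Longrightarrow>
   inverse_pair N k (prod_list (map f is)) (prod_list (map g (rev is)))"
proof (induction "is")
  case (Cons i "is")
  then show ?case using inverse_pair_mult[of N k "f i" "g i"] by simp
qed (simp add: inverse_pair_def FF_one JJ_zero)

definition fpi :: "nat \<Rightarrow> complex \<Rightarrow> free_elt" where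
  "fpi N k = fX 1 * prod_list (map (fT k) [1..<N])"

definition fpi_inv :: "nat \<Rightarrow> complex \<Rightarrow> free_elt" where
  "fpi_inv N k = prod_list (map (fTi k) (rev [1..<N])) * fXinv 1"

lemma fpi_inverse: assumes N: "1 \<le> N" shows "inverse_pair N k (fpi N k) (fpi_inv N k)"
  unfolding fpi_def fpi_inv_def
proof (rule inverse_pair_mult)
  show "inverse_pair N k (fX 1) (fXinv 1)"
    unfolding inverse_pair_def using N
    by (intro conjI FF_fX FF_fXinv subsetD[OF JJ_rels] daha_rels.X_Xinv daha_rels.Xinv_X) auto
  show "inverse_pair N k (prod_list (map (fT k) [1..<N])) (prod_list (map (fTi k) (rev [1..<N])))"
    by (rule inverse_pair_prod_list) (simp add: inverse_pair_def FF_fT FF_fTi fT_fTi)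
qed

lemma inverse_pair_cl:
  assumes "inverse_pair N k f g"
  shows "inv\<^bsub>HH N k\<^esub> (cl N k f) = cl N k g"
proof -
  interpret ring "HH N k" by (rule HH_ring)
  show ?thesis using assms unfolding inverse_pair_def
    by (intro inv_char) (simp_all add: cl_mult cl_one cl_eq_iff FF_mult FF_one cl_carrier)
qed

definition last_gen :: "nat \<Rightarrow> nat \<Rightarrow> (nat \<Rightarrow> complex) \<Rightarrow> complex \<Rightarrow> free_elt" where
  "last_gen N l z k = fpi_inv N k * cyc_prod l z"

definition gen_set :: "nat \<Rightarrow> nat \<Rightarrow> (nat \<Rightarrow> complex) \<Rightarrow> complex \<Rightarrow> free_elt set" where
  "gen_set N l z k = fT k ` {1..<N} \<union> fy ` {1..N} \<union> {fpi N k, last_gen N l z k}"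

lemma gen_set_FF: assumes N: "1 \<le> N" shows "gen_set N l z k \<subseteq> FF N"
proof -
  have pi: "fpi N k \<in> FF N" "fpi_inv N k \<in> FF N" using fpi_inverse[OF N, of k] by (simp_all add: inverse_pair_def)
  have "last_gen N l z k \<in> FF N" unfolding last_gen_def by (rule FF_mult[OF pi(2) FF_cyc_prod[OF N]])
  with pi(1) show ?thesis unfolding gen_set_def by (auto intro: FF_fT FF_fy)
qed

lemma cyclotomic_daha_eq:
  assumes N: "1 \<le> N"
  shows "cyclotomic_daha N l z 1 k = closed_subalgebra_generated N 1 k (cl N k ` gen_set N l z k)"
proof -
  have pi: "daha_pi N 1 k = cl N k (fpi N k)" by (simp only: daha_pi_def fpi_def)
  have "fpi_inv N k \<in> FF N" using fpi_inverse[OF N, of k] by (simp add: inverse_pair_def)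
  from cl_mult[OF this FF_cyc_prod[OF N]]
  have e: "inv\<^bsub>HH N k\<^esub> (cl N k (fpi N k)) \<otimes>\<^bsub>HH N k\<^esub> cl N k (cyc_prod l z) = cl N k (last_gen N l z k)"
    unfolding inverse_pair_cl[OF fpi_inverse[OF N]] last_gen_def .
  show ?thesis
    unfolding cyclotomic_daha_def gen_set_def image_Un image_image image_insert image_empty pi e ..
qed

text \<open>Representatives in the free algebra of the elements that preserve polynomials for all
  twists; by \<open>StF_congr\<close> membership depends only on the class.\<close>

definition StF :: "nat \<Rightarrow> nat \<Rightarrow> (nat \<Rightarrow> complex) \<Rightarrow> complex \<Rightarrow> free_elt set" where
  "StF N l z k = {f\<in>FF N. \<forall>i\<in>{1..l}. repE N k (z i) f \<in> ops (presv (ENp N))}"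

lemma preserves_plus_iff:
  assumes N: "1 \<le> N" and f: "f \<in> FF N"
  shows "preserves_plus N 1 k u (cl N k f) \<longleftrightarrow> repE N k u f \<in> ops (presv (ENp N))"
proof
  assume "preserves_plus N 1 k u (cl N k f)"
  then have pp: "act (repE N k u f) g \<in> PP_plus N" if "g \<in> PP_plus N" for g
    using preserves_plus_cl[OF N f] that by blast
  show "repE N k u f \<in> ops (presv (ENp N))"
    unfolding ops_def presv_def
  proof (intro CollectI allI ballI)
    fix n a assume a: "a \<in> ENp N"
    have "fps_const (mnm a) \<in> PP_plus N" using a by (auto simp: PP_plus_eq)
    from pp[OF this] have "Poly_Mapping.keys (fps_nth (act (repE N k u f) (fps_const (mnm a))) n) \<subseteq> ENp N"
      by (simp add: PP_plus_eq)
    moreover have "fps_nth (act (repE N k u f) (fps_const (mnm a))) n =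
        (\<Sum>i\<le>n. if i = n then app (fps_nth (repE N k u f) i) (mnm a) else 0)"
      unfolding act_nth by (rule sum.cong) auto
    ultimately show "Poly_Mapping.keys (app (fps_nth (repE N k u f) n) (mnm a)) \<subseteq> ENp N" by simp
  qed
next
  assume "repE N k u f \<in> ops (presv (ENp N))"
  from act_presv[OF this] show "preserves_plus N 1 k u (cl N k f)"
    unfolding preserves_plus_cl[OF N f] by (auto simp: PP_plus_eq)
qed

lemma StF_FF: "f \<in> StF N l z k \<Longrightarrow> f \<in> FF N" by (simp add: StF_def)

lemma Stab_eq: "1 \<le> N \<Longrightarrow>
  {a\<in>carrier (HH N k). \<forall>i\<in>{1..l}. preserves_plus N 1 k (z i) a} = cl N k ` StF N l z k"
  unfolding HH_carrier StF_def using preserves_plus_iff by fastforce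

lemma StF_congr:
  assumes N: "1 \<le> N" and "f \<in> StF N l z k" "g \<in> FF N" "f - g \<in> JJ N k"
  shows "g \<in> StF N l z k"
proof -
  have "repE N k u f = repE N k u g" for u using rep_JJ[OF N assms(4), of u] by (simp add: rep_diff)
  then show ?thesis using assms by (simp add: StF_def)
qed

lemma StF_cl_iff:
  assumes N: "1 \<le> N" and f: "f \<in> FF N"
  shows "cl N k f \<in> cl N k ` StF N l z k \<longleftrightarrow> f \<in> StF N l z k"
proof
  assume "cl N k f \<in> cl N k ` StF N l z k"
  then obtain g where g: "g \<in> StF N l z k" "cl N k f = cl N k g" by blast
  then have "g - f \<in> JJ N k" using cl_eq_iff[OF StF_FF[OF g(1)] f, of k] by simp
  then show "f \<in> StF N l z k" by (rule StF_congr[OF N g(1) f])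
qed (rule imageI)

lemma StF_mult: "f \<in> StF N l z k \<Longrightarrow> g \<in> StF N l z k \<Longrightarrow> f * g \<in> StF N l z k"
  by (simp add: StF_def rep_mult FF_mult ops_mult[OF subalg_presv])
lemma StF_add: "f \<in> StF N l z k \<Longrightarrow> g \<in> StF N l z k \<Longrightarrow> f + g \<in> StF N l z k"
  by (simp add: StF_def rep_add FF_add ops_add[OF subalg_presv])
lemma StF_diff: "f \<in> StF N l z k \<Longrightarrow> g \<in> StF N l z k \<Longrightarrow> f - g \<in> StF N l z k"
  by (simp add: StF_def rep_diff FF_diff ops_diff[OF subalg_presv])
lemma StF_scal: "scal c \<in> StF N l z k"
  by (simp add: StF_def FF_scal ops_scE[OF subalg_presv])
text \<open>Multiplication by \<epsilon> only shifts the coefficients of the operator. This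
  saturation allows the remainder of an approximation to be divided by \<epsilon> and approximated
  again.\<close>

lemma StF_X: "f \<in> FF N \<Longrightarrow> fps_X * f \<in> StF N l z k \<Longrightarrow> f \<in> StF N l z k"
proof -
  assume f: "f \<in> FF N" "fps_X * f \<in> StF N l z k"
  have "repE N k (z i) f \<in> ops (presv (ENp N))" if "i \<in> {1..l}" for i
  proof -
    have "fps_nth (fps_X * repE N k (z i) f) (Suc n) \<in> presv (ENp N)" for n
      using f(2) that by (simp only: StF_def ops_def rep_X mem_Collect_eq)
    then show ?thesis by (simp add: ops_def)
  qed
  then show ?thesis using f(1) by (simp add: StF_def)
qed

definition closed_subalg :: "nat \<Rightarrow> complex \<Rightarrow> free_elt set set \<Rightarrow> free_elt set set \<Rightarrow> bool" where
  "closed_subalg N k G B \<longleftrightarrow> subring B (HH N k) \<and> range (\<lambda>c. cl N k (scal c)) \<subseteq> B \<and>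
     adic_closed (HH N k) (cl N k fps_X) B \<and> G \<subseteq> B"

lemma gen_set_StF: assumes N: "1 \<le> N" shows "gen_set N l z k \<subseteq> StF N l z k"
proof -
  have RP: "f \<in> StF N l z k" if "f \<in> FF N" "\<And>u. u \<in> z ` {1..l} \<Longrightarrow> repE N k u f \<in> ops (RP N)" for f
    using that by (auto simp: StF_def ops_def)
  have "fT k i \<in> StF N l z k" if "i \<in> {1..<N}" for i
    using that by (intro RP) (simp_all add: FF_fT repE_fT TE_RP)
  moreover have "fy i \<in> StF N l z k" if "i \<in> {1..N}" for i
    using that by (intro RP) (simp_all add: FF_fy rep_fy gE_RP image_iff)
  moreover have "fpi N k \<in> StF N l z k"
  proof (rule RP)
    show "fpi N k \<in> FF N" using fpi_inverse[OF N] by (simp add: inverse_pair_def)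
    show "repE N k u (fpi N k) \<in> ops (RP N)" for u
      unfolding fpi_def rep_mult rep_prod_list repE_fX
      using N by (intro ops_mult[OF subalg_RP] ops_prod_list[OF subalg_RP] opX_RP) (auto simp: repE_fT TE_RP)
  qed
  moreover have "last_gen N l z k \<in> StF N l z k"
  proof (rule RP)
    show "last_gen N l z k \<in> FF N" using gen_set_FF[OF N] by (auto simp: gen_set_def)
    fix u assume "u \<in> z ` {1..l}"
    then obtain r where r: "r \<in> ops (RP N)" "repE N k u (cyc_prod l z) = opX 1 * r"
      using repE_cyc_prod[OF N] by blast
    have "repE N k u (last_gen N l z k) = repE N k u (prod_list (map (fTi k) (rev [1..<N]))) * opXi 1 * (opX 1 * r)"
      unfolding last_gen_def fpi_inv_def rep_mult r(2) repE_fXinv ..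
    then have "repE N k u (last_gen N l z k) = prod_list (map (repE N k u \<circ> fTi k) (rev [1..<N])) * (opXi 1 * opX 1) * r"
      unfolding rep_prod_list map_map by (simp only: mult.assoc)
    then have e: "repE N k u (last_gen N l z k) = prod_list (map (repE N k u \<circ> fTi k) (rev [1..<N])) * r"
      unfolding opX_opXi by simp
    show "repE N k u (last_gen N l z k) \<in> ops (RP N)"
      unfolding e by (intro ops_mult[OF subalg_RP] ops_prod_list[OF subalg_RP] r(1)) (auto simp: repE_fTi TEi_RP)
  qed
  ultimately show ?thesis unfolding gen_set_def by blast
qed

lemma closed_subalg_StF:
  assumes N: "1 \<le> N"
  shows "closed_subalg N k (cl N k ` gen_set N l z k) (cl N k ` StF N l z k)"
proof -
  interpret ring "HH N k" by (rule HH_ring)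
  note FF = StF_FF[of _ N l z k]
  have "subring (cl N k ` StF N l z k) (HH N k)"
  proof (rule subringI)
    show "cl N k ` StF N l z k \<subseteq> carrier (HH N k)" using StF_FF HH_carrier by fastforce
    show "\<one>\<^bsub>HH N k\<^esub> \<in> cl N k ` StF N l z k" unfolding cl_one using StF_scal[of 1] by simp
    show "\<ominus>\<^bsub>HH N k\<^esub> a \<in> cl N k ` StF N l z k" if a: "a \<in> cl N k ` StF N l z k" for a
    proof -
      obtain f where f: "f \<in> StF N l z k" "a = cl N k f" using a by blast
      have "scal 0 = (0 :: free_elt)" by (rule fps_ext) simp
      then have "- f \<in> StF N l z k" using StF_diff[OF StF_scal[of 0] f(1)] by simp
      then show ?thesis using f FF by (simp add: cl_uminus)
    qed
    show "a \<otimes>\<^bsub>HH N k\<^esub> b \<in> cl N k ` StF N l z k" "a \<oplus>\<^bsub>HH N k\<^esub> b \<in> cl N k ` StF N l z k"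
      if "a \<in> cl N k ` StF N l z k" "b \<in> cl N k ` StF N l z k" for a b
      using that by (force simp: cl_mult[OF FF FF] intro: StF_mult)
        (use that in \<open>force simp: cl_add[OF FF FF] intro: StF_add\<close>)
  qed
  moreover have "adic_closed (HH N k) (cl N k fps_X) (cl N k ` StF N l z k)"
    unfolding adic_closed_def
  proof (intro ballI impI)
    fix a assume "a \<in> carrier (HH N k)" and approx: "\<forall>n::nat. \<exists>s\<in>cl N k ` StF N l z k. \<exists>r\<in>carrier (HH N k).
      a = s \<oplus>\<^bsub>HH N k\<^esub> cl N k fps_X [^]\<^bsub>HH N k\<^esub> n \<otimes>\<^bsub>HH N k\<^esub> r"
    then obtain f where f: "f \<in> FF N" "a = cl N k f" unfolding HH_carrier by blast
    have "fps_nth (repE N k (z i) f) m \<in> presv (ENp N)" if "i \<in> {1..l}" for i m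
    proof -
      \<comment> \<open>An approximation modulo \<epsilon>^(m+1) already has the same coefficient m,
        so preservation of polynomials passes to the limit.\<close>
      obtain g h where g: "g \<in> StF N l z k" and h: "h \<in> FF N"
        and "a = cl N k g \<oplus>\<^bsub>HH N k\<^esub> cl N k fps_X [^]\<^bsub>HH N k\<^esub> Suc m \<otimes>\<^bsub>HH N k\<^esub> cl N k h"
        using approx[rule_format, of "Suc m"] unfolding HH_carrier by blast
      then have "cl N k f = cl N k (g + fps_X ^ Suc m * h)"
        using f FF[OF g] unfolding cl_pow[OF FF_X] by (simp only: cl_mult cl_add FF_Xpow FF_mult)
      then have "f - (g + fps_X ^ Suc m * h) \<in> JJ N k"
        using f(1) FF[OF g] h by (simp only: cl_eq_iff FF_add FF_Xpow FF_mult)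
      from rep_JJ[OF N this, of "z i"]
      have e: "repE N k (z i) f = repE N k (z i) g + fps_X ^ Suc m * repE N k (z i) h"
        by (simp only: rep_diff rep_add rep_Xpow right_minus_eq)
      have "fps_nth (repE N k (z i) f) m = fps_nth (repE N k (z i) g) m"
        unfolding e by (simp only: fps_add_nth fps_X_power_mult_nth) simp
      then show ?thesis using g that by (simp add: StF_def ops_def)
    qed
    then have "f \<in> StF N l z k" using f(1) by (simp add: StF_def ops_def)
    then show "a \<in> cl N k ` StF N l z k" using f(2) by blast
  qed
  ultimately show ?thesis
    unfolding closed_subalg_def using gen_set_StF[OF N] StF_scal by blast
qed

section \<open>Leading words realized by the generators, and approximation in powers of
  \<epsilon>\<close>

section \<open>Leading words\<close>

lemma Fl_mult:
  assumes p: "p \<in> Fl N k r" and q: "q \<in> Fl N k (Suc m)"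
  shows "p * q \<in> Fl N k (r + m)"
proof -
  obtain q' j where q': "q = q' + j" "q' \<in> Pl N (Suc m)" "j \<in> J0 N k" using q by (auto simp: Fl_def)
  show ?thesis unfolding q'(1) distrib_left
    by (intro Fl_add Fl_right[OF p q'(2)] Fl_J0 J0_left[OF q'(3) Fl_okp[OF p]])
qed

text \<open>The word is the leading part of some element of \<open>S\<close>, the error having fewer
  letters y.\<close>

definition cov :: "nat \<Rightarrow> complex \<Rightarrow> fpoly set \<Rightarrow> gen list \<Rightarrow> bool" where
  "cov N k S v \<longleftrightarrow> set v \<subseteq> gens N \<and> (\<exists>e\<in>S. cg N k (yc v) e (wp v))"

lemma cov_weq: "cov N k S a \<Longrightarrow> weq N a b \<Longrightarrow> cov N k S b"
  using weq_sound[of N a b k] unfolding cov_def by (metis cg_trans)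

lemma cov_img: "cov N k S a \<Longrightarrow> set b \<subseteq> gens N \<Longrightarrow> imgX a = imgX b \<Longrightarrow> imgY a = imgY b \<Longrightarrow> imgP a = imgP b \<Longrightarrow> cov N k S b"
  using cov_weq weq_complete unfolding cov_def by blast

lemma weq_S_cancel: "set is \<subseteq> {1..<N} \<Longrightarrow> weq N (map GS is @ map GS (rev is)) []"
proof (induction "is")
  case Nil
  show ?case by (simp add: weq.same)
next
  case (Cons i "is")
  then have i: "i \<in> {1..<N}" and IH: "weq N (map GS is @ map GS (rev is)) []" by auto
  have g: "set [GS i] \<subseteq> gens N" using i by simp
  have "weq N ([GS i] @ (map GS is @ map GS (rev is)) @ [GS i]) ([GS i] @ [] @ [GS i])"
    by (intro weq_append_left weq_append_right IH g)
  from weq.trans[OF this[simplified] weq.SS[OF i]] show ?case by simp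
qed

definition moved :: "nat \<Rightarrow> gen \<Rightarrow> gen" where
  "moved i g = (case g of GS j \<Rightarrow> GS j | GX j \<Rightarrow> GX (sr i j) | GXinv j \<Rightarrow> GXinv (sr i j) | GY j \<Rightarrow> GY (sr i j))"

lemma nth_0_prod_list: "fps_nth (prod_list fs) 0 = prod_list (map (\<lambda>f. fps_nth f 0) fs)" for fs :: "'a::ring_1 fps list"
  by (induction fs) (simp_all add: fps_mult_nth_0)

lemma wp_map: "prod_list (map (\<lambda>i. letter (g i)) is) = wp (map g is)"
  by (induction "is") (simp_all add: wp_Cons)

lemma prod_ly_lead: "1 \<le> N \<Longrightarrow> prod_list (map (\<lambda>x. ly 1 - Poly_Mapping.single 0 x) xs) - wp (replicate (length xs) (GY 1)) \<in> Fl N k (length xs)"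
proof (induction xs)
  case Nil
  then show ?case using J0_zero by (simp add: Fl_zero)
next
  case (Cons x xs)
  let ?P = "prod_list (map (\<lambda>x. ly 1 - Poly_Mapping.single 0 x) xs)" and ?n = "length xs"
  let ?W = "wp (replicate ?n (GY 1))"
  have IH: "?P - ?W \<in> Fl N k ?n" by (rule Cons.IH[OF Cons.prems])
  have "?W \<in> Pl N (Suc ?n)"
  proof (rule Pl_wp)
    show "set (replicate ?n (GY 1)) \<subseteq> gens N" using Cons.prems by auto
    have "yc (replicate m (GY 1)) = m" for m by (induction m) simp_all
    then show "yc (replicate ?n (GY 1)) < Suc ?n" by simp
  qed
  then have P: "?P \<in> Fl N k (Suc ?n)" using Fl_add[OF Fl_mono[OF IH, of "Suc ?n"] Fl_Pl] by fastforce
  have "ly 1 \<in> Pl N (Suc 1)" using Pl_letters(4)[of 1 N] Cons.prems by (simp add: numeral_2_eq_2)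
  from Fl_left[OF this IH] have "ly 1 * (?P - ?W) \<in> Fl N k (Suc ?n)" by simp
  from Fl_diff[OF this Fl_scalar[OF P, of x]]
  have "ly 1 * (?P - ?W) - Poly_Mapping.single 0 x * ?P \<in> Fl N k (Suc ?n)" .
  moreover have "prod_list (map (\<lambda>x. ly 1 - Poly_Mapping.single 0 x) (x # xs)) - wp (replicate (length (x # xs)) (GY 1))
      = ly 1 * (?P - ?W) - Poly_Mapping.single 0 x * ?P"
    by (simp add: wp_Cons left_diff_distrib right_diff_distrib)
  ultimately show ?case by simp
qed

lemma cyclotomic_factor_nth_0: "fps_nth (cyclotomic_factor x) 0 = ly 1 - Poly_Mapping.single 0 x"
  using fY_nths(2)[of 1] by (simp add: cyclotomic_factor_def)

lemma fTi_nth_0: "fps_nth (fTi k i) 0 = ls i"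
  by (simp add: fTi_def fT_nths cpar_def tpar_nths)

lemma fpi_nth_0: "fps_nth (fpi N k) 0 = wp (GX 1 # map GS [1..<N])"
  unfolding fpi_def fps_mult_nth_0 nth_0_prod_list map_map o_def fT_nths fX_nths wp_map wp_Cons ..

lemma last_gen_nth_0: "fps_nth (last_gen N l z k) 0 =
  wp (map GS (rev [1..<N]) @ [GXinv 1]) * prod_list (map (\<lambda>x. ly 1 - Poly_Mapping.single 0 x) (map z [1..<Suc l]))"
  unfolding last_gen_def fpi_inv_def fps_mult_nth_0 nth_0_prod_list map_map o_def fTi_nth_0 fXinv_nths
    cyclotomic_factor_nth_0 wp_map wp_append wp_Cons wp_Nil mult_1_right ..

definition sfree :: "gen list \<Rightarrow> bool" where "sfree a \<longleftrightarrow> set a \<inter> range GS = {}"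

lemma imgs_append:
  "sfree a \<Longrightarrow> imgX (a @ b) = imgX a + imgX b \<and> imgY (a @ b) = (\<lambda>j. imgY a j + imgY b j) \<and> imgP (a @ b) = imgP b"
proof (induction a)
  case (Cons g a)
  then have "perm_gen g = id" by (cases g) (auto simp: sfree_def)
  then show ?case using Cons by (auto simp: sfree_def subst_expo_id add.assoc)
qed simp

lemma sfree_append: "sfree (a @ b) \<longleftrightarrow> sfree a \<and> sfree b" by (auto simp: sfree_def)

lemma imgs_replicate:
  assumes "sfree c"
  shows "sfree (concat (replicate n c)) \<and> imgX (concat (replicate n c)) = frag_cmul (int n) (imgX c) \<and>
    imgY (concat (replicate n c)) = (\<lambda>j. n * imgY c j)"
proof (induction n)
  case 0
  show ?case by (simp add: sfree_def)
next
  case (Suc n)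
  have "frag_cmul (int (Suc n)) (imgX c) = imgX c + frag_cmul (int n) (imgX c)"
    by (rule poly_mapping_eqI) (simp add: lookup_add algebra_simps)
  then show ?case using Suc imgs_append[OF assms, of "concat (replicate n c)"] assms by (simp add: sfree_append)
qed

text \<open>The monomial X_i^a y_i^b spelled with the available pieces X_i, y_i and X_i^-1 y_i^l:
  every inverse brings l letters y_i, and the missing ones are appended. The truncated subtraction
  is exact when l a + b \<ge> 0.\<close>

definition block :: "nat \<Rightarrow> nat \<Rightarrow> int \<Rightarrow> nat \<Rightarrow> gen list" where
  "block l i a b = (if 0 \<le> a then concat (replicate (nat a) [GX i]) @ concat (replicate b [GY i])
     else concat (replicate (nat (- a)) (GXinv i # concat (replicate l [GY i]))) @
       concat (replicate (b - l * nat (- a)) [GY i]))"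

lemma imgs_block:
  assumes "0 \<le> int l * a + int b"
  shows "sfree (block l i a b)" "imgX (block l i a b) = Poly_Mapping.single i a"
    "imgY (block l i a b) = (\<lambda>j. if j = i then b else 0)"
proof -
  have s: "sfree [GX i]" "sfree [GY i]" "sfree [GXinv i]" by (auto simp: sfree_def)
  let ?d = "GXinv i # concat (replicate l [GY i])"
  have d: "sfree ?d" "imgX ?d = - Poly_Mapping.single i 1" "imgY ?d = (\<lambda>j. if j = i then l else 0)"
    using imgs_replicate[OF s(2), of l] by (auto simp: sfree_def subst_expo_id fun_eq_iff)
  have y: "sfree (concat (replicate n [GY i]))" "imgX (concat (replicate n [GY i])) = 0"
    "imgY (concat (replicate n [GY i])) = (\<lambda>j. if j = i then n else 0)" for n
    using imgs_replicate[OF s(2), of n] by (auto simp: fun_eq_iff)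
  have x: "sfree (concat (replicate n [GX i]))" "imgX (concat (replicate n [GX i])) = Poly_Mapping.single i (int n)"
    "imgY (concat (replicate n [GX i])) = (\<lambda>j. 0)" for n
    using imgs_replicate[OF s(1), of n] by (auto simp: fun_eq_iff intro!: poly_mapping_eqI simp: lookup_single when_def)
  have dn: "sfree (concat (replicate n ?d))" "imgX (concat (replicate n ?d)) = Poly_Mapping.single i (- int n)"
    "imgY (concat (replicate n ?d)) = (\<lambda>j. if j = i then n * l else 0)" for n
    using imgs_replicate[OF d(1), of n] unfolding d
    by (auto simp: fun_eq_iff intro!: poly_mapping_eqI simp: lookup_single when_def)
  have le: "l * nat (- a) \<le> b" if "a < 0"
  proof -
    have "int (l * nat (- a)) \<le> int b" using that assms by simp
    then show ?thesis by (simp only: of_nat_le_iff)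
  qed
  show "sfree (block l i a b)" unfolding block_def by (simp only: sfree_append x y dn split: if_split) simp
  show "imgX (block l i a b) = Poly_Mapping.single i a"
    unfolding block_def using imgs_append[OF x(1)] imgs_append[OF dn(1)] x(2) y(2) dn(2) by auto
  show "imgY (block l i a b) = (\<lambda>j. if j = i then b else 0)"
    unfolding block_def using imgs_append[OF x(1)] imgs_append[OF dn(1)] x(3) y(3) dn(3) le
    by (auto simp: fun_eq_iff mult.commute)
qed

lemma imgs_concat:
  assumes "\<And>i. sfree (f i)" "\<And>i. imgX (f i) = Poly_Mapping.single i (a i)" "\<And>i. imgY (f i) = (\<lambda>j. if j = i then b i else 0)"
  shows "distinct xs \<Longrightarrow> sfree (concat (map f xs)) \<and>
    (\<forall>j. Poly_Mapping.lookup (imgX (concat (map f xs))) j = (if j \<in> set xs then a j else 0)) \<and>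
    (\<forall>j. imgY (concat (map f xs)) j = (if j \<in> set xs then b j else 0))"
proof (induction xs)
  case Nil
  show ?case by (simp add: sfree_def)
next
  case (Cons x xs)
  then show ?case using imgs_append[OF assms(1)[of x], of "concat (map f xs)"] assms
    by (auto simp: sfree_append lookup_add lookup_single when_def)
qed

lemma imgs_filter:
  "imgX (filter (\<lambda>g. g \<in> range GS) v) = 0 \<and> imgY (filter (\<lambda>g. g \<in> range GS) v) = (\<lambda>j. 0) \<and>
   imgP (filter (\<lambda>g. g \<in> range GS) v) = imgP v"
proof (induction v)
  case (Cons g v)
  then show ?case by (cases g) auto
qed simp

lemma imgX_EN: "set v \<subseteq> gens N \<Longrightarrow> imgX v \<in> EN N"
proof (induction v)
  case Nil
  show ?case by (simp add: EN_def)
next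
  case (Cons g v)
  then have v: "imgX v \<in> EN N" and g: "g \<in> gens N" by auto
  have "subst_expo (perm_gen g) (imgX v) \<in> EN N"
  proof (cases g)
    case (GS i)
    then have i: "i \<in> {1..<N}" using g by simp
    have "subst_expo (sr i) (imgX v) \<in> EN N" by (rule subst_expo_EN(1)[OF _ sr_perm[OF i] v]) simp
    then show ?thesis using GS by simp
  qed (use v in \<open>simp_all add: subst_expo_id\<close>)
  moreover have "exX g \<in> EN N" using g by (cases g) (auto simp: EN_iff lookup_single when_def)
  ultimately show ?case by (simp add: EN_add)
qed

text \<open>\<open>S\<close> models the constant terms of a closed subalgebra that contains the
  generators and consists of elements preserving polynomials. The reduction of leading terms uses
  these properties only.\<close>

locale reduced_algebra =
  fixes N l :: nat and z :: "nat \<Rightarrow> complex" and k :: complex and S :: "fpoly set"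
  assumes N: "1 \<le> N" and S_okp: "S \<subseteq> okp N" and S_J0: "J0 N k \<subseteq> S"
    and S_scalar: "\<And>c. Poly_Mapping.single 0 c \<in> S"
    and S_add: "\<And>p q. p \<in> S \<Longrightarrow> q \<in> S \<Longrightarrow> p + q \<in> S" and S_mult: "\<And>p q. p \<in> S \<Longrightarrow> q \<in> S \<Longrightarrow> p * q \<in> S"
    and S_gen: "\<And>f. f \<in> gen_set N l z k \<Longrightarrow> fps_nth f 0 \<in> S"
    and S_pres: "\<And>p i. p \<in> S \<Longrightarrow> i \<in> {1..l} \<Longrightarrow> r0 N k (z i) p \<in> presv (ENp N)"
begin

lemma S_sum: "(\<And>x. x \<in> A \<Longrightarrow> f x \<in> S) \<Longrightarrow> sum f A \<in> S"
  by (induction A rule: infinite_finite_induct) (use S_scalar[of 0] S_add in auto)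

lemma cov_append: "cov N k S a \<Longrightarrow> cov N k S b \<Longrightarrow> cov N k S (a @ b)"
proof -
  assume "cov N k S a" "cov N k S b"
  then obtain e e' where e: "e \<in> S" "e - wp a \<in> Fl N k (yc a)" and e': "e' \<in> S" "e' - wp b \<in> Fl N k (yc b)"
    and g: "set a \<subseteq> gens N" "set b \<subseteq> gens N" by (auto simp: cov_def cg_def)
  have "e' - wp b + wp b \<in> Fl N k (Suc (yc b))"
    by (intro Fl_add Fl_mono[OF e'(2)] Fl_Pl Pl_wp g) auto
  then have "(e - wp a) * e' \<in> Fl N k (yc a + yc b)" by (intro Fl_mult[OF e(2)]) simp
  moreover have "wp a * (e' - wp b) \<in> Fl N k (yc a + yc b)" by (intro Fl_left Pl_wp g e'(2)) simp
  ultimately have "(e - wp a) * e' + wp a * (e' - wp b) \<in> Fl N k (yc a + yc b)" by (rule Fl_add)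
  moreover have "(e - wp a) * e' + wp a * (e' - wp b) = e * e' - wp (a @ b)"
    by (simp add: wp_append left_diff_distrib right_diff_distrib)
  ultimately show ?thesis using S_mult[OF e(1) e'(1)] g unfolding cov_def cg_def by auto
qed

lemma cov_mem: "set v \<subseteq> gens N \<Longrightarrow> wp v \<in> S \<Longrightarrow> cov N k S v"
  unfolding cov_def using cg_refl by blast

lemma cov_Nil: "cov N k S []" using S_scalar[of 1] by (intro cov_mem) simp_all

lemma cov_concat: "(\<And>v. v \<in> set vs \<Longrightarrow> cov N k S v) \<Longrightarrow> cov N k S (concat vs)"
  by (induction vs) (simp_all add: cov_Nil cov_append)

lemma cov_replicate: "cov N k S v \<Longrightarrow> cov N k S (concat (replicate n v))"
  by (rule cov_concat) auto

lemma cov_GS: "i \<in> {1..<N} \<Longrightarrow> cov N k S [GS i]"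
  using S_gen[of "fT k i"] by (intro cov_mem) (auto simp: gen_set_def fT_nths wp_Cons)

lemma cov_GY: "i \<in> {1..N} \<Longrightarrow> cov N k S [GY i]"
  using S_gen[of "fy i"] by (intro cov_mem) (auto simp: gen_set_def fy_def wp_Cons)

lemma cov_map_GS: "set is \<subseteq> {1..<N} \<Longrightarrow> cov N k S (map GS is)"
proof (induction "is")
  case (Cons i "is")
  then show ?case using cov_append[OF cov_GS[of i], of "map GS is"] by simp
qed (simp add: cov_Nil)

text \<open>Conjugation by s_i, whose word is available, transposes the indices i and i + 1. Words
  at index 1 are thereby moved to every other index.\<close>

lemma cov_moved:
  assumes i: "i \<in> {1..<N}" and v: "cov N k S v" "set v \<inter> range GS = {}"
  shows "cov N k S (map (moved i) v)"
proof -
  have gv: "set v \<subseteq> gens N" using v(1) by (simp add: cov_def)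
  have g: "set [GS i] \<subseteq> gens N" using i by simp
  have step: "weq N [GS i, h] [moved i h, GS i]" if "h \<in> set v" for h
  proof -
    have h: "h \<notin> range GS" "h \<in> gens N" using that v(2) gv by auto
    show ?thesis
    proof (cases h)
      case (GX j)
      with h have "j \<in> {1..N}" by simp
      from weq.SX[OF i this] show ?thesis by (simp add: moved_def GX)
    next
      case (GXinv j)
      with h have "j \<in> {1..N}" by simp
      from weq.SXi[OF i this] show ?thesis by (simp add: moved_def GXinv)
    next
      case (GY j)
      with h have "j \<in> {1..N}" by simp
      from weq.SY[OF i this] show ?thesis by (simp add: moved_def GY)
    qed (use h in auto)
  qed
  have mv: "weq N (GS i # v) (map (moved i) v @ [GS i])"
    by (rule weq_move) (use step g gv in auto)
  then have gm: "set (map (moved i) v) \<subseteq> gens N" using weq_gens[OF mv] by simp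
  have c: "cov N k S ([GS i] @ v @ [GS i])" by (intro cov_append cov_GS i v)
  have w: "weq N ((GS i # v) @ [GS i]) ((map (moved i) v @ [GS i]) @ [GS i])" by (rule weq_append_right[OF mv g])
  have "weq N (map (moved i) v @ [GS i, GS i]) (map (moved i) v @ [])"
    by (rule weq_append_left[OF weq.SS[OF i] gm])
  from cov_weq[OF c[simplified], OF weq.trans[OF w[simplified] this[simplified]]] show ?thesis .
qed

lemma cov_GX: "i \<in> {1..N} \<Longrightarrow> cov N k S [GX i]"
proof (induction i)
  case (Suc i)
  show ?case
  proof (cases "i = 0")
    case True
    have r: "set (rev [1..<N]) \<subseteq> {1..<N}" by simp
    \<comment> \<open>The constant term of \<pi> is X_1 s_1 ... s_(N-1); multiplying by the reversed
      product of transpositions leaves X_1.\<close>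
    have "cov N k S (GX 1 # map GS [1..<N])"
      by (rule cov_mem) (use S_gen[of "fpi N k"] N in \<open>auto simp: gen_set_def fpi_nth_0\<close>)
    from cov_append[OF this cov_map_GS[OF r]]
    have "cov N k S ([GX 1] @ (map GS [1..<N] @ map GS (rev [1..<N])))" by simp
    moreover have "weq N ([GX 1] @ (map GS [1..<N] @ map GS (rev [1..<N]))) ([GX 1] @ [])"
      by (rule weq_append_left[OF weq_S_cancel]) (use N in auto)
    ultimately have "cov N k S ([GX 1] @ [])" by (rule cov_weq)
    then show ?thesis using True by simp
  next
    case False
    then have i: "i \<in> {1..<N}" "i \<in> {1..N}" using Suc.prems by auto
    have "cov N k S (map (moved i) [GX i])" by (rule cov_moved[OF i(1) Suc.IH[OF i(2)]]) auto
    then show ?thesis by (simp add: moved_def)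
  qed
qed simp

text \<open>At index 1 the last generator has leading word s_(N-1) ... s_1 X_1^-1 y_1^l, since the
  constants subtracted from y_1 only affect lower order. Multiplication by s_1 ... s_(N-1) from the
  left strips the permutation.\<close>

lemma cov_GXinv: "i \<in> {1..N} \<Longrightarrow> cov N k S (GXinv i # concat (replicate l [GY i]))"
proof (induction i)
  case (Suc i)
  show ?case
  proof (cases "i = 0")
    case True
    let ?a = "map GS (rev [1..<N]) @ [GXinv 1]" and ?y = "replicate l (GY 1)"
    let ?P = "prod_list (map (\<lambda>x. ly 1 - Poly_Mapping.single 0 x) (map z [1..<Suc l]))"
    have ga: "set ?a \<subseteq> gens N" "set (?a @ ?y) \<subseteq> gens N" using N by auto
    have yS: "yc (map GS is) = 0" for "is" by (induction "is") simp_all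
    have yY: "yc (replicate m (GY 1)) = m" for m by (induction m) simp_all
    have "?P - wp ?y \<in> Fl N k l" using prod_ly_lead[OF N, of "map z [1..<Suc l]" k] by (simp del: upt_Suc)
    moreover have "wp ?a \<in> Pl N (Suc 0)" by (rule Pl_wp[OF ga(1)]) (simp add: yS)
    ultimately have "wp ?a * (?P - wp ?y) \<in> Fl N k (0 + l)" by (intro Fl_left)
    moreover have "yc (?a @ ?y) = 0 + l" by (simp only: yc_simps yS yY add_0)
    ultimately have "cg N k (yc (?a @ ?y)) (fps_nth (last_gen N l z k) 0) (wp (?a @ ?y))"
      unfolding cg_def last_gen_nth_0 wp_append[of ?a ?y] right_diff_distrib[symmetric] by (simp only:)
    moreover have "fps_nth (last_gen N l z k) 0 \<in> S" by (rule S_gen) (simp add: gen_set_def)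
    ultimately have "cov N k S (?a @ ?y)" using ga(2) unfolding cov_def by blast
    moreover have "cov N k S (map GS [1..<N])" by (rule cov_map_GS) auto
    ultimately have "cov N k S (map GS [1..<N] @ (?a @ ?y))" by (intro cov_append[of "map GS [1..<N]" "?a @ ?y"])
    moreover have "weq N ((map GS [1..<N] @ map GS (rev [1..<N])) @ [GXinv 1] @ ?y) ([] @ [GXinv 1] @ ?y)"
      by (rule weq_append_right[OF weq_S_cancel]) (use ga in auto)
    moreover have "concat (replicate m [GY 1]) = replicate m (GY 1)" for m by (induction m) simp_all
    ultimately show ?thesis using cov_weq[of N k S "map GS [1..<N] @ ?a @ ?y"] True by simp
  next
    case False
    then have i: "i \<in> {1..<N}" "i \<in> {1..N}" using Suc.prems by auto
    have "cov N k S (map (moved i) (GXinv i # concat (replicate l [GY i])))"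
      by (rule cov_moved[OF i(1) Suc.IH[OF i(2)]]) auto
    moreover have "map (moved i) (concat (replicate m [GY i])) = concat (replicate m [GY (Suc i)])" for m
      by (induction m) (simp_all add: moved_def)
    ultimately show ?thesis by (simp add: moved_def)
  qed
qed simp

lemma cov_block: assumes i: "i \<in> {1..N}" shows "cov N k S (block l i a b)"
proof (cases "0 \<le> a")
  case True
  have "cov N k S (concat (replicate (nat a) [GX i]) @ concat (replicate b [GY i]))"
    by (intro cov_append cov_replicate cov_GX cov_GY i)
  then show ?thesis by (simp only: block_def True if_True)
next
  case False
  have "cov N k S (concat (replicate (nat (- a)) (GXinv i # concat (replicate l [GY i]))) @ concat (replicate (b - l * nat (- a)) [GY i]))"
    by (intro cov_append cov_replicate cov_GXinv cov_GY i)
  then show ?thesis by (simp only: block_def False if_False)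
qed

text \<open>The blocks for i = 1, ..., N followed by the transposition letters of v form a word with
  the same image as v, and equality of images is enough for congruence of leading parts.\<close>

lemma cov_admissible:
  assumes v: "set v \<subseteq> gens N" and adm: "\<forall>i\<in>{1..N}. 0 \<le> int l * Poly_Mapping.lookup (imgX v) i + int (imgY v i)"
  shows "cov N k S v"
proof -
  have X0: "Poly_Mapping.lookup (imgX v) i = 0" if "i \<notin> {1..N}" for i
    using imgX_EN[OF v] that unfolding EN_iff by blast
  have Y0: "imgY v i = 0" if "i \<notin> {1..N}" for i
    using img_valid[OF v] that unfolding img_def valid_eq by blast
  have adm': "0 \<le> int l * Poly_Mapping.lookup (imgX v) i + int (imgY v i)" for i
    using adm X0[of i] by (cases "i \<in> {1..N}") auto
  let ?f = "\<lambda>i. block l i (Poly_Mapping.lookup (imgX v) i) (imgY v i)" and ?s = "filter (\<lambda>g. g \<in> range GS) v"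
  let ?u = "concat (map ?f [1..<Suc N])"
  have u: "sfree ?u" "\<And>j. Poly_Mapping.lookup (imgX ?u) j = (if j \<in> set [1..<Suc N] then Poly_Mapping.lookup (imgX v) j else 0)"
    "\<And>j. imgY ?u j = (if j \<in> set [1..<Suc N] then imgY v j else 0)"
    using imgs_concat[of ?f "Poly_Mapping.lookup (imgX v)" "imgY v" "[1..<Suc N]"] imgs_block[OF adm'] distinct_upt by blast+
  have set: "set [1..<Suc N] = {1..N}" by auto
  have "Poly_Mapping.lookup (imgX ?u) j = Poly_Mapping.lookup (imgX v) j" "imgY ?u j = imgY v j" for j
  proof -
    have "Poly_Mapping.lookup (imgX ?u) j = Poly_Mapping.lookup (imgX v) j \<and> imgY ?u j = imgY v j"
    proof (cases "j \<in> {1..N}")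
      case True
      show ?thesis unfolding u(2) u(3) set using True by (simp only: if_True simp_thms)
    next
      case False
      show ?thesis unfolding u(2) u(3) set X0[OF False] Y0[OF False] using False by (simp only: if_False simp_thms)
    qed
    then show "Poly_Mapping.lookup (imgX ?u) j = Poly_Mapping.lookup (imgX v) j" "imgY ?u j = imgY v j" by blast+
  qed
  then have "imgX ?u = imgX v" "imgY ?u = imgY v" by (simp_all only: poly_mapping_eqI ext)
  then have im: "imgX (?u @ ?s) = imgX v" "imgY (?u @ ?s) = imgY v" "imgP (?u @ ?s) = imgP v"
    using imgs_append[OF u(1), of ?s] imgs_filter[of v] by simp_all
  have "cov N k S ?s"
  proof -
    have "\<exists>is. ?s = map GS is" unfolding ex_map_conv by auto
    then obtain "is" where "is": "?s = map GS is" by blast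
    have "set ?s \<subseteq> gens N" using v by auto
    then have "set is \<subseteq> {1..<N}" unfolding "is" by auto
    then show ?thesis unfolding "is" by (rule cov_map_GS)
  qed
  moreover have "cov N k S ?u" by (rule cov_concat) (use cov_block in auto)
  ultimately have "cov N k S (?u @ ?s)" by (intro cov_append)
  from cov_img[OF this v im] show ?thesis .
qed

text \<open>The words of top degree are replaced by an element of \<open>S\<close>, image by image.
  What remains has smaller order and still preserves polynomials, so the induction on the filtration
  continues until only the ideal is left.\<close>

lemma symbol_reduce:
  assumes z: "\<forall>i\<in>{1..l}. \<forall>j\<in>{1..l}. i \<noteq> j \<longrightarrow> z i - z j \<notin> \<int>"
  shows "p \<in> Fl N k r \<Longrightarrow> \<forall>i\<in>{1..l}. r0 N k (z i) p \<in> presv (ENp N) \<Longrightarrow> p \<in> S"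
proof (induction r arbitrary: p)
  case 0
  then show ?case using S_J0 by (auto simp: Fl_zero)
next
  case (Suc R)
  obtain p' j where p': "p = p' + j" "p' \<in> Pl N (Suc R)" "j \<in> J0 N k" using Suc.prems(1) by (auto simp: Fl_def)
  have pres: "\<forall>i\<in>{1..l}. r0 N k (z i) p' \<in> presv (ENp N)"
    using Suc.prems(2) p' by (simp add: r0_add r0_J0[OF N])
  let ?c = "\<lambda>w. Poly_Mapping.lookup p' w" and ?I = "\<lambda>w. img (letters w)"
  have word: "set (letters w) \<subseteq> gens N" "yc (letters w) \<le> R" if "w \<in> Poly_Mapping.keys p'" for w
    using p'(2) that by (auto simp: Pl_def okp_def)
  let ?t = "\<lambda>w. Poly_Mapping.single 0 (?c w) * wp (letters w)"
  define T where "T = {w\<in>Poly_Mapping.keys p'. yc (letters w) = R}"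
  have finT: "finite T" by (simp add: T_def)
  have "p' = (\<Sum>w\<in>Poly_Mapping.keys p'. ?t w)"
    by (subst poly_mapping_decomp[of p']) (rule sum.cong, simp_all add: wp_def mult_single)
  also have "\<dots> = sum ?t T + sum ?t (Poly_Mapping.keys p' - T)"
    by (subst sum.subset_diff[of T]) (auto simp: T_def add.commute)
  finally have e: "p' = sum ?t T + sum ?t (Poly_Mapping.keys p' - T)" .
  have split: "p' - sum ?t T = sum ?t (Poly_Mapping.keys p' - T)"
    using add_diff_cancel_left'[of "sum ?t T" "sum ?t (Poly_Mapping.keys p' - T)"] unfolding e[symmetric] .
  have low: "p' - sum ?t T \<in> Fl N k R" unfolding split
  proof (rule Fl_sum)
    fix w assume w: "w \<in> Poly_Mapping.keys p' - T"
    then have "yc (letters w) < R" using word[of w] by (fastforce simp: T_def)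
    then show "?t w \<in> Fl N k R" using word(1)[of w] w by (intro Fl_scalar Fl_Pl Pl_wp) auto
  qed
  \<comment> \<open>For an admissible image every word is a leading word of \<open>S\<close>; for an
    inadmissible one the whole group is already of lower order, and s = 0 suffices.\<close>
  have group: "\<exists>s\<in>S. sum ?t {w\<in>T. ?I w = m} - s \<in> Fl N k R" if m: "m \<in> ?I ` T" for m
  proof -
    obtain w0 where w0: "w0 \<in> T" "m = ?I w0" using m by blast
    have k0: "w0 \<in> Poly_Mapping.keys p'" and R0: "yc (letters w0) = R" using w0(1) by (auto simp: T_def)
    obtain a b \<tau> where abt: "m = (a, b, \<tau>)" by (cases m)
    have ab: "imgX (letters w0) = a" "imgY (letters w0) = b" using w0(2) abt by (simp_all add: img_def)
    show ?thesis
    proof (cases "\<forall>i\<in>{1..N}. 0 \<le> int l * Poly_Mapping.lookup a i + int (b i)")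
      case True
      have "\<exists>e\<in>S. wp (letters w) - e \<in> Fl N k R" if "w \<in> T" "?I w = m" for w
      proof -
        have w: "w \<in> Poly_Mapping.keys p'" and R: "yc (letters w) = R" using \<open>w \<in> T\<close> by (auto simp: T_def)
        have "imgX (letters w) = a" "imgY (letters w) = b" using \<open>?I w = m\<close> abt by (simp_all add: img_def)
        then have "cov N k S (letters w)" using True by (intro cov_admissible word(1)[OF w]) simp
        then obtain e where "e \<in> S" "cg N k R e (wp (letters w))" unfolding cov_def R by blast
        from this(1) cg_sym[OF this(2)] show ?thesis unfolding cg_def by blast
      qed
      then obtain e where e: "\<And>w. w \<in> T \<Longrightarrow> ?I w = m \<Longrightarrow> e w \<in> S \<and> wp (letters w) - e w \<in> Fl N k R" by metis
      let ?T = "{w\<in>T. ?I w = m}" and ?s = "\<lambda>w. Poly_Mapping.single 0 (?c w) * e w"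
      have "sum ?s ?T \<in> S" using e by (intro S_sum S_mult S_scalar) auto
      moreover have "sum ?t ?T - sum ?s ?T \<in> Fl N k R"
        unfolding sum_subtractf[symmetric] right_diff_distrib[symmetric] using e by (intro Fl_sum Fl_scalar) auto
      ultimately show ?thesis by blast
    next
      case False
      then obtain i where i: "i \<in> {1..N}" "int l * Poly_Mapping.lookup a i + int (b i) < 0" by (auto simp: not_le)
      have "deg N (a, b, \<tau>) = R" using img_valid[OF word(1)[OF k0]] R0 w0(2) abt by simp
      from top_coefficients[OF N z p'(2) pres this i]
      have c0: "(\<Sum>w\<in>{w\<in>Poly_Mapping.keys p'. ?I w = m}. ?c w) = 0" unfolding abt .
      have TT: "{w\<in>T. ?I w = m} = {w\<in>Poly_Mapping.keys p'. ?I w = m}"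
      proof -
        have "yc (letters w) = R" if "w \<in> Poly_Mapping.keys p'" "?I w = m" for w
          using img_valid[OF word(1)[OF that(1)]] img_valid[OF word(1)[OF k0]] that(2) w0(2) R0 by simp
        then show ?thesis by (auto simp: T_def)
      qed
      \<comment> \<open>The coefficients of the group sum to zero, so the word of w0 may be
        subtracted from every word; the resulting differences are of lower order because the images
        agree.\<close>
      have "sum ?t {w\<in>T. ?I w = m} = (\<Sum>w\<in>{w\<in>T. ?I w = m}. Poly_Mapping.single 0 (?c w) * (wp (letters w) - wp (letters w0)))
          + (\<Sum>w\<in>{w\<in>T. ?I w = m}. Poly_Mapping.single 0 (?c w)) * wp (letters w0)"
        unfolding right_diff_distrib sum_subtractf sum_distrib_right by simp
      also have "(\<Sum>w\<in>{w\<in>T. ?I w = m}. Poly_Mapping.single 0 (?c w)) = (0 :: fpoly)"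
      proof -
        have "Poly_Mapping.single 0 (\<Sum>w\<in>{w\<in>Poly_Mapping.keys p'. ?I w = m}. ?c w) =
            (\<Sum>w\<in>{w\<in>Poly_Mapping.keys p'. ?I w = m}. Poly_Mapping.single 0 (?c w) :: fpoly)"
          by (rule additive_sum[OF scalar_single.sc_add])
        from this[unfolded c0 single_zero, symmetric] show ?thesis unfolding TT .
      qed
      finally have e: "sum ?t {w\<in>T. ?I w = m} - 0 = (\<Sum>w\<in>{w\<in>T. ?I w = m}. Poly_Mapping.single 0 (?c w) * (wp (letters w) - wp (letters w0)))"
        by simp
      have "sum ?t {w\<in>T. ?I w = m} - 0 \<in> Fl N k R" unfolding e
      proof (intro Fl_sum Fl_scalar)
        fix w assume w: "w \<in> {w\<in>T. ?I w = m}"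
        then have "?I w = ?I w0" "w \<in> Poly_Mapping.keys p'" "yc (letters w) = R" using w0(2) by (auto simp: T_def)
        then have "weq N (letters w) (letters w0)" by (intro weq_complete word(1) k0) (simp_all add: img_def)
        then have "cg N k (yc (letters w)) (wp (letters w)) (wp (letters w0))" using weq_sound by blast
        then show "wp (letters w) - wp (letters w0) \<in> Fl N k R"
          unfolding cg_def \<open>yc (letters w) = R\<close> .
      qed
      then show ?thesis using S_scalar[of 0] by (intro bexI[of _ 0]) simp_all
    qed
  qed
  define s where "s = (\<lambda>m. SOME s. s \<in> S \<and> sum ?t {w\<in>T. ?I w = m} - s \<in> Fl N k R)"
  have s: "s m \<in> S \<and> sum ?t {w\<in>T. ?I w = m} - s m \<in> Fl N k R" if "m \<in> ?I ` T" for m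
    unfolding s_def by (rule someI_ex, use group[OF that] in blast)
  let ?s = "sum s (?I ` T)"
  have sS: "?s \<in> S"
  proof (rule S_sum)
    show "s m \<in> S" if "m \<in> ?I ` T" for m using s[OF that] ..
  qed
  have eq: "sum ?t T - ?s = (\<Sum>m\<in>?I ` T. sum ?t {w\<in>T. ?I w = m} - s m)"
    unfolding sum_subtractf sum.image_gen[OF finT, of ?t ?I] ..
  have "sum ?t T - ?s \<in> Fl N k R" unfolding eq
  proof (rule Fl_sum)
    show "sum ?t {w\<in>T. ?I w = m} - s m \<in> Fl N k R" if "m \<in> ?I ` T" for m using s[OF that] ..
  qed
  moreover have "u - a + (a - b) = u - b" for u a b :: fpoly by simp
  ultimately have F: "p' - ?s \<in> Fl N k R" using Fl_add[OF low] by (metis (no_types))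
  \<comment> \<open>The induction hypothesis needs the remainder to preserve polynomials again,
    which holds because elements of \<open>S\<close> do.\<close>
  have "p' - ?s \<in> S"
  proof (rule Suc.IH[OF F], intro ballI)
    fix i assume i: "i \<in> {1..l}"
    have "r0 N k (z i) (p' - ?s) + r0 N k (z i) ?s = r0 N k (z i) p'"
      unfolding r0_add[symmetric] diff_add_cancel ..
    then have e: "r0 N k (z i) (p' - ?s) = r0 N k (z i) p' - r0 N k (z i) ?s" unfolding eq_diff_eq .
    show "r0 N k (z i) (p' - ?s) \<in> presv (ENp N)"
      unfolding e by (rule subalg_diff[OF subalg_presv bspec[OF pres i] S_pres[OF sS i]])
  qed
  from S_add[OF S_add[OF this sS] subsetD[OF S_J0 p'(3)]] show ?case unfolding p'(1) diff_add_cancel .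
qed

end

section \<open>Elements preserving polynomials\<close>

lemma adic_closed_Int: "adic_closed R e A \<Longrightarrow> adic_closed R e B \<Longrightarrow> adic_closed R e (A \<inter> B)"
  unfolding adic_closed_def by (meson IntD1 IntD2 IntI)

lemma closed_subalg_Int:
  assumes "closed_subalg N k G A" "closed_subalg N k G B"
  shows "closed_subalg N k G (A \<inter> B)"
proof -
  have "subring A (HH N k)" "subring B (HH N k)"
    and ad: "adic_closed (HH N k) (cl N k fps_X) A" "adic_closed (HH N k) (cl N k fps_X) B"
    and rest: "range (\<lambda>c. cl N k (scal c)) \<subseteq> A" "range (\<lambda>c. cl N k (scal c)) \<subseteq> B" "G \<subseteq> A" "G \<subseteq> B"
    using assms by (simp_all only: closed_subalg_def)
  from ring.subring_inter[OF HH_ring this(1,2)] adic_closed_Int[OF ad] rest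
  show ?thesis by (simp only: closed_subalg_def Int_subset_iff simp_thms)
qed

text \<open>Modulo \<epsilon>, every stabilizing element agrees with one of the subalgebra; the
  difference divided by \<epsilon> is again stabilizing. Repeating this approximates the element
  modulo every power of \<epsilon>, and closedness gives membership.\<close>

lemma StF_subset_closed_subalg:
  assumes N: "1 \<le> N" and z: "\<forall>i\<in>{1..l}. \<forall>j\<in>{1..l}. i \<noteq> j \<longrightarrow> z i - z j \<notin> \<int>"
    and B: "closed_subalg N k (cl N k ` gen_set N l z k) B"
  shows "cl N k ` StF N l z k \<subseteq> B"
proof
  \<comment> \<open>An arbitrary closed subalgebra containing the generators need not preserve
    polynomials. The intersection does, and it still contains the generators and is closed.\<close>
  define C where "C = B \<inter> cl N k ` StF N l z k"
  have C: "closed_subalg N k (cl N k ` gen_set N l z k) C"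
    unfolding C_def by (rule closed_subalg_Int[OF B closed_subalg_StF[OF N]])
  have sub: "subring C (HH N k)" and C_scal: "\<And>c. cl N k (scal c) \<in> C"
    and C_adic: "adic_closed (HH N k) (cl N k fps_X) C" and C_gen: "\<And>f. f \<in> gen_set N l z k \<Longrightarrow> cl N k f \<in> C"
    using C unfolding closed_subalg_def by auto
  have C_add: "cl N k (f + g) \<in> C" and C_mult: "cl N k (f * g) \<in> C"
    if "f \<in> FF N" "g \<in> FF N" "cl N k f \<in> C" "cl N k g \<in> C" for f g
    using subringE(7)[OF sub that(3,4)] subringE(6)[OF sub that(3,4)] that(1,2) by (simp_all add: cl_add cl_mult)
  have C_StF: "f \<in> StF N l z k" if "f \<in> FF N" "cl N k f \<in> C" for f
    using that StF_cl_iff[OF N that(1)] by (auto simp: C_def)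
  define S where "S = {fps_nth f 0 | f. f \<in> FF N \<and> cl N k f \<in> C}"
  have S_I: "fps_nth f 0 \<in> S" if "f \<in> FF N" "cl N k f \<in> C" for f using that by (auto simp: S_def)
  interpret S: reduced_algebra N l z k S
  proof
    show "1 \<le> N" by (rule N)
    show "S \<subseteq> okp N" by (auto simp: S_def ops_def)
    show "J0 N k \<subseteq> S"
    proof
      fix p assume "p \<in> J0 N k"
      then obtain f where f: "f \<in> JJ N k" "p = fps_nth f 0" by (auto simp: J0_def)
      have "cl N k f = cl N k 0" using f(1) JJ_FF[OF f(1)] by (simp add: cl_eq_iff FF_zero)
      then have "cl N k f \<in> C" using subringE(2)[OF sub] by (simp add: cl_zero)
      then show "p \<in> S" using S_I[OF JJ_FF[OF f(1)]] f(2) by simp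
    qed
    show "Poly_Mapping.single 0 c \<in> S" for c
      using S_I[OF FF_scal C_scal, of "fps_const c"] by simp
    show "p + q \<in> S" "p * q \<in> S" if pq: "p \<in> S" "q \<in> S" for p q
    proof -
      obtain f g where f: "f \<in> FF N" "cl N k f \<in> C" "p = fps_nth f 0" and g: "g \<in> FF N" "cl N k g \<in> C" "q = fps_nth g 0"
        using pq unfolding S_def by blast
      show "p + q \<in> S" using S_I[OF FF_add[OF f(1) g(1)] C_add[OF f(1) g(1) f(2) g(2)]] f(3) g(3) by simp
      show "p * q \<in> S" using S_I[OF FF_mult[OF f(1) g(1)] C_mult[OF f(1) g(1) f(2) g(2)]] f(3) g(3)
        by (simp add: fps_mult_nth_0)
    qed
    show "fps_nth f 0 \<in> S" if "f \<in> gen_set N l z k" for f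
      using S_I[of f] C_gen[OF that] gen_set_FF[OF N, of l z k] that by blast
    show "r0 N k (z i) p \<in> presv (ENp N)" if p: "p \<in> S" and i: "i \<in> {1..l}" for p i
    proof -
      obtain f where f: "f \<in> FF N" "cl N k f \<in> C" "p = fps_nth f 0" using p unfolding S_def by blast
      have "repE N k (z i) f \<in> ops (presv (ENp N))" using C_StF[OF f(1,2)] i by (simp add: StF_def)
      then have "fps_nth (repE N k (z i) f) 0 \<in> presv (ENp N)" by (simp add: ops_def)
      then show ?thesis by (simp only: rep_nth_0 f(3))
    qed
  qed
  have step: "\<exists>g h. g \<in> FF N \<and> cl N k g \<in> C \<and> h \<in> StF N l z k \<and> f = g + fps_X * h" if f: "f \<in> StF N l z k" for f
  proof -
    have "fps_nth f 0 \<in> okp N" using StF_FF[OF f] by (simp add: ops_def)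
    \<comment> \<open>The constant term involves finitely many words, so the number of letters y is
      bounded and the filtration is reached at some r.\<close>
    then obtain r where r: "fps_nth f 0 \<in> Pl N r"
      using finite_nat_set_iff_bounded[of "(\<lambda>w. yc (letters w)) ` Poly_Mapping.keys (fps_nth f 0)"]
      by (auto simp: Pl_def)
    have "r0 N k (z i) (fps_nth f 0) \<in> presv (ENp N)" if "i \<in> {1..l}" for i
    proof -
      have "repE N k (z i) f \<in> ops (presv (ENp N))" using f that by (simp add: StF_def)
      then have "fps_nth (repE N k (z i) f) 0 \<in> presv (ENp N)" by (simp add: ops_def)
      then show ?thesis by (simp only: rep_nth_0)
    qed
    then have "fps_nth f 0 \<in> S" by (intro S.symbol_reduce[OF z Fl_Pl[OF r]]) blast
    then obtain g where g: "g \<in> FF N" "cl N k g \<in> C" "fps_nth g 0 = fps_nth f 0" unfolding S_def by auto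
    define h where "h = fps_shift 1 (f - g)"
    have h: "h \<in> FF N" unfolding h_def by (intro FF_shift FF_diff StF_FF[OF f] g(1))
    have fg: "fps_X * h = f - g" unfolding h_def by (rule fps_ext) (use g(3) in \<open>simp split: nat.split\<close>)
    \<comment> \<open>Both f and its approximation g stabilize polynomials; here it matters that g
      was taken from the intersection \<open>C\<close>.\<close>
    have "fps_X * h \<in> StF N l z k" unfolding fg by (rule StF_diff[OF f C_StF[OF g(1,2)]])
    then have "h \<in> StF N l z k" by (rule StF_X[OF h])
    moreover have "f = g + fps_X * h" unfolding fg by simp
    ultimately show ?thesis using g(1,2) by blast
  qed
  fix a assume "a \<in> cl N k ` StF N l z k"
  then obtain f where f: "f \<in> StF N l z k" "a = cl N k f" by blast
  \<comment> \<open>The one-step approximation is applied to the remainder h each time, and its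
    contribution enters with the factor \<epsilon>^n, which belongs to \<open>C\<close> as a
    scalar.\<close>
  have approx: "\<exists>g h. g \<in> FF N \<and> cl N k g \<in> C \<and> h \<in> StF N l z k \<and> f = g + fps_X ^ n * h" for n
  proof (induction n)
    case 0
    have "scal 0 = (0 :: free_elt)" by (rule fps_ext) simp
    then have "cl N k 0 \<in> C" using C_scal[of 0] by simp
    then show ?case using f(1) FF_zero by (intro exI[of _ 0] exI[of _ f]) simp
  next
    case (Suc n)
    then obtain g h where g: "g \<in> FF N" "cl N k g \<in> C" "h \<in> StF N l z k" "f = g + fps_X ^ n * h" by blast
    obtain g' h' where g': "g' \<in> FF N" "cl N k g' \<in> C" "h' \<in> StF N l z k" "h = g' + fps_X * h'" using step[OF g(3)] by blast
    have X: "fps_X ^ n = (scal (fps_X ^ n) :: free_elt)"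
      by (induction n) (simp_all add: scal_mult)
    have "cl N k (fps_X ^ n) \<in> C" unfolding X by (rule C_scal)
    then have "cl N k (g + fps_X ^ n * g') \<in> C" using g(1,2) g'(1,2) by (intro C_add C_mult FF_mult FF_Xpow)
    moreover have "f = (g + fps_X ^ n * g') + fps_X ^ Suc n * h'"
      unfolding g(4) g'(4) by (simp only: distrib_left power_Suc2 mult.assoc add.assoc)
    moreover have "g + fps_X ^ n * g' \<in> FF N" by (intro FF_add FF_mult FF_Xpow g(1) g'(1))
    ultimately show ?case using g'(3) by blast
  qed
  have "\<exists>s\<in>C. \<exists>r\<in>carrier (HH N k). a = s \<oplus>\<^bsub>HH N k\<^esub> cl N k fps_X [^]\<^bsub>HH N k\<^esub> n \<otimes>\<^bsub>HH N k\<^esub> r" for n :: nat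
  proof -
    obtain g h where g: "g \<in> FF N" "cl N k g \<in> C" "h \<in> StF N l z k" "f = g + fps_X ^ n * h" using approx by blast
    have h: "h \<in> FF N" by (rule StF_FF[OF g(3)])
    have "a = cl N k g \<oplus>\<^bsub>HH N k\<^esub> cl N k fps_X [^]\<^bsub>HH N k\<^esub> n \<otimes>\<^bsub>HH N k\<^esub> cl N k h"
      unfolding f(2) g(4) cl_pow[OF FF_X] cl_mult[OF FF_Xpow h] cl_add[OF g(1) FF_mult[OF FF_Xpow h]] ..
    then show ?thesis using g(2) cl_carrier[OF h] by blast
  qed
  moreover have "a \<in> carrier (HH N k)" unfolding f(2) by (rule cl_carrier[OF StF_FF[OF f(1)]])
  ultimately have "a \<in> C" using C_adic unfolding adic_closed_def by blast
  then show "a \<in> B" by (simp add: C_def)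
qed

lemma cyclotomic_daha_Stab:
  assumes N: "1 \<le> N" and z: "\<forall>i\<in>{1..l}. \<forall>j\<in>{1..l}. i \<noteq> j \<longrightarrow> z i - z j \<notin> \<int>"
  shows "cyclotomic_daha N l z 1 k = cl N k ` StF N l z k"
proof -
  have "cyclotomic_daha N l z 1 k = \<Inter> {B. closed_subalg N k (cl N k ` gen_set N l z k) B}"
    unfolding cyclotomic_daha_eq[OF N] closed_subalgebra_generated_def closed_subalg_def ..
  also have "\<dots> = cl N k ` StF N l z k"
  proof
    show "\<Inter> {B. closed_subalg N k (cl N k ` gen_set N l z k) B} \<subseteq> cl N k ` StF N l z k"
      by (rule Inter_lower) (simp only: mem_Collect_eq closed_subalg_StF[OF N])
    show "cl N k ` StF N l z k \<subseteq> \<Inter> {B. closed_subalg N k (cl N k ` gen_set N l z k) B}"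
      by (rule Inter_greatest) (rule StF_subset_closed_subalg[OF N z], simp only: mem_Collect_eq)
  qed
  finally show ?thesis .
qed

theorem corollary3p7:
  fixes N l :: nat and z :: "nat \<Rightarrow> complex"
  assumes "N \<ge> 1"
    and "\<forall>i\<in>{1..l}. \<forall>j\<in>{1..l}. i \<noteq> j \<longrightarrow> z i - z j \<notin> \<int>"
  shows "\<exists>K :: complex set. countable K \<and>
    (\<forall>k. k \<notin> K \<longrightarrow>
      cyclotomic_daha N l z 1 k =
        {a \<in> carrier (formal_daha N 1 k). \<forall>i\<in>{1..l}. preserves_plus N 1 k (z i) a})"
proof (intro exI[of _ "{}"] conjI allI impI)
  show "cyclotomic_daha N l z 1 k =
      {a \<in> carrier (formal_daha N 1 k). \<forall>i\<in>{1..l}. preserves_plus N 1 k (z i) a}" for k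
    unfolding cyclotomic_daha_Stab[OF assms] Stab_eq[OF assms(1)] ..
qed simp

end
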